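(* Let $\mathbf{M}$ be a bicomplete closed symmetric monoidal category, $\overline{\mathbf{D}}=(\mathbf{D},\perp)$ an orthogonal category, $j:\mathbf{C}\to\mathbf{D}$ the embedding of a full subcategory $\mathbf{C}\subseteq\mathbf{D}$, and $\overline{\mathbf{C}}=(\mathbf{C},j^*(\perp))$. Then the adjunction $$\mathcal{O}_{j\,!}:\mathbf{Alg}_{\mathcal{O}_{\overline{\mathbf{C}}}}(\mathbf{M})\rightleftarrows\mathbf{Alg}_{\mathcal{O}_{\overline{\mathbf{D}}}}(\mathbf{M}):\mathcal{O}_j^*$$ induced by the orthogonal functor $j:\overline{\mathbf{C}}\to\overline{\mathbf{D}}$ exhibits $\mathbf{Alg}_{\mathcal{O}_{\overline{\mathbf{C}}}}(\mathbf{M})$ as a full coreflective subcategory of $\mathbf{Alg}_{\mathcal{O}_{\overline{\mathbf{D}}}}(\mathbf{M})$, i.e. the unit $\eta:\mathrm{id}\to\mathcal{O}_j^*\,\mathcal{O}_{j\,!}$ is a natural isomorphism.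
   Context: Colored operads are symmetric and $\mathbf{Set}$-valued: a colored operad $\mathcal{O}$ has a set of colors, sets of operations $\mathcal{O}\binom{t}{\underline{c}}$, permutation maps $\mathcal{O}\binom{t}{\underline{c}}\to\mathcal{O}\binom{t}{\underline{c}\sigma}$ with $\underline{c}\sigma=(c_{\sigma(1)},\dots,c_{\sigma(n)})$, compositions $\gamma$ and units, subject to the usual axioms. A morphism consists of a map of color sets and compatible maps of operations. $\mathbf{Op}_{\mathfrak{C}}$ is the category of operads with color set $\mathfrak{C}$ and morphisms that are the identity on colors. Orthogonal category: a pair $\overline{\mathbf{C}}=(\mathbf{C},\perp)$ of a small category $\mathbf{C}$ and a set $\perp$ of pairs $(f_1,f_2)$ of $\mathbf{C}$-morphisms with common target (written $f_1\perp f_2$) that is symmetric and stable under post-composition ($f_1\perp f_2\Rightarrow gf_1\perp gf_2$) and pre-composition ($f_1\perp f_2\Rightarrow f_1h_1\perp f_2h_2$). An orthogonal functor is a functor preserving orthogonal pairs. For a functor $j:\mathbf{C}\to\mathbf{D}$ and an orthogonality relation $\perp$ on $\mathbf{D}$, the pullback is $j^*(\perp)=\{(f_1,f_2)\text{ with common target}: j(f_1)\perp j(f_2)\}$. The operad $\mathcal{O}_{\mathbf{C}}$: the colors are the objects $\mathbf{C}_0$; $\mathcal{O}_{\mathbf{C}}\binom{t}{\underline{c}}=\Sigma_n\times\prod_{i=1}^n\mathbf{C}(c_i,t)$ with elements $(\sigma,\underline{f})$; permutations act by $(\sigma,\underline{f})\mapsto(\sigma\sigma',\underline{f}\sigma')$;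 composition is $\gamma\big((\sigma,\underline{f}),((\sigma_i,\underline{g}_i))_i\big)=\big(\sigma(\sigma_1,\dots,\sigma_m),(f_1g_{11},\dots,f_1g_{1k_1},\dots,f_mg_{m1},\dots,f_mg_{mk_m})\big)$, where $\sigma(\sigma_1,\dots,\sigma_m)$ is the composition in the associative operad (sum permutation $\sigma_1\oplus\cdots\oplus\sigma_m$ followed by the block permutation moving the $i$-th block to the $\sigma(i)$-th block position); units are $(e,\mathrm{id}_t)$. The operad $\mathcal{O}_{\overline{\mathbf{C}}}$ is the quotient of $\mathcal{O}_{\mathbf{C}}$ (coequalizer in $\mathbf{Op}_{\mathbf{C}_0}$) universally identifying $(e,(f_1,f_2))$ with $(\tau,(f_1,f_2))$ for all orthogonal pairs $(f_1,f_2)$, with $e,\tau\in\Sigma_2$ the identity and the transposition. An orthogonal functor $F:\overline{\mathbf{C}}\to\overline{\mathbf{D}}$ induces an operad morphism $\mathcal{O}_F:\mathcal{O}_{\overline{\mathbf{C}}}\to\mathcal{O}_{\overline{\mathbf{D}}}$, given by $F$ on colors and $[(\sigma,\underline{f})]\mapsto[(\sigma,F(\underline{f}))]$ on operations. Algebras: an $\mathcal{O}$-algebra $A$ in $\mathbf{M}$ consists of objects $A_t\in\mathbf{M}$ for all colors $t$ and morphisms $\alpha(o):A_{c_1}\otimes\cdots\otimes A_{c_n}\to A_t$ for all $o\in\mathcal{O}\binom{t}{\underline{c}}$, subject to the usual axioms; $\mathbf{Alg}_{\mathcal{O}}(\mathbf{M})$ is their category. For an operad morphism $\phi:\mathcal{O}\to\mathcal{P}$,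 $\phi^*:\mathbf{Alg}_{\mathcal{P}}(\mathbf{M})\to\mathbf{Alg}_{\mathcal{O}}(\mathbf{M})$ is the pullback functor ($\phi^*(B)_t=B_{\phi(t)}$, action $o\mapsto\alpha^B(\phi(o))$); it has a left adjoint $\phi_!$. *)

theory Defs
  imports "HOL-Combinatorics.Permutations" "HOL-Library.FuncSet"
begin

section \<open>Categories, functors and adjunctions\<close>

record ('o, 'm) cat =
  Obj :: "'o set"
  Arr :: "'m set"
  Dom :: "'m \<Rightarrow> 'o"
  Cod :: "'m \<Rightarrow> 'o"
  Id :: "'o \<Rightarrow> 'm"
  Comp :: "'m \<Rightarrow> 'm \<Rightarrow> 'm"  (infixl "\<cdot>\<index>" 70)

definition hom :: "('o, 'm, 'z) cat_scheme \<Rightarrow> 'o \<Rightarrow> 'o \<Rightarrow> 'm set" where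
  "hom C a b = {f \<in> Arr C. Dom C f = a \<and> Cod C f = b}"

text \<open>The value of \<open>g \<cdot> f\<close> is only constrained when \<open>Dom C g = Cod C f\<close>.\<close>

locale category =
  fixes C :: "('o, 'm, 'z) cat_scheme" (structure)
  assumes Dom_Obj: "f \<in> Arr C \<Longrightarrow> Dom C f \<in> Obj C"
    and Cod_Obj: "f \<in> Arr C \<Longrightarrow> Cod C f \<in> Obj C"
    and Id_hom: "a \<in> Obj C \<Longrightarrow> Id C a \<in> hom C a a"
    and Comp_hom: "f \<in> hom C a b \<Longrightarrow> g \<in> hom C b c \<Longrightarrow> g \<cdot> f \<in> hom C a c"
    and Comp_Id_left: "f \<in> hom C a b \<Longrightarrow> Id C b \<cdot> f = f"
    and Comp_Id_right: "f \<in> hom C a b \<Longrightarrow> f \<cdot> Id C a = f"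
    and Comp_assoc: "f \<in> hom C a b \<Longrightarrow> g \<in> hom C b c \<Longrightarrow> h \<in> hom C c d \<Longrightarrow>
      (h \<cdot> g) \<cdot> f = h \<cdot> (g \<cdot> f)"

definition inverse_arrows :: "('o, 'm, 'z) cat_scheme \<Rightarrow> 'm \<Rightarrow> 'm \<Rightarrow> bool" where
  "inverse_arrows C f g \<longleftrightarrow> f \<in> Arr C \<and> g \<in> hom C (Cod C f) (Dom C f) \<and>
     g \<cdot>\<^bsub>C\<^esub> f = Id C (Dom C f) \<and> f \<cdot>\<^bsub>C\<^esub> g = Id C (Cod C f)"

definition is_iso :: "('o, 'm, 'z) cat_scheme \<Rightarrow> 'm \<Rightarrow> bool" where
  "is_iso C f \<longleftrightarrow> (\<exists>g. inverse_arrows C f g)"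

definition inv_arr :: "('o, 'm, 'z) cat_scheme \<Rightarrow> 'm \<Rightarrow> 'm" where
  "inv_arr C f = (THE g. inverse_arrows C f g)"

record ('o1, 'm1, 'o2, 'm2) func =
  FObj :: "'o1 \<Rightarrow> 'o2"
  FArr :: "'m1 \<Rightarrow> 'm2"

definition is_functor ::
  "('o1, 'm1, 'y) cat_scheme \<Rightarrow> ('o2, 'm2, 'z) cat_scheme \<Rightarrow> ('o1, 'm1, 'o2, 'm2) func \<Rightarrow> bool" where
  "is_functor C D F \<longleftrightarrow> category C \<and> category D \<and>
     (\<forall>a \<in> Obj C. FObj F a \<in> Obj D) \<and>
     (\<forall>a b. \<forall>f \<in> hom C a b. FArr F f \<in> hom D (FObj F a) (FObj F b)) \<and>
     (\<forall>a \<in> Obj C. FArr F (Id C a) = Id D (FObj F a)) \<and>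
     (\<forall>a b c. \<forall>f \<in> hom C a b. \<forall>g \<in> hom C b c.
        FArr F (g \<cdot>\<^bsub>C\<^esub> f) = FArr F g \<cdot>\<^bsub>D\<^esub> FArr F f)"

definition id_func :: "('o, 'm, 'o, 'm) func" where
  "id_func = \<lparr>FObj = (\<lambda>a. a), FArr = (\<lambda>f. f)\<rparr>"

definition comp_func ::
  "('o2, 'm2, 'o3, 'm3) func \<Rightarrow> ('o1, 'm1, 'o2, 'm2) func \<Rightarrow> ('o1, 'm1, 'o3, 'm3) func" where
  "comp_func G F = \<lparr>FObj = FObj G \<circ> FObj F, FArr = FArr G \<circ> FArr F\<rparr>"

definition fully_faithful ::
  "('o1, 'm1, 'y) cat_scheme \<Rightarrow> ('o2, 'm2, 'z) cat_scheme \<Rightarrow> ('o1, 'm1, 'o2, 'm2) func \<Rightarrow> bool" where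
  "fully_faithful C D F \<longleftrightarrow>
     (\<forall>a \<in> Obj C. \<forall>b \<in> Obj C. bij_betw (FArr F) (hom C a b) (hom D (FObj F a) (FObj F b)))"

definition nat_trans ::
  "('o1, 'm1, 'y) cat_scheme \<Rightarrow> ('o2, 'm2, 'z) cat_scheme \<Rightarrow>
   ('o1, 'm1, 'o2, 'm2) func \<Rightarrow> ('o1, 'm1, 'o2, 'm2) func \<Rightarrow> ('o1 \<Rightarrow> 'm2) \<Rightarrow> bool" where
  "nat_trans C D F G \<eta> \<longleftrightarrow>
     (\<forall>a \<in> Obj C. \<eta> a \<in> hom D (FObj F a) (FObj G a)) \<and>
     (\<forall>a b. \<forall>f \<in> hom C a b. FArr G f \<cdot>\<^bsub>D\<^esub> \<eta> a = \<eta> b \<cdot>\<^bsub>D\<^esub> FArr F f)"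

definition nat_iso ::
  "('o1, 'm1, 'y) cat_scheme \<Rightarrow> ('o2, 'm2, 'z) cat_scheme \<Rightarrow>
   ('o1, 'm1, 'o2, 'm2) func \<Rightarrow> ('o1, 'm1, 'o2, 'm2) func \<Rightarrow> ('o1 \<Rightarrow> 'm2) \<Rightarrow> bool" where
  "nat_iso C D F G \<eta> \<longleftrightarrow> nat_trans C D F G \<eta> \<and> (\<forall>a \<in> Obj C. is_iso D (\<eta> a))"

text \<open>\<open>L : C \<rightarrow> D\<close> is left adjoint to \<open>R : D \<rightarrow> C\<close> with unit \<open>\<eta>\<close> and counit \<open>\<epsilon>\<close>; the last two
  conjuncts are the triangle identities.\<close>

definition adjunction ::
  "('o1, 'm1, 'y) cat_scheme \<Rightarrow> ('o2, 'm2, 'z) cat_scheme \<Rightarrow>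
   ('o1, 'm1, 'o2, 'm2) func \<Rightarrow> ('o2, 'm2, 'o1, 'm1) func \<Rightarrow>
   ('o1 \<Rightarrow> 'm1) \<Rightarrow> ('o2 \<Rightarrow> 'm2) \<Rightarrow> bool" where
  "adjunction C D L R \<eta> \<epsilon> \<longleftrightarrow>
     is_functor C D L \<and> is_functor D C R \<and>
     nat_trans C C id_func (comp_func R L) \<eta> \<and>
     nat_trans D D (comp_func L R) id_func \<epsilon> \<and>
     (\<forall>a \<in> Obj C. \<epsilon> (FObj L a) \<cdot>\<^bsub>D\<^esub> FArr L (\<eta> a) = Id D (FObj L a)) \<and>
     (\<forall>b \<in> Obj D. FArr R (\<epsilon> b) \<cdot>\<^bsub>C\<^esub> \<eta> (FObj R b) = Id C (FObj R b))"

definition full_subcategory :: "('o, 'm) cat \<Rightarrow> ('o, 'm) cat \<Rightarrow> bool" where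
  "full_subcategory C D \<longleftrightarrow> category C \<and> category D \<and>
     Obj C \<subseteq> Obj D \<and>
     (\<forall>a \<in> Obj C. \<forall>b \<in> Obj C. hom C a b = hom D a b) \<and>
     (\<forall>a \<in> Obj C. Id C a = Id D a) \<and>
     (\<forall>a b c. \<forall>f \<in> hom C a b. \<forall>g \<in> hom C b c. g \<cdot>\<^bsub>C\<^esub> f = g \<cdot>\<^bsub>D\<^esub> f)"

text \<open>The embedding \<open>j : C \<rightarrow> D\<close> of a subcategory: \<open>j a = a\<close> and \<open>j f = f\<close>.\<close>

definition embedding :: "('o, 'm, 'o, 'm) func" where
  "embedding = \<lparr>FObj = (\<lambda>a. a), FArr = (\<lambda>f. f)\<rparr>"


section \<open>Bicomplete closed symmetric monoidal categories\<close>

definition is_cone ::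
  "('i, 'j, 'y) cat_scheme \<Rightarrow> ('o, 'm, 'z) cat_scheme \<Rightarrow> ('i, 'j, 'o, 'm) func \<Rightarrow> 'o \<Rightarrow> ('i \<Rightarrow> 'm) \<Rightarrow> bool"
  where
  "is_cone J C F X p \<longleftrightarrow> X \<in> Obj C \<and> (\<forall>i \<in> Obj J. p i \<in> hom C X (FObj F i)) \<and>
     (\<forall>i k. \<forall>u \<in> hom J i k. FArr F u \<cdot>\<^bsub>C\<^esub> p i = p k)"

definition is_limit ::
  "('i, 'j, 'y) cat_scheme \<Rightarrow> ('o, 'm, 'z) cat_scheme \<Rightarrow> ('i, 'j, 'o, 'm) func \<Rightarrow> 'o \<Rightarrow> ('i \<Rightarrow> 'm) \<Rightarrow> bool"
  where
  "is_limit J C F X p \<longleftrightarrow> is_cone J C F X p \<and>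
     (\<forall>Y q. is_cone J C F Y q \<longrightarrow>
        (\<exists>!h. h \<in> hom C Y X \<and> (\<forall>i \<in> Obj J. p i \<cdot>\<^bsub>C\<^esub> h = q i)))"

definition is_cocone ::
  "('i, 'j, 'y) cat_scheme \<Rightarrow> ('o, 'm, 'z) cat_scheme \<Rightarrow> ('i, 'j, 'o, 'm) func \<Rightarrow> 'o \<Rightarrow> ('i \<Rightarrow> 'm) \<Rightarrow> bool"
  where
  "is_cocone J C F X p \<longleftrightarrow> X \<in> Obj C \<and> (\<forall>i \<in> Obj J. p i \<in> hom C (FObj F i) X) \<and>
     (\<forall>i k. \<forall>u \<in> hom J i k. p k \<cdot>\<^bsub>C\<^esub> FArr F u = p i)"

definition is_colimit ::
  "('i, 'j, 'y) cat_scheme \<Rightarrow> ('o, 'm, 'z) cat_scheme \<Rightarrow> ('i, 'j, 'o, 'm) func \<Rightarrow> 'o \<Rightarrow> ('i \<Rightarrow> 'm) \<Rightarrow> bool"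
  where
  "is_colimit J C F X p \<longleftrightarrow> is_cocone J C F X p \<and>
     (\<forall>Y q. is_cocone J C F Y q \<longrightarrow>
        (\<exists>!h. h \<in> hom C X Y \<and> (\<forall>i \<in> Obj J. h \<cdot>\<^bsub>C\<^esub> p i = q i)))"

text \<open>Size convention: the type \<open>'u\<close> plays the role of the universe of small sets.  A small
  category is one whose objects and arrows are elements of \<open>'u\<close>, and bicompleteness is existence
  of limits and colimits of all diagrams indexed by such categories.  The objects and arrows of
  the bicomplete category itself live in unrelated types, so that they may form a proper class
  relative to \<open>'u\<close>.\<close>

definition bicomplete :: "'u itself \<Rightarrow> ('o, 'm, 'z) cat_scheme \<Rightarrow> bool" where
  "bicomplete _ C \<longleftrightarrow> category C \<and>
     (\<forall>(J :: ('u, 'u) cat) F. is_functor J C F \<longrightarrow>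
        (\<exists>X p. is_limit J C F X p) \<and> (\<exists>X p. is_colimit J C F X p))"

record ('o, 'm) smc = "('o, 'm) cat" +
  TObj :: "'o \<Rightarrow> 'o \<Rightarrow> 'o"  (infixr "\<otimes>\<index>" 75)
  TArr :: "'m \<Rightarrow> 'm \<Rightarrow> 'm"  (infixr "\<boxtimes>\<index>" 75)
  TUnit :: "'o"
  Assoc :: "'o \<Rightarrow> 'o \<Rightarrow> 'o \<Rightarrow> 'm"
  LUnit :: "'o \<Rightarrow> 'm"
  RUnit :: "'o \<Rightarrow> 'm"
  Sym :: "'o \<Rightarrow> 'o \<Rightarrow> 'm"

locale symmetric_monoidal_category = category M
  for M :: "('o, 'm, 'z) smc_scheme" (structure) +
  assumes TObj_Obj: "a \<in> Obj M \<Longrightarrow> b \<in> Obj M \<Longrightarrow> a \<otimes> b \<in> Obj M"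
    and TArr_hom: "f \<in> hom M a b \<Longrightarrow> g \<in> hom M c d \<Longrightarrow> f \<boxtimes> g \<in> hom M (a \<otimes> c) (b \<otimes> d)"
    and TArr_Id: "a \<in> Obj M \<Longrightarrow> b \<in> Obj M \<Longrightarrow> Id M a \<boxtimes> Id M b = Id M (a \<otimes> b)"
    and TArr_Comp: "f \<in> hom M a b \<Longrightarrow> f' \<in> hom M b c \<Longrightarrow> g \<in> hom M d e \<Longrightarrow> g' \<in> hom M e k \<Longrightarrow>
      (f' \<cdot> f) \<boxtimes> (g' \<cdot> g) = (f' \<boxtimes> g') \<cdot> (f \<boxtimes> g)"
    and TUnit_Obj: "TUnit M \<in> Obj M"
    and Assoc_hom: "a \<in> Obj M \<Longrightarrow> b \<in> Obj M \<Longrightarrow> c \<in> Obj M \<Longrightarrow>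
      Assoc M a b c \<in> hom M ((a \<otimes> b) \<otimes> c) (a \<otimes> (b \<otimes> c))"
    and Assoc_iso: "a \<in> Obj M \<Longrightarrow> b \<in> Obj M \<Longrightarrow> c \<in> Obj M \<Longrightarrow> is_iso M (Assoc M a b c)"
    and Assoc_nat: "f \<in> hom M a a' \<Longrightarrow> g \<in> hom M b b' \<Longrightarrow> h \<in> hom M c c' \<Longrightarrow>
      Assoc M a' b' c' \<cdot> ((f \<boxtimes> g) \<boxtimes> h) = (f \<boxtimes> (g \<boxtimes> h)) \<cdot> Assoc M a b c"
    and LUnit_hom: "a \<in> Obj M \<Longrightarrow> LUnit M a \<in> hom M (TUnit M \<otimes> a) a"
    and LUnit_iso: "a \<in> Obj M \<Longrightarrow> is_iso M (LUnit M a)"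
    and LUnit_nat: "f \<in> hom M a b \<Longrightarrow> LUnit M b \<cdot> (Id M (TUnit M) \<boxtimes> f) = f \<cdot> LUnit M a"
    and RUnit_hom: "a \<in> Obj M \<Longrightarrow> RUnit M a \<in> hom M (a \<otimes> TUnit M) a"
    and RUnit_iso: "a \<in> Obj M \<Longrightarrow> is_iso M (RUnit M a)"
    and RUnit_nat: "f \<in> hom M a b \<Longrightarrow> RUnit M b \<cdot> (f \<boxtimes> Id M (TUnit M)) = f \<cdot> RUnit M a"
    and Sym_hom: "a \<in> Obj M \<Longrightarrow> b \<in> Obj M \<Longrightarrow> Sym M a b \<in> hom M (a \<otimes> b) (b \<otimes> a)"
    and Sym_nat: "f \<in> hom M a a' \<Longrightarrow> g \<in> hom M b b' \<Longrightarrow>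
      Sym M a' b' \<cdot> (f \<boxtimes> g) = (g \<boxtimes> f) \<cdot> Sym M a b"
    and Sym_Sym: "a \<in> Obj M \<Longrightarrow> b \<in> Obj M \<Longrightarrow> Sym M b a \<cdot> Sym M a b = Id M (a \<otimes> b)"
    and pentagon: "a \<in> Obj M \<Longrightarrow> b \<in> Obj M \<Longrightarrow> c \<in> Obj M \<Longrightarrow> d \<in> Obj M \<Longrightarrow>
      Assoc M a b (c \<otimes> d) \<cdot> Assoc M (a \<otimes> b) c d =
      (Id M a \<boxtimes> Assoc M b c d) \<cdot> (Assoc M a (b \<otimes> c) d \<cdot> (Assoc M a b c \<boxtimes> Id M d))"
    and triangle: "a \<in> Obj M \<Longrightarrow> b \<in> Obj M \<Longrightarrow>
      (Id M a \<boxtimes> LUnit M b) \<cdot> Assoc M a (TUnit M) b = RUnit M a \<boxtimes> Id M b"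
    and hexagon: "a \<in> Obj M \<Longrightarrow> b \<in> Obj M \<Longrightarrow> c \<in> Obj M \<Longrightarrow>
      Assoc M b c a \<cdot> (Sym M a (b \<otimes> c) \<cdot> Assoc M a b c) =
      (Id M b \<boxtimes> Sym M a c) \<cdot> (Assoc M b a c \<cdot> (Sym M a b \<boxtimes> Id M c))"

text \<open>Existence of internal homs: every functor \<open>- \<otimes> b\<close> has a right adjoint, given objectwise by
  a universal evaluation arrow.\<close>

locale closed_symmetric_monoidal_category = symmetric_monoidal_category M
  for M :: "('o, 'm, 'z) smc_scheme" (structure) +
  assumes closed: "b \<in> Obj M \<Longrightarrow> c \<in> Obj M \<Longrightarrow>
    \<exists>e \<in> Obj M. \<exists>ev \<in> hom M (e \<otimes> b) c. \<forall>a \<in> Obj M. \<forall>f \<in> hom M (a \<otimes> b) c.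
      \<exists>!g. g \<in> hom M a e \<and> ev \<cdot> (g \<boxtimes> Id M b) = f"

text \<open>Iterated tensor products are bracketed to the right and end with the unit object:
  \<open>tens M [a\<^sub>1, \<dots>, a\<^sub>n] = a\<^sub>1 \<otimes> (a\<^sub>2 \<otimes> \<dots> (a\<^sub>n \<otimes> I))\<close>.\<close>

definition tens :: "('o, 'm, 'z) smc_scheme \<Rightarrow> 'o list \<Rightarrow> 'o" where
  "tens M as = foldr (TObj M) as (TUnit M)"

definition tens_arr :: "('o, 'm, 'z) smc_scheme \<Rightarrow> 'm list \<Rightarrow> 'm" where
  "tens_arr M fs = foldr (TArr M) fs (Id M (TUnit M))"

text \<open>The canonical coherence isomorphisms
  \<open>tens M as \<otimes> tens M bs \<rightarrow> tens M (as @ bs)\<close> and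
  \<open>tens M (map (tens M) ass) \<rightarrow> tens M (concat ass)\<close>.\<close>

fun tens_append :: "('o, 'm, 'z) smc_scheme \<Rightarrow> 'o list \<Rightarrow> 'o list \<Rightarrow> 'm" where
  "tens_append M [] bs = LUnit M (tens M bs)"
| "tens_append M (a # as) bs =
     (Id M a \<boxtimes>\<^bsub>M\<^esub> tens_append M as bs) \<cdot>\<^bsub>M\<^esub> Assoc M a (tens M as) (tens M bs)"

fun tens_concat :: "('o, 'm, 'z) smc_scheme \<Rightarrow> 'o list list \<Rightarrow> 'm" where
  "tens_concat M [] = Id M (TUnit M)"
| "tens_concat M (as # ass) =
     tens_append M as (concat ass) \<cdot>\<^bsub>M\<^esub> (Id M (tens M as) \<boxtimes>\<^bsub>M\<^esub> tens_concat M ass)"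

text \<open>Let \<open>a\<close> be a family of objects indexed by positions.  For a position \<open>l\<close> occurring in
  \<open>ks\<close>, the arrow \<open>tens_insert M a l ks\<close> moves the first factor of
  \<open>a l \<otimes> tens M (map a (remove1 l ks))\<close> past the factors preceding \<open>l\<close> in \<open>ks\<close>, arriving at
  \<open>tens M (map a ks)\<close>.  If \<open>ls\<close> is a rearrangement of the distinct list \<open>ks\<close>, then
  \<open>tens_rearrange M a ls ks\<close> is the symmetry isomorphism
  \<open>tens M (map a ls) \<rightarrow> tens M (map a ks)\<close>.\<close>

fun tens_insert :: "('o, 'm, 'z) smc_scheme \<Rightarrow> (nat \<Rightarrow> 'o) \<Rightarrow> nat \<Rightarrow> nat list \<Rightarrow> 'm" where
  "tens_insert M a l [] = undefined"
| "tens_insert M a l (k # ks) =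
     (if k = l then Id M (a l \<otimes>\<^bsub>M\<^esub> tens M (map a ks))
      else (Id M (a k) \<boxtimes>\<^bsub>M\<^esub> tens_insert M a l ks) \<cdot>\<^bsub>M\<^esub>
        (Assoc M (a k) (a l) (tens M (map a (remove1 l ks))) \<cdot>\<^bsub>M\<^esub>
          ((Sym M (a l) (a k) \<boxtimes>\<^bsub>M\<^esub> Id M (tens M (map a (remove1 l ks)))) \<cdot>\<^bsub>M\<^esub>
            inv_arr M (Assoc M (a l) (a k) (tens M (map a (remove1 l ks)))))))"

fun tens_rearrange :: "('o, 'm, 'z) smc_scheme \<Rightarrow> (nat \<Rightarrow> 'o) \<Rightarrow> nat list \<Rightarrow> nat list \<Rightarrow> 'm" where
  "tens_rearrange M a [] ks = Id M (TUnit M)"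
| "tens_rearrange M a (l # ls) ks =
     tens_insert M a l ks \<cdot>\<^bsub>M\<^esub> (Id M (a l) \<boxtimes>\<^bsub>M\<^esub> tens_rearrange M a ls (remove1 l ks))"

text \<open>\<open>tens (permute_list \<sigma> as) \<rightarrow> tens as\<close>, sending the \<open>i\<close>-th factor to position \<open>\<sigma> i\<close>.\<close>

definition tens_perm :: "('o, 'm, 'z) smc_scheme \<Rightarrow> (nat \<Rightarrow> nat) \<Rightarrow> 'o list \<Rightarrow> 'm" where
  "tens_perm M \<sigma> as = tens_rearrange M ((!) as) (map \<sigma> [0..<length as]) [0..<length as]"


section \<open>Symmetric colored operads\<close>

text \<open>Positions are numbered from \<open>0\<close>, elements of \<open>\<Sigma>\<^sub>n\<close> are functions \<open>\<sigma>\<close> with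
  \<open>\<sigma> permutes {..<n}\<close>, and \<open>c\<sigma>\<close> is \<open>permute_list \<sigma> c\<close>.  Since operation sets of different
  profiles need not be disjoint, the structure maps carry the profile as arguments:

  \<^item> \<open>Act P cs t \<sigma>\<close> maps \<open>Ops P cs t\<close> to \<open>Ops P (permute_list \<sigma> cs) t\<close>;
  \<^item> \<open>Gam P ts t css x ys\<close> is \<open>\<gamma>(x, ys)\<close>, where \<open>x \<in> Ops P ts t\<close> and
    \<open>ys ! i \<in> Ops P (css ! i) (ts ! i)\<close>.\<close>

record ('c, 'x) operad =
  Colors :: "'c set"
  Ops :: "'c list \<Rightarrow> 'c \<Rightarrow> 'x set"
  Act :: "'c list \<Rightarrow> 'c \<Rightarrow> (nat \<Rightarrow> nat) \<Rightarrow> 'x \<Rightarrow> 'x"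
  Gam :: "'c list \<Rightarrow> 'c \<Rightarrow> 'c list list \<Rightarrow> 'x \<Rightarrow> 'x list \<Rightarrow> 'x"
  Unt :: "'c \<Rightarrow> 'x"

definition composable :: "('c, 'x) operad \<Rightarrow> 'c list \<Rightarrow> 'c list list \<Rightarrow> 'x list \<Rightarrow> bool" where
  "composable P ts css ys \<longleftrightarrow> length css = length ts \<and> length ys = length ts \<and>
     (\<forall>i < length ts. ys ! i \<in> Ops P (css ! i) (ts ! i))"

text \<open>The position \<open>p\<close> in a sequence of blocks of lengths \<open>ks\<close>, as (block, offset).\<close>

fun locate :: "nat list \<Rightarrow> nat \<Rightarrow> nat \<times> nat" where
  "locate [] p = (0, p)"
| "locate (k # ks) p =
     (if p < k then (0, p) else (let (i, r) = locate ks (p - k) in (Suc i, r)))"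

text \<open>\<open>\<sigma>(\<tau>\<^sub>1, \<dots>, \<tau>\<^sub>m)\<close> for \<open>\<tau>\<^sub>i \<in> \<Sigma>\<^bsub>k\<^sub>i\<^esub>\<close>: after applying \<open>\<tau>\<^sub>i\<close> within block \<open>i\<close>, that block starts
  behind all blocks \<open>j\<close> with \<open>\<sigma> j < \<sigma> i\<close>.\<close>

definition block_perm :: "(nat \<Rightarrow> nat) \<Rightarrow> nat list \<Rightarrow> (nat \<Rightarrow> nat) list \<Rightarrow> nat \<Rightarrow> nat" where
  "block_perm \<sigma> ks \<tau>s p =
     (if p < sum_list ks
      then (let (i, r) = locate ks p in
             (\<Sum>j | j < length ks \<and> \<sigma> j < \<sigma> i. ks ! j) + (\<tau>s ! i) r)
      else p)"

record ('c, 'x, 'd, 'y) operad_map =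
  MCol :: "'c \<Rightarrow> 'd"
  MOp :: "'c list \<Rightarrow> 'c \<Rightarrow> 'x \<Rightarrow> 'y"

text \<open>The operadic congruence generated by a relation \<open>R\<close> on operations of equal profile.\<close>

inductive op_cong ::
  "('c, 'x) operad \<Rightarrow> ('c list \<Rightarrow> 'c \<Rightarrow> 'x \<Rightarrow> 'x \<Rightarrow> bool) \<Rightarrow> 'c list \<Rightarrow> 'c \<Rightarrow> 'x \<Rightarrow> 'x \<Rightarrow> bool"
  for P :: "('c, 'x) operad" and R :: "'c list \<Rightarrow> 'c \<Rightarrow> 'x \<Rightarrow> 'x \<Rightarrow> bool" where
  base: "R cs t x y \<Longrightarrow> x \<in> Ops P cs t \<Longrightarrow> y \<in> Ops P cs t \<Longrightarrow> op_cong P R cs t x y"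
| refl: "x \<in> Ops P cs t \<Longrightarrow> op_cong P R cs t x x"
| sym: "op_cong P R cs t x y \<Longrightarrow> op_cong P R cs t y x"
| trans: "op_cong P R cs t x y \<Longrightarrow> op_cong P R cs t y z \<Longrightarrow> op_cong P R cs t x z"
| Act: "op_cong P R cs t x y \<Longrightarrow> \<sigma> permutes {..<length cs} \<Longrightarrow>
    op_cong P R (permute_list \<sigma> cs) t (Act P cs t \<sigma> x) (Act P cs t \<sigma> y)"
| Gam: "op_cong P R ts t x y \<Longrightarrow> length css = length ts \<Longrightarrow> length xs = length ts \<Longrightarrow>
    length ys = length ts \<Longrightarrow>
    (\<And>i. i < length ts \<Longrightarrow> op_cong P R (css ! i) (ts ! i) (xs ! i) (ys ! i)) \<Longrightarrow>
    op_cong P R (concat css) t (Gam P ts t css x xs) (Gam P ts t css y ys)"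

text \<open>The quotient of \<open>P\<close> by an operadic congruence \<open>E\<close>: operations are equivalence classes, and
  the structure maps are computed on representatives.  For \<open>E = op_cong P R\<close> this is the
  coequalizer, among operads with the same colors, that universally identifies the operations
  related by \<open>R\<close>: every operad morphism identifying them is constant on the classes of \<open>E\<close>.\<close>

definition quotient_operad ::
  "('c, 'x) operad \<Rightarrow> ('c list \<Rightarrow> 'c \<Rightarrow> 'x \<Rightarrow> 'x \<Rightarrow> bool) \<Rightarrow> ('c, 'x set) operad" where
  "quotient_operad P E = \<lparr>
     Colors = Colors P,
     Ops = (\<lambda>cs t. (\<lambda>x. {z. E cs t x z}) ` Ops P cs t),
     Act = (\<lambda>cs t \<sigma> X. {z. \<exists>x \<in> X. E (permute_list \<sigma> cs) t (Act P cs t \<sigma> x) z}),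
     Gam = (\<lambda>ts t css X Ys.
       {z. \<exists>x \<in> X. \<exists>ys. list_all2 (\<in>) ys Ys \<and> E (concat css) t (Gam P ts t css x ys) z}),
     Unt = (\<lambda>t. {z. E [t] t (Unt P t) z}) \<rparr>"


section \<open>The operad of an orthogonal category\<close>

locale orthogonal_category = category D
  for D :: "('o, 'm) cat" (structure) and orth :: "('m \<times> 'm) set" +
  assumes orth_Arr: "(f1, f2) \<in> orth \<Longrightarrow> f1 \<in> Arr D \<and> f2 \<in> Arr D \<and> Cod D f1 = Cod D f2"
    and orth_sym: "(f1, f2) \<in> orth \<Longrightarrow> (f2, f1) \<in> orth"
    and orth_post: "(f1, f2) \<in> orth \<Longrightarrow> g \<in> Arr D \<Longrightarrow> Dom D g = Cod D f1 \<Longrightarrow>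
      (g \<cdot> f1, g \<cdot> f2) \<in> orth"
    and orth_pre: "(f1, f2) \<in> orth \<Longrightarrow> h1 \<in> Arr D \<Longrightarrow> h2 \<in> Arr D \<Longrightarrow>
      Cod D h1 = Dom D f1 \<Longrightarrow> Cod D h2 = Dom D f2 \<Longrightarrow> (f1 \<cdot> h1, f2 \<cdot> h2) \<in> orth"

definition orth_pullback ::
  "('o1, 'm1) cat \<Rightarrow> ('o1, 'm1, 'o2, 'm2) func \<Rightarrow> ('m2 \<times> 'm2) set \<Rightarrow> ('m1 \<times> 'm1) set" where
  "orth_pullback C F orth =
     {(f1, f2). f1 \<in> Arr C \<and> f2 \<in> Arr C \<and> Cod C f1 = Cod C f2 \<and> (FArr F f1, FArr F f2) \<in> orth}"

definition cat_operad :: "('o, 'm) cat \<Rightarrow> ('o, (nat \<Rightarrow> nat) \<times> 'm list) operad" where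
  "cat_operad C = \<lparr>
     Colors = Obj C,
     Ops = (\<lambda>cs t. {(\<sigma>, fs). set cs \<subseteq> Obj C \<and> t \<in> Obj C \<and> \<sigma> permutes {..<length cs} \<and>
       length fs = length cs \<and> (\<forall>i < length cs. fs ! i \<in> hom C (cs ! i) t)}),
     Act = (\<lambda>cs t \<sigma>' (\<sigma>, fs). (\<sigma> \<circ> \<sigma>', permute_list \<sigma>' fs)),
     Gam = (\<lambda>ts t css (\<sigma>, fs) ys.
       (block_perm \<sigma> (map length css) (map fst ys),
        concat (map2 (\<lambda>f gs. map (\<lambda>g. f \<cdot>\<^bsub>C\<^esub> g) gs) fs (map snd ys)))),
     Unt = (\<lambda>t. (id, [Id C t])) \<rparr>"

definition orth_rel ::
  "('o, 'm) cat \<Rightarrow> ('m \<times> 'm) set \<Rightarrow> 'o list \<Rightarrow> 'o \<Rightarrow>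
   (nat \<Rightarrow> nat) \<times> 'm list \<Rightarrow> (nat \<Rightarrow> nat) \<times> 'm list \<Rightarrow> bool" where
  "orth_rel C orth cs t x y \<longleftrightarrow>
     (\<exists>f1 f2. (f1, f2) \<in> orth \<and> cs = [Dom C f1, Dom C f2] \<and> t = Cod C f1 \<and>
        x = (id, [f1, f2]) \<and> y = (Transposition.transpose 0 1, [f1, f2]))"

definition orth_cong ::
  "('o, 'm) cat \<Rightarrow> ('m \<times> 'm) set \<Rightarrow> 'o list \<Rightarrow> 'o \<Rightarrow>
   (nat \<Rightarrow> nat) \<times> 'm list \<Rightarrow> (nat \<Rightarrow> nat) \<times> 'm list \<Rightarrow> bool" where
  "orth_cong C orth = op_cong (cat_operad C) (orth_rel C orth)"

definition orth_operad ::
  "('o, 'm) cat \<Rightarrow> ('m \<times> 'm) set \<Rightarrow> ('o, ((nat \<Rightarrow> nat) \<times> 'm list) set) operad" where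
  "orth_operad C orth = quotient_operad (cat_operad C) (orth_cong C orth)"

text \<open>The operad morphism \<open>[(\<sigma>, fs)] \<mapsto> [(\<sigma>, F fs)]\<close> induced by an orthogonal functor \<open>F\<close> into
  \<open>(D, orth)\<close>.\<close>

definition orth_operad_map ::
  "('o2, 'm2) cat \<Rightarrow> ('m2 \<times> 'm2) set \<Rightarrow> ('o1, 'm1, 'o2, 'm2) func \<Rightarrow>
   ('o1, ((nat \<Rightarrow> nat) \<times> 'm1 list) set, 'o2, ((nat \<Rightarrow> nat) \<times> 'm2 list) set) operad_map" where
  "orth_operad_map D orth F = \<lparr>
     MCol = FObj F,
     MOp = (\<lambda>cs t X. {z. \<exists>(\<sigma>, fs) \<in> X.
       orth_cong D orth (map (FObj F) cs) (FObj F t) (\<sigma>, map (FArr F) fs) z}) \<rparr>"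


section \<open>Algebras over operads\<close>

record ('c, 'x, 'o, 'm) alg =
  Car :: "'c \<Rightarrow> 'o"
  Str :: "'c list \<Rightarrow> 'c \<Rightarrow> 'x \<Rightarrow> 'm"

text \<open>Both components are required to be \<open>undefined\<close> outside their domain, so that equality of
  algebras is equality of the mathematical objects.  The unit law involves the right unitor since
  \<open>tens M [a] = a \<otimes> I\<close>.\<close>

locale operad_algebra =
  fixes P :: "('c, 'x) operad" and M :: "('o, 'm, 'z) smc_scheme" (structure)
    and A :: "('c, 'x, 'o, 'm) alg"
  assumes Car_Obj: "t \<in> Colors P \<Longrightarrow> Car A t \<in> Obj M"
    and Car_extensional: "Car A \<in> extensional (Colors P)"
    and Str_hom: "x \<in> Ops P cs t \<Longrightarrow> Str A cs t x \<in> hom M (tens M (map (Car A) cs)) (Car A t)"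
    and Str_extensional: "x \<notin> Ops P cs t \<Longrightarrow> Str A cs t x = undefined"
    and Str_Unt: "t \<in> Colors P \<Longrightarrow> Str A [t] t (Unt P t) = RUnit M (Car A t)"
    and Str_Act: "x \<in> Ops P cs t \<Longrightarrow> \<sigma> permutes {..<length cs} \<Longrightarrow>
      Str A (permute_list \<sigma> cs) t (Act P cs t \<sigma> x) =
      Str A cs t x \<cdot> tens_perm M \<sigma> (map (Car A) cs)"
    and Str_Gam: "x \<in> Ops P ts t \<Longrightarrow> composable P ts css ys \<Longrightarrow>
      Str A (concat css) t (Gam P ts t css x ys) \<cdot> tens_concat M (map (map (Car A)) css) =
      Str A ts t x \<cdot> tens_arr M (map (\<lambda>i. Str A (css ! i) (ts ! i) (ys ! i)) [0..<length ts])"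

definition alg_hom ::
  "('c, 'x) operad \<Rightarrow> ('o, 'm, 'z) smc_scheme \<Rightarrow>
   ('c, 'x, 'o, 'm) alg \<Rightarrow> ('c, 'x, 'o, 'm) alg \<Rightarrow> ('c \<Rightarrow> 'm) \<Rightarrow> bool" where
  "alg_hom P M A B h \<longleftrightarrow> h \<in> extensional (Colors P) \<and>
     (\<forall>t \<in> Colors P. h t \<in> hom M (Car A t) (Car B t)) \<and>
     (\<forall>cs t. \<forall>x \<in> Ops P cs t.
        h t \<cdot>\<^bsub>M\<^esub> Str A cs t x = Str B cs t x \<cdot>\<^bsub>M\<^esub> tens_arr M (map h cs))"

text \<open>Arrows of the category of algebras are recorded together with their source and target.\<close>

type_synonym ('c, 'x, 'o, 'm) alg_arr =
  "('c, 'x, 'o, 'm) alg \<times> ('c \<Rightarrow> 'm) \<times> ('c, 'x, 'o, 'm) alg"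

definition Alg ::
  "('c, 'x) operad \<Rightarrow> ('o, 'm, 'z) smc_scheme \<Rightarrow>
   (('c, 'x, 'o, 'm) alg, ('c, 'x, 'o, 'm) alg_arr) cat" where
  "Alg P M = \<lparr>
     Obj = {A. operad_algebra P M A},
     Arr = {(A, h, B). operad_algebra P M A \<and> operad_algebra P M B \<and> alg_hom P M A B h},
     Dom = (\<lambda>(A, h, B). A),
     Cod = (\<lambda>(A, h, B). B),
     Id = (\<lambda>A. (A, (\<lambda>t \<in> Colors P. Id M (Car A t)), A)),
     Comp = (\<lambda>(A', k, B') (A, h, B). (A, (\<lambda>t \<in> Colors P. k t \<cdot>\<^bsub>M\<^esub> h t), B')) \<rparr>"

text \<open>The pullback functor \<open>\<phi>\<^sup>* : Alg Q M \<rightarrow> Alg P M\<close> along an operad morphism \<open>\<phi> : P \<rightarrow> Q\<close>.\<close>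

definition pullback_alg ::
  "('c, 'x) operad \<Rightarrow> ('c, 'x, 'd, 'y) operad_map \<Rightarrow>
   ('d, 'y, 'o, 'm) alg \<Rightarrow> ('c, 'x, 'o, 'm) alg" where
  "pullback_alg P \<phi> B = \<lparr>
     Car = (\<lambda>t \<in> Colors P. Car B (MCol \<phi> t)),
     Str = (\<lambda>cs t. \<lambda>x \<in> Ops P cs t. Str B (map (MCol \<phi>) cs) (MCol \<phi> t) (MOp \<phi> cs t x)) \<rparr>"

definition pullback_functor ::
  "('c, 'x) operad \<Rightarrow> ('c, 'x, 'd, 'y) operad_map \<Rightarrow>
   (('d, 'y, 'o, 'm) alg, ('d, 'y, 'o, 'm) alg_arr, ('c, 'x, 'o, 'm) alg, ('c, 'x, 'o, 'm) alg_arr) func"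
  where
  "pullback_functor P \<phi> = \<lparr>
     FObj = pullback_alg P \<phi>,
     FArr = (\<lambda>(A, h, B). (pullback_alg P \<phi> A, (\<lambda>t \<in> Colors P. h (MCol \<phi> t)), pullback_alg P \<phi> B)) \<rparr>"

end

theory Submission
  imports Defs
begin

text \<open>
  An algebra over the operad of an orthogonal category \<open>D\<close> is the same thing as an orthogonal monoid
  functor: a functor \<open>X : D \<rightarrow> M\<close> with a monoid structure on every \<open>X t\<close> for which all \<open>X f\<close> are monoid
  homomorphisms and such that \<open>X f\<close> and \<open>X g\<close> commute in the target whenever \<open>f \<bottom> g\<close>.  Such a functor on
  the full subcategory \<open>C\<close> is extended to \<open>t\<close> in \<open>D\<close> by the colimit of
  \<open>X (Dom f\<^sub>1) \<otimes> \<dots> \<otimes> X (Dom f\<^sub>n)\<close> over all words \<open>f\<^sub>1 \<dots> f\<^sub>n\<close> of arrows into \<open>t\<close> with domain in \<open>C\<close>,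
  modulo four local rewriting rules (functoriality, multiplication, unit, commutation of orthogonal
  letters); the tensor product preserves these colimits because \<open>M\<close> is closed, and concatenation of
  words is the multiplication.  For \<open>t\<close> in \<open>C\<close> every word rewrites along its letters to the one-letter
  word \<open>id\<close>, so \<open>X t\<close> itself is such a colimit.  With this choice the extension restricts to \<open>X\<close> on
  the nose, i.e. identities are universal arrows to the restriction functor, which forces the unit of
  any adjunction to be invertible.
\<close>

section \<open>Calculus of arrows\<close>

text \<open>In an algebra every operation is a permutation of an ordered one
  \<open>(id, fs)\<close>, so ordered words suffice as generators, and permutations survive only in
  the rule that exchanges orthogonal letters. Fullness matters because over an object of
  \<open>C\<close> all letters of a word lie in \<open>C\<close>; hence \<open>X t\<close> with its
  own products is a cocone there, and the pulled-back relation makes it respect the exchange rule.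
  Much of the labour is coherence. Algebra structures use right-bracketed tensor products ending in
  \<open>I\<close> and a symmetry assembled from insertions, so coherence is proved for exactly
  these formulas: rearrangements compose, commute with concatenation, and match the block
  permutations of operadic composition. A second obstacle is that algebras are compared by equality.
  Taking the colimit over an object of \<open>C\<close> to be \<open>X t\<close> itself yields an
  algebra whose restriction equals the given one. For an arbitrary left adjoint, the inverse of the
  unit at \<open>a\<close> can then be written down as the restriction of the counit at the strict
  extension of \<open>a\<close>.\<close>

context category
begin

lemma Arr_Comp [simp]: "f \<in> Arr C \<Longrightarrow> g \<in> Arr C \<Longrightarrow> Dom C g = Cod C f \<Longrightarrow> g \<cdot> f \<in> Arr C"
  and Dom_Comp [simp]: "f \<in> Arr C \<Longrightarrow> g \<in> Arr C \<Longrightarrow> Dom C g = Cod C f \<Longrightarrow> Dom C (g \<cdot> f) = Dom C f"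
  and Cod_Comp [simp]: "f \<in> Arr C \<Longrightarrow> g \<in> Arr C \<Longrightarrow> Dom C g = Cod C f \<Longrightarrow> Cod C (g \<cdot> f) = Cod C g"
  using Comp_hom[of f "Dom C f" "Cod C f" g "Cod C g"] by (auto simp: hom_def)

lemma Arr_Id [simp]: "a \<in> Obj C \<Longrightarrow> Id C a \<in> Arr C"
  and Dom_Id [simp]: "a \<in> Obj C \<Longrightarrow> Dom C (Id C a) = a"
  and Cod_Id [simp]: "a \<in> Obj C \<Longrightarrow> Cod C (Id C a) = a"
  using Id_hom[of a] by (auto simp: hom_def)

lemma Obj_Dom_Cod [simp]: "f \<in> Arr C \<Longrightarrow> Dom C f \<in> Obj C" "f \<in> Arr C \<Longrightarrow> Cod C f \<in> Obj C"
  by (auto intro: Dom_Obj Cod_Obj)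

lemma Id_Comp [simp]: "f \<in> Arr C \<Longrightarrow> Cod C f = b \<Longrightarrow> Id C b \<cdot> f = f"
  and Comp_Id [simp]: "f \<in> Arr C \<Longrightarrow> Dom C f = a \<Longrightarrow> f \<cdot> Id C a = f"
  by (auto intro: Comp_Id_left Comp_Id_right simp: hom_def)

lemma assoc [simp]: "f \<in> Arr C \<Longrightarrow> g \<in> Arr C \<Longrightarrow> h \<in> Arr C \<Longrightarrow> Dom C g = Cod C f \<Longrightarrow> Dom C h = Cod C g \<Longrightarrow>
    (h \<cdot> g) \<cdot> f = h \<cdot> (g \<cdot> f)"
  by (rule Comp_assoc[of f "Dom C f" "Cod C f" g "Cod C g" h "Cod C h"]) (auto simp: hom_def)

text \<open>Composites are kept right-bracketed by \<open>assoc\<close>, so a two-factor equation no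
  longer matches inside a longer composite. Naturality and coherence laws are applied there in the
  form \<open>reassoc[OF ...]\<close>.\<close>

lemma reassoc: "g \<cdot> f = h \<Longrightarrow> f \<in> Arr C \<Longrightarrow> g \<in> Arr C \<Longrightarrow> Dom C g = Cod C f \<Longrightarrow> z \<in> Arr C \<Longrightarrow>
    Dom C f = Cod C z \<Longrightarrow> g \<cdot> (f \<cdot> z) = h \<cdot> z"
  by (metis assoc)

lemma inverse_arrows_unique:
  assumes "inverse_arrows C f g" "inverse_arrows C f h"
  shows "g = h"
proof -
  have *: "g \<cdot> (f \<cdot> h) = (g \<cdot> f) \<cdot> h"
    using assms by (intro assoc[symmetric]) (auto simp: inverse_arrows_def hom_def)
  have "g \<cdot> f = Id C (Dom C f)" "f \<cdot> h = Id C (Cod C f)"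
    using assms by (simp_all add: inverse_arrows_def)
  with * show ?thesis
    using assms by (simp add: inverse_arrows_def hom_def del: assoc)
qed

lemma inv_arr_eq: "inverse_arrows C f g \<Longrightarrow> inv_arr C f = g"
  unfolding inv_arr_def by (blast intro: inverse_arrows_unique)

lemma inverse_arrows_inv: "is_iso C f \<Longrightarrow> inverse_arrows C f (inv_arr C f)"
  unfolding is_iso_def using inv_arr_eq by blast

lemma is_iso_Arr: "is_iso C f \<Longrightarrow> f \<in> Arr C"
  by (auto simp: is_iso_def inverse_arrows_def)

lemma inv_arr_simps [simp]:
  assumes "is_iso C f"
  shows "inv_arr C f \<in> Arr C" "Dom C (inv_arr C f) = Cod C f" "Cod C (inv_arr C f) = Dom C f"
    "inv_arr C f \<cdot> f = Id C (Dom C f)" "f \<cdot> inv_arr C f = Id C (Cod C f)"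
  using inverse_arrows_inv[OF assms] by (auto simp: inverse_arrows_def hom_def)

lemma inv_arr_reassoc [simp]:
  assumes "is_iso C f" "z \<in> Arr C"
  shows "Cod C z = Dom C f \<Longrightarrow> inv_arr C f \<cdot> (f \<cdot> z) = z"
    "Cod C z = Cod C f \<Longrightarrow> f \<cdot> (inv_arr C f \<cdot> z) = z"
  using assms is_iso_Arr[OF assms(1)] by (simp_all flip: assoc)

lemma iso_epi:
  assumes "is_iso C e" "f \<cdot> e = g \<cdot> e" "f \<in> Arr C" "g \<in> Arr C" "Dom C f = Cod C e" "Dom C g = Cod C e"
  shows "f = g"
proof -
  have "(f \<cdot> e) \<cdot> inv_arr C e = (g \<cdot> e) \<cdot> inv_arr C e" using assms(2) by simp
  then show ?thesis using assms(1,3-) is_iso_Arr[OF assms(1)] by simp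
qed

lemma iso_mono:
  assumes "is_iso C e" "e \<cdot> f = e \<cdot> g" "f \<in> Arr C" "g \<in> Arr C" "Cod C f = Dom C e" "Cod C g = Dom C e"
  shows "f = g"
  using arg_cong[OF assms(2), of "\<lambda>h. inv_arr C e \<cdot> h"] assms(1,3-) by simp

lemma is_isoI: "f \<in> Arr C \<Longrightarrow> g \<in> Arr C \<Longrightarrow> Dom C g = Cod C f \<Longrightarrow> Cod C g = Dom C f \<Longrightarrow>
    g \<cdot> f = Id C (Dom C f) \<Longrightarrow> f \<cdot> g = Id C (Cod C f) \<Longrightarrow> is_iso C f"
  by (auto simp: is_iso_def inverse_arrows_def hom_def)

lemma is_iso_Id [simp]: "a \<in> Obj C \<Longrightarrow> is_iso C (Id C a)"
  by (rule is_isoI[of _ "Id C a"]) auto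

lemma is_iso_Comp [simp]: "is_iso C f \<Longrightarrow> is_iso C g \<Longrightarrow> Dom C g = Cod C f \<Longrightarrow> is_iso C (g \<cdot> f)"
  by (rule is_isoI[of _ "inv_arr C f \<cdot> inv_arr C g"]) (auto simp: is_iso_Arr)

end

section \<open>Kelly's consequences of the axioms for unitors and symmetry\<close>

context symmetric_monoidal_category
begin

declare TObj_Obj [simp] TUnit_Obj [simp] Assoc_iso [simp] LUnit_iso [simp] RUnit_iso [simp]
  TArr_Id [simp] Sym_Sym [simp]

abbreviation I where "I \<equiv> TUnit M"

lemma TArr_simps [simp]:
  assumes "f \<in> Arr M" "g \<in> Arr M"
  shows "f \<boxtimes> g \<in> Arr M" "Dom M (f \<boxtimes> g) = Dom M f \<otimes> Dom M g" "Cod M (f \<boxtimes> g) = Cod M f \<otimes> Cod M g"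
  using TArr_hom[of f "Dom M f" "Cod M f" g "Dom M g" "Cod M g"] assms by (auto simp: hom_def)

lemma Assoc_simps [simp]:
  assumes "a \<in> Obj M" "b \<in> Obj M" "c \<in> Obj M"
  shows "Assoc M a b c \<in> Arr M" "Dom M (Assoc M a b c) = (a \<otimes> b) \<otimes> c"
    "Cod M (Assoc M a b c) = a \<otimes> (b \<otimes> c)"
  using Assoc_hom[OF assms] by (auto simp: hom_def)

lemma LUnit_simps [simp]: "a \<in> Obj M \<Longrightarrow> LUnit M a \<in> Arr M" "a \<in> Obj M \<Longrightarrow> Dom M (LUnit M a) = I \<otimes> a"
    "a \<in> Obj M \<Longrightarrow> Cod M (LUnit M a) = a"
  using LUnit_hom[of a] by (auto simp: hom_def)

lemma RUnit_simps [simp]: "a \<in> Obj M \<Longrightarrow> RUnit M a \<in> Arr M" "a \<in> Obj M \<Longrightarrow> Dom M (RUnit M a) = a \<otimes> I"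
    "a \<in> Obj M \<Longrightarrow> Cod M (RUnit M a) = a"
  using RUnit_hom[of a] by (auto simp: hom_def)

lemma Sym_simps [simp]:
  assumes "a \<in> Obj M" "b \<in> Obj M"
  shows "Sym M a b \<in> Arr M" "Dom M (Sym M a b) = a \<otimes> b" "Cod M (Sym M a b) = b \<otimes> a"
  using Sym_hom[OF assms] by (auto simp: hom_def)

text \<open>Oriented towards a single tensor of composites; steps that need a tensor factor as a
  separate arrow remove the rule from the simplifier.\<close>

lemma interchange [simp]:
  assumes "f \<in> Arr M" "f' \<in> Arr M" "g \<in> Arr M" "g' \<in> Arr M" "Dom M f' = Cod M f" "Dom M g' = Cod M g"
  shows "(f' \<boxtimes> g') \<cdot> (f \<boxtimes> g) = (f' \<cdot> f) \<boxtimes> (g' \<cdot> g)"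
  using TArr_Comp[of f "Dom M f" "Cod M f" f' "Cod M f'" g "Dom M g" "Cod M g" g' "Cod M g'"] assms
  by (auto simp: hom_def)

lemma interchange_reassoc [simp]:
  assumes "f \<in> Arr M" "f' \<in> Arr M" "g \<in> Arr M" "g' \<in> Arr M" "Dom M f' = Cod M f" "Dom M g' = Cod M g"
    "z \<in> Arr M" "Cod M z = Dom M f \<otimes> Dom M g"
  shows "(f' \<boxtimes> g') \<cdot> ((f \<boxtimes> g) \<cdot> z) = ((f' \<cdot> f) \<boxtimes> (g' \<cdot> g)) \<cdot> z"
  using assms by (simp flip: assoc)

lemma is_iso_TArr [simp]: "is_iso M f \<Longrightarrow> is_iso M g \<Longrightarrow> is_iso M (f \<boxtimes> g)"
  by (rule is_isoI[of _ "inv_arr M f \<boxtimes> inv_arr M g"]) (auto simp: is_iso_Arr)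

lemma Assoc_nat':
  "f \<in> Arr M \<Longrightarrow> g \<in> Arr M \<Longrightarrow> h \<in> Arr M \<Longrightarrow> Cod M f = a \<Longrightarrow> Cod M g = b \<Longrightarrow> Cod M h = c \<Longrightarrow>
   Assoc M a b c \<cdot> ((f \<boxtimes> g) \<boxtimes> h) =
   (f \<boxtimes> (g \<boxtimes> h)) \<cdot> Assoc M (Dom M f) (Dom M g) (Dom M h)"
  by (rule Assoc_nat) (auto simp: hom_def)

lemma Assoc_inv_nat:
  assumes "f \<in> Arr M" "g \<in> Arr M" "h \<in> Arr M" "Cod M f = a" "Cod M g = b" "Cod M h = c"
  shows "inv_arr M (Assoc M a b c) \<cdot> (f \<boxtimes> (g \<boxtimes> h)) =
   ((f \<boxtimes> g) \<boxtimes> h) \<cdot> inv_arr M (Assoc M (Dom M f) (Dom M g) (Dom M h))"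
proof -
  have o: "a \<in> Obj M" "b \<in> Obj M" "c \<in> Obj M" using assms by auto
  show ?thesis
    by (rule iso_mono[OF Assoc_iso[OF o]], insert o assms)
      (simp_all add: reassoc[OF Assoc_nat'])
qed

lemma LUnit_nat': "f \<in> Arr M \<Longrightarrow> Cod M f = b \<Longrightarrow> LUnit M b \<cdot> (Id M I \<boxtimes> f) = f \<cdot> LUnit M (Dom M f)"
  by (rule LUnit_nat) (auto simp: hom_def)

lemma RUnit_nat': "f \<in> Arr M \<Longrightarrow> Cod M f = b \<Longrightarrow> RUnit M b \<cdot> (f \<boxtimes> Id M I) = f \<cdot> RUnit M (Dom M f)"
  by (rule RUnit_nat) (auto simp: hom_def)

lemma RUnit_inv_nat:
  assumes "f \<in> Arr M" "Cod M f = b"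
  shows "inv_arr M (RUnit M b) \<cdot> f = (f \<boxtimes> Id M I) \<cdot> inv_arr M (RUnit M (Dom M f))"
proof (rule iso_mono[of "RUnit M b"])
  show "RUnit M b \<cdot> (inv_arr M (RUnit M b) \<cdot> f) =
      RUnit M b \<cdot> ((f \<boxtimes> Id M I) \<cdot> inv_arr M (RUnit M (Dom M f)))"
    using assms by (auto simp: reassoc[OF RUnit_nat'])
qed (use assms in auto)

lemma LUnit_inv_nat:
  assumes "f \<in> Arr M" "Cod M f = b"
  shows "inv_arr M (LUnit M b) \<cdot> f = (Id M I \<boxtimes> f) \<cdot> inv_arr M (LUnit M (Dom M f))"
proof (rule iso_mono[of "LUnit M b"])
  show "LUnit M b \<cdot> (inv_arr M (LUnit M b) \<cdot> f) =
      LUnit M b \<cdot> ((Id M I \<boxtimes> f) \<cdot> inv_arr M (LUnit M (Dom M f)))"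
    using assms by (auto simp: reassoc[OF LUnit_nat'])
qed (use assms in auto)

lemma Sym_nat': "f \<in> Arr M \<Longrightarrow> g \<in> Arr M \<Longrightarrow> Cod M f = a \<Longrightarrow> Cod M g = b \<Longrightarrow>
    Sym M a b \<cdot> (f \<boxtimes> g) = (g \<boxtimes> f) \<cdot> Sym M (Dom M f) (Dom M g)"
  by (rule Sym_nat) (auto simp: hom_def)

lemma Sym_iso [simp]: "a \<in> Obj M \<Longrightarrow> b \<in> Obj M \<Longrightarrow> is_iso M (Sym M a b)"
  by (rule is_isoI[of _ "Sym M b a"]) auto

text \<open>Naturality of the right unitor. Coherence laws can therefore be checked after tensoring
  with \<open>I\<close>, where the pentagon and the triangle apply.\<close>

lemma tensor_unit_faithful:
  assumes "f \<boxtimes> Id M I = g \<boxtimes> Id M I" "f \<in> Arr M" "g \<in> Arr M" "Dom M f = Dom M g" "Cod M f = Cod M g"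
  shows "f = g"
proof (rule iso_epi[of "RUnit M (Dom M f)"])
  show "f \<cdot> RUnit M (Dom M f) = g \<cdot> RUnit M (Dom M f)"
    using assms RUnit_nat'[of f "Cod M f"] RUnit_nat'[of g "Cod M f"] by simp
qed (use assms in auto)

lemma unit_tensor_faithful:
  assumes "Id M I \<boxtimes> f = Id M I \<boxtimes> g" "f \<in> Arr M" "g \<in> Arr M" "Dom M f = Dom M g" "Cod M f = Cod M g"
  shows "f = g"
proof (rule iso_epi[of "LUnit M (Dom M f)"])
  show "f \<cdot> LUnit M (Dom M f) = g \<cdot> LUnit M (Dom M f)"
    using assms LUnit_nat'[of f "Cod M f"] LUnit_nat'[of g "Cod M f"] by simp
qed (use assms in auto)

lemma pentagon':
  assumes "a \<in> Obj M" "b \<in> Obj M" "c \<in> Obj M" "d \<in> Obj M"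
  shows "(Id M a \<boxtimes> Assoc M b c d) \<cdot> (Assoc M a (b \<otimes> c) d \<cdot> (Assoc M a b c \<boxtimes> Id M d)) =
    Assoc M a b (c \<otimes> d) \<cdot> Assoc M (a \<otimes> b) c d"
  using pentagon[OF assms] by simp

text \<open>Tensoring with \<open>I\<close> on the left turns the claim into the pentagon for
  \<open>I, I, a, x\<close>, where two uses of the triangle trade the left unitors for
  \<open>RUnit M I\<close>.\<close>

lemma LUnit_tensor:
  assumes [simp]: "a \<in> Obj M" "x \<in> Obj M"
  shows "LUnit M (a \<otimes> x) \<cdot> Assoc M I a x = LUnit M a \<boxtimes> Id M x"
proof -
  let ?e = "Assoc M I (I \<otimes> a) x \<cdot> (Assoc M I I a \<boxtimes> Id M x)"
  have "(Id M I \<boxtimes> (LUnit M (a \<otimes> x) \<cdot> Assoc M I a x)) \<cdot> ?e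
      = (Id M I \<boxtimes> LUnit M (a \<otimes> x)) \<cdot> ((Id M I \<boxtimes> Assoc M I a x) \<cdot> ?e)"
    by simp
  also have "\<dots> = (Id M I \<boxtimes> LUnit M (a \<otimes> x)) \<cdot> (Assoc M I I (a \<otimes> x) \<cdot> Assoc M (I \<otimes> I) a x)"
    by (simp only: pentagon' assms TUnit_Obj)
  also have "\<dots> = (RUnit M I \<boxtimes> Id M (a \<otimes> x)) \<cdot> Assoc M (I \<otimes> I) a x"
    by (simp add: reassoc[OF triangle])
  also have "\<dots> = Assoc M I a x \<cdot> ((RUnit M I \<boxtimes> Id M a) \<boxtimes> Id M x)"
    by (simp add: Assoc_nat')
  also have "\<dots> = Assoc M I a x \<cdot> (((Id M I \<boxtimes> LUnit M a) \<boxtimes> Id M x) \<cdot> (Assoc M I I a \<boxtimes> Id M x))"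
    by (simp add: triangle)
  also have "\<dots> = (Id M I \<boxtimes> (LUnit M a \<boxtimes> Id M x)) \<cdot> ?e"
    by (simp add: reassoc[OF Assoc_nat'] del: interchange)
  finally have "Id M I \<boxtimes> (LUnit M (a \<otimes> x) \<cdot> Assoc M I a x) = Id M I \<boxtimes> (LUnit M a \<boxtimes> Id M x)"
    by (rule iso_epi[rotated]) simp_all
  then show ?thesis
    by (rule unit_tensor_faithful) simp_all
qed

text \<open>The mirror argument: the pentagon for \<open>a, b, I, I\<close>, read after tensoring
  with \<open>I\<close> on the right.\<close>

lemma RUnit_tensor:
  assumes [simp]: "a \<in> Obj M" "b \<in> Obj M"
  shows "(Id M a \<boxtimes> RUnit M b) \<cdot> Assoc M a b I = RUnit M (a \<otimes> b)"
proof -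
  have "Assoc M a b I \<cdot> (RUnit M (a \<otimes> b) \<boxtimes> Id M I)
     = Assoc M a b I \<cdot> ((Id M (a \<otimes> b) \<boxtimes> LUnit M I) \<cdot> Assoc M (a \<otimes> b) I I)"
    by (simp add: triangle)
  also have "\<dots> = (Id M a \<boxtimes> (Id M b \<boxtimes> LUnit M I)) \<cdot> (Assoc M a b (I \<otimes> I) \<cdot> Assoc M (a \<otimes> b) I I)"
    using Assoc_nat'[of "Id M a" "Id M b" "LUnit M I" a b I]
    by (simp flip: assoc)
  also have "\<dots> = (Id M a \<boxtimes> (Id M b \<boxtimes> LUnit M I)) \<cdot>
     ((Id M a \<boxtimes> Assoc M b I I) \<cdot> (Assoc M a (b \<otimes> I) I \<cdot> (Assoc M a b I \<boxtimes> Id M I)))"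
    by (simp only: pentagon' assms TUnit_Obj)
  also have "\<dots> = (Id M a \<boxtimes> (RUnit M b \<boxtimes> Id M I)) \<cdot> (Assoc M a (b \<otimes> I) I \<cdot> (Assoc M a b I \<boxtimes> Id M I))"
    by (simp add: triangle)
  also have "\<dots> = Assoc M a b I \<cdot> (((Id M a \<boxtimes> RUnit M b) \<boxtimes> Id M I) \<cdot> (Assoc M a b I \<boxtimes> Id M I))"
    by (simp add: reassoc[OF Assoc_nat'] del: interchange)
  finally have "RUnit M (a \<otimes> b) \<boxtimes> Id M I = ((Id M a \<boxtimes> RUnit M b) \<boxtimes> Id M I) \<cdot> (Assoc M a b I \<boxtimes> Id M I)"
    by (rule iso_mono[rotated]) simp_all
  then have "((Id M a \<boxtimes> RUnit M b) \<cdot> Assoc M a b I) \<boxtimes> Id M I = RUnit M (a \<otimes> b) \<boxtimes> Id M I"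
    by simp
  then show ?thesis
    by (rule tensor_unit_faithful) simp_all
qed

text \<open>Naturality of the right unitor along itself gives
  \<open>RUnit M (I \<otimes> I) = RUnit M I \<boxtimes> Id M I\<close>; the triangle and
  \<open>RUnit_tensor\<close> then express this arrow in two ways.\<close>

lemma LUnit_eq_RUnit: "LUnit M I = RUnit M I"
proof -
  have *: "RUnit M (I \<otimes> I) = RUnit M I \<boxtimes> Id M I"
    by (rule iso_mono[of "RUnit M I"]) (simp_all add: RUnit_nat')
  have "(Id M I \<boxtimes> LUnit M I) \<cdot> Assoc M I I I = (Id M I \<boxtimes> RUnit M I) \<cdot> Assoc M I I I"
    by (simp add: triangle RUnit_tensor *)
  then have "Id M I \<boxtimes> LUnit M I = Id M I \<boxtimes> RUnit M I"
    by (rule iso_epi[rotated]) simp_all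
  then show ?thesis
    by (rule unit_tensor_faithful) simp_all
qed

text \<open>The hexagon for \<open>a, I, I\<close>: once the triangle and
  \<open>LUnit_tensor\<close> have removed the associators, one copy of the symmetry
  cancels.\<close>

lemma LUnit_Sym:
  assumes [simp]: "a \<in> Obj M"
  shows "LUnit M a \<cdot> Sym M a I = RUnit M a"
proof -
  have "Sym M a I \<cdot> (RUnit M a \<boxtimes> Id M I) = Sym M a I \<cdot> ((Id M a \<boxtimes> LUnit M I) \<cdot> Assoc M a I I)"
    by (simp add: triangle)
  also have "\<dots> = (LUnit M I \<boxtimes> Id M a) \<cdot> (Sym M a (I \<otimes> I) \<cdot> Assoc M a I I)"
    by (simp add: reassoc[OF Sym_nat'])
  also have "\<dots> = LUnit M (I \<otimes> a) \<cdot> (Assoc M I I a \<cdot> (Sym M a (I \<otimes> I) \<cdot> Assoc M a I I))"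
    by (simp add: LUnit_tensor[symmetric])
  also have "\<dots> = LUnit M (I \<otimes> a) \<cdot> ((Id M I \<boxtimes> Sym M a I) \<cdot> (Assoc M I a I \<cdot> (Sym M a I \<boxtimes> Id M I)))"
    by (simp add: hexagon)
  also have "\<dots> = Sym M a I \<cdot> (LUnit M (a \<otimes> I) \<cdot> (Assoc M I a I \<cdot> (Sym M a I \<boxtimes> Id M I)))"
    by (simp add: reassoc[OF LUnit_nat'])
  also have "\<dots> = Sym M a I \<cdot> ((LUnit M a \<boxtimes> Id M I) \<cdot> (Sym M a I \<boxtimes> Id M I))"
    by (simp add: reassoc[OF LUnit_tensor] del: interchange)
  finally have "RUnit M a \<boxtimes> Id M I = (LUnit M a \<boxtimes> Id M I) \<cdot> (Sym M a I \<boxtimes> Id M I)"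
    by (rule iso_mono[rotated]) simp_all
  then have "(LUnit M a \<cdot> Sym M a I) \<boxtimes> Id M I = RUnit M a \<boxtimes> Id M I"
    by simp
  then show ?thesis
    by (rule tensor_unit_faithful) simp_all
qed

end

section \<open>Moving a factor past another\<close>

context symmetric_monoidal_category
begin

text \<open>The adjacent transposition of a right-bracketed product; \<open>x\<close> stands for all
  later factors. The same composite, with an iterated tensor product for \<open>x\<close>, occurs in
  \<open>tens_insert\<close>.\<close>

definition swap :: "'o \<Rightarrow> 'o \<Rightarrow> 'o \<Rightarrow> 'm" where
  "swap a b x = Assoc M b a x \<cdot> ((Sym M a b \<boxtimes> Id M x) \<cdot> inv_arr M (Assoc M a b x))"

lemma swap_simps [simp]:
  assumes "a \<in> Obj M" "b \<in> Obj M" "x \<in> Obj M"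
  shows "swap a b x \<in> Arr M" "Dom M (swap a b x) = a \<otimes> (b \<otimes> x)" "Cod M (swap a b x) = b \<otimes> (a \<otimes> x)"
  using assms by (simp_all add: swap_def)

lemma swap_Assoc: "a \<in> Obj M \<Longrightarrow> b \<in> Obj M \<Longrightarrow> x \<in> Obj M \<Longrightarrow>
    swap a b x \<cdot> Assoc M a b x = Assoc M b a x \<cdot> (Sym M a b \<boxtimes> Id M x)"
  by (simp add: swap_def)

lemma swap_swap [simp]: "a \<in> Obj M \<Longrightarrow> b \<in> Obj M \<Longrightarrow> x \<in> Obj M \<Longrightarrow>
    swap b a x \<cdot> swap a b x = Id M (a \<otimes> (b \<otimes> x))"
  by (simp add: swap_def)

lemma swap_swap_reassoc [simp]: "a \<in> Obj M \<Longrightarrow> b \<in> Obj M \<Longrightarrow> x \<in> Obj M \<Longrightarrow> z \<in> Arr M \<Longrightarrow>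
    Cod M z = a \<otimes> (b \<otimes> x) \<Longrightarrow> swap b a x \<cdot> (swap a b x \<cdot> z) = z"
  by (simp add: reassoc[OF swap_swap])

lemma swap_iso [simp]: "a \<in> Obj M \<Longrightarrow> b \<in> Obj M \<Longrightarrow> x \<in> Obj M \<Longrightarrow> is_iso M (swap a b x)"
  by (rule is_isoI[of _ "swap b a x"]) auto

lemma swap_nat:
  assumes "f \<in> Arr M" "g \<in> Arr M" "h \<in> Arr M" "Cod M f = a" "Cod M g = b" "Cod M h = c"
  shows "swap a b c \<cdot> (f \<boxtimes> (g \<boxtimes> h)) = (g \<boxtimes> (f \<boxtimes> h)) \<cdot> swap (Dom M f) (Dom M g) (Dom M h)"
proof -
  have o [simp]: "a \<in> Obj M" "b \<in> Obj M" "c \<in> Obj M" using assms by auto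
  have "swap a b c \<cdot> (f \<boxtimes> (g \<boxtimes> h)) = Assoc M b a c \<cdot> (((Sym M a b \<cdot> (f \<boxtimes> g)) \<boxtimes> h) \<cdot>
      inv_arr M (Assoc M (Dom M f) (Dom M g) (Dom M h)))"
    using assms by (simp add: swap_def Assoc_inv_nat)
  also have "\<dots> = Assoc M b a c \<cdot> (((g \<boxtimes> f) \<boxtimes> h) \<cdot> ((Sym M (Dom M f) (Dom M g) \<boxtimes> Id M (Dom M h)) \<cdot>
      inv_arr M (Assoc M (Dom M f) (Dom M g) (Dom M h))))"
    using assms by (simp add: Sym_nat')
  also have "\<dots> = (g \<boxtimes> (f \<boxtimes> h)) \<cdot> swap (Dom M f) (Dom M g) (Dom M h)"
    using assms by (simp add: swap_def reassoc[OF Assoc_nat'] del: interchange interchange_reassoc)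
  finally show ?thesis .
qed

text \<open>The hexagon with a tail. Precomposing with the associators that bracket
  \<open>l, k, m\<close> together reduces it to \<open>hexagon\<close> tensored with
  \<open>x\<close>; pentagons move the tail in and out.\<close>

lemma swap_tensor_right:
  assumes [simp]: "l \<in> Obj M" "k \<in> Obj M" "m \<in> Obj M" "x \<in> Obj M"
  shows "(Id M k \<boxtimes> swap l m x) \<cdot> (swap l k (m \<otimes> x) \<cdot> (Id M l \<boxtimes> Assoc M k m x)) =
    Assoc M k m (l \<otimes> x) \<cdot> swap l (k \<otimes> m) x"
proof -
  let ?e = "Assoc M l (k \<otimes> m) x \<cdot> (Assoc M l k m \<boxtimes> Id M x)"
  have "((Id M k \<boxtimes> swap l m x) \<cdot> (swap l k (m \<otimes> x) \<cdot> (Id M l \<boxtimes> Assoc M k m x))) \<cdot> ?e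
     = (Id M k \<boxtimes> swap l m x) \<cdot> (swap l k (m \<otimes> x) \<cdot> ((Id M l \<boxtimes> Assoc M k m x) \<cdot> ?e))"
    by simp
  also have "\<dots> = (Id M k \<boxtimes> swap l m x) \<cdot> (swap l k (m \<otimes> x) \<cdot> (Assoc M l k (m \<otimes> x) \<cdot> Assoc M (l \<otimes> k) m x))"
    by (simp only: pentagon' assms)
  also have "\<dots> = (Id M k \<boxtimes> swap l m x) \<cdot> (Assoc M k l (m \<otimes> x) \<cdot> ((Sym M l k \<boxtimes> Id M (m \<otimes> x)) \<cdot> Assoc M (l \<otimes> k) m x))"
    by (simp add: reassoc[OF swap_Assoc])
  also have "\<dots> = (Id M k \<boxtimes> swap l m x) \<cdot> ((Assoc M k l (m \<otimes> x) \<cdot> Assoc M (k \<otimes> l) m x) \<cdot>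
    ((Sym M l k \<boxtimes> Id M m) \<boxtimes> Id M x))"
    by (simp add: Assoc_nat')
  also have "\<dots> = (Id M k \<boxtimes> swap l m x) \<cdot> (((Id M k \<boxtimes> Assoc M l m x) \<cdot> (Assoc M k (l \<otimes> m) x \<cdot>
    (Assoc M k l m \<boxtimes> Id M x))) \<cdot> ((Sym M l k \<boxtimes> Id M m) \<boxtimes> Id M x))"
    by (simp only: pentagon assms)
  also have "\<dots> = (Id M k \<boxtimes> Assoc M m l x) \<cdot> ((Id M k \<boxtimes> (Sym M l m \<boxtimes> Id M x)) \<cdot> (Assoc M k (l \<otimes> m) x \<cdot>
    ((Assoc M k l m \<cdot> (Sym M l k \<boxtimes> Id M m)) \<boxtimes> Id M x)))"
    by (simp add: swap_Assoc)
  also have "\<dots> = (Id M k \<boxtimes> Assoc M m l x) \<cdot> (Assoc M k (m \<otimes> l) x \<cdot> (((Id M k \<boxtimes> Sym M l m) \<cdot> (Assoc M k l m \<cdot>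
    (Sym M l k \<boxtimes> Id M m))) \<boxtimes> Id M x))"
  proof -
    have "(Id M k \<boxtimes> (Sym M l m \<boxtimes> Id M x)) \<cdot> Assoc M k (l \<otimes> m) x = Assoc M k (m \<otimes> l) x \<cdot> ((Id M k \<boxtimes> Sym M l m) \<boxtimes> Id M x)"
      by (simp add: Assoc_nat')
    from reassoc[OF this] show ?thesis by simp
  qed
  also have "\<dots> = (Id M k \<boxtimes> Assoc M m l x) \<cdot> (Assoc M k (m \<otimes> l) x \<cdot> ((Assoc M k m l \<boxtimes> Id M x) \<cdot>
    ((Sym M l (k \<otimes> m) \<cdot> Assoc M l k m) \<boxtimes> Id M x)))"
    by (simp add: hexagon[symmetric])
  also have "\<dots> = ((Id M k \<boxtimes> Assoc M m l x) \<cdot> (Assoc M k (m \<otimes> l) x \<cdot> (Assoc M k m l \<boxtimes> Id M x))) \<cdot>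
    ((Sym M l (k \<otimes> m) \<boxtimes> Id M x) \<cdot> (Assoc M l k m \<boxtimes> Id M x))"
    by simp
  also have "\<dots> = (Assoc M k m (l \<otimes> x) \<cdot> Assoc M (k \<otimes> m) l x) \<cdot> ((Sym M l (k \<otimes> m) \<boxtimes> Id M x) \<cdot> (Assoc M l k m \<boxtimes> Id M x))"
    by (simp only: pentagon assms)
  also have "\<dots> = (Assoc M k m (l \<otimes> x) \<cdot> swap l (k \<otimes> m) x) \<cdot> ?e"
    by (simp add: reassoc[OF swap_Assoc])
  finally show ?thesis
    by (rule iso_epi[rotated]) simp_all
qed

text \<open>The second hexagon is the inverse of the first, because \<open>swap\<close> is inverse
  to the opposite \<open>swap\<close>.\<close>

lemma swap_tensor_left:
  assumes [simp]: "l \<in> Obj M" "k \<in> Obj M" "m \<in> Obj M" "x \<in> Obj M"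
  shows "(Id M l \<boxtimes> Assoc M k m x) \<cdot> swap (k \<otimes> m) l x =
    swap k l (m \<otimes> x) \<cdot> ((Id M k \<boxtimes> swap m l x) \<cdot> Assoc M k m (l \<otimes> x))"
proof (rule iso_mono[of "(Id M k \<boxtimes> swap l m x) \<cdot> swap l k (m \<otimes> x)"])
  have "((Id M k \<boxtimes> swap l m x) \<cdot> swap l k (m \<otimes> x)) \<cdot> ((Id M l \<boxtimes> Assoc M k m x) \<cdot> swap (k \<otimes> m) l x)
     = ((Id M k \<boxtimes> swap l m x) \<cdot> (swap l k (m \<otimes> x) \<cdot> (Id M l \<boxtimes> Assoc M k m x))) \<cdot> swap (k \<otimes> m) l x"
    by simp
  also have "\<dots> = Assoc M k m (l \<otimes> x)"
    by (simp only: swap_tensor_right assms) simp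
  finally show "((Id M k \<boxtimes> swap l m x) \<cdot> swap l k (m \<otimes> x)) \<cdot> ((Id M l \<boxtimes> Assoc M k m x) \<cdot> swap (k \<otimes> m) l x) =
    ((Id M k \<boxtimes> swap l m x) \<cdot> swap l k (m \<otimes> x)) \<cdot>
    (swap k l (m \<otimes> x) \<cdot> ((Id M k \<boxtimes> swap m l x) \<cdot> Assoc M k m (l \<otimes> x)))"
    by simp
qed simp_all

lemma swap_unit_right:
  assumes [simp]: "a \<in> Obj M" "x \<in> Obj M"
  shows "LUnit M (a \<otimes> x) \<cdot> swap a I x = Id M a \<boxtimes> LUnit M x"
proof (rule iso_epi[of "Assoc M a I x"])
  have "(LUnit M (a \<otimes> x) \<cdot> swap a I x) \<cdot> Assoc M a I x = (LUnit M a \<cdot> Sym M a I) \<boxtimes> Id M x"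
    by (simp add: swap_Assoc reassoc[OF LUnit_tensor])
  also have "\<dots> = (Id M a \<boxtimes> LUnit M x) \<cdot> Assoc M a I x"
    by (simp add: LUnit_Sym triangle)
  finally show "(LUnit M (a \<otimes> x) \<cdot> swap a I x) \<cdot> Assoc M a I x = (Id M a \<boxtimes> LUnit M x) \<cdot> Assoc M a I x" .
qed simp_all

lemma swap_unit_left:
  assumes [simp]: "a \<in> Obj M" "x \<in> Obj M"
  shows "(Id M a \<boxtimes> LUnit M x) \<cdot> swap I a x = LUnit M (a \<otimes> x)"
  by (simp flip: swap_unit_right)

text \<open>By \<open>swap_tensor_right\<close>, passing \<open>l\<close> over two factors in turn
  is passing it over their tensor product; there the exchange of \<open>k\<close> and
  \<open>m\<close> slides through by naturality of \<open>swap\<close>.\<close>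

lemma yang_baxter:
  assumes [simp]: "l \<in> Obj M" "k \<in> Obj M" "m \<in> Obj M" "x \<in> Obj M"
  shows "(Id M m \<boxtimes> swap l k x) \<cdot> (swap l m (k \<otimes> x) \<cdot> (Id M l \<boxtimes> swap k m x)) =
    swap k m (l \<otimes> x) \<cdot> ((Id M k \<boxtimes> swap l m x) \<cdot> swap l k (m \<otimes> x))"
proof -
  let ?e = "Id M l \<boxtimes> Assoc M k m x"
  have "(swap k m (l \<otimes> x) \<cdot> ((Id M k \<boxtimes> swap l m x) \<cdot> swap l k (m \<otimes> x))) \<cdot> ?e =
     swap k m (l \<otimes> x) \<cdot> ((Id M k \<boxtimes> swap l m x) \<cdot> (swap l k (m \<otimes> x) \<cdot> ?e))"
    by simp
  also have "\<dots> = swap k m (l \<otimes> x) \<cdot> (Assoc M k m (l \<otimes> x) \<cdot> swap l (k \<otimes> m) x)"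
    by (simp only: swap_tensor_right assms)
  also have "\<dots> = Assoc M m k (l \<otimes> x) \<cdot> ((Sym M k m \<boxtimes> (Id M l \<boxtimes> Id M x)) \<cdot> swap l (k \<otimes> m) x)"
    by (simp add: reassoc[OF swap_Assoc])
  also have "\<dots> = Assoc M m k (l \<otimes> x) \<cdot> (swap l (m \<otimes> k) x \<cdot> (Id M l \<boxtimes> (Sym M k m \<boxtimes> Id M x)))"
    by (simp add: swap_nat)
  also have "\<dots> = (Assoc M m k (l \<otimes> x) \<cdot> swap l (m \<otimes> k) x) \<cdot> (Id M l \<boxtimes> (Sym M k m \<boxtimes> Id M x))"
    by simp
  also have "\<dots> = ((Id M m \<boxtimes> swap l k x) \<cdot> (swap l m (k \<otimes> x) \<cdot> (Id M l \<boxtimes> Assoc M m k x))) \<cdot>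
    (Id M l \<boxtimes> (Sym M k m \<boxtimes> Id M x))"
    by (simp only: swap_tensor_right assms)
  also have "\<dots> = ((Id M m \<boxtimes> swap l k x) \<cdot> (swap l m (k \<otimes> x) \<cdot> (Id M l \<boxtimes> swap k m x))) \<cdot> ?e"
    by (simp add: swap_Assoc)
  finally show ?thesis
    by (rule iso_epi[rotated, OF HOL.sym]) simp_all
qed

text \<open>The one-step case of compatibility between permutations and concatenation: after
  precomposing with an associator, only the pentagon and naturality of the associator are
  needed.\<close>

lemma swap_tail:
  assumes [simp]: "l \<in> Obj M" "k \<in> Obj M" "c \<in> Obj M" "x \<in> Obj M"
  shows "(Id M k \<boxtimes> Assoc M l c x) \<cdot> (Assoc M k (l \<otimes> c) x \<cdot> (swap l k c \<boxtimes> Id M x)) =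
    swap l k (c \<otimes> x) \<cdot> ((Id M l \<boxtimes> Assoc M k c x) \<cdot> Assoc M l (k \<otimes> c) x)"
proof -
  let ?e = "Assoc M l k c \<boxtimes> Id M x"
  have "((Id M k \<boxtimes> Assoc M l c x) \<cdot> (Assoc M k (l \<otimes> c) x \<cdot> (swap l k c \<boxtimes> Id M x))) \<cdot> ?e
    = ((Id M k \<boxtimes> Assoc M l c x) \<cdot> (Assoc M k (l \<otimes> c) x \<cdot> (Assoc M k l c \<boxtimes> Id M x))) \<cdot> ((Sym M l k \<boxtimes> Id M c) \<boxtimes> Id M x)"
    by (simp add: swap_Assoc)
  also have "\<dots> = Assoc M k l (c \<otimes> x) \<cdot> ((Sym M l k \<boxtimes> Id M (c \<otimes> x)) \<cdot> Assoc M (l \<otimes> k) c x)"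
    by (simp only: pentagon' assms) (simp add: Assoc_nat')
  also have "\<dots> = swap l k (c \<otimes> x) \<cdot> (Assoc M l k (c \<otimes> x) \<cdot> Assoc M (l \<otimes> k) c x)"
    by (simp add: reassoc[OF swap_Assoc])
  also have "\<dots> = swap l k (c \<otimes> x) \<cdot> ((Id M l \<boxtimes> Assoc M k c x) \<cdot> (Assoc M l (k \<otimes> c) x \<cdot> ?e))"
    by (simp only: pentagon' assms)
  also have "\<dots> = (swap l k (c \<otimes> x) \<cdot> ((Id M l \<boxtimes> Assoc M k c x) \<cdot> Assoc M l (k \<otimes> c) x)) \<cdot> ?e"
    by simp
  finally show ?thesis
    by (rule iso_epi[rotated]) simp_all
qed

text \<open>Links the insertion formulas, which only know \<open>swap\<close>, to the bare symmetry
  in the commutation law for orthogonal arrows.\<close>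

lemma swap_unit_Sym:
  assumes [simp]: "a \<in> Obj M" "b \<in> Obj M"
  shows "(Id M b \<boxtimes> RUnit M a) \<cdot> swap a b I = Sym M a b \<cdot> (Id M a \<boxtimes> RUnit M b)"
proof (rule iso_epi[of "Assoc M a b I"])
  show "((Id M b \<boxtimes> RUnit M a) \<cdot> swap a b I) \<cdot> Assoc M a b I = (Sym M a b \<cdot> (Id M a \<boxtimes> RUnit M b)) \<cdot> Assoc M a b I"
    by (simp add: swap_Assoc reassoc[OF RUnit_tensor] RUnit_nat' RUnit_tensor)
qed simp_all

end

section \<open>Iterated tensor products with a tail\<close>

context symmetric_monoidal_category
begin

text \<open>\<open>tens\<close> is the case \<open>x = I\<close>. With a free tail, concatenation of
  lists is strict: \<open>tobj (as @ bs) x\<close> equals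
  \<open>tobj as (tobj bs x)\<close>.\<close>

definition tobj :: "'o list \<Rightarrow> 'o \<Rightarrow> 'o" where
  "tobj as x = foldr (TObj M) as x"

definition tarr :: "'m list \<Rightarrow> 'm \<Rightarrow> 'm" where
  "tarr fs g = foldr (TArr M) fs g"

lemma tobj_simps [simp]: "tobj [] x = x" "tobj (a # as) x = a \<otimes> tobj as x"
    "tobj (as @ bs) x = tobj as (tobj bs x)"
  by (simp_all add: tobj_def)

lemma tarr_simps [simp]: "tarr [] g = g" "tarr (f # fs) g = f \<boxtimes> tarr fs g"
    "tarr (fs @ fs') g = tarr fs (tarr fs' g)"
  by (simp_all add: tarr_def)

lemma tens_tobj: "tens M as = tobj as I"
  by (simp add: tens_def tobj_def)

lemma tens_arr_tarr: "tens_arr M fs = tarr fs (Id M I)"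
  by (simp add: tens_arr_def tarr_def)

lemma tobj_Obj [simp]: "set as \<subseteq> Obj M \<Longrightarrow> x \<in> Obj M \<Longrightarrow> tobj as x \<in> Obj M"
  by (induction as) auto

lemma tarr_typ [simp]:
  assumes "set fs \<subseteq> Arr M" "g \<in> Arr M"
  shows "tarr fs g \<in> Arr M" "Dom M (tarr fs g) = tobj (map (Dom M) fs) (Dom M g)"
    "Cod M (tarr fs g) = tobj (map (Cod M) fs) (Cod M g)"
  using assms by (induction fs) auto

abbreviation tid :: "'o list \<Rightarrow> 'm \<Rightarrow> 'm" where
  "tid as \<equiv> tarr (map (Id M) as)"

lemma map_Dom_Id [simp]: "set as \<subseteq> Obj M \<Longrightarrow> map (Dom M \<circ> Id M) as = as"
    "set as \<subseteq> Obj M \<Longrightarrow> map (Cod M \<circ> Id M) as = as"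
  by (auto intro!: map_idI)

lemma Id_subset_Arr [simp]: "as \<subseteq> Obj M \<Longrightarrow> Id M ` as \<subseteq> Arr M"
  by auto

lemma tid_Id [simp]: "set as \<subseteq> Obj M \<Longrightarrow> x \<in> Obj M \<Longrightarrow> tid as (Id M x) = Id M (tobj as x)"
  by (induction as) auto

lemma tid_Comp: "set as \<subseteq> Obj M \<Longrightarrow> f \<in> Arr M \<Longrightarrow> g \<in> Arr M \<Longrightarrow> Dom M g = Cod M f \<Longrightarrow>
    tid as g \<cdot> tid as f = tid as (g \<cdot> f)"
  by (induction as) auto

lemma tarr_map_Comp: "\<forall>k \<in> set ks. f k \<in> Arr M \<and> g k \<in> Arr M \<and> Dom M (g k) = Cod M (f k) \<Longrightarrow>
   x \<in> Arr M \<Longrightarrow> y \<in> Arr M \<Longrightarrow> Dom M y = Cod M x \<Longrightarrow>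
    tarr (map g ks) y \<cdot> tarr (map f ks) x = tarr (map (\<lambda>k. g k \<cdot> f k) ks) (y \<cdot> x)"
proof (induction ks)
  case (Cons k ks)
  have "map (Dom M \<circ> g) ks = map (Cod M \<circ> f) ks" using Cons.prems(1) by auto
  then have "tobj (map (Dom M \<circ> g) ks) z = tobj (map (Cod M \<circ> f) ks) z" for z by (rule arg_cong)
  moreover have "f ` set ks \<subseteq> Arr M" "g ` set ks \<subseteq> Arr M" using Cons.prems(1) by auto
  moreover note Cons
  ultimately show ?case by simp
qed simp

text \<open>\<open>append_arr as x : tens as \<otimes> x \<rightarrow> a\<^sub>1 \<otimes> (\<dots> (a\<^sub>n \<otimes> x))\<close>\<close>

primrec append_arr :: "'o list \<Rightarrow> 'o \<Rightarrow> 'm" where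
  "append_arr [] x = LUnit M x"
| "append_arr (a # as) x = (Id M a \<boxtimes> append_arr as x) \<cdot> Assoc M a (tobj as I) x"

lemma tens_append_eq: "tens_append M as bs = append_arr as (tobj bs I)"
  by (induction as) (simp_all add: tens_tobj)

lemma append_arr_typ [simp]:
  assumes "set as \<subseteq> Obj M" "x \<in> Obj M"
  shows "append_arr as x \<in> Arr M" "Dom M (append_arr as x) = tobj as I \<otimes> x"
    "Cod M (append_arr as x) = tobj as x"
proof -
  have "append_arr as x \<in> Arr M \<and> Dom M (append_arr as x) = tobj as I \<otimes> x \<and> Cod M (append_arr as x) = tobj as x"
    using assms by (induction as) auto
  then show "append_arr as x \<in> Arr M" "Dom M (append_arr as x) = tobj as I \<otimes> x"
    "Cod M (append_arr as x) = tobj as x" by auto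
qed

lemma append_arr_iso [simp]: "set as \<subseteq> Obj M \<Longrightarrow> x \<in> Obj M \<Longrightarrow> is_iso M (append_arr as x)"
  by (induction as) auto

lemma append_arr_nat:
  assumes "set fs \<subseteq> Arr M" "g \<in> Arr M" "Cod M g = y" "map (Cod M) fs = bs"
  shows "append_arr bs y \<cdot> (tarr fs (Id M I) \<boxtimes> g) = tarr fs g \<cdot> append_arr (map (Dom M) fs) (Dom M g)"
  using assms
proof (induction fs arbitrary: bs)
  case (Cons f fs)
  then have [simp]: "set fs \<subseteq> Arr M" "f \<in> Arr M" "y \<in> Obj M" "Cod M ` set fs \<subseteq> Obj M" "Dom M ` set fs \<subseteq> Obj M" by auto
  have bs: "bs = Cod M f # map (Cod M) fs" using Cons.prems by auto
  have "append_arr bs y \<cdot> (tarr (f # fs) (Id M I) \<boxtimes> g) =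
     (f \<boxtimes> (append_arr (map (Cod M) fs) y \<cdot> (tarr fs (Id M I) \<boxtimes> g))) \<cdot> Assoc M (Dom M f) (tobj (map (Dom M) fs)
       I) (Dom M g)"
    using Cons.prems by (simp add: bs Assoc_nat')
  then show ?case using Cons by simp
qed (auto simp: LUnit_nat')

lemma append_arr_tid: "set as \<subseteq> Obj M \<Longrightarrow> g \<in> Arr M \<Longrightarrow> Cod M g = y \<Longrightarrow>
   append_arr as y \<cdot> (Id M (tobj as I) \<boxtimes> g) = tid as g \<cdot> append_arr as (Dom M g)"
  using append_arr_nat[of "map (Id M) as" g y as] by simp

text \<open>The empty list is \<open>LUnit_eq_RUnit\<close>, each further factor
  \<open>RUnit_tensor\<close>.\<close>

lemma append_arr_unit: "set as \<subseteq> Obj M \<Longrightarrow> append_arr as I = RUnit M (tobj as I)"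
  by (induction as) (simp_all add: LUnit_eq_RUnit RUnit_tensor)

text \<open>Each factor of \<open>as\<close> contributes one pentagon, the empty list
  \<open>LUnit_tensor\<close>. This is the source of associativity when words are multiplied by
  concatenation.\<close>

lemma append_arr_append:
  assumes "set as \<subseteq> Obj M" "set bs \<subseteq> Obj M" "x \<in> Obj M"
  shows "append_arr as (tobj bs x) \<cdot> ((Id M (tobj as I) \<boxtimes> append_arr bs x) \<cdot> Assoc M (tobj as I) (tobj bs I) x)
    = append_arr (as @ bs) x \<cdot> (append_arr as (tobj bs I) \<boxtimes> Id M x)"
  using assms
proof (induction as)
  case Nil
  then show ?case by (simp add: reassoc[OF LUnit_nat'] LUnit_tensor)
next
  case (Cons a as)
  let ?A = "tobj as I" and ?B = "tobj bs I"
  have [simp]: "a \<in> Obj M" "set as \<subseteq> Obj M" "set bs \<subseteq> Obj M" "x \<in> Obj M" using Cons.prems by auto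
  have "append_arr (a # as) (tobj bs x) \<cdot> ((Id M (tobj (a # as) I) \<boxtimes> append_arr bs x) \<cdot> Assoc M (tobj (a # as) I) ?B x)
    = (Id M a \<boxtimes> append_arr as (tobj bs x)) \<cdot> ((Assoc M a ?A (tobj bs x) \<cdot> ((Id M a \<boxtimes> Id M ?A) \<boxtimes> append_arr bs
      x)) \<cdot> Assoc M (a \<otimes> ?A) ?B x)"
    by simp
  also have "\<dots> = (Id M a \<boxtimes> (append_arr as (tobj bs x) \<cdot> (Id M ?A \<boxtimes> append_arr bs x))) \<cdot> (Assoc M a ?A (?B \<otimes> x) \<cdot>
    Assoc M (a \<otimes> ?A) ?B x)"
    by (subst Assoc_nat') simp_all
  also have "\<dots> = (Id M a \<boxtimes> (append_arr as (tobj bs x) \<cdot> ((Id M ?A \<boxtimes> append_arr bs x) \<cdot> Assoc M ?A ?B x))) \<cdot>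
    (Assoc M a (?A \<otimes> ?B) x \<cdot> (Assoc M a ?A ?B \<boxtimes> Id M x))"
    by (simp add: pentagon)
  also have "\<dots> = (Id M a \<boxtimes> append_arr (as @ bs) x) \<cdot> (((Id M a \<boxtimes> (append_arr as ?B \<boxtimes> Id M x)) \<cdot>
    Assoc M a (?A \<otimes> ?B) x) \<cdot> (Assoc M a ?A ?B \<boxtimes> Id M x))"
    using Cons.IH by simp
  also have "(Id M a \<boxtimes> (append_arr as ?B \<boxtimes> Id M x)) \<cdot> Assoc M a (?A \<otimes> ?B) x = Assoc M a (tobj as ?B) x \<cdot>
    ((Id M a \<boxtimes> append_arr as ?B) \<boxtimes> Id M x)"
    by (simp add: Assoc_nat')
  finally show ?case by simp
qed

section \<open>Permuting the factors of an iterated tensor product\<close>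

text \<open>As \<open>tens_insert\<close> and \<open>tens_rearrange\<close>, but acting on the leading factors of
  \<open>a\<^sub>1 \<otimes> (\<dots> (a\<^sub>n \<otimes> x))\<close>.  Keeping the tail \<open>x\<close> arbitrary is what makes the inductions below go through.\<close>

primrec insert_arr :: "(nat \<Rightarrow> 'o) \<Rightarrow> nat \<Rightarrow> nat list \<Rightarrow> 'o \<Rightarrow> 'm" where
  "insert_arr a l [] x = undefined"
| "insert_arr a l (k # ks) x =
     (if k = l then Id M (a l \<otimes> tobj (map a ks) x)
      else (Id M (a k) \<boxtimes> insert_arr a l ks x) \<cdot> swap (a l) (a k) (tobj (map a (remove1 l ks)) x))"

primrec perm_arr :: "(nat \<Rightarrow> 'o) \<Rightarrow> nat list \<Rightarrow> nat list \<Rightarrow> 'o \<Rightarrow> 'm" where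
  "perm_arr a [] ks x = Id M x"
| "perm_arr a (l # ls) ks x = insert_arr a l ks x \<cdot> (Id M (a l) \<boxtimes> perm_arr a ls (remove1 l ks) x)"

lemma tens_insert_eq: "tens_insert M a l ks = insert_arr a l ks I"
  by (induction ks) (simp_all add: tens_tobj swap_def)

lemma tens_rearrange_eq: "tens_rearrange M a ls ks = perm_arr a ls ks I"
  by (induction ls arbitrary: ks) (simp_all add: tens_insert_eq)

lemma insert_arr_cong: "l \<in> set ks \<Longrightarrow> \<forall>k \<in> set ks. a k = b k \<Longrightarrow> insert_arr a l ks x = insert_arr b l ks x"
proof (induction ks)
  case (Cons k ks)
  have "map a (remove1 l ks) = map b (remove1 l ks)"
    using Cons.prems by (auto dest: notin_set_remove1 intro!: map_cong)
  then show ?case using Cons by (auto cong: map_cong)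
qed simp

lemma mset_Cons_eqD: "mset (l # ls) = mset ks \<Longrightarrow> l \<in> set ks \<and> mset ls = mset (remove1 l ks)"
  by (metis add_mset_remove_trivial list.set_intros(1) mset.simps(2) mset_eq_setD mset_remove1)

lemma perm_arr_cong: "mset ls = mset ks \<Longrightarrow> \<forall>k \<in> set ks. a k = b k \<Longrightarrow> perm_arr a ls ks x = perm_arr b ls ks x"
proof (induction ls arbitrary: ks)
  case (Cons l ls)
  note l = mset_Cons_eqD[OF Cons.prems(1)]
  have "\<forall>k \<in> set (remove1 l ks). a k = b k"
    using Cons.prems(2) by (meson notin_set_remove1)
  then show ?case using Cons.prems l insert_arr_cong[of l ks a b] Cons.IH by simp
qed simp

lemma insert_arr_relabel: "inj_on f (insert l (set ks)) \<Longrightarrow> l \<in> set ks \<Longrightarrow>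
   insert_arr a (f l) (map f ks) x = insert_arr (a \<circ> f) l ks x"
proof (induction ks)
  case (Cons k ks)
  have "remove1 (f l) (map f ks) = map f (remove1 l ks)" if "inj_on f (insert l (set ks))" for ks
    using that by (induction ks) (auto simp: inj_on_def)
  moreover have "inj_on f (insert l (set ks))"
    using Cons.prems(1) by (auto simp: inj_on_def)
  moreover have "f k = f l \<longleftrightarrow> k = l" using Cons.prems by (auto simp: inj_on_def)
  ultimately show ?case using Cons by (auto simp: comp_def)
qed simp

text \<open>Rearrangements see positions only through the objects they carry, so positions may be
  renamed. Used to shift a block into a longer list and to transport along a permutation of the
  inputs.\<close>

lemma perm_arr_relabel: "inj_on f (set ks) \<Longrightarrow> mset ls = mset ks \<Longrightarrow>
   perm_arr a (map f ls) (map f ks) x = perm_arr (a \<circ> f) ls ks x"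
proof (induction ls arbitrary: ks)
  case (Cons l ls)
  note l = mset_Cons_eqD[OF Cons.prems(2)]
  then have i: "inj_on f (insert l (set ks))" using Cons.prems(1) by (simp add: insert_absorb)
  have "remove1 (f l) (map f ks) = map f (remove1 l ks)" if "inj_on f (insert l (set ks))" for ks
    using that by (induction ks) (auto simp: inj_on_def)
  moreover have "inj_on f (set (remove1 l ks))"
    using Cons.prems(1) by (meson inj_on_subset set_remove1_subset)
  ultimately show ?case using l i Cons.IH insert_arr_relabel[OF i] by (simp add: comp_def)
qed simp

declare mset_remove1 [simp del]

context
  fixes a :: "nat \<Rightarrow> 'o"
  assumes a_Obj [simp]: "\<And>k. a k \<in> Obj M"
begin

lemma image_a_Obj [simp]: "a ` S \<subseteq> Obj M" "(Id M \<circ> a) ` S \<subseteq> Arr M" by auto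

lemma insert_arr_typ:
  assumes "l \<in> set ks" "x \<in> Obj M"
  shows "insert_arr a l ks x \<in> Arr M \<and> Dom M (insert_arr a l ks x) = a l \<otimes> tobj (map a (remove1 l ks)) x \<and>
    Cod M (insert_arr a l ks x) = tobj (map a ks) x"
  using assms by (induction ks) auto

lemmas insert_arr_simps [simp] = insert_arr_typ[THEN conjunct1] insert_arr_typ[THEN conjunct2, THEN conjunct1]
  insert_arr_typ[THEN conjunct2, THEN conjunct2]

lemma perm_arr_typ:
  assumes "mset ls = mset ks" "x \<in> Obj M"
  shows "perm_arr a ls ks x \<in> Arr M \<and> Dom M (perm_arr a ls ks x) = tobj (map a ls) x \<and>
    Cod M (perm_arr a ls ks x) = tobj (map a ks) x"
  using assms
proof (induction ls arbitrary: ks)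
  case (Cons l ls)
  note l = mset_Cons_eqD[OF Cons.prems(1)]
  then show ?case using Cons.IH[of "remove1 l ks"] Cons.prems by simp
qed auto

lemmas perm_arr_simps [simp] = perm_arr_typ[THEN conjunct1] perm_arr_typ[THEN conjunct2, THEN conjunct1]
  perm_arr_typ[THEN conjunct2, THEN conjunct2]

lemma perm_arr_refl [simp]: "x \<in> Obj M \<Longrightarrow> perm_arr a ks ks x = Id M (tobj (map a ks) x)"
  by (induction ks) auto

text \<open>If the head of \<open>ms\<close> is \<open>k\<close> or \<open>l\<close>, both sides
  simplify to the same arrow. Otherwise both factors pass the head, and the Yang-Baxter equation
  exchanges the order in which they do so.\<close>

lemma insert_insert:
  assumes "k \<in> set ms" "l \<in> set ms" "k \<noteq> l" "x \<in> Obj M"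
  shows "insert_arr a k ms x \<cdot> ((Id M (a k) \<boxtimes> insert_arr a l (remove1 k ms) x) \<cdot>
      swap (a l) (a k) (tobj (map a (remove1 l (remove1 k ms))) x)) =
    insert_arr a l ms x \<cdot> (Id M (a l) \<boxtimes> insert_arr a k (remove1 l ms) x)"
  using assms
proof (induction ms)
  case (Cons m ms)
  note [simp] = \<open>x \<in> Obj M\<close>
  have comm: "remove1 l (remove1 k ms) = remove1 k (remove1 l ms)" by (rule remove1_commute)
  have in1: "k \<noteq> l \<Longrightarrow> l \<in> set ms \<Longrightarrow> l \<in> set (remove1 k ms)" for k l by simp
  consider "m = k" | "m = l" | "m \<noteq> k" "m \<noteq> l" by blast
  then show ?case
  proof cases
    case 1
    then show ?thesis using Cons.prems by auto
  next
    case 2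
    then show ?thesis using Cons.prems by (auto simp: comm)
  next
    case 3
    then have [simp]: "k \<in> set ms" "l \<in> set ms" "l \<in> set (remove1 k ms)" "k \<in> set (remove1 l ms)"
      using Cons.prems by auto
    let ?Y = "tobj (map a (remove1 k (remove1 l ms))) x"
    have [simp]: "?Y \<in> Obj M" by simp
    have "insert_arr a k (m # ms) x \<cdot> ((Id M (a k) \<boxtimes> insert_arr a l (remove1 k (m # ms)) x) \<cdot>
        swap (a l) (a k) (tobj (map a (remove1 l (remove1 k (m # ms)))) x))
      = (Id M (a m) \<boxtimes> insert_arr a k ms x) \<cdot> ((swap (a k) (a m) (tobj (map a (remove1 k ms)) x) \<cdot>
          (Id M (a k) \<boxtimes> (Id M (a m) \<boxtimes> insert_arr a l (remove1 k ms) x))) \<cdot>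
          ((Id M (a k) \<boxtimes> swap (a l) (a m) ?Y) \<cdot> swap (a l) (a k) (a m \<otimes> ?Y)))"
      using 3 by (simp add: comm)
    also have "\<dots> = (Id M (a m) \<boxtimes> (insert_arr a k ms x \<cdot> (Id M (a k) \<boxtimes> insert_arr a l (remove1 k ms) x))) \<cdot>
        (swap (a k) (a m) (a l \<otimes> ?Y) \<cdot> ((Id M (a k) \<boxtimes> swap (a l) (a m) ?Y) \<cdot> swap (a l) (a k) (a m \<otimes> ?Y)))"
      by (subst swap_nat) (simp_all add: comm)
    also have "\<dots> = (Id M (a m) \<boxtimes> (insert_arr a k ms x \<cdot> ((Id M (a k) \<boxtimes> insert_arr a l (remove1 k ms) x) \<cdot>
      swap (a l) (a k) ?Y))) \<cdot>
        (swap (a l) (a m) (a k \<otimes> ?Y) \<cdot> (Id M (a l) \<boxtimes> swap (a k) (a m) ?Y))"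
      by (simp add: yang_baxter[symmetric] comm)
    also have "\<dots> = (Id M (a m) \<boxtimes> (insert_arr a l ms x \<cdot> (Id M (a l) \<boxtimes> insert_arr a k (remove1 l ms) x))) \<cdot>
        (swap (a l) (a m) (a k \<otimes> ?Y) \<cdot> (Id M (a l) \<boxtimes> swap (a k) (a m) ?Y))"
      using Cons.IH \<open>k \<noteq> l\<close> by (simp add: comm)
    also have "\<dots> = (Id M (a m) \<boxtimes> insert_arr a l ms x) \<cdot>
      (((Id M (a m) \<boxtimes> (Id M (a l) \<boxtimes> insert_arr a k (remove1 l ms) x)) \<cdot>
        swap (a l) (a m) (a k \<otimes> ?Y)) \<cdot> (Id M (a l) \<boxtimes> swap (a k) (a m) ?Y))"
      by simp
    also have "(Id M (a m) \<boxtimes> (Id M (a l) \<boxtimes> insert_arr a k (remove1 l ms) x)) \<cdot> swap (a l) (a m) (a k \<otimes> ?Y) =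
        swap (a l) (a m) (tobj (map a (remove1 l ms)) x) \<cdot> (Id M (a l) \<boxtimes> (Id M (a m) \<boxtimes> insert_arr a k (remove1 l
          ms) x))"
      by (simp add: swap_nat)
    finally show ?thesis using 3 by (simp add: comm)
  qed
qed simp

text \<open>Induction on \<open>ks\<close>: when \<open>l\<close> is not the head, the insertion of
  the head and that of \<open>l\<close> are exchanged by \<open>insert_insert\<close>. The lemma
  supplies the inductive step of \<open>perm_arr_trans\<close>.\<close>

lemma perm_insert:
  assumes "mset ks = mset ms" "l \<in> set ks" "x \<in> Obj M"
  shows "perm_arr a ks ms x \<cdot> insert_arr a l ks x =
    insert_arr a l ms x \<cdot> (Id M (a l) \<boxtimes> perm_arr a (remove1 l ks) (remove1 l ms) x)"
  using assms
proof (induction ks arbitrary: ms)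
  case (Cons k ks)
  note [simp] = \<open>x \<in> Obj M\<close>
  note k = mset_Cons_eqD[OF Cons.prems(1)]
  show ?case
  proof (cases "k = l")
    case True
    then show ?thesis using k by simp
  next
    case False
    have [simp]: "l \<in> set ks" "k \<in> set ms" "mset ks = mset (remove1 k ms)" using False Cons.prems k by auto
    have lms [simp]: "l \<in> set ms" using Cons.prems(2) mset_eq_setD[OF Cons.prems(1)] by blast
    have comm: "remove1 l (remove1 k ms) = remove1 k (remove1 l ms)" by (rule remove1_commute)
    have [simp]: "l \<in> set (remove1 k ms)" "k \<in> set (remove1 l ms)" using False by auto
    have [simp]: "mset (remove1 l ks) = mset (remove1 k (remove1 l ms))"
      by (metis \<open>mset ks = mset (remove1 k ms)\<close> mset_remove1 comm)
    let ?Y = "tobj (map a (remove1 l ks)) x" and ?Z = "tobj (map a (remove1 k (remove1 l ms))) x"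
    let ?p = "perm_arr a (remove1 l ks) (remove1 k (remove1 l ms)) x"
    have "perm_arr a (k # ks) ms x \<cdot> insert_arr a l (k # ks) x =
      insert_arr a k ms x \<cdot> ((Id M (a k) \<boxtimes> (perm_arr a ks (remove1 k ms) x \<cdot> insert_arr a l ks x)) \<cdot> swap (a l)
        (a k) ?Y)"
      using False by simp
    also have "\<dots> = insert_arr a k ms x \<cdot> ((Id M (a k) \<boxtimes> insert_arr a l (remove1 k ms) x) \<cdot>
        ((Id M (a k) \<boxtimes> (Id M (a l) \<boxtimes> ?p)) \<cdot> swap (a l) (a k) ?Y))"
      using Cons.IH[of "remove1 k ms"] by (simp add: comm)
    also have "(Id M (a k) \<boxtimes> (Id M (a l) \<boxtimes> ?p)) \<cdot> swap (a l) (a k) ?Y = swap (a l) (a k) ?Z \<cdot>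
      (Id M (a l) \<boxtimes> (Id M (a k) \<boxtimes> ?p))"
      by (simp add: swap_nat)
    also have "insert_arr a k ms x \<cdot> ((Id M (a k) \<boxtimes> insert_arr a l (remove1 k ms) x) \<cdot>
        (swap (a l) (a k) ?Z \<cdot> (Id M (a l) \<boxtimes> (Id M (a k) \<boxtimes> ?p)))) =
       (insert_arr a k ms x \<cdot> ((Id M (a k) \<boxtimes> insert_arr a l (remove1 k ms) x) \<cdot>
        swap (a l) (a k) ?Z)) \<cdot> (Id M (a l) \<boxtimes> (Id M (a k) \<boxtimes> ?p))"
      by (simp add: comm)
    also have "\<dots> = (insert_arr a l ms x \<cdot> (Id M (a l) \<boxtimes> insert_arr a k (remove1 l ms) x)) \<cdot>
      (Id M (a l) \<boxtimes> (Id M (a k) \<boxtimes> ?p))"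
      using insert_insert[of k ms l x] False by (simp only: comm) simp
    finally show ?thesis using False by simp
  qed
qed simp

text \<open>Coherence of the symmetry in the form used throughout: a chain of rearrangements depends
  only on its first and last order. Each insertion of the first rearrangement is carried across the
  second by \<open>perm_insert\<close>.\<close>

lemma perm_arr_trans:
  assumes "mset ls = mset ks" "mset ks = mset ms" "x \<in> Obj M"
  shows "perm_arr a ks ms x \<cdot> perm_arr a ls ks x = perm_arr a ls ms x"
  using assms
proof (induction ls arbitrary: ks ms)
  case (Cons l ls)
  note [simp] = \<open>x \<in> Obj M\<close>
  note l = mset_Cons_eqD[OF Cons.prems(1)]
  note l' = mset_Cons_eqD[OF HOL.trans[OF Cons.prems(1,2)]]
  have [simp]: "l \<in> set ks" "l \<in> set ms" "mset ls = mset (remove1 l ks)" "mset (remove1 l ks) =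
    mset (remove1 l ms)" "mset ks = mset ms"
    using l l' Cons.prems by auto
  have "perm_arr a ks ms x \<cdot> perm_arr a (l # ls) ks x =
     (perm_arr a ks ms x \<cdot> insert_arr a l ks x) \<cdot> (Id M (a l) \<boxtimes> perm_arr a ls (remove1 l ks) x)"
    by simp
  also have "\<dots> = perm_arr a (l # ls) ms x"
    by (subst perm_insert) (simp_all add: Cons.IH)
  finally show ?case .
qed simp

lemma insert_arr_tail: "l \<in> set ks \<Longrightarrow> insert_arr a l (ks @ zs) x = insert_arr a l ks (tobj (map a zs) x)"
  by (induction ks) (auto simp: remove1_append)

lemma perm_arr_tail: "mset ls = mset ks \<Longrightarrow> x \<in> Obj M \<Longrightarrow>
   perm_arr a (ls @ zs) (ks @ zs) x = perm_arr a ls ks (tobj (map a zs) x)"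
proof (induction ls arbitrary: ks)
  case (Cons l ls)
  note l = mset_Cons_eqD[OF Cons.prems(1)]
  then show ?case using Cons.IH[of "remove1 l ks"] Cons.prems insert_arr_tail[of l ks zs x]
    by (simp add: remove1_append)
qed simp

lemma tid_map_typ [simp]:
  assumes "f \<in> Arr M"
  shows "tarr (map (Id M \<circ> a) us) f \<in> Arr M" "Dom M (tarr (map (Id M \<circ> a) us) f) = tobj (map a us) (Dom M f)"
    "Cod M (tarr (map (Id M \<circ> a) us) f) = tobj (map a us) (Cod M f)"
  using assms by (induction us) auto

lemma perm_arr_head: "mset ls = mset ks \<Longrightarrow> x \<in> Obj M \<Longrightarrow>
   perm_arr a (us @ ls) (us @ ks) x = tid (map a us) (perm_arr a ls ks x)"
  by (induction us) auto

lemma insert_arr_append: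
  assumes "l \<in> set ks" "x \<in> Obj M"
  shows "append_arr (map a ks) x \<cdot> (insert_arr a l ks I \<boxtimes> Id M x) =
    insert_arr a l ks x \<cdot> append_arr (map a (l # remove1 l ks)) x"
  using assms
proof (induction ks)
  case (Cons k ks)
  note [simp] = \<open>x \<in> Obj M\<close>
  show ?case
  proof (cases "k = l")
    case False
    then have [simp]: "l \<in> set ks" using Cons.prems by auto
    let ?R = "map a (remove1 l ks)"
    let ?K = "tobj ?R I"
    have [simp]: "set ?R \<subseteq> Obj M" "?K \<in> Obj M" by auto
    have "append_arr (map a (k # ks)) x \<cdot> (insert_arr a l (k # ks) I \<boxtimes> Id M x)
      = (Id M (a k) \<boxtimes> append_arr (map a ks) x) \<cdot> ((Assoc M (a k) (tobj (map a ks) I) x \<cdot>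
         ((Id M (a k) \<boxtimes> insert_arr a l ks I) \<boxtimes> Id M x)) \<cdot> (swap (a l) (a k) ?K \<boxtimes> Id M x))"
      using False by simp
    also have "\<dots> = (Id M (a k) \<boxtimes> (append_arr (map a ks) x \<cdot> (insert_arr a l ks I \<boxtimes> Id M x))) \<cdot>
         (Assoc M (a k) (a l \<otimes> ?K) x \<cdot> (swap (a l) (a k) ?K \<boxtimes> Id M x))"
      by (subst Assoc_nat') simp_all
    also have "\<dots> = (Id M (a k) \<boxtimes> insert_arr a l ks x) \<cdot> ((Id M (a k) \<boxtimes> (Id M (a l) \<boxtimes> append_arr ?R x)) \<cdot>
        ((Id M (a k) \<boxtimes> Assoc M (a l) ?K x) \<cdot> (Assoc M (a k) (a l \<otimes> ?K) x \<cdot> (swap (a l) (a k) ?K \<boxtimes> Id M x))))"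
      using Cons.IH by simp
    also have "\<dots> = (Id M (a k) \<boxtimes> insert_arr a l ks x) \<cdot> (((Id M (a k) \<boxtimes> (Id M (a l) \<boxtimes> append_arr ?R x)) \<cdot>
        swap (a l) (a k) (?K \<otimes> x)) \<cdot> ((Id M (a l) \<boxtimes> Assoc M (a k) ?K x) \<cdot> Assoc M (a l) (a k \<otimes> ?K) x))"
      by (subst swap_tail) simp_all
    also have "(Id M (a k) \<boxtimes> (Id M (a l) \<boxtimes> append_arr ?R x)) \<cdot> swap (a l) (a k) (?K \<otimes> x) =
       swap (a l) (a k) (tobj ?R x) \<cdot> (Id M (a l) \<boxtimes> (Id M (a k) \<boxtimes> append_arr ?R x))"
      by (simp add: swap_nat)
    finally show ?thesis using False by simp
  qed simp
qed simp

text \<open>Every transposition inside the first list commutes with attaching the tail, by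
  \<open>swap_tail\<close> through \<open>insert_arr_append\<close>.\<close>

lemma perm_arr_append:
  assumes "mset ls = mset ks" "x \<in> Obj M"
  shows "append_arr (map a ks) x \<cdot> (perm_arr a ls ks I \<boxtimes> Id M x) = perm_arr a ls ks x \<cdot> append_arr (map a ls) x"
  using assms
proof (induction ls arbitrary: ks)
  case (Cons l ls)
  note l = mset_Cons_eqD[OF Cons.prems(1)]
  have [simp]: "x \<in> Obj M" "l \<in> set ks" "mset ls = mset (remove1 l ks)" using l Cons.prems by auto
  let ?R = "remove1 l ks"
  have "append_arr (map a ks) x \<cdot> (perm_arr a (l # ls) ks I \<boxtimes> Id M x) =
    (append_arr (map a ks) x \<cdot> (insert_arr a l ks I \<boxtimes> Id M x)) \<cdot> ((Id M (a l) \<boxtimes> perm_arr a ls ?R I) \<boxtimes> Id M x)"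
    by simp
  also have "\<dots> = insert_arr a l ks x \<cdot> ((Id M (a l) \<boxtimes> append_arr (map a ?R) x) \<cdot>
     (Assoc M (a l) (tobj (map a ?R) I) x \<cdot> ((Id M (a l) \<boxtimes> perm_arr a ls ?R I) \<boxtimes> Id M x)))"
    by (subst insert_arr_append) simp_all
  also have "\<dots> = insert_arr a l ks x \<cdot> ((Id M (a l) \<boxtimes> (append_arr (map a ?R) x \<cdot> (perm_arr a ls ?R I \<boxtimes> Id M x))) \<cdot>
     Assoc M (a l) (tobj (map a ls) I) x)"
    by (subst Assoc_nat') simp_all
  also have "\<dots> = perm_arr a (l # ls) ks x \<cdot> append_arr (map a (l # ls)) x"
    by (subst Cons.IH) simp_all
  finally show ?case .
qed simp

end

lemma insert_arr_nat:
  assumes [simp]: "\<And>k. h k \<in> Arr M" "g \<in> Arr M"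
    and h: "\<And>k. Dom M (h k) = a k" "\<And>k. Cod M (h k) = b k" "Dom M g = x" "Cod M g = y"
    and l: "l \<in> set ks"
  shows "insert_arr b l ks y \<cdot> (h l \<boxtimes> tarr (map h (remove1 l ks)) g) = tarr (map h ks) g \<cdot> insert_arr a l ks x"
  using l
proof (induction ks)
  case (Cons k ks)
  have b: "b k \<in> Obj M" "a k \<in> Obj M" for k using h(1,2)[symmetric] by auto
  have [simp]: "x \<in> Obj M" "y \<in> Obj M" using h(3,4)[symmetric] by auto
  have map: "map (Dom M \<circ> h) ks = map a ks" "map (Cod M \<circ> h) ks = map b ks" for ks using h by auto
  have sub: "h ` S \<subseteq> Arr M" "a ` S \<subseteq> Obj M" "b ` S \<subseteq> Obj M" for S using b by auto
  note [simp] = insert_arr_simps[of a, OF b(2)] insert_arr_simps[of b, OF b(1)] b map sub h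
  show ?case
  proof (cases "k = l")
    case False
    then have [simp]: "l \<in> set ks" using Cons.prems by auto
    let ?g = "tarr (map h (remove1 l ks)) g"
    have "insert_arr b l (k # ks) y \<cdot> (h l \<boxtimes> tarr (map h (remove1 l (k # ks))) g) =
       (Id M (b k) \<boxtimes> insert_arr b l ks y) \<cdot> (swap (b l) (b k) (Cod M ?g) \<cdot> (h l \<boxtimes> (h k \<boxtimes> ?g)))"
      using False by simp
    also have "\<dots> = (h k \<boxtimes> (insert_arr b l ks y \<cdot> (h l \<boxtimes> ?g))) \<cdot> swap (a l) (a k) (Dom M ?g)"
      by (subst swap_nat) simp_all
    also have "\<dots> = tarr (map h (k # ks)) g \<cdot> insert_arr a l (k # ks) x"
      using False Cons.IH by simp
    finally show ?thesis .
  qed simp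
qed simp

text \<open>Families are total on positions, so \<open>h k\<close> has to be an arrow for every
  \<open>k\<close>; where only finitely many positions matter, the others carry \<open>I\<close> and
  its identity.\<close>

lemma perm_arr_nat:
  assumes [simp]: "\<And>k. h k \<in> Arr M" "g \<in> Arr M"
    and h: "\<And>k. Dom M (h k) = a k" "\<And>k. Cod M (h k) = b k" "Dom M g = x" "Cod M g = y"
    and l: "mset ls = mset ks"
  shows "perm_arr b ls ks y \<cdot> tarr (map h ls) g = tarr (map h ks) g \<cdot> perm_arr a ls ks x"
  using l
proof (induction ls arbitrary: ks)
  case (Cons l ls)
  note l = mset_Cons_eqD[OF Cons.prems(1)]
  have [simp]: "l \<in> set ks" "mset ls = mset (remove1 l ks)" using l Cons.prems by auto
  have b: "b k \<in> Obj M" "a k \<in> Obj M" for k using h(1,2)[symmetric] by auto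
  have [simp]: "x \<in> Obj M" "y \<in> Obj M" using h(3,4)[symmetric] by auto
  have map: "map (Dom M \<circ> h) ks = map a ks" "map (Cod M \<circ> h) ks = map b ks" for ks using h by auto
  have sub: "h ` S \<subseteq> Arr M" "a ` S \<subseteq> Obj M" "b ` S \<subseteq> Obj M" for S using b by auto
  note [simp] = insert_arr_simps[of a, OF b(2)] insert_arr_simps[of b, OF b(1)]
     perm_arr_simps[of a, OF b(2)] perm_arr_simps[of b, OF b(1)] b map sub h
  have "perm_arr b (l # ls) ks y \<cdot> tarr (map h (l # ls)) g =
    insert_arr b l ks y \<cdot> (h l \<boxtimes> (perm_arr b ls (remove1 l ks) y \<cdot> tarr (map h ls) g))"
    by simp
  also have "\<dots> = (insert_arr b l ks y \<cdot> (h l \<boxtimes> tarr (map h (remove1 l ks)) g)) \<cdot>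
    (Id M (a l) \<boxtimes> perm_arr a ls (remove1 l ks) x)"
    by (simp add: Cons.IH)
  also have "\<dots> = tarr (map h ks) g \<cdot> perm_arr a (l # ls) ks x"
    by (subst insert_arr_nat[where a=a and x=x]) simp_all
  finally show ?case .
qed (simp add: h)

end

section \<open>Permutations and concatenation\<close>

context symmetric_monoidal_category
begin

context
  fixes a :: "nat \<Rightarrow> 'o"
  assumes a_Obj [simp]: "\<And>k. a k \<in> Obj M"
begin

lemmas [simp] = image_a_Obj[of a, OF a_Obj] tid_map_typ[of a, OF a_Obj]
  insert_arr_simps[of a, OF a_Obj] perm_arr_simps[of a, OF a_Obj] perm_arr_refl[of a, OF a_Obj]

text \<open>Iterating \<open>swap_tensor_right\<close> over \<open>bs\<close> breaks the
  transposition past a whole block into the adjacent transpositions that make up the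
  insertion.\<close>

lemma swap_block_single:
  assumes "l \<notin> set bs" "y \<in> Obj M"
  shows "append_arr (map a bs) (a l \<otimes> y) \<cdot> swap (a l) (tobj (map a bs) I) y =
    insert_arr a l (bs @ [l]) y \<cdot> (Id M (a l) \<boxtimes> append_arr (map a bs) y)"
  using assms
proof (induction bs)
  case Nil
  then show ?case by (simp add: swap_unit_right)
next
  case (Cons b bs)
  let ?B = "tobj (map a bs) I"
  have [simp]: "y \<in> Obj M" "l \<noteq> b" "b \<noteq> l" "l \<notin> set bs" "remove1 l (bs @ [l]) = bs"
    using Cons.prems by (auto simp: remove1_append)
  have "append_arr (map a (b # bs)) (a l \<otimes> y) \<cdot> swap (a l) (tobj (map a (b # bs)) I) y =
    (Id M (a b) \<boxtimes> append_arr (map a bs) (a l \<otimes> y)) \<cdot> (Assoc M (a b) ?B (a l \<otimes> y) \<cdot> swap (a l) (a b \<otimes> ?B) y)"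
    by simp
  also have "\<dots> = (Id M (a b) \<boxtimes> (append_arr (map a bs) (a l \<otimes> y) \<cdot> swap (a l) ?B y)) \<cdot>
     (swap (a l) (a b) (?B \<otimes> y) \<cdot> (Id M (a l) \<boxtimes> Assoc M (a b) ?B y))"
    by (simp flip: swap_tensor_right)
  also have "\<dots> = (Id M (a b) \<boxtimes> insert_arr a l (bs @ [l]) y) \<cdot> (((Id M (a b) \<boxtimes> (Id M (a l) \<boxtimes> append_arr (map a bs) y)) \<cdot>
     swap (a l) (a b) (?B \<otimes> y)) \<cdot> (Id M (a l) \<boxtimes> Assoc M (a b) ?B y))"
    using Cons.IH by simp
  also have "(Id M (a b) \<boxtimes> (Id M (a l) \<boxtimes> append_arr (map a bs) y)) \<cdot> swap (a l) (a b) (?B \<otimes> y) =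
     swap (a l) (a b) (tobj (map a bs) y) \<cdot> (Id M (a l) \<boxtimes> (Id M (a b) \<boxtimes> append_arr (map a bs) y))"
    by (simp add: swap_nat)
  finally show ?case by simp
qed

text \<open>The dual induction, over \<open>as\<close> with \<open>swap_tensor_left\<close>; each
  factor split off then crosses \<open>bs\<close> by \<open>swap_block_single\<close>. Distinctness
  makes labels determine places.\<close>

lemma swap_block:
  assumes "distinct (as @ bs)" "y \<in> Obj M"
  shows "append_arr (map a bs) (tobj (map a as) y) \<cdot> ((Id M (tobj (map a bs) I) \<boxtimes> append_arr (map a as) y) \<cdot>
      swap (tobj (map a as) I) (tobj (map a bs) I) y) =
    perm_arr a (as @ bs) (bs @ as) y \<cdot> (append_arr (map a as) (tobj (map a bs) y) \<cdot>
      (Id M (tobj (map a as) I) \<boxtimes> append_arr (map a bs) y))"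
  using assms
proof (induction as)
  case Nil
  then show ?case by (simp add: swap_unit_left LUnit_nat' append_arr_tid)
next
  case (Cons l as)
  let ?A = "tobj (map a as) I" and ?B = "tobj (map a bs) I"
  let ?Ay = "tobj (map a as) y" and ?By = "tobj (map a bs) y"
  have [simp]: "y \<in> Obj M" "l \<notin> set bs" "l \<notin> set as" "mset (as @ bs) = mset (bs @ as)" using Cons.prems by auto
  have [simp]: "remove1 l (bs @ l # as) = bs @ as" "remove1 l (bs @ [l]) = bs" by (auto simp: remove1_append)
  have "append_arr (map a bs) (tobj (map a (l # as)) y) \<cdot> ((Id M ?B \<boxtimes> append_arr (map a (l # as)) y) \<cdot>
      swap (tobj (map a (l # as)) I) ?B y) =
     append_arr (map a bs) (a l \<otimes> ?Ay) \<cdot> ((Id M ?B \<boxtimes> (Id M (a l) \<boxtimes> append_arr (map a as) y)) \<cdot>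
       ((Id M ?B \<boxtimes> Assoc M (a l) ?A y) \<cdot> swap (a l \<otimes> ?A) ?B y))"
    by simp
  also have "\<dots> = append_arr (map a bs) (a l \<otimes> ?Ay) \<cdot> (((Id M ?B \<boxtimes> (Id M (a l) \<boxtimes> append_arr (map a as) y)) \<cdot>
       swap (a l) ?B (?A \<otimes> y)) \<cdot> ((Id M (a l) \<boxtimes> swap ?A ?B y) \<cdot> Assoc M (a l) ?A (?B \<otimes> y)))"
    by (simp add: swap_tensor_left)
  also have "(Id M ?B \<boxtimes> (Id M (a l) \<boxtimes> append_arr (map a as) y)) \<cdot> swap (a l) ?B (?A \<otimes> y) =
      swap (a l) ?B ?Ay \<cdot> (Id M (a l) \<boxtimes> (Id M ?B \<boxtimes> append_arr (map a as) y))"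
    by (simp add: swap_nat)
  also have "append_arr (map a bs) (a l \<otimes> ?Ay) \<cdot>
    ((swap (a l) ?B ?Ay \<cdot> (Id M (a l) \<boxtimes> (Id M ?B \<boxtimes> append_arr (map a as) y))) \<cdot>
       ((Id M (a l) \<boxtimes> swap ?A ?B y) \<cdot> Assoc M (a l) ?A (?B \<otimes> y))) =
      (append_arr (map a bs) (a l \<otimes> ?Ay) \<cdot> swap (a l) ?B ?Ay) \<cdot> ((Id M (a l) \<boxtimes> ((Id M ?B \<boxtimes> append_arr (map a as) y) \<cdot>
        swap ?A ?B y)) \<cdot> Assoc M (a l) ?A (?B \<otimes> y))"
    by simp
  also have "\<dots> = insert_arr a l (bs @ [l]) ?Ay \<cdot> ((Id M (a l) \<boxtimes> (append_arr (map a bs) ?Ay \<cdot>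
    ((Id M ?B \<boxtimes> append_arr (map a as) y) \<cdot>
        swap ?A ?B y))) \<cdot> Assoc M (a l) ?A (?B \<otimes> y))"
    by (subst swap_block_single) simp_all
  also have "\<dots> = insert_arr a l (bs @ [l]) ?Ay \<cdot> ((Id M (a l) \<boxtimes> (perm_arr a (as @ bs) (bs @ as) y \<cdot>
    (append_arr (map a as) ?By \<cdot>
      (Id M ?A \<boxtimes> append_arr (map a bs) y)))) \<cdot> Assoc M (a l) ?A (?B \<otimes> y))"
    using Cons.IH Cons.prems by simp
  also have "\<dots> = (insert_arr a l (bs @ [l]) ?Ay \<cdot> (Id M (a l) \<boxtimes> perm_arr a (as @ bs) (bs @ as) y)) \<cdot>
      ((Id M (a l) \<boxtimes> append_arr (map a as) ?By) \<cdot> ((Id M (a l) \<boxtimes> (Id M ?A \<boxtimes> append_arr (map a bs) y)) \<cdot> Assoc M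
        (a l) ?A (?B \<otimes> y)))"
    by simp
  also have "insert_arr a l (bs @ [l]) ?Ay = insert_arr a l (bs @ l # as) y"
    using insert_arr_tail[OF a_Obj, where l=l and ks="bs @ [l]" and zs=as and x=y] by simp
  also have "(Id M (a l) \<boxtimes> (Id M ?A \<boxtimes> append_arr (map a bs) y)) \<cdot> Assoc M (a l) ?A (?B \<otimes> y) =
     Assoc M (a l) ?A ?By \<cdot> ((Id M (a l) \<boxtimes> Id M ?A) \<boxtimes> append_arr (map a bs) y)"
    by (subst Assoc_nat') simp_all
  finally show ?case by simp
qed

text \<open>The case of tail \<open>I\<close>, where \<open>swap_unit_Sym\<close> trades
  \<open>swap\<close> for the symmetry; the unitor on the second factor cancels as an
  isomorphism.\<close>

lemma Sym_append:
  assumes "distinct (as @ bs)"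
  shows "append_arr (map a bs) (tobj (map a as) I) \<cdot> Sym M (tobj (map a as) I) (tobj (map a bs) I) =
    perm_arr a (as @ bs) (bs @ as) I \<cdot> append_arr (map a as) (tobj (map a bs) I)"
proof (rule iso_epi[of "Id M (tobj (map a as) I) \<boxtimes> RUnit M (tobj (map a bs) I)"])
  show "(append_arr (map a bs) (tobj (map a as) I) \<cdot> Sym M (tobj (map a as) I) (tobj (map a bs) I)) \<cdot>
     (Id M (tobj (map a as) I) \<boxtimes> RUnit M (tobj (map a bs) I)) =
    (perm_arr a (as @ bs) (bs @ as) I \<cdot> append_arr (map a as) (tobj (map a bs) I)) \<cdot>
     (Id M (tobj (map a as) I) \<boxtimes> RUnit M (tobj (map a bs) I))"
    using swap_block[OF assms TUnit_Obj] by (simp add: append_arr_unit swap_unit_Sym)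
qed simp_all

text \<open>\<open>tens_concat\<close> in terms of positions, with block \<open>k\<close> occupying
  the positions \<open>blk k\<close>. Labelling by positions is what allows rearrangements of blocks
  to be compared with rearrangements of single factors.\<close>

primrec concat_arr :: "(nat \<Rightarrow> nat list) \<Rightarrow> nat list \<Rightarrow> 'm" where
  "concat_arr blk [] = Id M I"
| "concat_arr blk (k # ks) = append_arr (map a (blk k)) (tobj (map a (concat (map blk ks))) I) \<cdot>
     (Id M (tobj (map a (blk k)) I) \<boxtimes> concat_arr blk ks)"

lemma tens_concat_eq: "tens_concat M (map (\<lambda>k. map a (blk k)) ks) = concat_arr blk ks"
proof (induction ks)
  case (Cons k ks)
  have "concat (map (\<lambda>k. map a (blk k)) ks) = map a (concat (map blk ks))"
    by (simp add: map_concat comp_def)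
  then show ?case using Cons by (simp add: tens_append_eq tens_tobj)
qed simp

lemma concat_arr_typ:
  "concat_arr blk ks \<in> Arr M \<and> Dom M (concat_arr blk ks) = tobj (map (\<lambda>k. tobj (map a (blk k)) I) ks) I \<and>
   Cod M (concat_arr blk ks) = tobj (map a (concat (map blk ks))) I"
  by (induction ks) auto

lemmas concat_arr_simps [simp] = concat_arr_typ[THEN conjunct1] concat_arr_typ[THEN conjunct2, THEN conjunct1]
  concat_arr_typ[THEN conjunct2, THEN conjunct2]

lemma mset_concat_cong:
  fixes blk blk' :: "nat \<Rightarrow> nat list" and ls ks :: "nat list"
  shows "(\<And>k. mset (blk k) = mset (blk' k)) \<Longrightarrow> mset ls = mset ks \<Longrightarrow>
   mset (concat (map blk ls)) = mset (concat (map blk' ks))"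
proof -
  assume *: "\<And>k. mset (blk k) = mset (blk' k)" and "mset ls = mset ks"
  then have "(\<Sum>l\<in>#mset ls. mset (blk l)) = (\<Sum>l\<in>#mset ks. mset (blk' l))" by simp
  moreover have "mset (concat (map b ls)) = (\<Sum>l\<in>#mset ls. mset (b l))" for ls :: "nat list" and b :: "nat \<Rightarrow> nat list"
    by (induction ls) auto
  ultimately show ?thesis by (simp only:)
qed

text \<open>Blocks are treated one at a time: \<open>perm_arr_append\<close> handles the first,
  \<open>append_arr_tid\<close> the remaining ones, and \<open>perm_arr_trans\<close> merges the two
  rearrangements.\<close>

lemma concat_arr_perm_blocks:
  assumes blk: "\<And>k. mset (blk k) = mset (blk' k)"
  shows "concat_arr blk' ks \<cdot> tarr (map (\<lambda>k. perm_arr a (blk k) (blk' k) I) ks) (Id M I) =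
    perm_arr a (concat (map blk ks)) (concat (map blk' ks)) I \<cdot> concat_arr blk ks"
proof (induction ks)
  case (Cons k ks)
  let ?zs = "concat (map blk ks)" and ?zs' = "concat (map blk' ks)"
  let ?A = "blk k" and ?A' = "blk' k"
  have [simp]: "mset ?zs = mset ?zs'" "mset (blk j) = mset (blk' j)" for j
    using blk by (auto intro: mset_concat_cong)
  have [simp]: "Dom M \<circ> (\<lambda>k. perm_arr a (blk k) (blk' k) I) = (\<lambda>k. tobj (map a (blk k)) I)"
     "Cod M \<circ> (\<lambda>k. perm_arr a (blk k) (blk' k) I) = (\<lambda>k. tobj (map a (blk' k)) I)"
     "(\<lambda>k. perm_arr a (blk k) (blk' k) I) ` S \<subseteq> Arr M" for S by auto
  let ?Z = "tobj (map a ?zs) I" and ?Z' = "tobj (map a ?zs') I"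
  have "concat_arr blk' (k # ks) \<cdot> tarr (map (\<lambda>k. perm_arr a (blk k) (blk' k) I) (k # ks)) (Id M I) =
    append_arr (map a ?A') ?Z' \<cdot> (perm_arr a ?A ?A' I \<boxtimes> (concat_arr blk' ks \<cdot> tarr (map (\<lambda>k. perm_arr a (blk k)
      (blk' k) I) ks) (Id M I)))"
    by simp
  also have "\<dots> = (append_arr (map a ?A') ?Z' \<cdot> (perm_arr a ?A ?A' I \<boxtimes> Id M ?Z')) \<cdot>
     ((Id M (tobj (map a ?A) I) \<boxtimes> perm_arr a ?zs ?zs' I) \<cdot> (Id M (tobj (map a ?A) I) \<boxtimes> concat_arr blk ks))"
    by (simp add: Cons.IH)
  also have "\<dots> = perm_arr a ?A ?A' ?Z' \<cdot> ((append_arr (map a ?A) ?Z' \<cdot> (Id M (tobj (map a ?A) I) \<boxtimes> perm_arr a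
    ?zs ?zs' I)) \<cdot>
     (Id M (tobj (map a ?A) I) \<boxtimes> concat_arr blk ks))"
    by (subst perm_arr_append[OF a_Obj]) simp_all
  also have "\<dots> = (perm_arr a ?A ?A' ?Z' \<cdot> tid (map a ?A) (perm_arr a ?zs ?zs' I)) \<cdot> (append_arr (map a ?A) ?Z \<cdot>
     (Id M (tobj (map a ?A) I) \<boxtimes> concat_arr blk ks))"
    by (subst append_arr_tid) simp_all
  also have "perm_arr a ?A ?A' ?Z' \<cdot> tid (map a ?A) (perm_arr a ?zs ?zs' I) =
      perm_arr a (?A @ ?zs') (?A' @ ?zs') I \<cdot> perm_arr a (?A @ ?zs) (?A @ ?zs') I"
    by (simp add: perm_arr_tail[OF a_Obj] perm_arr_head[OF a_Obj])
  also have "\<dots> = perm_arr a (?A @ ?zs) (?A' @ ?zs') I"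
    by (rule perm_arr_trans[OF a_Obj]) auto
  finally show ?case by simp
qed simp

text \<open>When block \<open>l\<close> passes block \<open>k\<close>, a single \<open>swap\<close>
  of tensor products occurs, which \<open>swap_block\<close> expands into a rearrangement of their
  factors.\<close>

lemma concat_arr_insert:
  assumes "l \<in> set ks" "distinct (concat (map blk ks))"
  shows "concat_arr blk ks \<cdot> insert_arr (\<lambda>k. tobj (map a (blk k)) I) l ks I =
    perm_arr a (concat (map blk (l # remove1 l ks))) (concat (map blk ks)) I \<cdot> concat_arr blk (l # remove1 l ks)"
  using assms
proof (induction ks)
  case (Cons k ks)
  let ?b = "\<lambda>k. tobj (map a (blk k)) I"
  have [simp]: "?b k \<in> Obj M" for k by simp
  note [simp] = insert_arr_simps[of ?b]
  show ?case
  proof (cases "k = l")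
    case False
    let ?rs = "concat (map blk (remove1 l ks))" and ?zs = "concat (map blk ks)"
    have [simp]: "l \<in> set ks" using False Cons.prems by auto
    have ms: "mset (l # remove1 l ks) = mset ks" by (simp add: mset_remove1)
    have [simp]: "mset (blk l @ ?rs) = mset ?zs" "mset (blk l) + mset ?rs = mset ?zs"
      using mset_concat_cong[OF HOL.refl ms, of blk] by simp_all
    have d: "distinct (blk k @ ?zs)" using Cons.prems by simp
    then have d': "distinct (blk k @ blk l @ ?rs)"
      by (rule mset_eq_imp_distinct_iff[THEN iffD2, rotated]) (use \<open>mset (blk l @ ?rs) = mset ?zs\<close> in \<open>simp
        only: mset_append\<close>)
    then have d'': "distinct (blk l @ blk k)" by auto
    let ?R = "tobj (map a ?rs) I" and ?Z = "tobj (map a ?zs) I"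
    let ?K = "map a (blk k)" and ?L = "map a (blk l)"
    let ?c = "concat_arr blk (remove1 l ks)"
    have "concat_arr blk (k # ks) \<cdot> insert_arr ?b l (k # ks) I =
      append_arr ?K ?Z \<cdot> ((Id M (?b k) \<boxtimes> (concat_arr blk ks \<cdot> insert_arr ?b l ks I)) \<cdot>
        swap (?b l) (?b k) (tobj (map ?b (remove1 l ks)) I))"
      using False by simp
    also have "\<dots> = (append_arr ?K ?Z \<cdot> (Id M (?b k) \<boxtimes> perm_arr a (blk l @ ?rs) ?zs I)) \<cdot>
      ((Id M (?b k) \<boxtimes> append_arr ?L ?R) \<cdot>
        ((Id M (?b k) \<boxtimes> (Id M (?b l) \<boxtimes> ?c)) \<cdot> swap (?b l) (?b k) (tobj (map ?b (remove1 l ks)) I)))"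
      using Cons.IH d by simp
    also have "(Id M (?b k) \<boxtimes> (Id M (?b l) \<boxtimes> ?c)) \<cdot> swap (?b l) (?b k) (tobj (map ?b (remove1 l ks)) I) =
       swap (?b l) (?b k) ?R \<cdot> (Id M (?b l) \<boxtimes> (Id M (?b k) \<boxtimes> ?c))"
      by (simp add: swap_nat)
    also have "append_arr ?K ?Z \<cdot> (Id M (?b k) \<boxtimes> perm_arr a (blk l @ ?rs) ?zs I) =
       tid ?K (perm_arr a (blk l @ ?rs) ?zs I) \<cdot> append_arr ?K (tobj ?L ?R)"
      by (subst append_arr_tid) simp_all
    also have "(tid ?K (perm_arr a (blk l @ ?rs) ?zs I) \<cdot> append_arr ?K (tobj ?L ?R)) \<cdot>
      ((Id M (?b k) \<boxtimes> append_arr ?L ?R) \<cdot>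
        (swap (?b l) (?b k) ?R \<cdot> (Id M (?b l) \<boxtimes> (Id M (?b k) \<boxtimes> ?c)))) =
       tid ?K (perm_arr a (blk l @ ?rs) ?zs I) \<cdot> ((append_arr ?K (tobj ?L ?R) \<cdot> ((Id M (?b k) \<boxtimes> append_arr ?L ?R) \<cdot>
        swap (?b l) (?b k) ?R)) \<cdot> (Id M (?b l) \<boxtimes> (Id M (?b k) \<boxtimes> ?c)))"
      by simp
    also have "append_arr ?K (tobj ?L ?R) \<cdot> ((Id M (?b k) \<boxtimes> append_arr ?L ?R) \<cdot> swap (?b l) (?b k) ?R) =
       perm_arr a (blk l @ blk k) (blk k @ blk l) ?R \<cdot> (append_arr ?L (tobj ?K ?R) \<cdot> (Id M (?b l) \<boxtimes> append_arr ?K ?R))"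
      by (rule swap_block[OF d'']) simp
    also have "tid ?K (perm_arr a (blk l @ ?rs) ?zs I) \<cdot> ((perm_arr a (blk l @ blk k) (blk k @ blk l) ?R \<cdot>
         (append_arr ?L (tobj ?K ?R) \<cdot> (Id M (?b l) \<boxtimes> append_arr ?K ?R))) \<cdot> (Id M (?b l) \<boxtimes> (Id M (?b k) \<boxtimes> ?c))) =
       (tid ?K (perm_arr a (blk l @ ?rs) ?zs I) \<cdot> perm_arr a (blk l @ blk k) (blk k @ blk l) ?R) \<cdot>
         (append_arr ?L (tobj ?K ?R) \<cdot> (Id M (?b l) \<boxtimes> (append_arr ?K ?R \<cdot> (Id M (?b k) \<boxtimes> ?c))))"
      by simp
    also have "tid ?K (perm_arr a (blk l @ ?rs) ?zs I) \<cdot> perm_arr a (blk l @ blk k) (blk k @ blk l) ?R =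
       perm_arr a (blk k @ blk l @ ?rs) (blk k @ ?zs) I \<cdot> perm_arr a (blk l @ blk k @ ?rs) (blk k @ blk l @ ?rs) I"
      using perm_arr_tail[OF a_Obj, where ls="blk l @ blk k" and ks="blk k @ blk l" and x=I and zs="?rs"]
        perm_arr_head[OF a_Obj, where ls="blk l @ ?rs" and ks="?zs" and x=I and us="blk k"] by simp
    also have "\<dots> = perm_arr a (blk l @ blk k @ ?rs) (blk k @ ?zs) I"
      by (rule perm_arr_trans[OF a_Obj]) (use \<open>mset (blk l @ ?rs) = mset ?zs\<close> in simp_all)
    finally show ?thesis using False by simp
  qed simp
qed simp

text \<open>Built from \<open>concat_arr_insert\<close> in the way \<open>perm_arr\<close> is built
  from insertions. It accounts for the outer part of a block permutation,
  \<open>concat_arr_perm_blocks\<close> for the parts inside the blocks.\<close>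

lemma concat_arr_perm:
  assumes "mset ls = mset ks" "distinct (concat (map blk ks))"
  shows "concat_arr blk ks \<cdot> perm_arr (\<lambda>k. tobj (map a (blk k)) I) ls ks I =
    perm_arr a (concat (map blk ls)) (concat (map blk ks)) I \<cdot> concat_arr blk ls"
  using assms
proof (induction ls arbitrary: ks)
  case (Cons l ls)
  note l = mset_Cons_eqD[OF Cons.prems(1)]
  let ?b = "\<lambda>k. tobj (map a (blk k)) I"
  have [simp]: "?b k \<in> Obj M" for k by simp
  note [simp] = insert_arr_simps[of ?b] perm_arr_simps[of ?b]
  have [simp]: "l \<in> set ks" "mset ls = mset (remove1 l ks)" using l by auto
  let ?c = "\<lambda>ks. concat (map blk ks)" and ?r = "remove1 l ks"
  have m: "mset (?c ls) = mset (?c ?r)" "mset (blk l @ ?c ?r) = mset (?c ks)"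
    using mset_concat_cong[OF HOL.refl, of ls ?r blk] mset_concat_cong[OF HOL.refl, of "l # ?r" ks blk]
    by (simp_all add: mset_remove1)
  have d: "distinct (?c ?r)"
    using mset_eq_imp_distinct_iff[OF m(2)] Cons.prems(2) by auto
  have "concat_arr blk ks \<cdot> perm_arr ?b (l # ls) ks I =
     (concat_arr blk ks \<cdot> insert_arr ?b l ks I) \<cdot> (Id M (?b l) \<boxtimes> perm_arr ?b ls ?r I)"
    by simp
  also have "\<dots> = perm_arr a (blk l @ ?c ?r) (?c ks) I \<cdot> (append_arr (map a (blk l)) (tobj (map a (?c ?r)) I) \<cdot>
      (Id M (?b l) \<boxtimes> (concat_arr blk ?r \<cdot> perm_arr ?b ls ?r I)))"
    using m by (subst concat_arr_insert) (simp_all add: Cons.prems)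
  also have "\<dots> = perm_arr a (blk l @ ?c ?r) (?c ks) I \<cdot> ((append_arr (map a (blk l)) (tobj (map a (?c ?r)) I) \<cdot>
      (Id M (?b l) \<boxtimes> perm_arr a (?c ls) (?c ?r) I)) \<cdot> (Id M (?b l) \<boxtimes> concat_arr blk ls))"
    using m by (subst Cons.IH) (simp_all add: d)
  also have "append_arr (map a (blk l)) (tobj (map a (?c ?r)) I) \<cdot> (Id M (?b l) \<boxtimes> perm_arr a (?c ls) (?c ?r) I) =
      tid (map a (blk l)) (perm_arr a (?c ls) (?c ?r) I) \<cdot> append_arr (map a (blk l)) (tobj (map a (?c ls)) I)"
    using m by (subst append_arr_tid) simp_all
  also have "perm_arr a (blk l @ ?c ?r) (?c ks) I \<cdot> ((tid (map a (blk l)) (perm_arr a (?c ls) (?c ?r) I) \<cdot>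
       append_arr (map a (blk l)) (tobj (map a (?c ls)) I)) \<cdot> (Id M (?b l) \<boxtimes> concat_arr blk ls)) =
     (perm_arr a (blk l @ ?c ?r) (?c ks) I \<cdot> perm_arr a (blk l @ ?c ls) (blk l @ ?c ?r) I) \<cdot> concat_arr blk (l # ls)"
    using m by (simp add: perm_arr_head[OF a_Obj])
  also have "perm_arr a (blk l @ ?c ?r) (?c ks) I \<cdot> perm_arr a (blk l @ ?c ls) (blk l @ ?c ?r) I =
      perm_arr a (blk l @ ?c ls) (?c ks) I"
    using m by (intro perm_arr_trans[OF a_Obj]) simp_all
  finally show ?case by simp
qed simp

end

lemma tens_concat_Cons:
  "tens_concat M (as # ass) = append_arr as (tobj (concat ass) I) \<cdot> (Id M (tobj as I) \<boxtimes> tens_concat M ass)"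
  by (simp add: tens_append_eq tens_tobj)

text \<open>Invertibility is what later lets \<open>tens_concat\<close> be cancelled from the
  composition law of an algebra.\<close>

lemma tens_concat_typ:
  "\<forall>as \<in> set ass. set as \<subseteq> Obj M \<Longrightarrow> is_iso M (tens_concat M ass) \<and>
     Dom M (tens_concat M ass) = tobj (map (\<lambda>as. tobj as I) ass) I \<and> Cod M (tens_concat M ass) = tobj (concat ass) I"
proof (induction ass)
  case (Cons as ass)
  then have "set (concat ass) \<subseteq> Obj M" by auto
  moreover have "tobj (map (\<lambda>as. tobj as I) ass) I \<in> Obj M"
    using Cons.prems by (intro tobj_Obj) auto
  ultimately show ?case using Cons is_iso_Arr[of "tens_concat M ass"]
    by (auto simp add: tens_concat_Cons simp del: tens_concat.simps)
qed auto

end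

section \<open>Block permutations\<close>

definition offset :: "nat list \<Rightarrow> nat \<Rightarrow> nat" where
  "offset ks i = sum_list (take i ks)"

lemma offset_Cons [simp]: "offset (k # ks) 0 = 0" "offset (k # ks) (Suc i) = k + offset ks i"
  by (simp_all add: offset_def)

lemma map_add_upt': "map ((+) n) [0..<k] = [n..<n + k]"
  by (induction k) auto

lemma concat_offset: "concat (map (\<lambda>i. map ((+) (offset ks i)) [0..<ks ! i]) [0..<length ks]) = [0..<sum_list ks]"
proof (induction ks rule: rev_induct)
  case (snoc k ks)
  let ?f = "\<lambda>ks i. map ((+) (offset ks i)) [0..<ks ! i]"
  have *: "map (?f (ks @ [k])) [0..<length ks] = map (?f ks) [0..<length ks]"
    by (rule map_cong) (auto simp: offset_def nth_append)
  have "concat (map (?f (ks @ [k])) [0..<length (ks @ [k])]) =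
      concat (map (?f (ks @ [k])) [0..<length ks]) @ ?f (ks @ [k]) (length ks)"
    by simp
  also have "\<dots> = [0..<sum_list ks] @ [sum_list ks..<sum_list ks + k]"
    unfolding * snoc.IH by (simp add: offset_def map_add_upt')
  also have "\<dots> = [0..<sum_list (ks @ [k])]"
    by (simp add: upt_add_eq_append[of 0, simplified])
  finally show ?case .
qed simp

lemma locate_offset: "i < length ks \<Longrightarrow> r < ks ! i \<Longrightarrow> locate ks (offset ks i + r) = (i, r)"
proof (induction ks arbitrary: i)
  case (Cons k ks)
  then show ?case by (cases i) auto
qed simp

lemma offset_less: "i < length ks \<Longrightarrow> r < ks ! i \<Longrightarrow> offset ks i + r < sum_list ks"
proof (induction ks arbitrary: i)
  case (Cons k ks)
  then show ?case by (cases i) (auto simp: add.assoc)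
qed simp

lemma nth_concat_offset: "i < length xss \<Longrightarrow> r < length (xss ! i) \<Longrightarrow>
   concat xss ! (offset (map length xss) i + r) = xss ! i ! r"
proof (induction xss arbitrary: i)
  case (Cons xs xss)
  then show ?case by (cases i) (auto simp: nth_append add.assoc)
qed simp

text \<open>The inputs in the order in which they get multiplied: the \<open>i\<close>-th input goes
  to place \<open>\<sigma> i\<close>, so place \<open>q\<close> is taken by input
  \<open>inv \<sigma> q\<close>.\<close>

definition positions :: "(nat \<Rightarrow> nat) \<Rightarrow> nat \<Rightarrow> nat list" where
  "positions \<sigma> n = map (inv \<sigma>) [0..<n]"

lemma length_positions [simp]: "length (positions \<sigma> n) = n"
  by (simp add: positions_def)

lemma mset_positions [simp]:
  assumes "\<sigma> permutes {..<n}"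
  shows "mset (positions \<sigma> n) = mset [0..<n]"
proof -
  have "inv \<sigma> permutes {..<n}" by (rule permutes_inv[OF assms])
  then have "inj_on (inv \<sigma>) {..<n}" "inv \<sigma> ` {..<n} = {..<n}"
    by (simp_all add: permutes_inj_on permutes_image)
  then have "distinct (positions \<sigma> n)" "set (positions \<sigma> n) = set [0..<n]"
    by (simp_all add: positions_def distinct_map atLeast0LessThan)
  then show ?thesis by (metis distinct_upt set_eq_iff_mset_eq_distinct)
qed

lemma set_positions [simp]: "\<sigma> permutes {..<n} \<Longrightarrow> set (positions \<sigma> n) = {..<n}"
  using mset_eq_setD[OF mset_positions] by (simp add: atLeast0LessThan)

lemma map_positions: "\<sigma> permutes {..<n} \<Longrightarrow> map \<sigma> (positions \<sigma> n) = [0..<n]"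
  by (simp add: positions_def permutes_inverses comp_def)

text \<open>Reindexing by \<open>\<sigma>\<close> turns the starting point that
  \<open>block_perm\<close> assigns to a block into an ordinary offset, in the list of block lengths
  put into reading order.\<close>

lemma sum_less_permuted:
  assumes "\<sigma> permutes {..<length ks}" "q < length ks"
  shows "(\<Sum>j | j < length ks \<and> \<sigma> j < q. ks ! j) = offset (map (\<lambda>p. ks ! inv \<sigma> p) [0..<length ks]) q"
proof -
  have "(\<Sum>j | j < length ks \<and> \<sigma> j < q. ks ! j) = (\<Sum>p<q. ks ! inv \<sigma> p)"
  proof (rule sum.reindex_bij_witness[of _ "inv \<sigma>" \<sigma>])
    fix p assume "p \<in> {..<q}"
    then have "inv \<sigma> p \<in> {..<length ks}"
      using assms permutes_in_image[OF permutes_inv[OF assms(1)], of p] by auto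
    then show "inv \<sigma> p \<in> {j. j < length ks \<and> \<sigma> j < q}"
      using \<open>p \<in> {..<q}\<close> assms(1) by (simp add: permutes_inverses)
  qed (auto simp: permutes_inverses[OF assms(1)])
  also have "\<dots> = offset (map (\<lambda>p. ks ! inv \<sigma> p) [0..<length ks]) q"
    using assms(2) by (simp add: offset_def take_map take_upt sum_list_distinct_conv_sum_set atLeast0LessThan)
  finally show ?thesis .
qed

text \<open>The list on the right, \<open>L\<close> in the proof, is mapped by
  \<open>block_perm\<close> onto \<open>[0..<N]\<close> in order and is itself a rearrangement of
  \<open>[0..<N]\<close>, where \<open>N\<close> is the sum of \<open>ks\<close>. Bijectivity and
  the reading order both come out of this.\<close>

lemma block_perm_positions:
  assumes \<sigma>: "\<sigma> permutes {..<length ks}" and \<tau>: "\<And>i. i < length ks \<Longrightarrow> \<tau>s ! i permutes {..<ks ! i}"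
  shows "block_perm \<sigma> ks \<tau>s permutes {..<sum_list ks}"
    and "positions (block_perm \<sigma> ks \<tau>s) (sum_list ks) =
      concat (map (\<lambda>i. map ((+) (offset ks i)) (positions (\<tau>s ! i) (ks ! i))) (positions \<sigma> (length ks)))"
proof -
  let ?n = "length ks" and ?N = "sum_list ks" and ?bp = "block_perm \<sigma> ks \<tau>s"
  let ?ks' = "map (\<lambda>p. ks ! inv \<sigma> p) [0..<?n]"
  define L where "L = concat (map (\<lambda>i. map ((+) (offset ks i)) (positions (\<tau>s ! i) (ks ! i))) (positions \<sigma> ?n))"
  have inv: "inv \<sigma> q < ?n" if "q < ?n" for q
    using that permutes_in_image[OF permutes_inv[OF \<sigma>], of q] by simp
  have bp: "?bp (offset ks i + r) = (\<Sum>j | j < ?n \<and> \<sigma> j < \<sigma> i. ks ! j) + (\<tau>s ! i) r" if "i < ?n" "r < ks ! i" for i r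
    using offset_less[OF that] locate_offset[OF that] by (simp add: block_perm_def)
  have bp_block: "map ?bp (map ((+) (offset ks i)) (positions (\<tau>s ! i) (ks ! i))) =
     map ((+) (offset ?ks' q)) [0..<?ks' ! q]" if q: "q < ?n" and i: "i = inv \<sigma> q" for i q
  proof -
    have i': "i < ?n" and "\<sigma> i = q" using inv[OF q] i \<sigma> by (auto simp: permutes_inverses)
    have "map ?bp (map ((+) (offset ks i)) (positions (\<tau>s ! i) (ks ! i))) =
       map (\<lambda>r. offset ?ks' q + (\<tau>s ! i) r) (positions (\<tau>s ! i) (ks ! i))"
      using \<tau>[OF i'] by (simp add: bp i' \<open>\<sigma> i = q\<close> sum_less_permuted[OF \<sigma> q])
    also have "\<dots> = map ((+) (offset ?ks' q)) (map (\<tau>s ! i) (positions (\<tau>s ! i) (ks ! i)))"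
      by simp
    also have "map (\<tau>s ! i) (positions (\<tau>s ! i) (ks ! i)) = [0..<?ks' ! q]"
      unfolding map_positions[OF \<tau>[OF i']] using q i by simp
    finally show ?thesis .
  qed
  have sum': "sum_list ?ks' = ?N"
  proof -
    have "mset (map ((!) ks) (positions \<sigma> ?n)) = mset (map ((!) ks) [0..<?n])"
      by (simp only: mset_map mset_positions[OF \<sigma>])
    then have "sum_list (map ((!) ks) (positions \<sigma> ?n)) = sum_list (map ((!) ks) [0..<?n])"
      by (metis sum_mset_sum_list)
    then show ?thesis by (simp add: positions_def comp_def map_nth)
  qed
  have "map ?bp L = concat (map (\<lambda>i. map ?bp (map ((+) (offset ks i)) (positions (\<tau>s ! i) (ks ! i))))
    (map (inv \<sigma>) [0..<?n]))"
    unfolding L_def positions_def[of \<sigma>] by (simp only: map_concat map_map comp_def)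
  also have "\<dots> = concat (map (\<lambda>q. map ((+) (offset ?ks' q)) [0..<?ks' ! q]) [0..<length ?ks'])"
  proof (rule arg_cong[where f=concat], rule nth_equalityI)
    fix q assume "q < length (map (\<lambda>i. map ?bp (map ((+) (offset ks i)) (positions (\<tau>s ! i) (ks ! i))))
      (map (inv \<sigma>) [0..<?n]))"
    then have q: "q < ?n" by simp
    then show "map (\<lambda>i. map ?bp (map ((+) (offset ks i)) (positions (\<tau>s ! i) (ks ! i)))) (map (inv \<sigma>) [0..<?n]) ! q =
        map (\<lambda>q. map ((+) (offset ?ks' q)) [0..<?ks' ! q]) [0..<length ?ks'] ! q"
      using bp_block[OF q HOL.refl] by (simp del: map_map)
  qed simp
  also have "\<dots> = [0..<?N]"
    by (simp only: concat_offset sum')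
  finally have map_L: "map ?bp L = [0..<?N]" .
  have "mset L = mset (concat (map (\<lambda>i. map ((+) (offset ks i)) [0..<ks ! i]) [0..<?n]))"
  proof -
    have "mset L = (\<Sum>i\<in>#mset (positions \<sigma> ?n). image_mset ((+) (offset ks i)) (mset (positions (\<tau>s ! i) (ks ! i))))"
      unfolding L_def by (simp add: mset_concat comp_def flip: sum_mset_sum_list)
    also have "\<dots> = (\<Sum>i\<in>#mset [0..<?n]. image_mset ((+) (offset ks i)) (mset [0..<ks ! i]))"
      unfolding mset_positions[OF \<sigma>]
      by (rule arg_cong[where f=sum_mset], rule image_mset_cong) (use \<tau> mset_positions in auto)
    also have "\<dots> = mset (concat (map (\<lambda>i. map ((+) (offset ks i)) [0..<ks ! i]) [0..<?n]))"
      by (simp add: mset_concat comp_def flip: sum_mset_sum_list)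
    finally show ?thesis .
  qed
  then have "mset L = mset [0..<?N]" by (simp only: concat_offset)
  then have "set L = set [0..<?N]" by (rule mset_eq_setD)
  then have set_L: "set L = {..<?N}" by (simp only: set_upt atLeast0LessThan)
  have "?bp ` {..<?N} = {..<?N}"
    using arg_cong[OF map_L, of set] set_L by (simp add: atLeast0LessThan)
  \<comment> \<open>The image is the whole domain, a finite set, which forces injectivity.\<close>
  then have "bij_betw ?bp {..<?N} {..<?N}"
    by (simp add: bij_betw_def eq_card_imp_inj_on)
  then show p: "?bp permutes {..<?N}"
    by (rule bij_imp_permutes) (simp add: block_perm_def)
  have "map (inv ?bp) (map ?bp L) = L"
    using permutes_inverses(2)[OF p] by (simp add: comp_def)
  then show "positions ?bp ?N = L" by (simp add: map_L positions_def)
qed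

section \<open>Algebras over the operad of an orthogonal category in terms of representatives\<close>

lemma cat_operad_simps [simp]:
  "Colors (cat_operad D) = Obj D"
  "(\<sigma>, fs) \<in> Ops (cat_operad D) cs t \<longleftrightarrow> set cs \<subseteq> Obj D \<and> t \<in> Obj D \<and> \<sigma> permutes {..<length cs} \<and>
       length fs = length cs \<and> (\<forall>i < length cs. fs ! i \<in> hom D (cs ! i) t)"
  "Act (cat_operad D) cs t \<sigma>' (\<sigma>, fs) = (\<sigma> \<circ> \<sigma>', permute_list \<sigma>' fs)"
  "Gam (cat_operad D) ts t css (\<sigma>, fs) ys = (block_perm \<sigma> (map length css) (map fst ys),
        concat (map2 (\<lambda>f gs. map (\<lambda>g. f \<cdot>\<^bsub>D\<^esub> g) gs) fs (map snd ys)))"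
  "Unt (cat_operad D) t = (id, [cat.Id D t])"
  by (simp_all add: cat_operad_def)

lemma cat_operad_Act:
  assumes "x \<in> Ops (cat_operad D) cs t" "\<sigma> permutes {..<length cs}"
  shows "Act (cat_operad D) cs t \<sigma> x \<in> Ops (cat_operad D) (permute_list \<sigma> cs) t"
proof -
  obtain \<tau> fs where x: "x = (\<tau>, fs)" by (cases x)
  have "set (permute_list \<sigma> cs) = set cs" using assms(2) by simp
  moreover have "permute_list \<sigma> fs ! i \<in> hom D (permute_list \<sigma> cs ! i) t" if "i < length cs" for i
  proof -
    have "\<sigma> i < length cs" using permutes_in_image[OF assms(2), of i] that by simp
    then show ?thesis using assms that by (simp add: x permute_list_nth)
  qed
  ultimately show ?thesis using assms by (simp add: x permutes_compose)
qed

lemma cat_operad_Gam: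
  assumes D: "category D" and x: "x \<in> Ops (cat_operad D) ts t"
    and len: "length css = length ts" "length ys = length ts"
    and ys: "\<And>i. i < length ts \<Longrightarrow> ys ! i \<in> Ops (cat_operad D) (css ! i) (ts ! i)"
  shows "Gam (cat_operad D) ts t css x ys \<in> Ops (cat_operad D) (concat css) t"
proof -
  interpret category D by fact
  obtain \<sigma> fs where x': "x = (\<sigma>, fs)" by (cases x)
  have yi: "set (css ! i) \<subseteq> Obj D" "fst (ys ! i) permutes {..<length (css ! i)}" "length (snd (ys ! i)) =
    length (css ! i)"
    "\<And>r. r < length (css ! i) \<Longrightarrow> snd (ys ! i) ! r \<in> hom D (css ! i ! r) (ts ! i)" if "i < length ts" for i
    using ys[OF that] by (cases "ys ! i"; simp)+
  let ?gss = "map2 (\<lambda>f gs. map (\<lambda>g. f \<cdot>\<^bsub>D\<^esub> g) gs) fs (map snd ys)"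
  have "block_perm \<sigma> (map length css) (map fst ys) permutes {..<sum_list (map length css)}"
    by (rule block_perm_positions(1)) (use x x' len yi in auto)
  moreover have "set (concat css) \<subseteq> Obj D" using yi(1) len by (auto simp: in_set_conv_nth) (metis nth_mem subsetD)
  moreover have l: "list_all2 (\<lambda>gs cs. list_all2 (\<lambda>g c. g \<in> hom D c t) gs cs) ?gss css"
    using x x' len yi(3,4) by (auto simp: list_all2_conv_all_nth intro!: Comp_hom)
  then have "list_all2 (\<lambda>g c. g \<in> hom D c t) (concat ?gss) (concat css)"
    by (rule concat_transfer[unfolded rel_fun_def, rule_format])
  ultimately show ?thesis
    using x x' by (simp add: list_all2_conv_all_nth length_concat)
qed

lemma orth_cong_Ops:
  assumes D: "category D" and "orth_cong D orth cs t x y"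
  shows "x \<in> Ops (cat_operad D) cs t \<and> y \<in> Ops (cat_operad D) cs t"
  using assms(2) unfolding orth_cong_def
proof (induction rule: op_cong.induct)
  case (Act cs t x y \<sigma>)
  then show ?case by (simp add: cat_operad_Act)
next
  case (Gam ts t x y css xs ys)
  then show ?case by (simp add: cat_operad_Gam[OF D])
qed auto

definition op_class :: "('o, 'm) cat \<Rightarrow> ('m \<times> 'm) set \<Rightarrow> 'o list \<Rightarrow> 'o \<Rightarrow>
    (nat \<Rightarrow> nat) \<times> 'm list \<Rightarrow> ((nat \<Rightarrow> nat) \<times> 'm list) set" where
  "op_class D orth cs t x = {z. orth_cong D orth cs t x z}"

lemma op_class_eq: "orth_cong D orth cs t x y \<Longrightarrow> op_class D orth cs t x = op_class D orth cs t y"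
  unfolding op_class_def orth_cong_def by (blast intro: op_cong.sym op_cong.trans)

lemma op_class_self: "x \<in> Ops (cat_operad D) cs t \<Longrightarrow> x \<in> op_class D orth cs t x"
  unfolding op_class_def orth_cong_def by (blast intro: op_cong.refl)

lemma orth_operad_simps:
  "Colors (orth_operad D orth) = Obj D"
  "Ops (orth_operad D orth) cs t = op_class D orth cs t ` Ops (cat_operad D) cs t"
  "Unt (orth_operad D orth) t = op_class D orth [t] t (Unt (cat_operad D) t)"
  by (simp_all add: orth_operad_def quotient_operad_def op_class_def)

lemma orth_operad_Act:
  assumes "x \<in> Ops (cat_operad D) cs t" "\<sigma> permutes {..<length cs}"
  shows "Act (orth_operad D orth) cs t \<sigma> (op_class D orth cs t x) =
    op_class D orth (permute_list \<sigma> cs) t (Act (cat_operad D) cs t \<sigma> x)" (is "?L = ?R")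
proof
  show "?L \<subseteq> ?R"
    using assms(2) by (auto simp: orth_operad_def quotient_operad_def op_class_def orth_cong_def
        simp del: cat_operad_simps intro: op_cong.trans op_cong.Act)
  show "?R \<subseteq> ?L"
    using op_class_self[OF assms(1), of orth]
    by (auto simp: orth_operad_def quotient_operad_def op_class_def simp del: cat_operad_simps split_paired_Ex)
qed

text \<open>Any other choice of representatives yields an equivalent composite, since
  \<open>op_cong\<close> is closed under \<open>Gam\<close>.\<close>

lemma orth_operad_Gam:
  assumes x: "x \<in> Ops (cat_operad D) ts t"
    and len: "length css = length ts" "length ys = length ts"
    and ys: "\<And>i. i < length ts \<Longrightarrow> ys ! i \<in> Ops (cat_operad D) (css ! i) (ts ! i)"
    and Ys: "length Ys = length ts" "\<And>i. i < length ts \<Longrightarrow> Ys ! i = op_class D orth (css ! i) (ts ! i) (ys ! i)"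
  shows "Gam (orth_operad D orth) ts t css (op_class D orth ts t x) Ys =
    op_class D orth (concat css) t (Gam (cat_operad D) ts t css x ys)" (is "?L = ?R")
proof
  show "?L \<subseteq> ?R"
  proof
    fix z assume "z \<in> ?L"
    then obtain x' ys' where x': "orth_cong D orth ts t x x'" and ys': "list_all2 (\<in>) ys' Ys"
      and z: "orth_cong D orth (concat css) t (Gam (cat_operad D) ts t css x' ys') z"
      by (auto simp: orth_operad_def quotient_operad_def op_class_def)
    have "orth_cong D orth (concat css) t (Gam (cat_operad D) ts t css x ys) (Gam (cat_operad D) ts t css x' ys')"
      using x' ys' len Ys unfolding orth_cong_def
      by (intro op_cong.Gam) (auto simp: list_all2_conv_all_nth op_class_def orth_cong_def)
    with z show "z \<in> ?R" unfolding op_class_def orth_cong_def by (blast intro: op_cong.trans)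
  qed
  have "list_all2 (\<in>) ys Ys"
    using len Ys ys by (auto simp: list_all2_conv_all_nth op_class_self)
  then show "?R \<subseteq> ?L"
    using op_class_self[OF x, of orth]
    by (auto simp: orth_operad_def quotient_operad_def op_class_def simp del: cat_operad_simps split_paired_Ex)
qed

text \<open>An algebra over the quotient operad amounts to an algebra over
  \<open>cat_operad D\<close> whose structure maps agree on the generating pairs. Stating the laws
  for representatives keeps equivalence classes out of the computations.\<close>

locale rep_algebra = symmetric_monoidal_category M + D: category D
  for M :: "('o, 'm, 'z) smc_scheme" (structure) and D :: "('c, 'a) cat" and orth :: "('a \<times> 'a) set" +
  fixes X :: "'c \<Rightarrow> 'o" and s :: "'c list \<Rightarrow> 'c \<Rightarrow> (nat \<Rightarrow> nat) \<times> 'a list \<Rightarrow> 'm"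
  assumes X_Obj [simp]: "t \<in> Obj D \<Longrightarrow> X t \<in> Obj M"
    and s_hom: "x \<in> Ops (cat_operad D) cs t \<Longrightarrow> s cs t x \<in> hom M (tens M (map X cs)) (X t)"
    and s_Unt: "t \<in> Obj D \<Longrightarrow> s [t] t (Unt (cat_operad D) t) = RUnit M (X t)"
    and s_Act: "x \<in> Ops (cat_operad D) cs t \<Longrightarrow> \<sigma> permutes {..<length cs} \<Longrightarrow>
      s (permute_list \<sigma> cs) t (Act (cat_operad D) cs t \<sigma> x) = s cs t x \<cdot> tens_perm M \<sigma> (map X cs)"
    and s_Gam: "x \<in> Ops (cat_operad D) ts t \<Longrightarrow> composable (cat_operad D) ts css ys \<Longrightarrow>
      s (concat css) t (Gam (cat_operad D) ts t css x ys) \<cdot> tens_concat M (map (map X) css) =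
      s ts t x \<cdot> tens_arr M (map (\<lambda>i. s (css ! i) (ts ! i) (ys ! i)) [0..<length ts])"
    and s_orth: "orth_rel D orth cs t x y \<Longrightarrow> x \<in> Ops (cat_operad D) cs t \<Longrightarrow> y \<in> Ops (cat_operad D) cs t \<Longrightarrow>
      s cs t x = s cs t y"
begin

text \<open>The universal property of the generated congruence, by induction on its derivation.
  Membership in \<open>Ops\<close> is carried along so that the laws apply to both
  operations.\<close>

lemma s_cong: "orth_cong D orth cs t x y \<Longrightarrow>
    x \<in> Ops (cat_operad D) cs t \<and> y \<in> Ops (cat_operad D) cs t \<and> s cs t x = s cs t y"
  unfolding orth_cong_def
proof (induction rule: op_cong.induct)
  case (Act cs t x y \<sigma>)
  then show ?case by (simp add: cat_operad_Act s_Act)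
next
  case (Gam ts t x y css xs ys)
  let ?G = "Gam (cat_operad D) ts t css"
  have ops: "?G x xs \<in> Ops (cat_operad D) (concat css) t" "?G y ys \<in> Ops (cat_operad D) (concat css) t"
    using Gam by (simp_all add: cat_operad_Gam[OF D.category_axioms])
  have m: "map (\<lambda>i. s (css ! i) (ts ! i) (xs ! i)) [0..<length ts] = map (\<lambda>i. s (css ! i) (ts ! i) (ys ! i))
    [0..<length ts]"
    using Gam by auto
  have c: "composable (cat_operad D) ts css xs" "composable (cat_operad D) ts css ys"
    using Gam by (simp_all add: composable_def)
  have xy: "x \<in> Ops (cat_operad D) ts t" "y \<in> Ops (cat_operad D) ts t" "s ts t x = s ts t y"
    using Gam by simp_all
  have eq: "s (concat css) t (?G x xs) \<cdot> tens_concat M (map (map X) css) =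
     s (concat css) t (?G y ys) \<cdot> tens_concat M (map (map X) css)"
    by (simp only: s_Gam[OF xy(1) c(1)] s_Gam[OF xy(2) c(2)] m xy(3))
  have "set cs \<subseteq> Obj D" if "cs \<in> set css" for cs
  proof -
    obtain i where "i < length css" "css ! i = cs" using \<open>cs \<in> set css\<close> by (auto simp: in_set_conv_nth)
    then show ?thesis using Gam.IH(2)[of i] Gam.hyps by (cases "xs ! i") auto
  qed
  then have "\<forall>as \<in> set (map (map X) css). set as \<subseteq> Obj M" by (auto intro!: X_Obj)
  note tc = tens_concat_typ[OF this]
  \<comment> \<open>\<open>s_Gam\<close> determines the composite only after precomposition with
    \<open>tens_concat\<close>, an isomorphism that can be cancelled.\<close>
  have "s (concat css) t (?G x xs) = s (concat css) t (?G y ys)"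
    by (rule iso_epi[OF _ eq]) (use tc s_hom[OF ops(1)] s_hom[OF ops(2)] in \<open>auto simp: hom_def tens_tobj map_concat\<close>)
  with ops show ?case by blast
qed (auto simp: s_orth)

end

text \<open>The choice of representative does not matter, by \<open>s_cong\<close>. The restrictions
  supply the values \<open>undefined\<close> on which equality of algebras depends.\<close>

definition rep_to_alg :: "('c, 'a) cat \<Rightarrow> ('a \<times> 'a) set \<Rightarrow> ('c \<Rightarrow> 'o) \<Rightarrow>
   ('c list \<Rightarrow> 'c \<Rightarrow> (nat \<Rightarrow> nat) \<times> 'a list \<Rightarrow> 'm) \<Rightarrow> ('c, ((nat \<Rightarrow> nat) \<times> 'a list) set, 'o, 'm) alg" where
  "rep_to_alg D orth X s = \<lparr>Car = restrict X (Obj D),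
     Str = (\<lambda>cs t. \<lambda>Z \<in> Ops (orth_operad D orth) cs t. s cs t (SOME x. x \<in> Z))\<rparr>"

definition alg_rep :: "('c, 'a) cat \<Rightarrow> ('a \<times> 'a) set \<Rightarrow> ('c, ((nat \<Rightarrow> nat) \<times> 'a list) set, 'o, 'm) alg \<Rightarrow>
   'c list \<Rightarrow> 'c \<Rightarrow> (nat \<Rightarrow> nat) \<times> 'a list \<Rightarrow> 'm" where
  "alg_rep D orth A cs t x = Str A cs t (op_class D orth cs t x)"

context rep_algebra
begin

lemma rep_to_alg_Str:
  assumes "x \<in> Ops (cat_operad D) cs t"
  shows "Str (rep_to_alg D orth X s) cs t (op_class D orth cs t x) = s cs t x"
proof -
  have "(SOME z. z \<in> op_class D orth cs t x) \<in> op_class D orth cs t x"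
    by (rule someI) (rule op_class_self[OF assms])
  then have "s cs t (SOME z. z \<in> op_class D orth cs t x) = s cs t x"
    using s_cong unfolding op_class_def by fastforce
  then show ?thesis using assms by (simp add: rep_to_alg_def orth_operad_simps)
qed

lemma alg_rep_rep_to_alg: "x \<in> Ops (cat_operad D) cs t \<Longrightarrow> alg_rep D orth (rep_to_alg D orth X s) cs t x = s cs t x"
  by (simp add: alg_rep_def rep_to_alg_Str)

lemma map_Car: "set cs \<subseteq> Obj D \<Longrightarrow> map (Car (rep_to_alg D orth X s)) cs = map X cs"
  by (auto simp: rep_to_alg_def)

lemma operad_algebra_rep_to_alg: "operad_algebra (orth_operad D orth) M (rep_to_alg D orth X s)"
proof
  let ?A = "rep_to_alg D orth X s" and ?O = "orth_operad D orth"
  have Ops_cs: "set cs \<subseteq> Obj D" "t \<in> Obj D" if "x \<in> Ops (cat_operad D) cs t" for x cs t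
    using that by (cases x; simp)+
  have Car: "Car ?A t = X t" if "t \<in> Obj D" for t using that by (simp add: rep_to_alg_def)
  show "Car ?A t \<in> Obj M" if "t \<in> Colors ?O" for t using that by (simp add: Car orth_operad_simps)
  show "Car ?A \<in> extensional (Colors ?O)" by (simp add: rep_to_alg_def orth_operad_simps)
  show "Str ?A cs t Z \<in> hom M (tens M (map (Car ?A) cs)) (Car ?A t)" if "Z \<in> Ops ?O cs t" for Z cs t
    using that Ops_cs[of _ cs t] s_hom by (auto simp: orth_operad_simps rep_to_alg_Str map_Car Car)
  show "Str ?A cs t Z = undefined" if "Z \<notin> Ops ?O cs t" for Z cs t
    using that by (simp add: rep_to_alg_def)
  show "Str ?A [t] t (Unt ?O t) = RUnit M (Car ?A t)" if t: "t \<in> Colors ?O" for t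
  proof -
    have t: "t \<in> Obj D" using t by (simp add: orth_operad_simps)
    have "Unt (cat_operad D) t \<in> Ops (cat_operad D) [t] t"
      using t by (simp add: D.Id_hom permutes_id)
    then show ?thesis using t s_Unt by (simp only: orth_operad_simps rep_to_alg_Str Car)
  qed
  show "Str ?A (permute_list \<sigma> cs) t (Act ?O cs t \<sigma> Z) = Str ?A cs t Z \<cdot> tens_perm M \<sigma> (map (Car ?A) cs)"
    if Z: "Z \<in> Ops ?O cs t" and \<sigma>: "\<sigma> permutes {..<length cs}" for Z cs t \<sigma>
  proof -
    obtain x where x: "x \<in> Ops (cat_operad D) cs t" "Z = op_class D orth cs t x"
      using Z unfolding orth_operad_simps by blast
    then show ?thesis using \<sigma> Ops_cs[OF x(1)]
      by (simp add: orth_operad_Act rep_to_alg_Str cat_operad_Act s_Act map_Car)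
  qed
  show "Str ?A (concat css) t (Gam ?O ts t css Z Ys) \<cdot> tens_concat M (map (map (Car ?A)) css) =
      Str ?A ts t Z \<cdot> tens_arr M (map (\<lambda>i. Str ?A (css ! i) (ts ! i) (Ys ! i)) [0..<length ts])"
    if Z: "Z \<in> Ops ?O ts t" and Ys: "composable ?O ts css Ys" for Z ts t css Ys
  proof -
    obtain x where x: "x \<in> Ops (cat_operad D) ts t" "Z = op_class D orth ts t x"
      using Z unfolding orth_operad_simps by blast
    have "\<forall>i<length ts. \<exists>y. y \<in> Ops (cat_operad D) (css ! i) (ts ! i) \<and> Ys ! i = op_class D orth (css ! i) (ts ! i) y"
      using Ys unfolding composable_def orth_operad_simps by blast
    then obtain y where y: "\<And>i. i < length ts \<Longrightarrow> y i \<in> Ops (cat_operad D) (css ! i) (ts ! i)"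
       "\<And>i. i < length ts \<Longrightarrow> Ys ! i = op_class D orth (css ! i) (ts ! i) (y i)" by metis
    let ?ys = "map y [0..<length ts]"
    have len: "length css = length ts" "length Ys = length ts" using Ys by (auto simp: composable_def)
    have c: "composable (cat_operad D) ts css ?ys" using y len by (simp add: composable_def)
    have G: "Gam ?O ts t css Z Ys = op_class D orth (concat css) t (Gam (cat_operad D) ts t css x ?ys)"
      unfolding x(2) by (rule orth_operad_Gam) (use x(1) len y in auto)
    have g: "Gam (cat_operad D) ts t css x ?ys \<in> Ops (cat_operad D) (concat css) t"
      by (rule cat_operad_Gam[OF D.category_axioms]) (use x(1) len y in auto)
    have "\<forall>i<length css. set (css ! i) \<subseteq> Obj D" using y(1) Ops_cs(1) len by metis
    then have m: "map (map (Car ?A)) css = map (map X) css"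
      by (auto simp: in_set_conv_nth intro!: map_cong map_Car) (metis nth_mem subsetD Car)
    have "map (\<lambda>i. Str ?A (css ! i) (ts ! i) (Ys ! i)) [0..<length ts] =
      map (\<lambda>i. s (css ! i) (ts ! i) (?ys ! i)) [0..<length ts]"
      using y by (auto simp: rep_to_alg_Str)
    moreover have "Str ?A ts t Z = s ts t x" by (simp only: x(2) rep_to_alg_Str[OF x(1)])
    ultimately show ?thesis
      using s_Gam[OF x(1) c] by (simp only: G rep_to_alg_Str[OF g] m)
  qed
qed

end

lemma rep_algebra_alg_rep:
  assumes "operad_algebra (orth_operad D orth) M A" "symmetric_monoidal_category M" "category D"
  shows "rep_algebra M D orth (Car A) (alg_rep D orth A)"
proof -
  interpret A: operad_algebra "orth_operad D orth" M A by fact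
  interpret M: symmetric_monoidal_category M by fact
  interpret D: category D by fact
  have cl: "op_class D orth cs t x \<in> Ops (orth_operad D orth) cs t" if "x \<in> Ops (cat_operad D) cs t" for x cs t
    using that by (simp add: orth_operad_simps)
  show ?thesis
  proof
    show "Car A t \<in> Obj M" if "t \<in> Obj D" for t using A.Car_Obj that by (simp add: orth_operad_simps)
    show "alg_rep D orth A cs t x \<in> hom M (tens M (map (Car A) cs)) (Car A t)"
      if "x \<in> Ops (cat_operad D) cs t" for x cs t
      using A.Str_hom[OF cl[OF that]] by (simp add: alg_rep_def)
    show "alg_rep D orth A [t] t (Unt (cat_operad D) t) = RUnit M (Car A t)" if "t \<in> Obj D" for t
      using A.Str_Unt[of t] that unfolding alg_rep_def orth_operad_simps by blast
    show "alg_rep D orth A (permute_list \<sigma> cs) t (Act (cat_operad D) cs t \<sigma> x) =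
       alg_rep D orth A cs t x \<cdot>\<^bsub>M\<^esub> tens_perm M \<sigma> (map (Car A) cs)"
      if "x \<in> Ops (cat_operad D) cs t" "\<sigma> permutes {..<length cs}" for x cs t \<sigma>
      using A.Str_Act[OF cl[OF that(1)] that(2)] by (simp add: alg_rep_def orth_operad_Act[OF that])
    show "alg_rep D orth A (concat css) t (Gam (cat_operad D) ts t css x ys) \<cdot>\<^bsub>M\<^esub> tens_concat M
      (map (map (Car A)) css) =
      alg_rep D orth A ts t x \<cdot>\<^bsub>M\<^esub> tens_arr M (map (\<lambda>i. alg_rep D orth A (css ! i) (ts ! i) (ys ! i)) [0..<length ts])"
      if x: "x \<in> Ops (cat_operad D) ts t" and ys: "composable (cat_operad D) ts css ys" for x ts t css ys
    proof -
      let ?Ys = "map (\<lambda>i. op_class D orth (css ! i) (ts ! i) (ys ! i)) [0..<length ts]"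
      have c: "composable (orth_operad D orth) ts css ?Ys"
        using ys cl by (simp add: composable_def)
      have G: "Gam (orth_operad D orth) ts t css (op_class D orth ts t x) ?Ys =
          op_class D orth (concat css) t (Gam (cat_operad D) ts t css x ys)"
        by (rule orth_operad_Gam) (use x ys in \<open>auto simp: composable_def\<close>)
      have "map (\<lambda>i. Str A (css ! i) (ts ! i) (?Ys ! i)) [0..<length ts] =
          map (\<lambda>i. alg_rep D orth A (css ! i) (ts ! i) (ys ! i)) [0..<length ts]"
        by (simp add: alg_rep_def)
      then show ?thesis using A.Str_Gam[OF cl[OF x] c] by (simp only: G alg_rep_def)
    qed
    show "alg_rep D orth A cs t x = alg_rep D orth A cs t y"
      if "orth_rel D orth cs t x y" "x \<in> Ops (cat_operad D) cs t" "y \<in> Ops (cat_operad D) cs t" for cs t x y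
      using op_class_eq[of D orth cs t x y] that by (simp add: alg_rep_def orth_cong_def op_cong.base)
  qed
qed

lemma rep_to_alg_cong:
  assumes "\<And>t. t \<in> Obj D \<Longrightarrow> X t = Y t" "\<And>cs t x. x \<in> Ops (cat_operad D) cs t \<Longrightarrow> s cs t x = s' cs t x" "category D"
  shows "rep_to_alg D orth X s = rep_to_alg D orth Y s'"
proof -
  have "s cs t (SOME x. x \<in> Z) = s' cs t (SOME x. x \<in> Z)" if Z: "Z \<in> Ops (orth_operad D orth) cs t" for Z cs t
  proof -
    obtain x where x: "x \<in> Ops (cat_operad D) cs t" "Z = op_class D orth cs t x"
      using Z unfolding orth_operad_simps by blast
    then have "(SOME x. x \<in> Z) \<in> Z" using op_class_self by (metis someI)
    then have "(SOME x. x \<in> Z) \<in> Ops (cat_operad D) cs t"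
      using orth_cong_Ops[OF assms(3)] unfolding x(2) by (auto simp: op_class_def)
    then show ?thesis by (rule assms(2))
  qed
  then show ?thesis using assms(1) by (auto simp: rep_to_alg_def fun_eq_iff restrict_def)
qed

text \<open>The same algebra comes back, not merely an isomorphic one, because algebras are
  extensional. The strict equality between an algebra and the restriction of its extension rests on
  this.\<close>

lemma rep_to_alg_alg_rep:
  assumes "operad_algebra (orth_operad D orth) M A" "category D"
  shows "rep_to_alg D orth (Car A) (alg_rep D orth A) = A"
proof -
  interpret A: operad_algebra "orth_operad D orth" M A by fact
  have "alg_rep D orth A cs t (SOME x. x \<in> Z) = Str A cs t Z" if Z: "Z \<in> Ops (orth_operad D orth) cs t" for Z cs t
  proof -
    obtain x where x: "x \<in> Ops (cat_operad D) cs t" "Z = op_class D orth cs t x"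
      using Z unfolding orth_operad_simps by blast
    then have "(SOME x. x \<in> Z) \<in> Z" using op_class_self by (metis someI)
    then have "orth_cong D orth cs t x (SOME x. x \<in> Z)"
      by (simp only: x(2) op_class_def mem_Collect_eq)
    then have "op_class D orth cs t x = op_class D orth cs t (SOME x. x \<in> Z)"
      by (rule op_class_eq)
    then have "op_class D orth cs t (SOME x. x \<in> Z) = Z"
      by (simp only: x(2)[symmetric])
    then show ?thesis by (simp add: alg_rep_def)
  qed
  then have "Str (rep_to_alg D orth (Car A) (alg_rep D orth A)) = Str A"
    using A.Str_extensional by (auto simp: rep_to_alg_def fun_eq_iff restrict_def)
  moreover have "Car (rep_to_alg D orth (Car A) (alg_rep D orth A)) = Car A"
    using A.Car_extensional by (simp add: rep_to_alg_def orth_operad_simps extensional_restrict)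
  ultimately show ?thesis by simp
qed

lemma alg_hom_orth_operad:
  "alg_hom (orth_operad D orth) M A B h \<longleftrightarrow> h \<in> extensional (Obj D) \<and>
     (\<forall>t \<in> Obj D. h t \<in> hom M (Car A t) (Car B t)) \<and>
     (\<forall>cs t. \<forall>x \<in> Ops (cat_operad D) cs t.
        h t \<cdot>\<^bsub>M\<^esub> alg_rep D orth A cs t x = alg_rep D orth B cs t x \<cdot>\<^bsub>M\<^esub> tens_arr M (map h cs))"
  by (simp add: alg_hom_def orth_operad_simps alg_rep_def)

section \<open>Monoids and iterated multiplication\<close>

primrec prod_arr :: "('o, 'm, 'z) smc_scheme \<Rightarrow> 'm \<Rightarrow> 'm \<Rightarrow> 'm list \<Rightarrow> 'm" where
  "prod_arr M m u [] = u"
| "prod_arr M m u (g # gs) = m \<cdot>\<^bsub>M\<^esub> (g \<boxtimes>\<^bsub>M\<^esub> prod_arr M m u gs)"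

locale monoid_object = symmetric_monoidal_category M
  for M :: "('o, 'm, 'z) smc_scheme" (structure) +
  fixes x :: 'o and m u :: 'm
  assumes x_Obj [simp]: "x \<in> Obj M"
    and m_hom: "m \<in> hom M (x \<otimes> x) x"
    and u_hom: "u \<in> hom M I x"
    and mult_assoc: "m \<cdot> (m \<boxtimes> Id M x) = m \<cdot> ((Id M x \<boxtimes> m) \<cdot> Assoc M x x x)"
    and unit_left: "m \<cdot> (u \<boxtimes> Id M x) = LUnit M x"
    and unit_right: "m \<cdot> (Id M x \<boxtimes> u) = RUnit M x"
begin

lemma m_u_typ [simp]: "m \<in> Arr M" "Dom M m = x \<otimes> x" "Cod M m = x" "u \<in> Arr M" "Dom M u = I" "Cod M u = x"
  using m_hom u_hom by (auto simp: hom_def)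

lemma unit_left': "f \<in> Arr M \<Longrightarrow> Cod M f = x \<Longrightarrow> m \<cdot> (u \<boxtimes> f) = f \<cdot> LUnit M (Dom M f)"
  using reassoc[OF unit_left, of "Id M I \<boxtimes> f"] by (simp add: LUnit_nat')

lemma unit_right': "f \<in> Arr M \<Longrightarrow> Cod M f = x \<Longrightarrow> m \<cdot> (f \<boxtimes> u) = f \<cdot> RUnit M (Dom M f)"
  using reassoc[OF unit_right, of "f \<boxtimes> Id M I"] by (simp add: RUnit_nat')

lemma mult_assoc':
  assumes "f \<in> Arr M" "Cod M f = x" "g \<in> Arr M" "Cod M g = x" "h \<in> Arr M" "Cod M h = x"
  shows "m \<cdot> ((m \<cdot> (f \<boxtimes> g)) \<boxtimes> h) = m \<cdot> ((f \<boxtimes> (m \<cdot> (g \<boxtimes> h))) \<cdot> Assoc M (Dom M f) (Dom M g) (Dom M h))"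
proof -
  have "m \<cdot> ((m \<cdot> (f \<boxtimes> g)) \<boxtimes> h) = (m \<cdot> (m \<boxtimes> Id M x)) \<cdot> ((f \<boxtimes> g) \<boxtimes> h)"
    using assms by simp
  also have "\<dots> = m \<cdot> ((Id M x \<boxtimes> m) \<cdot> (Assoc M x x x \<cdot> ((f \<boxtimes> g) \<boxtimes> h)))"
    using assms by (simp add: mult_assoc)
  also have "\<dots> = m \<cdot> ((f \<boxtimes> (m \<cdot> (g \<boxtimes> h))) \<cdot> Assoc M (Dom M f) (Dom M g) (Dom M h))"
    using assms by (simp add: Assoc_nat')
  finally show ?thesis .
qed

abbreviation "pr \<equiv> prod_arr M m u"

definition "into gs \<longleftrightarrow> (\<forall>g \<in> set gs. g \<in> Arr M \<and> Cod M g = x)"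

lemma into_simps [simp]: "into []" "into (g # gs) \<longleftrightarrow> g \<in> Arr M \<and> Cod M g = x \<and> into gs"
  "into (gs @ hs) \<longleftrightarrow> into gs \<and> into hs"
  by (auto simp: into_def)

lemma into_Obj [simp]: "into gs \<Longrightarrow> Dom M ` set gs \<subseteq> Obj M"
  by (auto simp: into_def)

lemma prod_arr_typ [simp]:
  assumes "into gs"
  shows "pr gs \<in> Arr M" "Dom M (pr gs) = tobj (map (Dom M) gs) I" "Cod M (pr gs) = x"
  using assms by (induction gs) auto

text \<open>Associativity moves the factors of \<open>gs\<close> out one by one, and
  \<open>append_arr\<close> collects the associators; the empty list is the left unit law.\<close>

lemma prod_arr_append:
  "into gs \<Longrightarrow> into hs \<Longrightarrow>
    m \<cdot> (pr gs \<boxtimes> pr hs) = pr (gs @ hs) \<cdot> append_arr (map (Dom M) gs) (tobj (map (Dom M) hs) I)"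
proof (induction gs)
  case (Cons g gs)
  have "m \<cdot> (pr (g # gs) \<boxtimes> pr hs) =
    m \<cdot> ((g \<boxtimes> (m \<cdot> (pr gs \<boxtimes> pr hs))) \<cdot> Assoc M (Dom M g) (tobj (map (Dom M) gs) I) (tobj (map (Dom M) hs) I))"
    using Cons.prems by (simp add: mult_assoc')
  also have "\<dots> = m \<cdot> ((g \<boxtimes> (pr (gs @ hs) \<cdot> append_arr (map (Dom M) gs) (tobj (map (Dom M) hs) I))) \<cdot>
      Assoc M (Dom M g) (tobj (map (Dom M) gs) I) (tobj (map (Dom M) hs) I))"
    using Cons by simp
  also have "\<dots> = pr ((g # gs) @ hs) \<cdot> append_arr (map (Dom M) (g # gs)) (tobj (map (Dom M) hs) I)"
    using Cons.prems by simp
  finally show ?case .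
qed (simp add: unit_left')

text \<open>Generalized associativity: the recursion of \<open>tens_concat\<close> is matched by one
  use of \<open>prod_arr_append\<close> per block.\<close>

lemma prod_arr_concat:
  "\<forall>gs \<in> set Gs. into gs \<Longrightarrow> pr (map pr Gs) = pr (concat Gs) \<cdot> tens_concat M (map (map (Dom M)) Gs)"
proof (induction Gs)
  case (Cons gs Gs)
  have i: "into gs" "into (concat Gs)" "\<forall>gs \<in> set Gs. into gs" using Cons.prems by (auto simp: into_def)
  then have "\<forall>as \<in> set (map (map (Dom M)) Gs). set as \<subseteq> Obj M" by simp
  note tc = tens_concat_typ[OF this]
  have [simp]: "tens_concat M (map (map (Dom M)) Gs) \<in> Arr M"
    "Cod M (tens_concat M (map (map (Dom M)) Gs)) = tobj (map (Dom M) (concat Gs)) I"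
    using tc is_iso_Arr by (auto simp: map_concat)
  have [simp]: "tobj (map (Dom M) (concat Gs)) I \<in> Obj M"
    using into_Obj[OF i(2)] by (intro tobj_Obj) simp_all
  have "pr (map pr (gs # Gs)) = m \<cdot> (pr gs \<boxtimes> (pr (concat Gs) \<cdot> tens_concat M (map (map (Dom M)) Gs)))"
    using Cons.IH i by simp
  also have "\<dots> = (m \<cdot> (pr gs \<boxtimes> pr (concat Gs))) \<cdot> (Id M (tobj (map (Dom M) gs) I) \<boxtimes> tens_concat M
    (map (map (Dom M)) Gs))"
    using i by simp
  also have "\<dots> = pr (concat (gs # Gs)) \<cdot> tens_concat M (map (map (Dom M)) (gs # Gs))"
    using i by (simp add: prod_arr_append tens_concat_Cons map_concat[symmetric] del: tens_concat.simps)
  finally show ?case .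
qed simp

lemma prod_arr_precomp:
  "\<forall>k \<in> set ks. g k \<in> Arr M \<and> h k \<in> Arr M \<and> Cod M (g k) = x \<and> Dom M (g k) = Cod M (h k) \<Longrightarrow>
    pr (map (\<lambda>k. g k \<cdot> h k) ks) = pr (map g ks) \<cdot> tarr (map h ks) (Id M I)"
proof (induction ks)
  case (Cons k ks)
  have i: "into (map g ks)" "h ` set ks \<subseteq> Arr M" using Cons.prems by (auto simp: into_def)
  have "map (Dom M \<circ> g) ks = map (Cod M \<circ> h) ks" using Cons.prems by auto
  then have "tobj (map (Dom M \<circ> g) ks) I = tobj (map (Cod M \<circ> h) ks) I" by (rule arg_cong)
  then show ?case using Cons i by simp
qed simp

lemma prod_arr_hom:
  assumes "monoid_object M x' m' u'" "h \<in> hom M x x'" "h \<cdot> m = m' \<cdot> (h \<boxtimes> h)" "h \<cdot> u = u'" "into gs"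
  shows "h \<cdot> pr gs = prod_arr M m' u' (map ((\<cdot>) h) gs)"
  using assms(5)
proof (induction gs)
  case (Cons g gs)
  interpret m': monoid_object M x' m' u' by fact
  have h [simp]: "h \<in> Arr M" "Dom M h = x" "Cod M h = x'" using assms(2) by (auto simp: hom_def)
  have "h \<cdot> pr (g # gs) = m' \<cdot> ((h \<cdot> g) \<boxtimes> (h \<cdot> pr gs))"
    using Cons.prems reassoc[OF assms(3)] by simp
  then show ?case using Cons by simp
qed (use assms in simp)

end

section \<open>Orthogonal monoid functors\<close>

locale monoid_functor = symmetric_monoidal_category M + D: orthogonal_category D orth
  for M :: "('o, 'm, 'z) smc_scheme" (structure) and D :: "('c, 'a) cat" and orth +
  fixes X :: "'c \<Rightarrow> 'o" and F :: "'a \<Rightarrow> 'm" and mu un :: "'c \<Rightarrow> 'm"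
  assumes mon: "t \<in> Obj D \<Longrightarrow> monoid_object M (X t) (mu t) (un t)"
    and F_hom: "f \<in> Arr D \<Longrightarrow> F f \<in> hom M (X (Dom D f)) (X (Cod D f))"
    and F_Id: "t \<in> Obj D \<Longrightarrow> F (Id D t) = Id M (X t)"
    and F_Comp: "f \<in> Arr D \<Longrightarrow> g \<in> Arr D \<Longrightarrow> Dom D g = Cod D f \<Longrightarrow> F (g \<cdot>\<^bsub>D\<^esub> f) = F g \<cdot> F f"
    and F_mu: "f \<in> Arr D \<Longrightarrow> F f \<cdot> mu (Dom D f) = mu (Cod D f) \<cdot> (F f \<boxtimes> F f)"
    and F_un: "f \<in> Arr D \<Longrightarrow> F f \<cdot> un (Dom D f) = un (Cod D f)"
    and F_orth: "(f, g) \<in> orth \<Longrightarrow> mu (Cod D f) \<cdot> (F f \<boxtimes> F g) =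
      mu (Cod D f) \<cdot> ((F g \<boxtimes> F f) \<cdot> Sym M (X (Dom D f)) (X (Dom D g)))"
begin

lemma F_typ [simp]: "f \<in> Arr D \<Longrightarrow> F f \<in> Arr M" "f \<in> Arr D \<Longrightarrow> Dom M (F f) = X (Dom D f)"
    "f \<in> Arr D \<Longrightarrow> Cod M (F f) = X (Cod D f)"
  using F_hom[of f] by (auto simp: hom_def)

lemma X_Obj [simp]: "t \<in> Obj D \<Longrightarrow> X t \<in> Obj M"
  by (rule monoid_object.x_Obj[OF mon])

text \<open>The value \<open>I\<close> beyond the list makes the family object-valued at every
  position, as the lemmas on rearrangements require.\<close>

definition fam :: "'c list \<Rightarrow> nat \<Rightarrow> 'o" where
  "fam cs i = (if i < length cs then X (cs ! i) else I)"

text \<open>Sorting the inputs before multiplying keeps the product free of permutations: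
  equivariance becomes a statement about rearrangements alone, and composition splits into
  rearrangements and associativity.\<close>

definition str :: "'c list \<Rightarrow> 'c \<Rightarrow> (nat \<Rightarrow> nat) \<times> 'a list \<Rightarrow> 'm" where
  "str cs t p = prod_arr M (mu t) (un t) (map (\<lambda>i. F (snd p ! i)) (positions (fst p) (length cs))) \<cdot>
     perm_arr (fam cs) [0..<length cs] (positions (fst p) (length cs)) I"

lemma fam_Obj [simp]: "set cs \<subseteq> Obj D \<Longrightarrow> fam cs i \<in> Obj M"
  by (auto simp: fam_def intro!: X_Obj)

lemma map_fam [simp]: "map (fam cs) [0..<length cs] = map X cs"
  by (rule nth_equalityI) (auto simp: fam_def)

lemma Ops_into:
  assumes "(\<sigma>, fs) \<in> Ops (cat_operad D) cs t"
  shows "monoid_object.into M (X t) (map (\<lambda>i. F (fs ! i)) (positions \<sigma> (length cs)))"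
    and "Dom M (prod_arr M (mu t) (un t) (map (\<lambda>i. F (fs ! i)) (positions \<sigma> (length cs)))) =
      tobj (map (fam cs) (positions \<sigma> (length cs))) I"
proof -
  have "t \<in> Obj D" using assms by simp
  then interpret m: monoid_object M "X t" "mu t" "un t" by (rule mon)
  have "fs ! i \<in> hom D (cs ! i) t" "\<sigma> permutes {..<length cs}" if "i < length cs" for i using assms that by auto
  then have i: "m.into (map (\<lambda>i. F (fs ! i)) (positions \<sigma> (length cs)))"
    and "map (\<lambda>i. Dom M (F (fs ! i))) (positions \<sigma> (length cs)) = map (fam cs) (positions \<sigma> (length cs))"
    using assms by (auto simp: m.into_def hom_def fam_def)
  then show "Dom M (m.pr (map (\<lambda>i. F (fs ! i)) (positions \<sigma> (length cs)))) =
    tobj (map (fam cs) (positions \<sigma> (length cs))) I"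
    by (simp only: m.prod_arr_typ[OF i] map_map comp_def)
  show "m.into (map (\<lambda>i. F (fs ! i)) (positions \<sigma> (length cs)))" by (rule i)
qed

lemma str_hom:
  assumes "p \<in> Ops (cat_operad D) cs t"
  shows "str cs t p \<in> hom M (tobj (map X cs) I) (X t)"
proof -
  obtain \<sigma> fs where p: "p = (\<sigma>, fs)" by (cases p)
  have t: "t \<in> Obj D" and \<sigma>: "\<sigma> permutes {..<length cs}" and cs: "set cs \<subseteq> Obj D" using assms by (auto simp: p)
  interpret m: monoid_object M "X t" "mu t" "un t" using t by (rule mon)
  note i = Ops_into[OF assms[unfolded p]]
  have "\<And>i. fam cs i \<in> Obj M" using cs by simp
  note [simp] = perm_arr_simps[of "fam cs", OF this]
  show ?thesis using i \<sigma> by (simp add: p str_def hom_def)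
qed

lemma str_typ [simp]:
  assumes "p \<in> Ops (cat_operad D) cs t"
  shows "str cs t p \<in> Arr M" "Dom M (str cs t p) = tobj (map X cs) I" "Cod M (str cs t p) = X t"
  using str_hom[OF assms] by (auto simp: hom_def)

text \<open>The reading order of \<open>\<sigma> \<circ> \<tau>\<close> is that of
  \<open>\<sigma>\<close> renamed by \<open>inv \<tau>\<close>. After renaming positions by
  \<open>\<tau>\<close>, both sides multiply the same list, and \<open>perm_arr_trans\<close> splits
  off the symmetry for \<open>\<tau>\<close>.\<close>

lemma str_Act:
  assumes p: "p \<in> Ops (cat_operad D) cs t" and \<tau>: "\<tau> permutes {..<length cs}"
  shows "str (permute_list \<tau> cs) t (Act (cat_operad D) cs t \<tau> p) = str cs t p \<cdot> tens_perm M \<tau> (map X cs)"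
proof -
  obtain \<sigma> fs where p': "p = (\<sigma>, fs)" by (cases p)
  let ?n = "length cs" and ?pos = "positions \<sigma> (length cs)"
  have t: "t \<in> Obj D" and \<sigma>: "\<sigma> permutes {..<?n}" and cs: "set cs \<subseteq> Obj D" and len: "length fs = ?n"
    using p by (auto simp: p')
  interpret m: monoid_object M "X t" "mu t" "un t" using t by (rule mon)
  note i = Ops_into[OF p[unfolded p']]
  have a: "\<And>i. fam cs i \<in> Obj M" using cs by simp
  note [simp] = perm_arr_simps[of "fam cs", OF a]
  have lt: "\<tau> i < ?n" if "i < ?n" for i using permutes_in_image[OF \<tau>, of i] that by simp
  have lt': "inv \<tau> i < ?n" if "i < ?n" for i using permutes_in_image[OF permutes_inv[OF \<tau>], of i] that by simp
  have pos: "positions (\<sigma> \<circ> \<tau>) ?n = map (inv \<tau>) ?pos"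
    using permutes_bij[OF \<sigma>] permutes_bij[OF \<tau>] by (simp add: positions_def o_inv_distrib)
  have ms: "mset (map (inv \<tau>) ?pos) = mset [0..<?n]"
    unfolding pos[symmetric] by (rule mset_positions[OF permutes_compose[OF \<tau> \<sigma>]])
  have ms': "mset (map \<tau> [0..<?n]) = mset [0..<?n]"
    using mset_positions[OF permutes_inv[OF \<tau>]] by (simp add: positions_def permutes_inv_inv[OF \<tau>])
  have "perm_arr (fam (permute_list \<tau> cs)) [0..<?n] (map (inv \<tau>) ?pos) I =
      perm_arr (fam cs \<circ> \<tau>) [0..<?n] (map (inv \<tau>) ?pos) I"
    using \<sigma> \<tau> lt lt' ms by (intro perm_arr_cong) (auto simp: fam_def permute_list_nth)
  also have "\<dots> = perm_arr (fam cs) (map \<tau> [0..<?n]) (map \<tau> (map (inv \<tau>) ?pos)) I"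
    using ms by (intro perm_arr_relabel[symmetric]) (auto intro: permutes_inj_on[OF \<tau>])
  also have "map \<tau> (map (inv \<tau>) ?pos) = ?pos"
    using permutes_inverses(1)[OF \<tau>] by (simp add: comp_def)
  also have "perm_arr (fam cs) (map \<tau> [0..<?n]) ?pos I =
      perm_arr (fam cs) [0..<?n] ?pos I \<cdot> perm_arr (fam cs) (map \<tau> [0..<?n]) [0..<?n] I"
    by (rule perm_arr_trans[OF a, symmetric]) (use \<sigma> ms' in auto)
  also have "perm_arr (fam cs) (map \<tau> [0..<?n]) [0..<?n] I = tens_perm M \<tau> (map X cs)"
    unfolding tens_perm_def tens_rearrange_eq length_map
    by (rule perm_arr_cong[OF ms']) (auto simp: fam_def)
  finally have perm: "perm_arr (fam (permute_list \<tau> cs)) [0..<?n] (map (inv \<tau>) ?pos) I =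
     perm_arr (fam cs) [0..<?n] ?pos I \<cdot> tens_perm M \<tau> (map X cs)" .
  have tp: "tens_perm M \<tau> (map X cs) = perm_arr (fam cs) (map \<tau> [0..<?n]) [0..<?n] I"
    unfolding tens_perm_def tens_rearrange_eq length_map
    by (rule perm_arr_cong[OF ms']) (auto simp: fam_def)
  have m': "map (\<lambda>i. F (permute_list \<tau> fs ! i)) (map (inv \<tau>) ?pos) = map (\<lambda>i. F (fs ! i)) ?pos"
    using \<sigma> \<tau> lt' len by (auto simp: permute_list_nth permutes_inverses)
  then show ?thesis
    unfolding p' cat_operad_simps str_def length_permute_list fst_conv snd_conv pos perm m'
    using i ms' \<sigma> by (simp add: tp)
qed

lemma prod_arr_singleton:
  assumes "t \<in> Obj D" "f \<in> Arr M" "Cod M f = X t"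
  shows "mu t \<cdot> (f \<boxtimes> un t) = f \<cdot> RUnit M (Dom M f)"
proof -
  interpret m: monoid_object M "X t" "mu t" "un t" using assms(1) by (rule mon)
  show ?thesis using assms by (intro m.unit_right')
qed

lemma str_Unt:
  assumes [simp]: "t \<in> Obj D"
  shows "str [t] t (Unt (cat_operad D) t) = RUnit M (X t)"
proof -
  interpret m: monoid_object M "X t" "mu t" "un t" by (rule mon) simp
  have "positions id (Suc 0) = [0]" by (simp add: positions_def)
  moreover have "perm_arr (fam [t]) [0] [0] I = Id M (X t \<otimes> I)" by (simp add: fam_def)
  ultimately show ?thesis by (simp add: str_def F_Id m.unit_right)
qed

text \<open>The reading orders of identity and transposition are \<open>[0, 1]\<close> and
  \<open>[1, 0]\<close>, so the claim is \<open>F_orth\<close> with a \<open>swap\<close> in front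
  of \<open>I\<close> in place of the symmetry; \<open>swap_unit_Sym\<close> translates.\<close>

lemma str_orth:
  assumes "orth_rel D orth cs t p p'"
  shows "str cs t p = str cs t p'"
proof -
  obtain f g where fg: "(f, g) \<in> orth" and cs: "cs = [Dom D f, Dom D g]" "t = Cod D f"
    and p: "p = (id, [f, g])" "p' = (Transposition.transpose 0 1, [f, g])"
    using assms unfolding orth_rel_def by blast
  have [simp]: "f \<in> Arr D" "g \<in> Arr D" "Cod D g = Cod D f" using D.orth_Arr[OF fg] by auto
  interpret m: monoid_object M "X t" "mu t" "un t" by (rule mon) (simp add: cs)
  note mt = m.m_u_typ[unfolded cs(2)]
  have pos: "positions id 2 = [0, 1]" "positions (Transposition.transpose 0 1) 2 = [1, 0]"
    by (simp_all add: positions_def upt_rec)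
  have [simp]: "fam cs 0 = X (Dom D f)" "fam cs (Suc 0) = X (Dom D g)" by (simp_all add: fam_def cs)
  have perm: "perm_arr (fam cs) [0, 1] [0, 1] I = Id M (X (Dom D f) \<otimes> (X (Dom D g) \<otimes> I))"
     "perm_arr (fam cs) [0, 1] [1, 0] I = swap (X (Dom D f)) (X (Dom D g)) I"
    by simp_all
  have u: "[0..<2] = [0, 1::nat]" by (simp add: upt_rec)
  have "mu (Cod D f) \<cdot> ((F g \<boxtimes> (F f \<cdot> RUnit M (X (Dom D f)))) \<cdot> swap (X (Dom D f)) (X (Dom D g)) I) =
     (mu (Cod D f) \<cdot> (F g \<boxtimes> F f)) \<cdot> ((Id M (X (Dom D g)) \<boxtimes> RUnit M (X (Dom D f))) \<cdot> swap (X (Dom D f)) (X (Dom D g)) I)"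
    by (simp add: mt)
  also have "\<dots> = (mu (Cod D f) \<cdot> ((F g \<boxtimes> F f) \<cdot> Sym M (X (Dom D f)) (X (Dom D g)))) \<cdot>
    (Id M (X (Dom D f)) \<boxtimes> RUnit M (X (Dom D g)))"
    by (simp add: swap_unit_Sym mt)
  also have "\<dots> = mu (Cod D f) \<cdot> (F f \<boxtimes> (F g \<cdot> RUnit M (X (Dom D g))))"
    unfolding F_orth[OF fg, symmetric] by (simp add: mt)
  finally have *: "mu (Cod D f) \<cdot> ((F g \<boxtimes> (F f \<cdot> RUnit M (X (Dom D f)))) \<cdot> swap (X (Dom D f)) (X (Dom D g)) I) =
     mu (Cod D f) \<cdot> (F f \<boxtimes> (F g \<cdot> RUnit M (X (Dom D g))))" .
  have l: "length cs = 2" by (simp add: cs)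
  show ?thesis
    unfolding str_def p fst_conv snd_conv l pos u perm
    by (simp add: prod_arr_singleton cs(2) mt *)
qed

end

context monoid_functor
begin

text \<open>Both sides are brought to one form: sort all inputs into the global reading order
  \<open>L\<close>, then take a single product. On the right this takes naturality of the outer
  rearrangement, the homomorphism property of each \<open>F (fs ! i)\<close>, generalized
  associativity, and the collapse of outer and inner rearrangements into one.\<close>

lemma str_Gam:
  assumes p: "p \<in> Ops (cat_operad D) ts t" and ys: "composable (cat_operad D) ts css ys"
  shows "str (concat css) t (Gam (cat_operad D) ts t css p ys) \<cdot> tens_concat M (map (map X) css) =
      str ts t p \<cdot> tens_arr M (map (\<lambda>i. str (css ! i) (ts ! i) (ys ! i)) [0..<length ts])"
proof -
  obtain \<sigma> fs where p': "p = (\<sigma>, fs)" by (cases p)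
  define n where "n = length ts"
  define ks where "ks = map length css"
  define pos where "pos = positions \<sigma> n"
  define N where "N = sum_list ks"
  define \<tau> gs where "\<tau> i = fst (ys ! i)" and "gs i = snd (ys ! i)" for i
  define gss where "gss = map2 (\<lambda>f gs. map (\<lambda>g. f \<cdot>\<^bsub>D\<^esub> g) gs) fs (map snd ys)"
  define bp where "bp = block_perm \<sigma> ks (map fst ys)"
  have t: "t \<in> Obj D" and \<sigma>: "\<sigma> permutes {..<n}" and ts: "set ts \<subseteq> Obj D" and lfs: "length fs = n"
    and fs: "\<And>i. i < n \<Longrightarrow> fs ! i \<in> hom D (ts ! i) t"
    using p by (auto simp: p' n_def)
  have len: "length css = n" "length ys = n" "length ks = n" using ys by (auto simp: composable_def n_def ks_def)
  have y: "ys ! i \<in> Ops (cat_operad D) (css ! i) (ts ! i)" if "i < n" for i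
    using ys that by (simp add: composable_def n_def)
  have y': "(\<tau> i, gs i) \<in> Ops (cat_operad D) (css ! i) (ts ! i)" if "i < n" for i
    using y[OF that] by (simp add: \<tau>_def gs_def del: cat_operad_simps)
  have ksi: "ks ! i = length (css ! i)" if "i < n" for i using that len by (simp add: ks_def)
  have \<tau>: "\<tau> i permutes {..<ks ! i}" and lgs: "length (gs i) = ks ! i" and csi: "set (css ! i) \<subseteq> Obj D"
    and tsi: "ts ! i \<in> Obj D" and gsi: "\<And>r. r < ks ! i \<Longrightarrow> gs i ! r \<in> hom D (css ! i ! r) (ts ! i)" if "i < n" for i
    using y'[OF that] ksi[OF that] by simp_all
  have css: "set (concat css) \<subseteq> Obj D"
    using csi len by (auto simp: in_set_conv_nth) (metis nth_mem subsetD)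
  interpret m: monoid_object M "X t" "mu t" "un t" using t by (rule mon)

  \<comment> \<open>Positions are numbered through all blocks consecutively; \<open>a\<close> gives
    the object at each of them.\<close>
  define a where "a = fam (concat css)"
  have a: "\<And>i. a i \<in> Obj M" using css by (simp add: a_def)
  note [simp] = a image_a_Obj[of a, OF a] perm_arr_simps[of a, OF a] concat_arr_simps(1,3)[of a, OF a]
  have lcss: "length (concat css) = N" by (simp add: N_def ks_def length_concat)
  have a_off: "a (offset ks i + r) = X (css ! i ! r)" if "i < n" "r < ks ! i" for i r
    using offset_less[of i ks r] nth_concat_offset[of i css r] that len lcss ksi[OF that(1)]
    by (simp add: a_def fam_def N_def flip: ks_def)
  define G where "G q = F (concat gss ! q)" for q
  have lgss: "map length gss = ks" "length gss = n"
    using len lfs lgs by (auto simp: gss_def ks_def gs_def intro!: nth_equalityI)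
  have G_off: "G (offset ks i + r) = F (fs ! i) \<cdot> F (gs i ! r)" if "i < n" "r < ks ! i" for i r
  proof -
    have "gss ! i = map (\<lambda>g. fs ! i \<cdot>\<^bsub>D\<^esub> g) (gs i)"
      using that len lfs by (simp add: gss_def gs_def)
    then have "concat gss ! (offset ks i + r) = fs ! i \<cdot>\<^bsub>D\<^esub> gs i ! r"
      using nth_concat_offset[of i gss r] that lgss lgs by simp
    then show ?thesis using fs[of i] gsi[of i r] that by (auto simp: G_def hom_def intro!: F_Comp)
  qed

  \<comment> \<open>The global positions of block \<open>i\<close>, in the given order and, for
    \<open>blk'\<close>, in the block's own reading order; both are empty out of range so that the
    families are total.\<close>
  define blk where "blk i = (if i < n then map ((+) (offset ks i)) [0..<ks ! i] else [])" for i
  define blk' where "blk' i = (if i < n then map ((+) (offset ks i)) (positions (\<tau> i) (ks ! i)) else [])" for i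
  define L where "L = concat (map blk' pos)"
  have blk_mset: "mset (blk i) = mset (blk' i)" for i
    using mset_positions[OF \<tau>] by (auto simp: blk_def blk'_def)
  have map_a: "map a (blk i) = map X (css ! i)" if "i < n" for i
    using that a_off ksi by (auto simp: blk_def intro!: nth_equalityI)
  have pos_set: "i \<in> set pos \<longleftrightarrow> i < n" for i using \<sigma> by (simp add: pos_def)
  have pos_mset: "mset [0..<n] = mset pos" using \<sigma> by (simp add: pos_def)
  have cblk: "concat (map blk [0..<n]) = [0..<N]"
  proof -
    have "map blk [0..<n] = map (\<lambda>i. map ((+) (offset ks i)) [0..<ks ! i]) [0..<length ks]"
      by (simp add: blk_def len)
    then show ?thesis by (simp only: concat_offset N_def)
  qed
  have bp_pos: "positions bp N = L"
    and bp_perm: "bp permutes {..<N}"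
    using block_perm_positions[of \<sigma> ks "map fst ys"] \<sigma> \<tau> len
    by (auto simp: bp_def N_def L_def pos_def \<tau>_def blk'_def intro!: arg_cong[where f=concat])
  have ms_blk: "mset (concat (map blk [0..<n])) = mset (concat (map blk pos))"
    by (rule mset_concat_cong[OF a HOL.refl pos_mset])
  have ms_L: "mset (concat (map blk pos)) = mset L"
    unfolding L_def by (rule mset_concat_cong[OF a blk_mset HOL.refl])
  have dist: "distinct (concat (map blk pos))"
    using mset_eq_imp_distinct_iff[OF ms_blk] cblk by simp

  define b where "b i = tobj (map a (blk i)) I" for i
  have [simp]: "b i \<in> Obj M" for i by (simp add: b_def)
  have [simp]: "Dom M (concat_arr a blk is) = tobj (map b is) I"
      "Dom M (concat_arr a blk' is) = tobj (map (\<lambda>i. tobj (map a (blk' i)) I) is) I" for "is"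
    by (simp_all add: concat_arr_simps[of a, OF a] b_def[abs_def])
  \<comment> \<open>The inner operations as a family indexed by blocks, padded by the identity of
    \<open>I\<close>; \<open>\<Phi>\<close> below sorts the inputs inside a block.\<close>
  define h where "h i = (if i < n then str (css ! i) (ts ! i) (ys ! i) else Id M I)" for i
  define \<Phi> where "\<Phi> i = perm_arr a (blk i) (blk' i) I" for i
  have \<Phi>: "\<Phi> i \<in> Arr M" "Dom M (\<Phi> i) = b i" "Cod M (\<Phi> i) = tobj (map a (blk' i)) I" for i
    using blk_mset by (simp_all add: \<Phi>_def b_def)
  have h: "h i \<in> Arr M" "Dom M (h i) = b i" "Cod M (h i) = fam ts i" for i
    using y map_a by (auto simp: h_def b_def fam_def blk_def n_def)
  have G_into: "m.into (map G (blk' i))" if "i < n" for i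
  proof -
    have "set (positions (\<tau> i) (ks ! i)) = {..<ks ! i}" using \<tau>[OF that] by simp
    then show ?thesis using that fs[OF that] gsi[OF that] G_off by (auto simp: m.into_def blk'_def hom_def)
  qed
  have G_Dom: "map (Dom M) (map G (blk' i)) = map a (blk' i)" if "i < n" for i
  proof -
    have "set (positions (\<tau> i) (ks ! i)) = {..<ks ! i}" using \<tau>[OF that] by simp
    then show ?thesis using that fs[OF that] gsi[OF that] G_off a_off by (auto simp: blk'_def hom_def)
  qed
  \<comment> \<open>Pushing \<open>F (fs ! i)\<close> through the product of the inner operation
    gives the product of the images of the composite arrows, in the block's reading order.\<close>
  have Fh: "F (fs ! i) \<cdot> h i = m.pr (map G (blk' i)) \<cdot> \<Phi> i" if i: "i < n" for i
  proof -
    let ?q = "positions (\<tau> i) (ks ! i)"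
    have q: "set ?q = {..<ks ! i}" "mset [0..<ks ! i] = mset ?q" using \<tau>[OF i] by simp_all
    interpret mi: monoid_object M "X (ts ! i)" "mu (ts ! i)" "un (ts ! i)" using tsi[OF i] by (rule mon)
    have "perm_arr (fam (css ! i)) [0..<ks ! i] ?q I = perm_arr (a \<circ> (+) (offset ks i)) [0..<ks ! i] ?q I"
      using q i ksi by (intro perm_arr_cong) (auto simp: fam_def a_off)
    also have "\<dots> = perm_arr a (map ((+) (offset ks i)) [0..<ks ! i]) (map ((+) (offset ks i)) ?q) I"
      using q by (intro perm_arr_relabel[symmetric]) (auto simp: inj_on_def)
    also have "\<dots> = \<Phi> i" using i by (simp add: \<Phi>_def blk_def blk'_def)
    finally have hi: "h i = mi.pr (map (\<lambda>r. F (gs i ! r)) ?q) \<cdot> \<Phi> i"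
      using i ksi by (simp add: h_def str_def gs_def \<tau>_def)
    have into: "mi.into (map (\<lambda>r. F (gs i ! r)) ?q)"
      using q gsi[OF i] by (auto simp: mi.into_def hom_def)
    have dom: "map (Dom M) (map (\<lambda>r. F (gs i ! r)) ?q) = map a (blk' i)"
      using q gsi[OF i] i by (auto simp: blk'_def a_off hom_def)
    have f: "fs ! i \<in> Arr D" "Dom D (fs ! i) = ts ! i" "Cod D (fs ! i) = t" using fs[OF i] by (auto simp: hom_def)
    have "F (fs ! i) \<cdot> h i = (F (fs ! i) \<cdot> mi.pr (map (\<lambda>r. F (gs i ! r)) ?q)) \<cdot> \<Phi> i"
      using f \<Phi>[of i] into dom unfolding hi by (simp del: map_map)
    also have "F (fs ! i) \<cdot> mi.pr (map (\<lambda>r. F (gs i ! r)) ?q) = m.pr (map ((\<cdot>) (F (fs ! i))) (map (\<lambda>r.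
      F (gs i ! r)) ?q))"
      by (rule mi.prod_arr_hom[OF m.monoid_object_axioms _ _ _ into]) (use f F_mu[of "fs ! i"] F_un[of "fs ! i"]
        in \<open>auto simp: hom_def\<close>)
    also have "map ((\<cdot>) (F (fs ! i))) (map (\<lambda>r. F (gs i ! r)) ?q) = map G (blk' i)"
      using q i by (auto simp: blk'_def G_off)
    finally show ?thesis .
  qed

  let ?P = "perm_arr b [0..<n] pos I"
  have P [simp]: "?P \<in> Arr M" "Dom M ?P = tobj (map b [0..<n]) I" "Cod M ?P = tobj (map b pos) I"
    using perm_arr_simps[of b "[0..<n]" pos I] pos_mset by simp_all
  have h_image: "h ` S \<subseteq> Arr M" "\<Phi> ` S \<subseteq> Arr M" for S using h \<Phi> by auto
  have h_comp: "Dom M \<circ> h = b" "Cod M \<circ> h = fam ts" "Dom M \<circ> \<Phi> = b" "Cod M \<circ> \<Phi> = (\<lambda>i. tobj (map a (blk' i)) I)"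
    using h \<Phi> by auto
  note i = Ops_into[OF p[unfolded p'], folded n_def, folded pos_def]
  have fam_ts: "fam ts i \<in> Obj M" for i using ts by simp
  have "map (\<lambda>i. str (css ! i) (ts ! i) (ys ! i)) [0..<length ts] = map h [0..<n]"
    by (auto simp: h_def n_def)
  then have "str ts t p \<cdot> tens_arr M (map (\<lambda>i. str (css ! i) (ts ! i) (ys ! i)) [0..<length ts]) =
      str ts t p \<cdot> tarr (map h [0..<n]) (Id M I)"
    by (simp only: tens_arr_tarr)
  also have "\<dots> = m.pr (map (\<lambda>i. F (fs ! i)) pos) \<cdot> (perm_arr (fam ts) [0..<n] pos I \<cdot> tarr (map h [0..<n]) (Id M I))"
    using i pos_mset by (simp add: str_def p' n_def[symmetric] pos_def[symmetric] h_image h_comp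
      perm_arr_simps[of "fam ts", OF fam_ts] del: mset_upt)
  \<comment> \<open>Naturality lets the outer rearrangement act first, on the blocks as
    wholes.\<close>
  also have "perm_arr (fam ts) [0..<n] pos I \<cdot> tarr (map h [0..<n]) (Id M I) = tarr (map h pos) (Id M I) \<cdot> ?P"
    by (rule perm_arr_nat) (use h pos_mset in simp_all)
  also have "m.pr (map (\<lambda>i. F (fs ! i)) pos) \<cdot> (tarr (map h pos) (Id M I) \<cdot> ?P) =
     (m.pr (map (\<lambda>i. F (fs ! i)) pos) \<cdot> tarr (map h pos) (Id M I)) \<cdot> ?P"
    using i by (simp add: h_image h_comp)
  also have "m.pr (map (\<lambda>i. F (fs ! i)) pos) \<cdot> tarr (map h pos) (Id M I) = m.pr (map (\<lambda>i. F (fs ! i) \<cdot> h i) pos)"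
    using pos_set fs h by (intro m.prod_arr_precomp[symmetric]) (auto simp: hom_def fam_def n_def)
  also have "map (\<lambda>i. F (fs ! i) \<cdot> h i) pos = map (\<lambda>i. m.pr (map G (blk' i)) \<cdot> \<Phi> i) pos"
    using Fh pos_set by auto
  also have "m.pr (map (\<lambda>i. m.pr (map G (blk' i)) \<cdot> \<Phi> i) pos) =
     m.pr (map (\<lambda>i. m.pr (map G (blk' i))) pos) \<cdot> tarr (map \<Phi> pos) (Id M I)"
    using pos_set G_into \<Phi> G_Dom by (intro m.prod_arr_precomp) (auto simp del: map_map)
  also have "map (\<lambda>i. m.pr (map G (blk' i))) pos = map m.pr (map (\<lambda>i. map G (blk' i)) pos)"
    by simp
  also have "m.pr (map m.pr (map (\<lambda>i. map G (blk' i)) pos)) =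
     m.pr (map G L) \<cdot> tens_concat M (map (map (Dom M)) (map (\<lambda>i. map G (blk' i)) pos))"
    using G_into pos_set by (subst m.prod_arr_concat) (auto simp: L_def map_concat comp_def)
  also have "map (map (Dom M)) (map (\<lambda>i. map G (blk' i)) pos) = map (\<lambda>i. map a (blk' i)) pos"
    using G_Dom pos_set by simp
  also have "tens_concat M (map (\<lambda>i. map a (blk' i)) pos) = concat_arr a blk' pos"
    by (rule tens_concat_eq[OF a])
  finally have R: "str ts t p \<cdot> tens_arr M (map (\<lambda>i. str (css ! i) (ts ! i) (ys ! i)) [0..<length ts]) =
     ((m.pr (map G L) \<cdot> concat_arr a blk' pos) \<cdot> tarr (map \<Phi> pos) (Id M I)) \<cdot> ?P" .
  have L_into: "m.into (map G L)" using G_into pos_set by (auto simp: L_def m.into_def)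
  have L_Dom: "Dom M (m.pr (map G L)) = tobj (map a L) I"
  proof -
    have "map (Dom M) (map G L) = map a L"
      using G_Dom pos_set by (auto simp: L_def)
    then show ?thesis using m.prod_arr_typ(2)[OF L_into] by (simp only:)
  qed
  \<comment> \<open>What remains concerns the symmetry alone: sorting the blocks and then sorting
    inside each block is one sorting of all factors.\<close>
  have "((m.pr (map G L) \<cdot> concat_arr a blk' pos) \<cdot> tarr (map \<Phi> pos) (Id M I)) \<cdot> ?P =
     m.pr (map G L) \<cdot> ((concat_arr a blk' pos \<cdot> tarr (map \<Phi> pos) (Id M I)) \<cdot> ?P)"
    using L_into L_Dom by (simp add: h_image h_comp L_def)
  also have "concat_arr a blk' pos \<cdot> tarr (map \<Phi> pos) (Id M I) = perm_arr a (concat (map blk pos)) L I \<cdot>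
    concat_arr a blk pos"
    unfolding \<Phi>_def L_def by (rule concat_arr_perm_blocks[OF a blk_mset])
  also have "(perm_arr a (concat (map blk pos)) L I \<cdot> concat_arr a blk pos) \<cdot> ?P =
     perm_arr a (concat (map blk pos)) L I \<cdot> (concat_arr a blk pos \<cdot> ?P)"
    using ms_L by simp
  also have "concat_arr a blk pos \<cdot> ?P = perm_arr a [0..<N] (concat (map blk pos)) I \<cdot> concat_arr a blk [0..<n]"
    using concat_arr_perm[OF a pos_mset dist] by (simp add: b_def[abs_def] cblk)
  also have "perm_arr a (concat (map blk pos)) L I \<cdot> (perm_arr a [0..<N] (concat (map blk pos)) I \<cdot>
    concat_arr a blk [0..<n]) =
     (perm_arr a (concat (map blk pos)) L I \<cdot> perm_arr a [0..<N] (concat (map blk pos)) I) \<cdot> concat_arr a blk [0..<n]"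
    using ms_L ms_blk by (simp add: cblk del: mset_upt mset_concat)
  also have "perm_arr a (concat (map blk pos)) L I \<cdot> perm_arr a [0..<N] (concat (map blk pos)) I =
    perm_arr a [0..<N] L I"
    by (rule perm_arr_trans[OF a]) (use ms_L ms_blk cblk in simp_all)
  finally have R2: "((m.pr (map G L) \<cdot> concat_arr a blk' pos) \<cdot> tarr (map \<Phi> pos) (Id M I)) \<cdot> ?P =
     m.pr (map G L) \<cdot> (perm_arr a [0..<N] L I \<cdot> concat_arr a blk [0..<n])" .
  have tc: "tens_concat M (map (map X) css) = concat_arr a blk [0..<n]"
  proof -
    have "map (map X) css = map (\<lambda>i. map a (blk i)) [0..<n]"
      using map_a len by (auto intro!: nth_equalityI)
    then show ?thesis by (simp only: tens_concat_eq[OF a])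
  qed
  have "Gam (cat_operad D) ts t css p ys = (bp, concat gss)"
    by (simp add: p' bp_def ks_def gss_def)
  then have "str (concat css) t (Gam (cat_operad D) ts t css p ys) = m.pr (map G L) \<cdot> perm_arr a [0..<N] L I"
    by (simp only: str_def fst_conv snd_conv lcss bp_pos a_def[symmetric] G_def[symmetric])
  then show ?thesis
    unfolding R R2 tc using L_into L_Dom ms_L ms_blk by (simp add: cblk del: mset_upt mset_concat)
qed

lemma rep_algebra_str: "rep_algebra M D orth X str"
proof
  show "str cs t p \<in> hom M (tens M (map X cs)) (X t)" if "p \<in> Ops (cat_operad D) cs t" for p cs t
    using str_hom[OF that] by (simp add: tens_tobj)
qed (simp_all add: str_Unt str_Act str_Gam str_orth del: cat_operad_simps)

end

section \<open>The orthogonal monoid functor of an algebra\<close>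

lemma positions_id [simp]: "positions id n = [0..<n]"
  by (simp add: positions_def map_idI)

text \<open>All reading orders involved are trivial, so by \<open>concat_offset\<close> that of the
  block permutation is trivial too, and a permutation is determined by its reading order. Hence
  composites of ordered operations stay ordered.\<close>

lemma block_perm_id:
  assumes "length \<tau>s = length ks" "\<And>i. i < length ks \<Longrightarrow> \<tau>s ! i = id"
  shows "block_perm id ks \<tau>s = id"
proof -
  let ?bp = "block_perm id ks \<tau>s" and ?N = "sum_list ks"
  have \<tau>: "\<tau>s ! i permutes {..<ks ! i}" if "i < length ks" for i
    using assms that by (simp add: permutes_id)
  have p: "?bp permutes {..<?N}"
    by (rule block_perm_positions(1)[OF permutes_id \<tau>])
  have "map (\<lambda>i. map ((+) (offset ks i)) (positions (\<tau>s ! i) (ks ! i))) [0..<length ks] =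
      map (\<lambda>i. map ((+) (offset ks i)) [0..<ks ! i]) [0..<length ks]"
    by (rule map_cong) (auto simp: assms)
  then have pos: "positions ?bp ?N = [0..<?N]"
    by (simp only: block_perm_positions(2)[OF permutes_id \<tau>] positions_id concat_offset)
  have "inv ?bp q = q" if "q < ?N" for q
    using arg_cong[OF pos, of "\<lambda>l. l ! q"] that by (simp add: positions_def)
  moreover have "inv ?bp q = q" if "\<not> q < ?N" for q
    using permutes_inv[OF p] that by (simp add: permutes_def)
  ultimately have "inv ?bp = id" by (auto simp: fun_eq_iff)
  then show ?thesis using permutes_inv_inv[OF p] by simp
qed

locale orth_rep_algebra = rep_algebra M D orth X s + D: orthogonal_category D orth
  for M :: "('o, 'm, 'z) smc_scheme" (structure) and D :: "('c, 'a) cat" and orth :: "('a \<times> 'a) set"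
    and X :: "'c \<Rightarrow> 'o" and s :: "'c list \<Rightarrow> 'c \<Rightarrow> (nat \<Rightarrow> nat) \<times> 'a list \<Rightarrow> 'm"
begin

text \<open>Ordered operations suffice to recover the monoid functor. The input colors are read off
  from the arrows, so that words can be handled without carrying profiles.\<close>

definition ord_act :: "'c \<Rightarrow> 'a list \<Rightarrow> 'm" where
  "ord_act t fs = s (map (Dom D) fs) t (id, fs)"

text \<open>Iterated tensor products end with \<open>I\<close>; here and in \<open>act_mult\<close>
  the inverse unitor makes up for it.\<close>

definition act_arr :: "'a \<Rightarrow> 'm" where
  "act_arr f = ord_act (Cod D f) [f] \<cdot> inv_arr M (RUnit M (X (Dom D f)))"

definition act_mult :: "'c \<Rightarrow> 'm" where
  "act_mult t = ord_act t [Id D t, Id D t] \<cdot> (Id M (X t) \<boxtimes> inv_arr M (RUnit M (X t)))"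

definition act_unit :: "'c \<Rightarrow> 'm" where
  "act_unit t = ord_act t []"

definition arrs_into :: "'c \<Rightarrow> 'a list \<Rightarrow> bool" where
  "arrs_into t fs \<longleftrightarrow> t \<in> Obj D \<and> (\<forall>f \<in> set fs. f \<in> Arr D \<and> Cod D f = t)"

lemma arrs_into_simps [simp]: "arrs_into t [] \<longleftrightarrow> t \<in> Obj D" "arrs_into t (f # fs) \<longleftrightarrow> f \<in> Arr D \<and> Cod D f = t \<and>
  arrs_into t fs"
  "arrs_into t (fs @ gs) \<longleftrightarrow> arrs_into t fs \<and> arrs_into t gs"
  by (auto simp: arrs_into_def)

lemma arrs_into_Obj: "arrs_into t fs \<Longrightarrow> t \<in> Obj D" by (simp add: arrs_into_def)

lemma arrs_into_Ops: "arrs_into t fs \<Longrightarrow> (id, fs) \<in> Ops (cat_operad D) (map (Dom D) fs) t"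
  by (auto simp: arrs_into_def hom_def permutes_id)

abbreviation tD where "tD fs \<equiv> tobj (map (\<lambda>f. X (Dom D f)) fs) I"

lemma arrs_into_X [simp]: "arrs_into t fs \<Longrightarrow> (\<lambda>f. X (Dom D f)) ` set fs \<subseteq> Obj M"
  by (auto simp: arrs_into_def)

lemma ord_act_typ [simp]:
  assumes "arrs_into t fs"
  shows "ord_act t fs \<in> Arr M" "Dom M (ord_act t fs) = tD fs" "Cod M (ord_act t fs) = X t"
  using s_hom[OF arrs_into_Ops[OF assms]] by (auto simp: ord_act_def hom_def tens_tobj comp_def)

text \<open>The composition law for ordered operations, where \<open>block_perm_id\<close> removes
  the permutation.\<close>

lemma ord_act_Gam:
  assumes gs: "arrs_into t gs" and hss: "list_all2 (\<lambda>g hs. arrs_into (Dom D g) hs) gs hss"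
  shows "ord_act t (concat (map2 (\<lambda>g. map (\<lambda>h. g \<cdot>\<^bsub>D\<^esub> h)) gs hss)) \<cdot> tens_concat M (map (map (\<lambda>h. X (Dom D h))) hss) =
    ord_act t gs \<cdot> tens_arr M (map2 (\<lambda>g. ord_act (Dom D g)) gs hss)"
proof -
  let ?css = "map (map (Dom D)) hss" and ?ys = "map (\<lambda>hs. (id, hs)) hss" and ?ts = "map (Dom D) gs"
  have len: "length hss = length gs" using hss by (simp add: list_all2_lengthD)
  have y: "arrs_into (Dom D (gs ! i)) (hss ! i)" if "i < length gs" for i
    using hss that by (simp add: list_all2_conv_all_nth)
  have c: "composable (cat_operad D) ?ts ?css ?ys"
    unfolding composable_def using len y[THEN arrs_into_Ops] by (simp del: cat_operad_simps)
  have bp: "block_perm id (map length ?css) (map fst ?ys) = id"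
    by (rule block_perm_id) auto
  have G: "Gam (cat_operad D) ?ts t ?css (id, gs) ?ys = (id, concat (map2 (\<lambda>g. map (\<lambda>h. g \<cdot>\<^bsub>D\<^esub> h)) gs hss))"
    unfolding cat_operad_simps bp by (simp add: comp_def)
  have cs: "concat ?css = map (Dom D) (concat (map2 (\<lambda>g. map (\<lambda>h. g \<cdot>\<^bsub>D\<^esub> h)) gs hss))"
    using hss gs by (induction rule: list_all2_induct) (auto simp: arrs_into_def)
  have "map (\<lambda>i. s (?css ! i) (?ts ! i) (?ys ! i)) [0..<length ?ts] = map2 (\<lambda>g. ord_act (Dom D g)) gs hss"
    using len by (auto simp: ord_act_def intro!: nth_equalityI)
  then show ?thesis
    using s_Gam[OF arrs_into_Ops[OF gs] c] unfolding G unfolding ord_act_def cs by (simp add: comp_def)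
qed

lemma ord_act_Id: "t \<in> Obj D \<Longrightarrow> ord_act t [Id D t] = RUnit M (X t)"
  using s_Unt[of t] by (simp add: ord_act_def)

lemma act_arr_typ [simp]:
  assumes "f \<in> Arr D"
  shows "act_arr f \<in> Arr M" "Dom M (act_arr f) = X (Dom D f)" "Cod M (act_arr f) = X (Cod D f)"
  using assms by (simp_all add: act_arr_def)

lemma act_mult_typ [simp]:
  assumes "t \<in> Obj D"
  shows "act_mult t \<in> Arr M" "Dom M (act_mult t) = X t \<otimes> X t" "Cod M (act_mult t) = X t"
  using assms by (simp_all add: act_mult_def)

lemma act_unit_typ [simp]:
  assumes "t \<in> Obj D"
  shows "act_unit t \<in> Arr M" "Dom M (act_unit t) = I" "Cod M (act_unit t) = X t"
  using assms by (simp_all add: act_unit_def)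

lemma ord_act_single: "f \<in> Arr D \<Longrightarrow> ord_act (Cod D f) [f] = act_arr f \<cdot> RUnit M (X (Dom D f))"
  by (simp add: act_arr_def)

text \<open>The composition law with a single outer arrow; \<open>tens_concat\<close> is then a
  right unitor and cancels.\<close>

lemma act_arr_ord_act:
  assumes g: "g \<in> Arr D" and hs: "arrs_into (Dom D g) hs"
  shows "act_arr g \<cdot> ord_act (Dom D g) hs = ord_act (Cod D g) (map (\<lambda>h. g \<cdot>\<^bsub>D\<^esub> h) hs)"
proof (rule iso_epi[of "RUnit M (tD hs)"])
  have m: "tD (map (\<lambda>h. g \<cdot>\<^bsub>D\<^esub> h) hs) = tD hs" "arrs_into (Cod D g) (map (\<lambda>h. g \<cdot>\<^bsub>D\<^esub> h) hs)"
    using g hs by (auto simp: arrs_into_def intro!: arg_cong[where f="\<lambda>l. tobj l I"])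
  have [simp]: "tD hs \<in> Obj M" "set (map (\<lambda>f. X (Dom D f)) hs) \<subseteq> Obj M" using hs by simp_all
  have "ord_act (Cod D g) (map (\<lambda>h. g \<cdot>\<^bsub>D\<^esub> h) hs) \<cdot> RUnit M (tD hs) = ord_act (Cod D g) [g] \<cdot>
    (ord_act (Dom D g) hs \<boxtimes> Id M I)"
    using ord_act_Gam[of "Cod D g" "[g]" "[hs]"] g hs
    by (simp add: tens_append_eq tens_tobj append_arr_unit tens_arr_tarr)
  also have "\<dots> = (act_arr g \<cdot> ord_act (Dom D g) hs) \<cdot> RUnit M (tD hs)"
    using g hs by (simp add: ord_act_single RUnit_nat')
  finally show "(act_arr g \<cdot> ord_act (Dom D g) hs) \<cdot> RUnit M (tD hs) = ord_act (Cod D g) (map (\<lambda>h. g \<cdot>\<^bsub>D\<^esub> h) hs)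
    \<cdot> RUnit M (tD hs)" by simp
  show "Dom M (ord_act (Cod D g) (map (\<lambda>h. g \<cdot>\<^bsub>D\<^esub> h) hs)) = Cod M (RUnit M (tD hs))"
    using ord_act_typ(2)[OF m(2)] m(1) by simp
  show "ord_act (Cod D g) (map (\<lambda>h. g \<cdot>\<^bsub>D\<^esub> h) hs) \<in> Arr M" using ord_act_typ(1)[OF m(2)] .
  show "Dom M (act_arr g \<cdot> ord_act (Dom D g) hs) = Cod M (RUnit M (tD hs))" using g hs by simp
  show "act_arr g \<cdot> ord_act (Dom D g) hs \<in> Arr M" using g hs by simp
qed (use hs in simp)

text \<open>The composition law with outer operation \<open>[Id D t, Id D t]\<close>. The monoid
  laws, the homomorphism property and the commutation of orthogonal arrows are all obtained from it
  with very short lists.\<close>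

lemma act_mult_ord_act:
  assumes hs: "arrs_into t hs" and ks: "arrs_into t ks"
  shows "act_mult t \<cdot> (ord_act t hs \<boxtimes> ord_act t ks) = ord_act t (hs @ ks) \<cdot> append_arr (map (\<lambda>f.
    X (Dom D f)) hs) (tD ks)"
proof -
  have t [simp]: "t \<in> Obj D" using hs by (rule arrs_into_Obj)
  have o [simp]: "tD hs \<in> Obj M" "tD ks \<in> Obj M" using hs ks by simp_all
  have id: "map (\<lambda>h. Id D t \<cdot>\<^bsub>D\<^esub> h) hs = hs" "map (\<lambda>h. Id D t \<cdot>\<^bsub>D\<^esub> h) ks = ks"
    using hs ks by (auto simp: arrs_into_def intro!: map_idI)
  have "ord_act t (hs @ ks) \<cdot> (append_arr (map (\<lambda>f. X (Dom D f)) hs) (tD ks) \<cdot> (Id M (tD hs) \<boxtimes> RUnit M (tD ks))) =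
     ord_act t [Id D t, Id D t] \<cdot> (ord_act t hs \<boxtimes> (ord_act t ks \<boxtimes> Id M I))"
    using ord_act_Gam[of t "[Id D t, Id D t]" "[hs, ks]"] hs ks
    by (simp add: tens_append_eq tens_tobj append_arr_unit tens_arr_tarr id)
  then have "ord_act t (hs @ ks) \<cdot> (append_arr (map (\<lambda>f. X (Dom D f)) hs) (tD ks) \<cdot>
    (Id M (tD hs) \<boxtimes> RUnit M (tD ks))) \<cdot> (Id M (tD hs) \<boxtimes> inv_arr M (RUnit M (tD ks))) =
     (ord_act t [Id D t, Id D t] \<cdot> (ord_act t hs \<boxtimes> (ord_act t ks \<boxtimes> Id M I))) \<cdot> (Id M (tD hs) \<boxtimes> inv_arr M (RUnit
       M (tD ks)))"
    by (rule arg_cong)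
  then have "ord_act t (hs @ ks) \<cdot> append_arr (map (\<lambda>f. X (Dom D f)) hs) (tD ks) =
      ord_act t [Id D t, Id D t] \<cdot> (ord_act t hs \<boxtimes> ((ord_act t ks \<boxtimes> Id M I) \<cdot> inv_arr M (RUnit M (tD ks))))"
    using hs ks by simp
  also have "\<dots> = act_mult t \<cdot> (ord_act t hs \<boxtimes> ord_act t ks)"
    using hs ks by (simp add: act_mult_def RUnit_inv_nat)
  finally show ?thesis by simp
qed

text \<open>The relation identifies \<open>(id, [f, g])\<close> with the transposed operation, which
  also arises from \<open>(id, [g, f])\<close> by permuting its inputs; equivariance then produces
  the symmetry.\<close>

lemma ord_act_swap:
  assumes "(f, g) \<in> orth"
  shows "ord_act (Cod D f) [f, g] = ord_act (Cod D f) [g, f] \<cdot> swap (X (Dom D f)) (X (Dom D g)) I"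
proof -
  let ?\<tau> = "Transposition.transpose (0::nat) 1" and ?t = "Cod D f"
  have fg: "f \<in> Arr D" "g \<in> Arr D" "Cod D g = Cod D f" using D.orth_Arr[OF assms] by auto
  have t2: "{..<2::nat} = {0, 1}" by auto
  have \<tau>: "?\<tau> permutes {..<2}" by (rule permutes_swap_id) auto
  have ops: "(id, [f, g]) \<in> Ops (cat_operad D) [Dom D f, Dom D g] ?t"
    "(id, [g, f]) \<in> Ops (cat_operad D) [Dom D g, Dom D f] ?t"
     "(?\<tau>, [f, g]) \<in> Ops (cat_operad D) [Dom D f, Dom D g] ?t"
    using fg arrs_into_Ops[of ?t "[f, g]"] arrs_into_Ops[of ?t "[g, f]"] \<tau> by (simp_all add: numeral_2_eq_2)
  have "orth_rel D orth [Dom D f, Dom D g] ?t (id, [f, g]) (?\<tau>, [f, g])"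
    unfolding orth_rel_def using assms by blast
  then have "ord_act ?t [f, g] = s [Dom D f, Dom D g] ?t (?\<tau>, [f, g])"
    using s_orth ops by (simp add: ord_act_def del: cat_operad_simps)
  also have "\<dots> = s (permute_list ?\<tau> [Dom D g, Dom D f]) ?t (Act (cat_operad D) [Dom D g, Dom D f] ?t ?\<tau> (id, [g, f]))"
    by (simp add: permute_list_def upt_rec)
  also have "\<dots> = ord_act ?t [g, f] \<cdot> tens_perm M ?\<tau> (map X [Dom D g, Dom D f])"
    using s_Act[OF ops(2), of ?\<tau>] \<tau> by (simp add: ord_act_def numeral_2_eq_2 del: cat_operad_simps)
  also have "tens_perm M ?\<tau> (map X [Dom D g, Dom D f]) = swap (X (Dom D f)) (X (Dom D g)) I"
    unfolding tens_perm_def tens_rearrange_eq using fg by (simp add: upt_rec)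
  finally show ?thesis .
qed

lemma append_single: "a \<in> Obj M \<Longrightarrow> y \<in> Obj M \<Longrightarrow> append_arr [a] y = RUnit M a \<boxtimes> Id M y"
  by (simp add: triangle)

text \<open>For associativity both bracketings equal the ternary operation
  \<open>ord_act t [Id D t, Id D t, Id D t]\<close>; the unit laws insert an empty list. Unitors are
  precomposed because \<open>ord_act t [Id D t]\<close> is the right unitor, not the
  identity.\<close>

lemma monoid_object_act_mult:
  assumes [simp]: "t \<in> Obj D"
  shows "monoid_object M (X t) (act_mult t) (act_unit t)"
proof
  let ?x = "X t" and ?r = "RUnit M (X t)" and ?i = "Id D t"
  show "?x \<in> Obj M" "act_mult t \<in> hom M (?x \<otimes> ?x) ?x" "act_unit t \<in> hom M I ?x"
    by (simp_all add: hom_def)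
  show "act_mult t \<cdot> (act_unit t \<boxtimes> Id M ?x) = LUnit M ?x"
  proof (rule iso_epi[of "Id M I \<boxtimes> ?r"])
    show "(act_mult t \<cdot> (act_unit t \<boxtimes> Id M ?x)) \<cdot> (Id M I \<boxtimes> ?r) = LUnit M ?x \<cdot> (Id M I \<boxtimes> ?r)"
      using act_mult_ord_act[of t "[]" "[?i]"] by (simp add: act_unit_def ord_act_Id LUnit_nat')
  qed simp_all
  show "act_mult t \<cdot> (Id M ?x \<boxtimes> act_unit t) = RUnit M ?x"
  proof (rule iso_epi[of "?r \<boxtimes> Id M I"])
    show "(act_mult t \<cdot> (Id M ?x \<boxtimes> act_unit t)) \<cdot> (?r \<boxtimes> Id M I) = ?r \<cdot> (?r \<boxtimes> Id M I)"
      using act_mult_ord_act[of t "[?i]" "[]"] append_arr_unit[of "[?x]"] by (simp add: act_unit_def ord_act_Id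
        RUnit_nat')
  qed simp_all
  show "act_mult t \<cdot> (act_mult t \<boxtimes> Id M ?x) = act_mult t \<cdot> ((Id M ?x \<boxtimes> act_mult t) \<cdot> Assoc M ?x ?x ?x)"
  proof (rule iso_epi[of "(?r \<boxtimes> ?r) \<boxtimes> ?r"])
    let ?y = "?x \<otimes> I"
    have 1: "act_mult t \<cdot> (?r \<boxtimes> ?r) = ord_act t [?i, ?i] \<cdot> append_arr [?x] ?y"
      using act_mult_ord_act[of t "[?i]" "[?i]"] by (simp add: ord_act_Id)
    have 2: "act_mult t \<cdot> (ord_act t [?i, ?i] \<boxtimes> ?r) = ord_act t [?i, ?i, ?i] \<cdot> append_arr [?x, ?x] ?y"
      using act_mult_ord_act[of t "[?i, ?i]" "[?i]"] by (simp add: ord_act_Id)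
    have 3: "act_mult t \<cdot> (?r \<boxtimes> ord_act t [?i, ?i]) = ord_act t [?i, ?i, ?i] \<cdot> append_arr [?x] (tobj [?x, ?x] I)"
      using act_mult_ord_act[of t "[?i]" "[?i, ?i]"] by (simp add: ord_act_Id)
    have "(act_mult t \<cdot> (act_mult t \<boxtimes> Id M ?x)) \<cdot> ((?r \<boxtimes> ?r) \<boxtimes> ?r) = act_mult t \<cdot> ((act_mult t \<cdot> (?r \<boxtimes> ?r)) \<boxtimes> ?r)"
      by simp
    also have "\<dots> = (act_mult t \<cdot> (ord_act t [?i, ?i] \<boxtimes> ?r)) \<cdot> (append_arr [?x] ?y \<boxtimes> Id M ?y)"
      unfolding 1 by (simp del: append_arr.simps)
    also have "\<dots> = ord_act t [?i, ?i, ?i] \<cdot> (append_arr ([?x] @ [?x]) ?y \<cdot> (append_arr [?x] (tobj [?x] I) \<boxtimes> Id M ?y))"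
      unfolding 2 by (simp del: append_arr.simps)
    also have "\<dots> = ord_act t [?i, ?i, ?i] \<cdot> (append_arr [?x] (tobj [?x] ?y) \<cdot>
      ((Id M (tobj [?x] I) \<boxtimes> append_arr [?x] ?y) \<cdot> Assoc M (tobj [?x] I) (tobj [?x] I) ?y))"
      by (subst append_arr_append) simp_all
    also have "\<dots> = (ord_act t [?i, ?i, ?i] \<cdot> append_arr [?x] (tobj [?x, ?x] I)) \<cdot>
      ((Id M ?y \<boxtimes> append_arr [?x] ?y) \<cdot> Assoc M ?y ?y ?y)"
      by (simp del: append_arr.simps)
    also have "\<dots> = (act_mult t \<cdot> (?r \<boxtimes> (ord_act t [?i, ?i] \<cdot> append_arr [?x] ?y))) \<cdot> Assoc M ?y ?y ?y"
      unfolding 3[symmetric] by (simp del: append_arr.simps)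
    also have "\<dots> = (act_mult t \<cdot> (?r \<boxtimes> (act_mult t \<cdot> (?r \<boxtimes> ?r)))) \<cdot> Assoc M ?y ?y ?y"
      unfolding 1 ..
    also have "\<dots> = (act_mult t \<cdot> ((Id M ?x \<boxtimes> act_mult t) \<cdot> Assoc M ?x ?x ?x)) \<cdot> ((?r \<boxtimes> ?r) \<boxtimes> ?r)"
      by (simp add: Assoc_nat')
    finally show "(act_mult t \<cdot> (act_mult t \<boxtimes> Id M ?x)) \<cdot> ((?r \<boxtimes> ?r) \<boxtimes> ?r) =
       (act_mult t \<cdot> ((Id M ?x \<boxtimes> act_mult t) \<cdot> Assoc M ?x ?x ?x)) \<cdot> ((?r \<boxtimes> ?r) \<boxtimes> ?r)" .
  qed simp_all
qed

sublocale mf: monoid_functor M D orth X act_arr act_mult act_unit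
proof (intro monoid_functor.intro monoid_functor_axioms.intro)
  show "symmetric_monoidal_category M" "orthogonal_category D orth" by unfold_locales
  show "monoid_object M (X t) (act_mult t) (act_unit t)" if "t \<in> Obj D" for t using that
    by (rule monoid_object_act_mult)
  show "act_arr f \<in> hom M (X (Dom D f)) (X (Cod D f))" if "f \<in> Arr D" for f using that by (simp add: hom_def)
  show "act_arr (Id D t) = Id M (X t)" if "t \<in> Obj D" for t using that by (simp add: act_arr_def ord_act_Id)
  show "act_arr (g \<cdot>\<^bsub>D\<^esub> f) = act_arr g \<cdot> act_arr f" if "f \<in> Arr D" "g \<in> Arr D" "Dom D g = Cod D f" for f g
    using that act_arr_ord_act[of g "[f]"] by (simp add: act_arr_def[of "g \<cdot>\<^bsub>D\<^esub> f"] act_arr_def[of f] flip: assoc)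
  show "act_arr f \<cdot> act_unit (Dom D f) = act_unit (Cod D f)" if "f \<in> Arr D" for f
    using that act_arr_ord_act[of f "[]"] by (simp add: act_unit_def)
  show "act_arr f \<cdot> act_mult (Dom D f) = act_mult (Cod D f) \<cdot> (act_arr f \<boxtimes> act_arr f)" if f [simp]: "f \<in> Arr D" for f
  proof (rule iso_epi[of "RUnit M (X (Dom D f)) \<boxtimes> RUnit M (X (Dom D f))"])
    let ?r = "RUnit M (X (Dom D f))" and ?i = "Id D (Dom D f)"
    \<comment> \<open>Both composites come from the ordered operation \<open>[f, f]\<close>.\<close>
    have "(act_arr f \<cdot> act_mult (Dom D f)) \<cdot> (?r \<boxtimes> ?r) = act_arr f \<cdot> (ord_act (Dom D f) [?i, ?i] \<cdot>
      append_arr [X (Dom D f)] (X (Dom D f) \<otimes> I))"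
      using act_mult_ord_act[of "Dom D f" "[?i]" "[?i]"] by (simp add: ord_act_Id)
    also have "\<dots> = (act_arr f \<cdot> ord_act (Dom D f) [?i, ?i]) \<cdot> append_arr [X (Dom D f)] (X (Dom D f) \<otimes> I)"
      by simp
    also have "\<dots> = ord_act (Cod D f) [f, f] \<cdot> append_arr [X (Dom D f)] (X (Dom D f) \<otimes> I)"
      by (subst act_arr_ord_act) simp_all
    also have "\<dots> = (act_mult (Cod D f) \<cdot> (act_arr f \<boxtimes> act_arr f)) \<cdot> (?r \<boxtimes> ?r)"
      using act_mult_ord_act[of "Cod D f" "[f]" "[f]"] by (simp add: ord_act_single)
    finally show "(act_arr f \<cdot> act_mult (Dom D f)) \<cdot> (?r \<boxtimes> ?r) = (act_mult (Cod D f) \<cdot> (act_arr f \<boxtimes> act_arr f))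
      \<cdot> (?r \<boxtimes> ?r)" .
  qed simp_all
  show "act_mult (Cod D f) \<cdot> (act_arr f \<boxtimes> act_arr g) = act_mult (Cod D f) \<cdot> ((act_arr g \<boxtimes> act_arr f) \<cdot>
    Sym M (X (Dom D f)) (X (Dom D g)))"
    if fg: "(f, g) \<in> orth" for f g
  proof (rule iso_epi[of "RUnit M (X (Dom D f)) \<boxtimes> RUnit M (X (Dom D g))"])
    have [simp]: "f \<in> Arr D" "g \<in> Arr D" "Cod D g = Cod D f" using D.orth_Arr[OF fg] by auto
    let ?a = "X (Dom D f)" and ?b = "X (Dom D g)"
    let ?r = "RUnit M ?a" and ?r' = "RUnit M ?b"
    define c where "c k = (if k = (0::nat) then ?a else ?b)" for k
    have c: "c k \<in> Obj M" for k by (simp add: c_def)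
    \<comment> \<open>\<open>Sym_append\<close> for one-element blocks: moved across the
      concatenation, the symmetry becomes the \<open>swap\<close> of
      \<open>ord_act_swap\<close>.\<close>
    have sw: "append_arr [?b] (?a \<otimes> I) \<cdot> Sym M (?a \<otimes> I) (?b \<otimes> I) = swap ?a ?b I \<cdot> append_arr [?a] (?b \<otimes> I)"
      using Sym_append[where a = c and as = "[0]" and bs = "[1]", OF c] by (simp add: c_def del: append_arr.simps)
    have ord_act: "ord_act (Cod D f) [f] = act_arr f \<cdot> ?r" "ord_act (Cod D f) [g] = act_arr g \<cdot> ?r'"
      using ord_act_single[of f] ord_act_single[of g] by simp_all
    have "(act_mult (Cod D f) \<cdot> (act_arr f \<boxtimes> act_arr g)) \<cdot> (?r \<boxtimes> ?r') = ord_act (Cod D f) [f,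
      g] \<cdot> append_arr [?a] (?b \<otimes> I)"
      using act_mult_ord_act[of "Cod D f" "[f]" "[g]"] by (simp add: ord_act del: append_arr.simps)
    also have "\<dots> = (ord_act (Cod D f) [g, f] \<cdot> append_arr [?b] (?a \<otimes> I)) \<cdot> Sym M (?a \<otimes> I) (?b \<otimes> I)"
      using sw by (simp add: ord_act_swap[OF fg] del: append_arr.simps)
    also have "ord_act (Cod D f) [g, f] \<cdot> append_arr [?b] (?a \<otimes> I) = act_mult (Cod D f) \<cdot>
      ((act_arr g \<boxtimes> act_arr f) \<cdot> (?r' \<boxtimes> ?r))"
      using act_mult_ord_act[of "Cod D f" "[g]" "[f]"] by (simp add: ord_act del: append_arr.simps)
    also have "\<dots> \<cdot> Sym M (?a \<otimes> I) (?b \<otimes> I) = act_mult (Cod D f) \<cdot> ((act_arr g \<boxtimes> act_arr f) \<cdot> ((?r' \<boxtimes> ?r) \<cdot>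
      Sym M (?a \<otimes> I) (?b \<otimes> I)))"
      by (simp del: interchange interchange_reassoc)
    also have "(?r' \<boxtimes> ?r) \<cdot> Sym M (?a \<otimes> I) (?b \<otimes> I) = Sym M ?a ?b \<cdot> (?r \<boxtimes> ?r')"
      by (simp add: Sym_nat')
    also have "act_mult (Cod D f) \<cdot> ((act_arr g \<boxtimes> act_arr f) \<cdot> (Sym M ?a ?b \<cdot> (?r \<boxtimes> ?r'))) =
       (act_mult (Cod D f) \<cdot> ((act_arr g \<boxtimes> act_arr f) \<cdot> Sym M ?a ?b)) \<cdot> (?r \<boxtimes> ?r')"
      by simp
    finally show "(act_mult (Cod D f) \<cdot> (act_arr f \<boxtimes> act_arr g)) \<cdot> (?r \<boxtimes> ?r') =
       (act_mult (Cod D f) \<cdot> ((act_arr g \<boxtimes> act_arr f) \<cdot> Sym M ?a ?b)) \<cdot> (?r \<boxtimes> ?r')" .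
  qed (use D.orth_Arr[OF fg] in auto)
qed

text \<open>One letter at a time is split off by \<open>act_mult_ord_act\<close> applied to
  \<open>[f]\<close> and the remaining word.\<close>

lemma ord_act_prod_arr: "arrs_into t fs \<Longrightarrow> ord_act t fs = prod_arr M (act_mult t) (act_unit t) (map act_arr fs)"
proof (induction fs)
  case (Cons f fs)
  have f [simp]: "f \<in> Arr D" "t = Cod D f" "arrs_into (Cod D f) fs" using Cons.prems by auto
  let ?a = "X (Dom D f)"
  have [simp]: "tD fs \<in> Obj M" by (rule tobj_Obj) (use arrs_into_X[OF f(3)] in auto)
  have "ord_act t (f # fs) = act_mult t \<cdot> (act_arr f \<boxtimes> ord_act t fs)"
  proof (rule iso_epi[of "RUnit M ?a \<boxtimes> Id M (tD fs)"])
    show "ord_act t (f # fs) \<cdot> (RUnit M ?a \<boxtimes> Id M (tD fs)) = (act_mult t \<cdot> (act_arr f \<boxtimes> ord_act t fs)) \<cdot>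
      (RUnit M ?a \<boxtimes> Id M (tD fs))"
      using act_mult_ord_act[of "Cod D f" "[f]" fs] by (simp add: ord_act_single append_single del: append_arr.simps)
  qed simp_all
  then show ?case using Cons by simp
qed (simp add: act_unit_def)

text \<open>Every operation is a permutation of the ordered one whose arrows are listed in reading
  order. Equivariance thus determines the structure from ordered operations, and these are products
  by \<open>ord_act_prod_arr\<close>.\<close>

lemma s_str:
  assumes p: "p \<in> Ops (cat_operad D) cs t"
  shows "s cs t p = mf.str cs t p"
proof -
  obtain \<sigma> fs where p': "p = (\<sigma>, fs)" by (cases p)
  let ?n = "length cs" and ?pos = "positions \<sigma> (length cs)"
  have t: "t \<in> Obj D" and \<sigma>: "\<sigma> permutes {..<?n}" and cs: "set cs \<subseteq> Obj D" and len: "length fs = ?n"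
    and fs: "\<And>i. i < ?n \<Longrightarrow> fs ! i \<in> hom D (cs ! i) t"
    using p by (auto simp: p')
  define fs' where "fs' = map ((!) fs) ?pos"
  define cs' where "cs' = map ((!) cs) ?pos"
  have inv: "inv \<sigma> i < ?n" if "i < ?n" for i
    using permutes_in_image[OF permutes_inv[OF \<sigma>], of i] that by simp
  have \<sigma>i: "\<sigma> i < ?n" if "i < ?n" for i
    using permutes_in_image[OF \<sigma>, of i] that by simp
  have perm: "permute_list \<sigma> (map ((!) xs) ?pos) = xs" if "length xs = ?n" for xs :: "'e list"
    using that \<sigma> \<sigma>i by (intro nth_equalityI) (auto simp: permute_list_nth positions_def permutes_inverses)
  have arrs_into: "arrs_into t fs'" using fs t \<sigma> by (auto simp: arrs_into_def fs'_def hom_def)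
  have Dom: "map (Dom D) fs' = cs'" using fs \<sigma> by (auto simp: cs'_def fs'_def hom_def)
  have len': "length cs' = ?n" by (simp add: cs'_def)
  have ops: "(id, fs') \<in> Ops (cat_operad D) cs' t" using arrs_into_Ops[OF arrs_into] by (simp only: Dom)
  have "s cs t p = s (permute_list \<sigma> cs') t (Act (cat_operad D) cs' t \<sigma> (id, fs'))"
    using len by (simp add: p' cs'_def fs'_def perm)
  also have "\<dots> = ord_act t fs' \<cdot> tens_perm M \<sigma> (map X cs')"
    using s_Act[OF ops, of \<sigma>] \<sigma> len' by (simp add: ord_act_def Dom)
  also have "ord_act t fs' = prod_arr M (act_mult t) (act_unit t) (map (\<lambda>i. act_arr (fs ! i)) ?pos)"
    by (simp add: ord_act_prod_arr[OF arrs_into]) (simp add: fs'_def comp_def)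
  also have "tens_perm M \<sigma> (map X cs') = perm_arr (mf.fam cs) [0..<?n] ?pos I"
  proof -
    have ms: "mset (map \<sigma> [0..<?n]) = mset [0..<?n]"
      using mset_positions[OF permutes_inv[OF \<sigma>]] by (simp add: positions_def permutes_inv_inv[OF \<sigma>])
    have "tens_perm M \<sigma> (map X cs') = perm_arr (mf.fam cs \<circ> inv \<sigma>) (map \<sigma> [0..<?n]) [0..<?n] I"
      unfolding tens_perm_def tens_rearrange_eq length_map len'
      by (rule perm_arr_cong[OF ms]) (use inv in \<open>auto simp: mf.fam_def cs'_def positions_def\<close>)
    also have "\<dots> = perm_arr (mf.fam cs) (map (inv \<sigma>) (map \<sigma> [0..<?n])) (map (inv \<sigma>) [0..<?n]) I"
      using ms by (intro perm_arr_relabel[symmetric]) (auto intro: permutes_inj_on[OF permutes_inv[OF \<sigma>]])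
    also have "map (inv \<sigma>) (map \<sigma> [0..<?n]) = [0..<?n]"
      using permutes_inverses(2)[OF \<sigma>] by (simp add: comp_def map_idI)
    finally show ?thesis by (simp add: positions_def)
  qed
  finally show ?thesis by (simp add: mf.str_def p')
qed

end

section \<open>Algebra morphisms as natural families of monoid homomorphisms\<close>

definition mon_nat :: "('o, 'm, 'z) smc_scheme \<Rightarrow> ('c, 'a) cat \<Rightarrow> ('c \<Rightarrow> 'o) \<Rightarrow> ('a \<Rightarrow> 'm) \<Rightarrow> ('c \<Rightarrow> 'm) \<Rightarrow> ('c \<Rightarrow> 'm) \<Rightarrow>
   ('c \<Rightarrow> 'o) \<Rightarrow> ('a \<Rightarrow> 'm) \<Rightarrow> ('c \<Rightarrow> 'm) \<Rightarrow> ('c \<Rightarrow> 'm) \<Rightarrow> ('c \<Rightarrow> 'm) \<Rightarrow> bool" where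
  "mon_nat M D X F mu un X' F' mu' un' h \<longleftrightarrow>
     (\<forall>t \<in> Obj D. h t \<in> hom M (X t) (X' t) \<and> h t \<cdot>\<^bsub>M\<^esub> mu t = mu' t \<cdot>\<^bsub>M\<^esub> (h t \<boxtimes>\<^bsub>M\<^esub> h t) \<and> h t \<cdot>\<^bsub>M\<^esub> un t = un' t) \<and>
     (\<forall>f \<in> Arr D. h (Cod D f) \<cdot>\<^bsub>M\<^esub> F f = F' f \<cdot>\<^bsub>M\<^esub> h (Dom D f))"

text \<open>The homomorphism property carries \<open>h t\<close> through the product, naturality
  carries it past each arrow, and \<open>perm_arr_nat\<close> carries the family across the sorting
  of inputs.\<close>

lemma mon_nat_str:
  assumes "monoid_functor M D orth X F mu un" "monoid_functor M D orth X' F' mu' un'"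
    and h: "mon_nat M D X F mu un X' F' mu' un' h"
    and p: "p \<in> Ops (cat_operad D) cs t"
  shows "h t \<cdot>\<^bsub>M\<^esub> monoid_functor.str M X F mu un cs t p =
    monoid_functor.str M X' F' mu' un' cs t p \<cdot>\<^bsub>M\<^esub> tens_arr M (map h cs)"
proof -
  interpret A: monoid_functor M D orth X F mu un by fact
  interpret B: monoid_functor M D orth X' F' mu' un' by fact
  obtain \<sigma> fs where p': "p = (\<sigma>, fs)" by (cases p)
  let ?n = "length cs" and ?pos = "positions \<sigma> (length cs)"
  have t: "t \<in> Obj D" and \<sigma>: "\<sigma> permutes {..<?n}" and cs: "set cs \<subseteq> Obj D"
    and fs: "\<And>i. i < ?n \<Longrightarrow> fs ! i \<in> hom D (cs ! i) t" using p by (auto simp: p')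
  interpret a: monoid_object M "X t" "mu t" "un t" using t by (rule A.mon)
  interpret b: monoid_object M "X' t" "mu' t" "un' t" using t by (rule B.mon)
  note i = A.Ops_into[OF p[unfolded p']] and i' = B.Ops_into[OF p[unfolded p']]
  have fam: "\<And>i. A.fam cs i \<in> Obj M" "\<And>i. B.fam cs i \<in> Obj M" using cs by simp_all
  note [simp] = A.perm_arr_simps[of "A.fam cs", OF fam(1)] A.perm_arr_simps[of "B.fam cs", OF fam(2)]
  define k where "k i = (if i < ?n then h (cs ! i) else Id M (TUnit M))" for i
  have k: "k i \<in> Arr M" "Dom M (k i) = A.fam cs i" "Cod M (k i) = B.fam cs i" for i
    using h cs by (auto simp: mon_nat_def hom_def k_def A.fam_def B.fam_def subset_eq)
  have ms: "mset [0..<?n] = mset ?pos" using \<sigma> by simp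
  have ht: "h t \<in> Arr M" "Dom M (h t) = X t" "Cod M (h t) = X' t"
    and h_mu: "h t \<cdot>\<^bsub>M\<^esub> mu t = mu' t \<cdot>\<^bsub>M\<^esub> (h t \<boxtimes>\<^bsub>M\<^esub> h t)" "h t \<cdot>\<^bsub>M\<^esub> un t = un' t"
    using h t by (auto simp: mon_nat_def hom_def)
  have Fh: "h t \<cdot>\<^bsub>M\<^esub> F (fs ! j) = F' (fs ! j) \<cdot>\<^bsub>M\<^esub> k j" if "j < ?n" for j
    using h fs[OF that] that by (auto simp: mon_nat_def hom_def k_def)
  have pos_set: "set ?pos = {..<?n}" using \<sigma> by simp
  have "h t \<cdot>\<^bsub>M\<^esub> A.str cs t p = (h t \<cdot>\<^bsub>M\<^esub> a.pr (map (\<lambda>i. F (fs ! i)) ?pos)) \<cdot>\<^bsub>M\<^esub> A.perm_arr (A.fam cs) [0..<?n]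
    ?pos (TUnit M)"
    using i ht ms by (simp add: A.str_def p' del: mset_upt)
  also have "h t \<cdot>\<^bsub>M\<^esub> a.pr (map (\<lambda>i. F (fs ! i)) ?pos) = b.pr (map ((\<cdot>\<^bsub>M\<^esub>) (h t)) (map (\<lambda>i. F (fs ! i)) ?pos))"
    by (rule a.prod_arr_hom[OF b.monoid_object_axioms _ h_mu i(1)]) (use ht in \<open>simp add: hom_def\<close>)
  also have "map ((\<cdot>\<^bsub>M\<^esub>) (h t)) (map (\<lambda>i. F (fs ! i)) ?pos) = map (\<lambda>i. F' (fs ! i) \<cdot>\<^bsub>M\<^esub> k i) ?pos"
    using Fh pos_set by simp
  also have "b.pr (map (\<lambda>i. F' (fs ! i) \<cdot>\<^bsub>M\<^esub> k i) ?pos) = b.pr (map (\<lambda>i. F' (fs ! i)) ?pos) \<cdot>\<^bsub>M\<^esub> A.tarr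
    (map k ?pos) (Id M (TUnit M))"
    using fs k pos_set by (intro b.prod_arr_precomp) (auto simp: hom_def B.fam_def)
  also have "(b.pr (map (\<lambda>i. F' (fs ! i)) ?pos) \<cdot>\<^bsub>M\<^esub> A.tarr (map k ?pos) (Id M (TUnit M))) \<cdot>\<^bsub>M\<^esub> A.perm_arr
    (A.fam cs) [0..<?n] ?pos (TUnit M) =
     b.pr (map (\<lambda>i. F' (fs ! i)) ?pos) \<cdot>\<^bsub>M\<^esub> (A.tarr (map k ?pos) (Id M (TUnit M)) \<cdot>\<^bsub>M\<^esub> A.perm_arr (A.fam cs)
       [0..<?n] ?pos (TUnit M))"
  proof -
    have c: "Dom M \<circ> k = A.fam cs" "Cod M \<circ> k = B.fam cs" "\<And>S. k ` S \<subseteq> Arr M" using k by auto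
    show ?thesis using i' ms by (simp add: c del: mset_upt)
  qed
  also have "A.tarr (map k ?pos) (Id M (TUnit M)) \<cdot>\<^bsub>M\<^esub> A.perm_arr (A.fam cs) [0..<?n] ?pos (TUnit M) =
      A.perm_arr (B.fam cs) [0..<?n] ?pos (TUnit M) \<cdot>\<^bsub>M\<^esub> A.tarr (map k [0..<?n]) (Id M (TUnit M))"
    by (rule A.perm_arr_nat[symmetric]) (use k ms in simp_all)
  also have "map k [0..<?n] = map h cs"
    by (rule nth_equalityI) (auto simp: k_def)
  finally have "h t \<cdot>\<^bsub>M\<^esub> A.str cs t p = b.pr (map (\<lambda>i. F' (fs ! i)) ?pos) \<cdot>\<^bsub>M\<^esub>
     (A.perm_arr (B.fam cs) [0..<?n] ?pos (TUnit M) \<cdot>\<^bsub>M\<^esub> A.tarr (map h cs) (Id M (TUnit M)))" .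
  moreover have "A.tobj (map (Cod M \<circ> h) cs) (TUnit M) = A.tobj (map X' cs) (TUnit M)" "h ` set cs \<subseteq> Arr M"
    using h cs by (auto simp: mon_nat_def hom_def subset_eq intro!: arg_cong[where f="\<lambda>l. A.tobj l (TUnit M)"])
  ultimately show ?thesis
    using i' ms by (simp add: B.str_def p' A.tens_arr_tarr del: mset_upt)
qed

text \<open>Three kinds of test operations suffice: \<open>[f]\<close> for naturality, the empty
  list for the unit, and \<open>[Id D t, Id D t]\<close> for the multiplication.\<close>

lemma mon_natI:
  assumes "monoid_functor M D orth X F mu un" "monoid_functor M D orth X' F' mu' un'"
    and h: "\<And>t. t \<in> Obj D \<Longrightarrow> h t \<in> hom M (X t) (X' t)"
    and str: "\<And>cs t p. p \<in> Ops (cat_operad D) cs t \<Longrightarrow> h t \<cdot>\<^bsub>M\<^esub> monoid_functor.str M X F mu un cs t p =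
      monoid_functor.str M X' F' mu' un' cs t p \<cdot>\<^bsub>M\<^esub> tens_arr M (map h cs)"
  shows "mon_nat M D X F mu un X' F' mu' un' h"
proof -
  interpret A: monoid_functor M D orth X F mu un by fact
  interpret B: monoid_functor M D orth X' F' mu' un' by fact
  have h': "h t \<in> Arr M" "Dom M (h t) = X t" "Cod M (h t) = X' t" if "t \<in> Obj D" for t
    using h[OF that] by (auto simp: hom_def)
  note [simp] = h'
  have "h (Cod D f) \<cdot>\<^bsub>M\<^esub> F f = F' f \<cdot>\<^bsub>M\<^esub> h (Dom D f)" if f [simp]: "f \<in> Arr D" for f
  proof (rule A.iso_epi[of "RUnit M (X (Dom D f))"])
    have p: "(id, [f]) \<in> Ops (cat_operad D) [Dom D f] (Cod D f)"
      by (simp add: hom_def permutes_id)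
    have "A.perm_arr (A.fam [Dom D f]) [0] [0] (TUnit M) = Id M (X (Dom D f) \<otimes>\<^bsub>M\<^esub> TUnit M)"
       "A.perm_arr (B.fam [Dom D f]) [0] [0] (TUnit M) = Id M (X' (Dom D f) \<otimes>\<^bsub>M\<^esub> TUnit M)"
      by (simp_all add: A.fam_def B.fam_def)
    then show "(h (Cod D f) \<cdot>\<^bsub>M\<^esub> F f) \<cdot>\<^bsub>M\<^esub> RUnit M (X (Dom D f)) = (F' f \<cdot>\<^bsub>M\<^esub> h (Dom D f)) \<cdot>\<^bsub>M\<^esub> RUnit M (X (Dom D f))"
      using str[OF p] by (simp add: A.str_def B.str_def A.prod_arr_singleton B.prod_arr_singleton
        A.tens_arr_tarr A.RUnit_nat')
  qed simp_all
  moreover have "h t \<cdot>\<^bsub>M\<^esub> un t = un' t" if t: "t \<in> Obj D" for t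
  proof -
    interpret a: monoid_object M "X t" "mu t" "un t" using t by (rule A.mon)
    interpret b: monoid_object M "X' t" "mu' t" "un' t" using t by (rule B.mon)
    have p: "(id, []) \<in> Ops (cat_operad D) [] t" using t by simp
    show ?thesis using str[OF p] by (simp add: A.str_def B.str_def A.tens_arr_tarr)
  qed
  moreover have "h t \<cdot>\<^bsub>M\<^esub> mu t = mu' t \<cdot>\<^bsub>M\<^esub> (h t \<boxtimes>\<^bsub>M\<^esub> h t)" if t [simp]: "t \<in> Obj D" for t
  proof (rule A.iso_epi[of "Id M (X t) \<boxtimes>\<^bsub>M\<^esub> RUnit M (X t)"])
    interpret a: monoid_object M "X t" "mu t" "un t" using t by (rule A.mon)
    interpret b: monoid_object M "X' t" "mu' t" "un' t" using t by (rule B.mon)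
    let ?i = "Id D t"
    have p: "(id, [?i, ?i]) \<in> Ops (cat_operad D) [t, t] t"
      by (auto simp: hom_def permutes_id less_Suc_eq)
    have u: "[0..<2] = [0, 1::nat]" by (simp add: upt_rec)
    have "A.str [t, t] t (id, [?i, ?i]) = mu t \<cdot>\<^bsub>M\<^esub> (Id M (X t) \<boxtimes>\<^bsub>M\<^esub> RUnit M (X t))"
       "B.str [t, t] t (id, [?i, ?i]) = mu' t \<cdot>\<^bsub>M\<^esub> (Id M (X' t) \<boxtimes>\<^bsub>M\<^esub> RUnit M (X' t))"
      by (simp_all add: A.str_def B.str_def A.F_Id B.F_Id a.unit_right b.unit_right A.fam_def B.fam_def upt_rec)
    then show "(h t \<cdot>\<^bsub>M\<^esub> mu t) \<cdot>\<^bsub>M\<^esub> (Id M (X t) \<boxtimes>\<^bsub>M\<^esub> RUnit M (X t)) =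
       (mu' t \<cdot>\<^bsub>M\<^esub> (h t \<boxtimes>\<^bsub>M\<^esub> h t)) \<cdot>\<^bsub>M\<^esub> (Id M (X t) \<boxtimes>\<^bsub>M\<^esub> RUnit M (X t))"
      using str[OF p] by (simp add: A.tens_arr_tarr A.RUnit_nat')
  qed (use monoid_object.m_u_typ[OF A.mon[OF t]] monoid_object.m_u_typ[OF B.mon[OF t]] in simp_all)
  ultimately show ?thesis using h by (simp add: mon_nat_def)
qed

section \<open>Colimits of graphs\<close>

definition gcocone :: "('o, 'm, 'z) cat_scheme \<Rightarrow> 'v set \<Rightarrow> ('v \<times> 'v \<times> 'm) set \<Rightarrow> ('v \<Rightarrow> 'o) \<Rightarrow> 'o \<Rightarrow> ('v \<Rightarrow> 'm) \<Rightarrow> bool" where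
  "gcocone M V E G Y q \<longleftrightarrow> Y \<in> Obj M \<and> (\<forall>i \<in> V. q i \<in> hom M (G i) Y) \<and> (\<forall>(i, j, \<theta>) \<in> E. q j \<cdot>\<^bsub>M\<^esub> \<theta> = q i)"

text \<open>The diagram is a graph rather than a category: an edge \<open>(i, j, \<theta>)\<close>
  carries its own arrow, and only generating rewriting steps have to be listed.\<close>

definition gcolim :: "('o, 'm, 'z) cat_scheme \<Rightarrow> 'v set \<Rightarrow> ('v \<times> 'v \<times> 'm) set \<Rightarrow> ('v \<Rightarrow> 'o) \<Rightarrow> 'o \<Rightarrow> ('v \<Rightarrow> 'm) \<Rightarrow> bool" where
  "gcolim M V E G L \<iota> \<longleftrightarrow> gcocone M V E G L \<iota> \<and>
     (\<forall>Y q. gcocone M V E G Y q \<longrightarrow> (\<exists>!h. h \<in> hom M L Y \<and> (\<forall>i \<in> V. h \<cdot>\<^bsub>M\<^esub> \<iota> i = q i)))"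

definition wf_graph :: "('o, 'm, 'z) cat_scheme \<Rightarrow> 'v set \<Rightarrow> ('v \<times> 'v \<times> 'm) set \<Rightarrow> ('v \<Rightarrow> 'o) \<Rightarrow> bool" where
  "wf_graph M V E G \<longleftrightarrow> (\<forall>i \<in> V. G i \<in> Obj M) \<and> (\<forall>(i, j, \<theta>) \<in> E. i \<in> V \<and> j \<in> V \<and> \<theta> \<in> hom M (G i) (G j))"

text \<open>The graph is turned into a category by subdividing every edge \<open>i \<rightarrow> j\<close> into a span
  \<open>i \<leftarrow> e \<rightarrow> j\<close>; no two non-identity arrows of the result are composable.\<close>

lemma gcolim_exists:
  fixes code :: "('v + 'k) + ('k + 'k) \<Rightarrow> 'u" and M :: "('o, 'm, 'z) cat_scheme"
    and V :: "'v set" and K :: "'k set"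
  assumes bc: "bicomplete TYPE('u) M" and code: "inj code"
    and wf: "wf_graph M V (e ` K) G"
  shows "\<exists>L \<iota>. gcolim M V (e ` K) G L \<iota>"
proof -
  interpret M: category M using bc by (simp add: bicomplete_def)
  define d where "d = inv code"
  have d [simp]: "d (code x) = x" for x using code by (simp add: d_def)
  have code_eq [simp]: "code x = code y \<longleftrightarrow> x = y" for x y using code by (simp add: inj_eq)
  define src tgt th where "src k = fst (e k)" and "tgt k = fst (snd (e k))" and "th k = snd (snd (e k))" for k
  have e: "e k = (src k, tgt k, th k)" for k by (simp add: src_def tgt_def th_def)
  have wfV: "i \<in> V \<Longrightarrow> G i \<in> Obj M" for i using wf by (auto simp: wf_graph_def)
  have wfK: "src k \<in> V" "tgt k \<in> V" "th k \<in> hom M (G (src k)) (G (tgt k))" if "k \<in> K" for k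
    using wf that by (auto simp: wf_graph_def e)
  let ?v = "\<lambda>v. code (Inl (Inl v))" and ?k = "\<lambda>k. code (Inl (Inr k))"
  \<comment> \<open>Codes: \<open>Inl (Inl v)\<close> is a vertex, \<open>Inl (Inr k)\<close> the
    midpoint of an edge, \<open>Inr (Inl k)\<close> and \<open>Inr (Inr k)\<close> are its legs to
    source and target. Identities are the objects themselves, so composition returns the factor that
    is not an identity.\<close>
  define J :: "('u, 'u) cat" where "J = \<lparr>
    Obj = ?v ` V \<union> ?k ` K,
    Arr = ?v ` V \<union> ?k ` K \<union> (\<lambda>k. code (Inr (Inl k))) ` K \<union> (\<lambda>k. code (Inr (Inr k))) ` K,
    Dom = (\<lambda>x. case d x of Inl _ \<Rightarrow> x | Inr (Inl k) \<Rightarrow> ?k k | Inr (Inr k) \<Rightarrow> ?k k),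
    Cod = (\<lambda>x. case d x of Inl _ \<Rightarrow> x | Inr (Inl k) \<Rightarrow> ?v (src k) | Inr (Inr k) \<Rightarrow> ?v (tgt k)),
    Id = (\<lambda>x. x),
    Comp = (\<lambda>g f. case d g of Inl _ \<Rightarrow> f | Inr _ \<Rightarrow> g)\<rparr>"
  define F :: "('u, 'u, 'o, 'm) func" where "F = \<lparr>
    FObj = (\<lambda>x. case d x of Inl (Inl v) \<Rightarrow> G v | Inl (Inr k) \<Rightarrow> G (src k)),
    FArr = (\<lambda>x. case d x of Inl (Inl v) \<Rightarrow> Id M (G v) | Inl (Inr k) \<Rightarrow> Id M (G (src k))
       | Inr (Inl k) \<Rightarrow> Id M (G (src k)) | Inr (Inr k) \<Rightarrow> th k)\<rparr>"
  have J: "category J"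
    using wfK by unfold_locales (auto simp: J_def hom_def)
  interpret J: category J by (rule J)
  have F: "is_functor J M F"
    unfolding is_functor_def
  proof (intro conjI J M.category_axioms ballI allI)
    show "FObj F a \<in> Obj M" if "a \<in> Obj J" for a
      using that wfV wfK by (auto simp: J_def F_def)
    show "FArr F (Id J a) = Id M (FObj F a)" if "a \<in> Obj J" for a
      using that by (auto simp: J_def F_def)
    show "FArr F f \<in> hom M (FObj F a) (FObj F b)" if "f \<in> hom J a b" for f a b
      using that wfV wfK by (auto simp: J_def F_def hom_def)
    show "FArr F (g \<cdot>\<^bsub>J\<^esub> f) = FArr F g \<cdot>\<^bsub>M\<^esub> FArr F f" if "f \<in> hom J a b" "g \<in> hom J b c" for f g a b c
      using that wfV wfK by (auto simp: J_def F_def hom_def)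
  qed
  then obtain L p where L: "is_colimit J M F L p"
    using bc unfolding bicomplete_def by blast
  \<comment> \<open>At a midpoint a cocone takes its value at the source, because the source leg is
    sent to an identity.\<close>
  define ext where "ext q x = (case d x of Inl (Inl v) \<Rightarrow> q v | Inl (Inr k) \<Rightarrow> q (src k))" for q :: "'v \<Rightarrow> 'm" and x
  have to_cocone: "is_cocone J M F Y (ext q)" if "gcocone M V (e ` K) G Y q" for Y q
  proof -
    have q: "Y \<in> Obj M" "\<And>i. i \<in> V \<Longrightarrow> q i \<in> hom M (G i) Y" "\<And>k. k \<in> K \<Longrightarrow> q (tgt k) \<cdot>\<^bsub>M\<^esub> th k = q (src k)"
      using that by (auto simp: gcocone_def e)
    show ?thesis
      unfolding is_cocone_def
    proof (intro conjI ballI allI)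
      show "ext q i \<in> hom M (FObj F i) Y" if "i \<in> Obj J" for i
        using that q wfK by (auto simp: J_def F_def ext_def)
      show "ext q k \<cdot>\<^bsub>M\<^esub> FArr F u = ext q i" if "u \<in> hom J i k" for u i k
        using that q wfK by (auto simp: J_def F_def ext_def hom_def)
    qed (rule q)
  qed
  have p: "is_cocone J M F L p" using L by (simp add: is_colimit_def)
  have p_v: "p (?v v) \<in> hom M (G v) L" if "v \<in> V" for v
  proof -
    have "?v v \<in> Obj J" using that by (simp add: J_def)
    then have "p (?v v) \<in> hom M (FObj F (?v v)) L" using p unfolding is_cocone_def by blast
    then show ?thesis by (simp add: F_def)
  qed
  have p_k: "p (?k k) = p (?v (src k))" "p (?v (tgt k)) \<cdot>\<^bsub>M\<^esub> th k = p (?v (src k))" if "k \<in> K" for k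
  proof -
    have "code (Inr (Inl k)) \<in> hom J (?k k) (?v (src k))" "code (Inr (Inr k)) \<in> hom J (?k k) (?v (tgt k))"
      using that by (auto simp: J_def hom_def)
    then have "p (?v (src k)) \<cdot>\<^bsub>M\<^esub> FArr F (code (Inr (Inl k))) = p (?k k)"
       "p (?v (tgt k)) \<cdot>\<^bsub>M\<^esub> FArr F (code (Inr (Inr k))) = p (?k k)"
      using p unfolding is_cocone_def by blast+
    moreover have "p (?v (src k)) \<in> hom M (G (src k)) L"
      by (rule p_v[OF wfK(1)[OF that]])
    ultimately show "p (?k k) = p (?v (src k))" "p (?v (tgt k)) \<cdot>\<^bsub>M\<^esub> th k = p (?v (src k))"
      by (auto simp: F_def hom_def)
  qed
  have "gcolim M V (e ` K) G L (\<lambda>v. p (?v v))"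
    unfolding gcolim_def
  proof (intro conjI allI impI)
    show "gcocone M V (e ` K) G L (\<lambda>v. p (?v v))"
      using p p_k(2) p_v by (auto simp: gcocone_def is_cocone_def e)
    fix Y q assume q: "gcocone M V (e ` K) G Y q"
    have eq: "(\<forall>i\<in>Obj J. h \<cdot>\<^bsub>M\<^esub> p i = ext q i) \<longleftrightarrow> (\<forall>i\<in>V. h \<cdot>\<^bsub>M\<^esub> p (?v i) = q i)" for h
      using p_k(1) wfK(1) by (auto simp: J_def ext_def)
    show "\<exists>!h. h \<in> hom M L Y \<and> (\<forall>i\<in>V. h \<cdot>\<^bsub>M\<^esub> p (?v i) = q i)"
      using L to_cocone[OF q] unfolding is_colimit_def eq[symmetric] by blast
  qed
  then show ?thesis by blast
qed

text \<open>Uniqueness of factorizations, separated from existence so that it passes to tensor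
  products of several colimits.\<close>

definition jointly_epi :: "('o, 'm, 'z) cat_scheme \<Rightarrow> 'm set \<Rightarrow> 'o \<Rightarrow> bool" where
  "jointly_epi M S L \<longleftrightarrow> L \<in> Obj M \<and> (\<forall>f \<in> S. f \<in> Arr M \<and> Cod M f = L) \<and>
     (\<forall>Y. \<forall>h \<in> hom M L Y. \<forall>h' \<in> hom M L Y. (\<forall>f \<in> S. h \<cdot>\<^bsub>M\<^esub> f = h' \<cdot>\<^bsub>M\<^esub> f) \<longrightarrow> h = h')"

lemma jointly_epiD:
  assumes "jointly_epi M S L" "h \<in> Arr M" "h' \<in> Arr M" "Dom M h = L" "Dom M h' = L" "Cod M h = Cod M h'"
    "\<And>f. f \<in> S \<Longrightarrow> h \<cdot>\<^bsub>M\<^esub> f = h' \<cdot>\<^bsub>M\<^esub> f"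
  shows "h = h'"
  using assms unfolding jointly_epi_def hom_def by blast

lemma gcolim_jointly_epi:
  assumes "category M" "gcolim M V E G L \<iota>" "wf_graph M V E G"
  shows "jointly_epi M (\<iota> ` V) L"
proof -
  interpret category M by fact
  have c: "gcocone M V E G L \<iota>" using assms by (simp add: gcolim_def)
  have "h = h'" if h: "h \<in> hom M L Y" "h' \<in> hom M L Y" "\<forall>i \<in> V. h \<cdot>\<^bsub>M\<^esub> \<iota> i = h' \<cdot>\<^bsub>M\<^esub> \<iota> i" for Y h h'
  proof -
    have "gcocone M V E G Y (\<lambda>i. h \<cdot>\<^bsub>M\<^esub> \<iota> i)"
      unfolding gcocone_def
    proof (intro conjI ballI, safe)
      show "Y \<in> Obj M" using h by (auto simp: hom_def)
      show "h \<cdot>\<^bsub>M\<^esub> \<iota> i \<in> hom M (G i) Y" if "i \<in> V" for i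
        using h c that by (auto simp: hom_def gcocone_def)
      show "(h \<cdot>\<^bsub>M\<^esub> \<iota> j) \<cdot>\<^bsub>M\<^esub> \<theta> = h \<cdot>\<^bsub>M\<^esub> \<iota> i" if "(i, j, \<theta>) \<in> E" for i j \<theta>
      proof -
        have "\<iota> j \<cdot>\<^bsub>M\<^esub> \<theta> = \<iota> i" using c that by (auto simp: gcocone_def)
        moreover have "\<theta> \<in> hom M (G i) (G j)" "\<iota> j \<in> hom M (G j) L"
          using assms(3) c that by (auto simp: wf_graph_def gcocone_def)
        ultimately show ?thesis using h by (auto simp: hom_def)
      qed
    qed
    then have "\<exists>!k. k \<in> hom M L Y \<and> (\<forall>i \<in> V. k \<cdot>\<^bsub>M\<^esub> \<iota> i = h \<cdot>\<^bsub>M\<^esub> \<iota> i)"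
      using assms(2) by (simp add: gcolim_def)
    then show ?thesis using h by metis
  qed
  then show ?thesis using c by (auto simp: jointly_epi_def gcocone_def hom_def)
qed

context closed_symmetric_monoidal_category
begin

text \<open>Currying turns two arrows on \<open>L \<otimes> z\<close> into two arrows on
  \<open>L\<close>, where the hypothesis applies; uniqueness of curried arrows transfers the tested
  equations.\<close>

lemma jointly_epi_tensor_right:
  assumes S: "jointly_epi M S L" and z [simp]: "z \<in> Obj M"
  shows "jointly_epi M ((\<lambda>f. f \<boxtimes> Id M z) ` S) (L \<otimes> z)"
  unfolding jointly_epi_def
proof (intro conjI ballI allI impI)
  have L [simp]: "L \<in> Obj M" and S': "\<And>f. f \<in> S \<Longrightarrow> f \<in> Arr M \<and> Cod M f = L" using S by (auto simp: jointly_epi_def)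
  show "L \<otimes> z \<in> Obj M" by simp
  show "f \<in> Arr M" "Cod M f = L \<otimes> z" if "f \<in> (\<lambda>f. f \<boxtimes> Id M z) ` S" for f using that S' by auto
  fix Y h h' assume h: "h \<in> hom M (L \<otimes> z) Y" "h' \<in> hom M (L \<otimes> z) Y" and eq: "\<forall>f\<in>(\<lambda>f. f \<boxtimes> Id M z) ` S. h \<cdot> f = h' \<cdot> f"
  have "Y \<in> Obj M" using h by (auto simp: hom_def)
  then obtain e ev where e: "e \<in> Obj M" "ev \<in> hom M (e \<otimes> z) Y"
    and ev: "\<And>a f. a \<in> Obj M \<Longrightarrow> f \<in> hom M (a \<otimes> z) Y \<Longrightarrow> \<exists>!g. g \<in> hom M a e \<and> ev \<cdot> (g \<boxtimes> Id M z) = f"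
    using closed[OF z, of Y] by blast
  obtain k k' where k: "k \<in> hom M L e" "ev \<cdot> (k \<boxtimes> Id M z) = h" and k': "k' \<in> hom M L e" "ev \<cdot> (k' \<boxtimes> Id M z) = h'"
    using ev[OF L h(1)] ev[OF L h(2)] by blast
  have "k \<cdot> f = k' \<cdot> f" if f: "f \<in> S" for f
  proof -
    have 1: "ev \<cdot> ((k \<cdot> f) \<boxtimes> Id M z) = h \<cdot> (f \<boxtimes> Id M z)" "ev \<cdot> ((k' \<cdot> f) \<boxtimes> Id M z) = h' \<cdot> (f \<boxtimes> Id M z)"
      using k k' S'[OF f] e by (auto simp: hom_def)
    have 2: "h \<cdot> (f \<boxtimes> Id M z) \<in> hom M (Dom M f \<otimes> z) Y" "k \<cdot> f \<in> hom M (Dom M f) e" "k' \<cdot> f \<in> hom M (Dom M f) e"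
      using h k k' S'[OF f] by (auto simp: hom_def)
    then show ?thesis using ev[OF _ 2(1)] 1 eq f S'[OF f] by (metis Obj_Dom_Cod(1) imageI)
  qed
  then have "k = k'" using jointly_epiD[OF S, of k k'] k k' by (auto simp: hom_def)
  then show "h = h'" using k k' by simp
qed

text \<open>Transport along an isomorphism \<open>c\<close> of the common target, where each test
  arrow may also be changed by an isomorphism \<open>d\<close> of its domain. It serves to change
  sides of the tensor product by the symmetry.\<close>

lemma jointly_epi_iso:
  assumes S: "jointly_epi M S L" and c: "is_iso M c" "Dom M c = L"
    and S': "\<And>f. f \<in> S' \<Longrightarrow> f \<in> Arr M \<and> Cod M f = Cod M c" "\<And>f. f \<in> S \<Longrightarrow> \<exists>d. d \<in> Arr M \<and> Cod M d = Dom M f \<and>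
      is_iso M d \<and> c \<cdot> (f \<cdot> d) \<in> S'"
  shows "jointly_epi M S' (Cod M c)"
  unfolding jointly_epi_def
proof (intro conjI ballI allI impI)
  have cA: "c \<in> Arr M" using c by (simp add: is_iso_Arr)
  show "Cod M c \<in> Obj M" using cA by simp
  show "f \<in> Arr M" "Cod M f = Cod M c" if "f \<in> S'" for f using S' that by auto
  fix Y h h' assume h: "h \<in> hom M (Cod M c) Y" "h' \<in> hom M (Cod M c) Y" and eq: "\<forall>f\<in>S'. h \<cdot> f = h' \<cdot> f"
  have "h \<cdot> c = h' \<cdot> c"
  proof (rule jointly_epiD[OF S])
    fix f assume f: "f \<in> S"
    then have fA: "f \<in> Arr M" "Cod M f = L" using S by (auto simp: jointly_epi_def)
    obtain d where d: "d \<in> Arr M" "Cod M d = Dom M f" "is_iso M d" "c \<cdot> (f \<cdot> d) \<in> S'" using S'(2)[OF f] by blast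
    have "((h \<cdot> c) \<cdot> f) \<cdot> d = ((h' \<cdot> c) \<cdot> f) \<cdot> d"
      using eq d h cA c fA by (auto simp: hom_def)
    then show "(h \<cdot> c) \<cdot> f = (h' \<cdot> c) \<cdot> f"
      by (rule iso_epi[OF d(3)]) (use h cA c fA d in \<open>auto simp: hom_def\<close>)
  qed (use h cA c in \<open>auto simp: hom_def\<close>)
  then show "h = h'"
    by (rule iso_epi[OF c(1)]) (use h cA in \<open>auto simp: hom_def\<close>)
qed

lemma jointly_epi_tensor_left:
  assumes S: "jointly_epi M S L" and z [simp]: "z \<in> Obj M"
  shows "jointly_epi M ((\<lambda>f. Id M z \<boxtimes> f) ` S) (z \<otimes> L)"
proof -
  have L [simp]: "L \<in> Obj M" and S': "\<And>f. f \<in> S \<Longrightarrow> f \<in> Arr M \<and> Cod M f = L" using S by (auto simp: jointly_epi_def)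
  have "jointly_epi M ((\<lambda>f. Id M z \<boxtimes> f) ` S) (Cod M (Sym M L z))"
  proof (rule jointly_epi_iso[OF jointly_epi_tensor_right[OF S z]])
    fix f' assume "f' \<in> (\<lambda>f. f \<boxtimes> Id M z) ` S"
    then obtain f where f: "f \<in> S" "f' = f \<boxtimes> Id M z" by blast
    have "Sym M L z \<cdot> (f' \<cdot> Sym M z (Dom M f)) = Id M z \<boxtimes> f"
      using S'[OF f(1)] f(2) by (simp add: reassoc[OF Sym_nat'])
    then show "\<exists>d. d \<in> Arr M \<and> Cod M d = Dom M f' \<and> is_iso M d \<and> Sym M L z \<cdot> (f' \<cdot> d) \<in> (\<lambda>f. Id M z \<boxtimes> f) ` S"
      using S'[OF f(1)] f by (intro exI[of _ "Sym M z (Dom M f)"]) auto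
  qed (use S' in auto)
  then show ?thesis by simp
qed

text \<open>One variable at a time, since \<open>f \<boxtimes> g\<close> is \<open>f\<close>
  tensored with an identity after an identity tensored with \<open>g\<close>.\<close>

lemma jointly_epi_tensor:
  assumes S: "jointly_epi M S L" and S': "jointly_epi M S' L'"
  shows "jointly_epi M ((\<lambda>(f, g). f \<boxtimes> g) ` (S \<times> S')) (L \<otimes> L')"
  unfolding jointly_epi_def
proof (intro conjI ballI allI impI)
  have L [simp]: "L \<in> Obj M" "L' \<in> Obj M"
    and SA: "\<And>f. f \<in> S \<Longrightarrow> f \<in> Arr M \<and> Cod M f = L" "\<And>f. f \<in> S' \<Longrightarrow> f \<in> Arr M \<and> Cod M f = L'"
    using S S' by (auto simp: jointly_epi_def)
  show "L \<otimes> L' \<in> Obj M" by simp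
  show "f \<in> Arr M" "Cod M f = L \<otimes> L'" if "f \<in> (\<lambda>(f, g). f \<boxtimes> g) ` (S \<times> S')" for f using that SA by auto
  fix Y h h' assume h: "h \<in> hom M (L \<otimes> L') Y" "h' \<in> hom M (L \<otimes> L') Y"
    and eq: "\<forall>f\<in>(\<lambda>(f, g). f \<boxtimes> g) ` (S \<times> S'). h \<cdot> f = h' \<cdot> f"
  show "h = h'"
  proof (rule jointly_epiD[OF jointly_epi_tensor_right[OF S, of L']])
    fix f' assume "f' \<in> (\<lambda>f. f \<boxtimes> Id M L') ` S"
    then obtain f where f: "f \<in> S" "f' = f \<boxtimes> Id M L'" by blast
    show "h \<cdot> f' = h' \<cdot> f'"
    proof (rule jointly_epiD[OF jointly_epi_tensor_left[OF S', of "Dom M f"]])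
      fix g' assume "g' \<in> (\<lambda>g. Id M (Dom M f) \<boxtimes> g) ` S'"
      then obtain g where g: "g \<in> S'" "g' = Id M (Dom M f) \<boxtimes> g" by blast
      have "h \<cdot> (f \<boxtimes> g) = h' \<cdot> (f \<boxtimes> g)" using eq f g by auto
      then show "(h \<cdot> f') \<cdot> g' = (h' \<cdot> f') \<cdot> g'"
        using SA(1)[OF f(1)] SA(2)[OF g(1)] h f(2) g(2) by (auto simp: hom_def)
    qed (use SA(1)[OF f(1)] h f(2) in \<open>auto simp: hom_def\<close>)
  qed (use h in \<open>auto simp: hom_def\<close>)
qed

text \<open>Tensoring with \<open>z\<close> preserves the colimit: a compatible family on the
  objects \<open>G i \<otimes> z\<close> is curried to a cocone on \<open>G\<close>, factored
  through \<open>L\<close> and uncurried. Uniqueness is left to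
  \<open>jointly_epi_tensor_right\<close>.\<close>

lemma gcolim_tensor_right:
  assumes L: "gcolim M V E G L \<iota>" and wf: "wf_graph M V E G" and z [simp]: "z \<in> Obj M"
    and q: "Y \<in> Obj M" "\<And>i. i \<in> V \<Longrightarrow> q i \<in> hom M (G i \<otimes> z) Y"
      "\<And>i j \<theta>. (i, j, \<theta>) \<in> E \<Longrightarrow> q j \<cdot> (\<theta> \<boxtimes> Id M z) = q i"
  shows "\<exists>h \<in> hom M (L \<otimes> z) Y. \<forall>i \<in> V. h \<cdot> (\<iota> i \<boxtimes> Id M z) = q i"
proof -
  obtain e ev where e: "e \<in> Obj M" "ev \<in> hom M (e \<otimes> z) Y"
    and ev: "\<And>a f. a \<in> Obj M \<Longrightarrow> f \<in> hom M (a \<otimes> z) Y \<Longrightarrow> \<exists>!g. g \<in> hom M a e \<and> ev \<cdot> (g \<boxtimes> Id M z) = f"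
    using closed[OF z q(1)] by blast
  have G: "G i \<in> Obj M" if "i \<in> V" for i using wf that by (auto simp: wf_graph_def)
  have "\<forall>i \<in> V. \<exists>g. g \<in> hom M (G i) e \<and> ev \<cdot> (g \<boxtimes> Id M z) = q i"
    using ev[OF G q(2)] by blast
  then obtain k where k: "\<And>i. i \<in> V \<Longrightarrow> k i \<in> hom M (G i) e" "\<And>i. i \<in> V \<Longrightarrow> ev \<cdot> (k i \<boxtimes> Id M z) = q i" by metis
  have "gcocone M V E G e k"
    unfolding gcocone_def
  proof (intro conjI ballI, safe)
    fix i j \<theta> assume edge: "(i, j, \<theta>) \<in> E"
    then have ij: "i \<in> V" "j \<in> V" "\<theta> \<in> hom M (G i) (G j)" using wf by (auto simp: wf_graph_def)
    have "ev \<cdot> ((k j \<cdot> \<theta>) \<boxtimes> Id M z) = (ev \<cdot> (k j \<boxtimes> Id M z)) \<cdot> (\<theta> \<boxtimes> Id M z)"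
      using k(1)[OF ij(2)] ij(3) e by (auto simp: hom_def)
    also have "\<dots> = q i" using k(2)[OF ij(2)] q(3)[OF edge] by simp
    finally have "ev \<cdot> ((k j \<cdot> \<theta>) \<boxtimes> Id M z) = q i" .
    moreover have "k j \<cdot> \<theta> \<in> hom M (G i) e" using k(1)[OF ij(2)] ij(3) by (auto simp: hom_def)
    ultimately show "k j \<cdot> \<theta> = k i" using ev[OF G[OF ij(1)] q(2)[OF ij(1)]] k[OF ij(1)] by blast
  qed (use e k in auto)
  then obtain h where h: "h \<in> hom M L e" "\<And>i. i \<in> V \<Longrightarrow> h \<cdot> \<iota> i = k i"
    using L unfolding gcolim_def by blast
  have \<iota>: "\<iota> i \<in> hom M (G i) L" if "i \<in> V" for i using L that by (auto simp: gcolim_def gcocone_def)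
  have "(ev \<cdot> (h \<boxtimes> Id M z)) \<cdot> (\<iota> i \<boxtimes> Id M z) = q i" if "i \<in> V" for i
  proof -
    have "(ev \<cdot> (h \<boxtimes> Id M z)) \<cdot> (\<iota> i \<boxtimes> Id M z) = ev \<cdot> ((h \<cdot> \<iota> i) \<boxtimes> Id M z)"
      using h(1) \<iota>[OF that] e by (auto simp: hom_def)
    then show ?thesis using h(2)[OF that] k(2)[OF that] by simp
  qed
  moreover have "ev \<cdot> (h \<boxtimes> Id M z) \<in> hom M (L \<otimes> z) Y" using h e by (auto simp: hom_def)
  ultimately show ?thesis by blast
qed

lemma gcolim_tensor_left:
  assumes L: "gcolim M V E G L \<iota>" and wf: "wf_graph M V E G" and z [simp]: "z \<in> Obj M"
    and q: "Y \<in> Obj M" "\<And>i. i \<in> V \<Longrightarrow> q i \<in> hom M (z \<otimes> G i) Y"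
      "\<And>i j \<theta>. (i, j, \<theta>) \<in> E \<Longrightarrow> q j \<cdot> (Id M z \<boxtimes> \<theta>) = q i"
  shows "\<exists>h \<in> hom M (z \<otimes> L) Y. \<forall>i \<in> V. h \<cdot> (Id M z \<boxtimes> \<iota> i) = q i"
proof -
  have G: "G i \<in> Obj M" if "i \<in> V" for i using wf that by (auto simp: wf_graph_def)
  have \<iota>: "L \<in> Obj M" "\<And>i. i \<in> V \<Longrightarrow> \<iota> i \<in> hom M (G i) L" using L by (auto simp: gcolim_def gcocone_def)
  have "\<exists>h \<in> hom M (L \<otimes> z) Y. \<forall>i \<in> V. h \<cdot> (\<iota> i \<boxtimes> Id M z) = q i \<cdot> Sym M (G i) z"
  proof (rule gcolim_tensor_right[OF L wf z q(1)])
    show "q i \<cdot> Sym M (G i) z \<in> hom M (G i \<otimes> z) Y" if "i \<in> V" for i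
      using q(2)[OF that] G[OF that] by (auto simp: hom_def)
    fix i j \<theta> assume edge: "(i, j, \<theta>) \<in> E"
    then have ij: "i \<in> V" "j \<in> V" "\<theta> \<in> Arr M" "Dom M \<theta> = G i" "Cod M \<theta> = G j" using wf
      by (auto simp: wf_graph_def hom_def)
    have "(q j \<cdot> Sym M (G j) z) \<cdot> (\<theta> \<boxtimes> Id M z) = (q j \<cdot> (Id M z \<boxtimes> \<theta>)) \<cdot> Sym M (G i) z"
      using q(2)[OF ij(2)] ij G by (auto simp: hom_def Sym_nat')
    then show "(q j \<cdot> Sym M (G j) z) \<cdot> (\<theta> \<boxtimes> Id M z) = q i \<cdot> Sym M (G i) z"
      using q(3)[OF edge] by simp
  qed
  then obtain h where h: "h \<in> hom M (L \<otimes> z) Y" "\<And>i. i \<in> V \<Longrightarrow> h \<cdot> (\<iota> i \<boxtimes> Id M z) = q i \<cdot> Sym M (G i) z" by blast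
  have "(h \<cdot> Sym M z L) \<cdot> (Id M z \<boxtimes> \<iota> i) = q i" if i: "i \<in> V" for i
  proof -
    have "(h \<cdot> Sym M z L) \<cdot> (Id M z \<boxtimes> \<iota> i) = (h \<cdot> (\<iota> i \<boxtimes> Id M z)) \<cdot> Sym M z (G i)"
      using h(1) \<iota>(1) \<iota>(2)[OF i] G[OF i] by (auto simp: hom_def Sym_nat')
    also have "\<dots> = q i" using h(2)[OF i] q(2)[OF i] G[OF i] by (auto simp: hom_def)
    finally show ?thesis .
  qed
  moreover have "h \<cdot> Sym M z L \<in> hom M (z \<otimes> L) Y" using h(1) \<iota> by (auto simp: hom_def)
  ultimately show ?thesis by blast
qed

text \<open>Factor in the first variable for each fixed \<open>j\<close>, then in the second.
  Compatibility of the intermediate family with the second graph is tested on the injections of the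
  first colimit tensored with \<open>G' j\<close>, which are jointly epic.\<close>

lemma gcolim_tensor:
  assumes L: "gcolim M V E G L \<iota>" and wf: "wf_graph M V E G"
    and L': "gcolim M V' E' G' L' \<iota>'" and wf': "wf_graph M V' E' G'"
    and Y: "Y \<in> Obj M" and p: "\<And>i j. i \<in> V \<Longrightarrow> j \<in> V' \<Longrightarrow> p i j \<in> hom M (G i \<otimes> G' j) Y"
    and p1: "\<And>i i' \<theta> j. (i, i', \<theta>) \<in> E \<Longrightarrow> j \<in> V' \<Longrightarrow> p i' j \<cdot> (\<theta> \<boxtimes> Id M (G' j)) = p i j"
    and p2: "\<And>i j j' \<theta>. i \<in> V \<Longrightarrow> (j, j', \<theta>) \<in> E' \<Longrightarrow> p i j' \<cdot> (Id M (G i) \<boxtimes> \<theta>) = p i j"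
  shows "\<exists>h \<in> hom M (L \<otimes> L') Y. \<forall>i \<in> V. \<forall>j \<in> V'. h \<cdot> (\<iota> i \<boxtimes> \<iota>' j) = p i j"
proof -
  have G: "\<And>i. i \<in> V \<Longrightarrow> G i \<in> Obj M" "\<And>i. i \<in> V' \<Longrightarrow> G' i \<in> Obj M" using wf wf' by (auto simp: wf_graph_def)
  have \<iota>: "L \<in> Obj M" "\<And>i. i \<in> V \<Longrightarrow> \<iota> i \<in> Arr M \<and> Dom M (\<iota> i) = G i \<and> Cod M (\<iota> i) = L"
    "L' \<in> Obj M" "\<And>i. i \<in> V' \<Longrightarrow> \<iota>' i \<in> Arr M \<and> Dom M (\<iota>' i) = G' i \<and> Cod M (\<iota>' i) = L'"
    using L L' by (auto simp: gcolim_def gcocone_def hom_def)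
  have "\<forall>j \<in> V'. \<exists>h. h \<in> hom M (L \<otimes> G' j) Y \<and> (\<forall>i \<in> V. h \<cdot> (\<iota> i \<boxtimes> Id M (G' j)) = p i j)"
    using gcolim_tensor_right[OF L wf G(2) Y p p1] by blast
  then obtain k where k: "\<And>j. j \<in> V' \<Longrightarrow> k j \<in> hom M (L \<otimes> G' j) Y"
     "\<And>i j. i \<in> V \<Longrightarrow> j \<in> V' \<Longrightarrow> k j \<cdot> (\<iota> i \<boxtimes> Id M (G' j)) = p i j" by metis
  have "\<exists>h \<in> hom M (L \<otimes> L') Y. \<forall>j \<in> V'. h \<cdot> (Id M L \<boxtimes> \<iota>' j) = k j"
  proof (rule gcolim_tensor_left[OF L' wf' \<iota>(1) Y k(1)])
    fix j j' \<theta> assume edge: "(j, j', \<theta>) \<in> E'"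
    then have jj: "j \<in> V'" "j' \<in> V'" "\<theta> \<in> Arr M" "Dom M \<theta> = G' j" "Cod M \<theta> = G' j'"
      using wf' by (auto simp: wf_graph_def hom_def)
    show "k j' \<cdot> (Id M L \<boxtimes> \<theta>) = k j"
    proof (rule jointly_epiD[OF jointly_epi_tensor_right[OF gcolim_jointly_epi[OF category_axioms L wf] G(2)[OF
      jj(1)]]])
      fix f assume "f \<in> (\<lambda>f. f \<boxtimes> Id M (G' j)) ` \<iota> ` V"
      then obtain i where i: "i \<in> V" "f = \<iota> i \<boxtimes> Id M (G' j)" by blast
      have "(k j' \<cdot> (Id M L \<boxtimes> \<theta>)) \<cdot> f = (k j' \<cdot> (\<iota> i \<boxtimes> Id M (G' j'))) \<cdot> (Id M (G i) \<boxtimes> \<theta>)"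
        using k(1)[OF jj(2)] \<iota>(1) \<iota>(2)[OF i(1)] jj G(1)[OF i(1)] G(2) i(2) by (auto simp: hom_def)
      also have "\<dots> = k j \<cdot> f"
        using k(2) p2[OF i(1) edge] jj i by simp
      finally show "(k j' \<cdot> (Id M L \<boxtimes> \<theta>)) \<cdot> f = k j \<cdot> f" .
    qed (use k(1)[OF jj(1)] k(1)[OF jj(2)] jj \<iota> in \<open>auto simp: hom_def\<close>)
  qed
  then obtain h where h: "h \<in> hom M (L \<otimes> L') Y" "\<And>j. j \<in> V' \<Longrightarrow> h \<cdot> (Id M L \<boxtimes> \<iota>' j) = k j" by blast
  have "h \<cdot> (\<iota> i \<boxtimes> \<iota>' j) = p i j" if ij: "i \<in> V" "j \<in> V'" for i j
  proof -
    have "h \<cdot> (\<iota> i \<boxtimes> \<iota>' j) = (h \<cdot> (Id M L \<boxtimes> \<iota>' j)) \<cdot> (\<iota> i \<boxtimes> Id M (G' j))"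
      using h(1) \<iota>(1,3) \<iota>(2)[OF ij(1)] \<iota>(4)[OF ij(2)] G(2)[OF ij(2)] by (auto simp: hom_def)
    also have "\<dots> = p i j" using h(2)[OF ij(2)] k(2)[OF ij] by simp
    finally show ?thesis .
  qed
  with h(1) show ?thesis by blast
qed

end

section \<open>Extending an orthogonal monoid functor along a full subcategory\<close>

locale full_sub = D: orthogonal_category D orth + C: category C
  for D C :: "('c, 'a) cat" and orth :: "('a \<times> 'a) set" +
  assumes full: "full_subcategory C D"
begin

lemma Obj_sub [simp]: "t \<in> Obj C \<Longrightarrow> t \<in> Obj D"
  using full by (auto simp: full_subcategory_def)

lemma full_arr:
  assumes "f \<in> Arr D" "Dom D f \<in> Obj C" "Cod D f \<in> Obj C"
  shows "f \<in> Arr C" "Dom C f = Dom D f" "Cod C f = Cod D f"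
proof -
  have "f \<in> hom D (Dom D f) (Cod D f)" using assms by (simp add: hom_def)
  then have "f \<in> hom C (Dom D f) (Cod D f)" using full assms unfolding full_subcategory_def by blast
  then show "f \<in> Arr C" "Dom C f = Dom D f" "Cod C f = Cod D f" by (auto simp: hom_def)
qed

lemma sub_arr [simp]:
  assumes "f \<in> Arr C"
  shows "f \<in> Arr D" "Dom C f = Dom D f" "Cod C f = Cod D f"
proof -
  have "f \<in> hom C (Dom C f) (Cod C f)" using assms by (simp add: hom_def)
  moreover have "hom C (Dom C f) (Cod C f) = hom D (Dom C f) (Cod C f)"
    using full C.Obj_Dom_Cod[OF assms] unfolding full_subcategory_def by blast
  ultimately have "f \<in> hom D (Dom C f) (Cod C f)" by blast
  then show "f \<in> Arr D" "Dom C f = Dom D f" "Cod C f = Cod D f" by (auto simp: hom_def)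
qed

lemma sub_arr_Obj [simp]: "f \<in> Arr C \<Longrightarrow> Dom D f \<in> Obj C" "f \<in> Arr C \<Longrightarrow> Cod D f \<in> Obj C"
  using C.Obj_Dom_Cod[of f] by auto

lemma sub_Comp:
  assumes "f \<in> Arr C" "g \<in> Arr C" "Dom C g = Cod C f"
  shows "g \<cdot>\<^bsub>D\<^esub> f = g \<cdot>\<^bsub>C\<^esub> f"
proof -
  have "f \<in> hom C (Dom C f) (Cod C f)" "g \<in> hom C (Cod C f) (Cod C g)" using assms by (simp_all add: hom_def)
  then have "g \<cdot>\<^bsub>C\<^esub> f = g \<cdot>\<^bsub>D\<^esub> f" using full unfolding full_subcategory_def by blast
  then show ?thesis by simp
qed

lemma sub_Id: "t \<in> Obj C \<Longrightarrow> cat.Id D t = cat.Id C t"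
  using full by (auto simp: full_subcategory_def)

end

text \<open>Each rule is directed along an arrow of \<open>M\<close>: \<open>RuleAct f g\<close>
  rewrites the composite of \<open>f\<close> and \<open>g\<close> to \<open>f\<close> along
  \<open>F g\<close>, \<open>RuleMult f\<close> merges two letters \<open>f\<close> along the
  multiplication, \<open>RuleUnit f\<close> creates a letter \<open>f\<close> along the unit, and
  \<open>RuleSwap f g\<close> exchanges two letters by the symmetry.\<close>

datatype 'a rule = RuleAct 'a 'a | RuleMult 'a | RuleUnit 'a | RuleSwap 'a 'a

locale extension = closed_symmetric_monoidal_category M + full_sub D C orth +
    A: monoid_functor M C "orth_pullback C embedding orth" X F mu un
  for M :: "('o, 'm, 'z) smc_scheme" (structure) and D C :: "('c, 'a) cat" and orth :: "('a \<times> 'a) set"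
    and X :: "'c \<Rightarrow> 'o" and F :: "'a \<Rightarrow> 'm" and mu un :: "'c \<Rightarrow> 'm"
begin

text \<open>The value \<open>I\<close> outside the domain makes \<open>src_obj\<close> object-valued on all arguments.\<close>

definition src_obj :: "'a \<Rightarrow> 'o" where
  "src_obj f = (if Dom D f \<in> Obj C then X (Dom D f) else I)"

lemma src_obj_Obj [simp]: "src_obj f \<in> Obj M" "src_obj ` S \<subseteq> Obj M"
  by (auto simp: src_obj_def)

abbreviation "srcs \<equiv> map src_obj"

abbreviation "G fs \<equiv> tobj (srcs fs) I"

definition into1 :: "'c \<Rightarrow> 'a \<Rightarrow> bool" where
  "into1 t f \<longleftrightarrow> f \<in> Arr D \<and> Cod D f = t \<and> Dom D f \<in> Obj C"

definition words :: "'c \<Rightarrow> 'a list set" where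
  "words t = {fs. \<forall>f \<in> set fs. into1 t f}"

lemma words_simps [simp]: "[] \<in> words t" "f # fs \<in> words t \<longleftrightarrow> into1 t f \<and> fs \<in> words t"
  "fs @ gs \<in> words t \<longleftrightarrow> fs \<in> words t \<and> gs \<in> words t"
  by (auto simp: words_def)

lemma into1D: "into1 t f \<Longrightarrow> f \<in> Arr D" "into1 t f \<Longrightarrow> Cod D f = t" "into1 t f \<Longrightarrow> Dom D f \<in> Obj C"
  "into1 t f \<Longrightarrow> src_obj f = X (Dom D f)"
  by (auto simp: into1_def src_obj_def)

lemma into1_comp: "into1 t f \<Longrightarrow> g \<in> Arr C \<Longrightarrow> Cod D g = Dom D f \<Longrightarrow> into1 t (f \<cdot>\<^bsub>D\<^esub> g) \<and> src_obj (f \<cdot>\<^bsub>D\<^esub> g) = X (Dom D g)"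
  by (auto simp: into1_def src_obj_def)

lemma into1_post: "into1 (Dom D g) f \<Longrightarrow> g \<in> Arr D \<Longrightarrow> into1 (Cod D g) (g \<cdot>\<^bsub>D\<^esub> f) \<and> src_obj (g \<cdot>\<^bsub>D\<^esub> f) = src_obj f"
  by (auto simp: into1_def src_obj_def)

lemma words_post: "fs \<in> words (Dom D g) \<Longrightarrow> g \<in> Arr D \<Longrightarrow> map ((\<cdot>\<^bsub>D\<^esub>) g) fs \<in> words (Cod D g) \<and>
  srcs (map ((\<cdot>\<^bsub>D\<^esub>) g) fs) = srcs fs"
  using into1_post by (auto simp: words_def)

fun valid :: "'c \<Rightarrow> 'a rule \<Rightarrow> bool" where
  "valid t (RuleAct f g) \<longleftrightarrow> into1 t f \<and> g \<in> Arr C \<and> Cod D g = Dom D f"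
| "valid t (RuleMult f) \<longleftrightarrow> into1 t f"
| "valid t (RuleUnit f) \<longleftrightarrow> into1 t f"
| "valid t (RuleSwap f g) \<longleftrightarrow> into1 t f \<and> into1 t g \<and> (f, g) \<in> orth"

fun lhs :: "'a rule \<Rightarrow> 'a list" where
  "lhs (RuleAct f g) = [f \<cdot>\<^bsub>D\<^esub> g]"
| "lhs (RuleMult f) = [f, f]"
| "lhs (RuleUnit f) = []"
| "lhs (RuleSwap f g) = [f, g]"

fun rhs :: "'a rule \<Rightarrow> 'a list" where
  "rhs (RuleAct f g) = [f]"
| "rhs (RuleMult f) = [f]"
| "rhs (RuleUnit f) = [f]"
| "rhs (RuleSwap f g) = [g, f]"

text \<open>\<open>x\<close> is the part of the tensor product to the right of the rewritten
  letters; it stays general because it grows when words are concatenated.\<close>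

fun rule_arr :: "'a rule \<Rightarrow> 'o \<Rightarrow> 'm" where
  "rule_arr (RuleAct f g) x = F g \<boxtimes> Id M x"
| "rule_arr (RuleMult f) x = (mu (Dom D f) \<boxtimes> Id M x) \<cdot> inv_arr M (Assoc M (X (Dom D f)) (X (Dom D f)) x)"
| "rule_arr (RuleUnit f) x = (un (Dom D f) \<boxtimes> Id M x) \<cdot> inv_arr M (LUnit M x)"
| "rule_arr (RuleSwap f g) x = swap (src_obj f) (src_obj g) x"

lemma A_mon_typ [simp]:
  assumes "t \<in> Obj C"
  shows "mu t \<in> Arr M" "Dom M (mu t) = X t \<otimes> X t" "Cod M (mu t) = X t" "un t \<in> Arr M" "Dom M (un t) = I"
    "Cod M (un t) = X t"
  using monoid_object.m_u_typ[OF A.mon[OF assms]] by simp_all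

lemma rule_words: "valid t r \<Longrightarrow> lhs r \<in> words t \<and> rhs r \<in> words t"
  by (cases r) (auto simp: into1_comp)

lemma rule_arr_typ [simp]:
  assumes "valid t r" "x \<in> Obj M"
  shows "rule_arr r x \<in> Arr M" "Dom M (rule_arr r x) = tobj (srcs (lhs r)) x" "Cod M (rule_arr r x) =
    tobj (srcs (rhs r)) x"
  using assms by (cases r; auto simp: into1D into1_comp)+

lemma LUnit_inv_tensor:
  assumes [simp]: "v \<in> Obj M" "x \<in> Obj M"
  shows "Assoc M I v x \<cdot> (inv_arr M (LUnit M v) \<boxtimes> Id M x) = inv_arr M (LUnit M (v \<otimes> x))"
proof (rule iso_mono[of "LUnit M (v \<otimes> x)"])
  show "LUnit M (v \<otimes> x) \<cdot> (Assoc M I v x \<cdot> (inv_arr M (LUnit M v) \<boxtimes> Id M x)) = LUnit M (v \<otimes> x) \<cdot>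
    inv_arr M (LUnit M (v \<otimes> x))"
    by (simp add: reassoc[OF LUnit_tensor])
qed simp_all

lemma pentagon_inv:
  assumes [simp]: "a \<in> Obj M" "b \<in> Obj M" "c \<in> Obj M" "x \<in> Obj M"
  shows "Assoc M (a \<otimes> b) c x \<cdot> (inv_arr M (Assoc M a b c) \<boxtimes> Id M x) =
    inv_arr M (Assoc M a b (c \<otimes> x)) \<cdot> ((Id M a \<boxtimes> Assoc M b c x) \<cdot> Assoc M a (b \<otimes> c) x)"
proof (rule iso_mono[of "Assoc M a b (c \<otimes> x)"])
  have "Assoc M a b (c \<otimes> x) \<cdot> (Assoc M (a \<otimes> b) c x \<cdot> (inv_arr M (Assoc M a b c) \<boxtimes> Id M x)) =
    ((Id M a \<boxtimes> Assoc M b c x) \<cdot> (Assoc M a (b \<otimes> c) x \<cdot> (Assoc M a b c \<boxtimes> Id M x))) \<cdot> (inv_arr M (Assoc M a b c) \<boxtimes>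
      Id M x)"
    by (simp only: pentagon' assms) simp
  then show "Assoc M a b (c \<otimes> x) \<cdot> (Assoc M (a \<otimes> b) c x \<cdot> (inv_arr M (Assoc M a b c) \<boxtimes> Id M x)) =
     Assoc M a b (c \<otimes> x) \<cdot> (inv_arr M (Assoc M a b (c \<otimes> x)) \<cdot> ((Id M a \<boxtimes> Assoc M b c x) \<cdot> Assoc M a (b \<otimes> c) x))"
    by simp
qed simp_all

text \<open>A naturality square for each rule, combined in the last three cases with one coherence
  law: \<open>pentagon_inv\<close>, \<open>LUnit_inv_tensor\<close>,
  \<open>swap_tail\<close>.\<close>

lemma rule_arr_append:
  assumes "valid t r" "x \<in> Obj M"
  shows "append_arr (srcs (rhs r @ vs)) x \<cdot> (rule_arr r (G vs) \<boxtimes> Id M x) =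
    rule_arr r (tobj (srcs vs) x) \<cdot> append_arr (srcs (lhs r @ vs)) x"
proof (cases r)
  case (RuleAct f g)
  then show ?thesis using assms by (auto simp: into1D into1_comp Assoc_nat')
next
  case (RuleMult f)
  have f: "Dom D f \<in> Obj C" "src_obj f = X (Dom D f)" using assms RuleMult by (auto simp: into1D)
  let ?a = "X (Dom D f)"
  have [simp]: "?a \<in> Obj M" using f by simp
  have "append_arr (srcs (rhs r @ vs)) x \<cdot> (rule_arr r (G vs) \<boxtimes> Id M x) =
     (Id M ?a \<boxtimes> append_arr (srcs vs) x) \<cdot> ((Assoc M ?a (G vs) x \<cdot> ((mu (Dom D f) \<boxtimes> Id M (G vs)) \<boxtimes> Id M x)) \<cdot>
       (inv_arr M (Assoc M ?a ?a (G vs)) \<boxtimes> Id M x))"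
    using assms f by (simp add: RuleMult)
  also have "\<dots> = (mu (Dom D f) \<boxtimes> append_arr (srcs vs) x) \<cdot> (Assoc M (?a \<otimes> ?a) (G vs) x \<cdot>
    (inv_arr M (Assoc M ?a ?a (G vs)) \<boxtimes> Id M x))"
    using assms f by (subst Assoc_nat') simp_all
  also have "\<dots> = (mu (Dom D f) \<boxtimes> Id M (tobj (srcs vs) x)) \<cdot> ((((Id M ?a \<boxtimes> Id M ?a) \<boxtimes> append_arr (srcs vs) x) \<cdot>
    inv_arr M (Assoc M ?a ?a (G vs \<otimes> x))) \<cdot>
      ((Id M ?a \<boxtimes> Assoc M ?a (G vs) x) \<cdot> Assoc M ?a (?a \<otimes> G vs) x))"
    using assms f by (subst pentagon_inv) simp_all
  also have "((Id M ?a \<boxtimes> Id M ?a) \<boxtimes> append_arr (srcs vs) x) \<cdot> inv_arr M (Assoc M ?a ?a (G vs \<otimes> x)) =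
      inv_arr M (Assoc M ?a ?a (tobj (srcs vs) x)) \<cdot> (Id M ?a \<boxtimes> (Id M ?a \<boxtimes> append_arr (srcs vs) x))"
    using assms by (subst Assoc_inv_nat) simp_all
  finally show ?thesis using assms f by (simp add: RuleMult)
next
  case (RuleUnit f)
  have f: "Dom D f \<in> Obj C" "src_obj f = X (Dom D f)" using assms RuleUnit by (auto simp: into1D)
  let ?a = "X (Dom D f)"
  have [simp]: "?a \<in> Obj M" using f by simp
  have "append_arr (srcs (rhs r @ vs)) x \<cdot> (rule_arr r (G vs) \<boxtimes> Id M x) =
     (Id M ?a \<boxtimes> append_arr (srcs vs) x) \<cdot> ((Assoc M ?a (G vs) x \<cdot> ((un (Dom D f) \<boxtimes> Id M (G vs)) \<boxtimes> Id M x)) \<cdot>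
       (inv_arr M (LUnit M (G vs)) \<boxtimes> Id M x))"
    using assms f by (simp add: RuleUnit)
  also have "\<dots> = (un (Dom D f) \<boxtimes> append_arr (srcs vs) x) \<cdot> (Assoc M I (G vs) x \<cdot> (inv_arr M (LUnit M (G vs)) \<boxtimes> Id M x))"
    using assms f by (subst Assoc_nat') simp_all
  also have "\<dots> = rule_arr r (tobj (srcs vs) x) \<cdot> append_arr (srcs (lhs r @ vs)) x"
    using assms f by (simp add: RuleUnit LUnit_inv_tensor LUnit_inv_nat)
  finally show ?thesis .
next
  case (RuleSwap f g)
  let ?a = "src_obj f" and ?b = "src_obj g" and ?p = "append_arr (srcs vs) x"
  have "append_arr (srcs (rhs r @ vs)) x \<cdot> (rule_arr r (G vs) \<boxtimes> Id M x) =
     (Id M ?b \<boxtimes> (Id M ?a \<boxtimes> ?p)) \<cdot> ((Id M ?b \<boxtimes> Assoc M ?a (G vs) x) \<cdot> (Assoc M ?b (?a \<otimes> G vs) x \<cdot> (swap ?a ?b (G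
       vs) \<boxtimes> Id M x)))"
    using assms by (simp add: RuleSwap)
  also have "\<dots> = ((Id M ?b \<boxtimes> (Id M ?a \<boxtimes> ?p)) \<cdot> swap ?a ?b (G vs \<otimes> x)) \<cdot> ((Id M ?a \<boxtimes> Assoc M ?b (G vs) x) \<cdot>
    Assoc M ?a (?b \<otimes> G vs) x)"
    using assms by (subst swap_tail) simp_all
  also have "(Id M ?b \<boxtimes> (Id M ?a \<boxtimes> ?p)) \<cdot> swap ?a ?b (G vs \<otimes> x) = swap ?a ?b (tobj (srcs vs) x) \<cdot>
    (Id M ?a \<boxtimes> (Id M ?b \<boxtimes> ?p))"
    using assms by (simp add: swap_nat)
  finally show ?thesis using assms by (simp add: RuleSwap)
qed

text \<open>A rule instance in context: the letters \<open>us\<close> before it are left alone, the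
  letters \<open>vs\<close> after it form the tail.\<close>

definition edge :: "'a list \<times> 'a rule \<times> 'a list \<Rightarrow> 'a list \<times> 'a list \<times> 'm" where
  "edge = (\<lambda>(us, r, vs). (us @ lhs r @ vs, us @ rhs r @ vs, tid (srcs us) (rule_arr r (G vs))))"

definition edge_set :: "'c \<Rightarrow> ('a list \<times> 'a rule \<times> 'a list) set" where
  "edge_set t = {(us, r, vs). us \<in> words t \<and> valid t r \<and> vs \<in> words t}"

abbreviation "edges t \<equiv> edge ` edge_set t"

lemma tid_srcs_typ [simp]:
  assumes "f \<in> Arr M"
  shows "tarr (map (Id M \<circ> src_obj) us) f \<in> Arr M" "Dom M (tarr (map (Id M \<circ> src_obj) us) f) = tobj (srcs us) (Dom M f)"
    "Cod M (tarr (map (Id M \<circ> src_obj) us) f) = tobj (srcs us) (Cod M f)"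
  using assms by (induction us) auto

lemma wf_edges: "wf_graph M (words t) (edges t) G"
  using rule_words by (auto simp: wf_graph_def edge_def edge_set_def hom_def)

lemma gcocone_iff:
  "gcocone M (words t) (edges t) G Y q \<longleftrightarrow> Y \<in> Obj M \<and> (\<forall>fs \<in> words t. q fs \<in> hom M (G fs) Y) \<and>
    (\<forall>us r vs. us \<in> words t \<longrightarrow> valid t r \<longrightarrow> vs \<in> words t \<longrightarrow>
      q (us @ rhs r @ vs) \<cdot> tid (srcs us) (rule_arr r (G vs)) = q (us @ lhs r @ vs))"
  by (auto simp: gcocone_def edge_def edge_set_def)

text \<open>A letterwise family into a monoid extends multiplicatively to words, and each of the
  last four hypotheses is what one rule demands. Used with \<open>X t\<close> itself as the monoid,
  and again with the values of the target in the universal property.\<close>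

lemma prod_cocone:
  assumes m: "monoid_object M y m u"
    and b: "\<And>f. into1 t f \<Longrightarrow> b f \<in> hom M (X (Dom D f)) y"
    and b_act: "\<And>f g. into1 t f \<Longrightarrow> g \<in> Arr C \<Longrightarrow> Cod D g = Dom D f \<Longrightarrow> b (f \<cdot>\<^bsub>D\<^esub> g) = b f \<cdot> F g"
    and b_mult: "\<And>f. into1 t f \<Longrightarrow> b f \<cdot> mu (Dom D f) = m \<cdot> (b f \<boxtimes> b f)"
    and b_unit: "\<And>f. into1 t f \<Longrightarrow> b f \<cdot> un (Dom D f) = u"
    and b_orth: "\<And>f g. into1 t f \<Longrightarrow> into1 t g \<Longrightarrow> (f, g) \<in> orth \<Longrightarrow>
      m \<cdot> (b f \<boxtimes> b g) = m \<cdot> ((b g \<boxtimes> b f) \<cdot> Sym M (X (Dom D f)) (X (Dom D g)))"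
  shows "gcocone M (words t) (edges t) G y (\<lambda>fs. prod_arr M m u (map b fs))"
proof -
  interpret m: monoid_object M y m u by fact
  have bt: "b f \<in> Arr M" "Dom M (b f) = src_obj f" "Cod M (b f) = y" if "into1 t f" for f
    using b[OF that] into1D(4)[OF that] by (auto simp: hom_def)
  have into: "m.into (map b fs)" if "fs \<in> words t" for fs
    using that bt by (auto simp: m.into_def words_def)
  have Dom: "map (Dom M) (map b fs) = srcs fs" if "fs \<in> words t" for fs
    using that bt by (auto simp: words_def)
  have p: "m.pr (map b fs) \<in> Arr M" "Dom M (m.pr (map b fs)) = G fs" "Cod M (m.pr (map b fs)) = y"
    if "fs \<in> words t" for fs
    using m.prod_arr_typ[OF into[OF that]] unfolding Dom[OF that] by simp_all
  \<comment> \<open>Rules at the front of a word; for the rules that affect two letters,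
    associativity first brings these together.\<close>
  have base: "m.pr (map b (rhs r @ vs)) \<cdot> rule_arr r (G vs) = m.pr (map b (lhs r @ vs))"
    if r: "valid t r" and vs: "vs \<in> words t" for r vs
  proof (cases r)
    case (RuleAct f g)
    then show ?thesis using r p[OF vs] bt[of f] b_act[of f g] into1D[of t f] by simp
  next
    case (RuleMult f)
    have f: "into1 t f" using r RuleMult by simp
    note ft = bt[OF f] into1D(3,4)[OF f]
    have "m.pr (map b (rhs r @ vs)) \<cdot> rule_arr r (G vs) =
       m \<cdot> (((b f \<cdot> mu (Dom D f)) \<boxtimes> m.pr (map b vs)) \<cdot> inv_arr M (Assoc M (src_obj f) (src_obj f) (G vs)))"
      using ft p[OF vs] by (simp add: RuleMult)
    also have "\<dots> = (m \<cdot> ((m \<cdot> (b f \<boxtimes> b f)) \<boxtimes> m.pr (map b vs))) \<cdot> inv_arr M (Assoc M (src_obj f) (src_obj f) (G vs))"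
      unfolding b_mult[OF f] using ft p[OF vs] by (simp del: interchange)
    also have "\<dots> = m.pr (map b (lhs r @ vs))"
      using ft p[OF vs] by (subst m.mult_assoc') (simp_all add: RuleMult)
    finally show ?thesis .
  next
    case (RuleUnit f)
    have f: "into1 t f" using r RuleUnit by simp
    note ft = bt[OF f] into1D(3,4)[OF f]
    have "m.pr (map b (rhs r @ vs)) \<cdot> rule_arr r (G vs) =
       (m \<cdot> ((b f \<cdot> un (Dom D f)) \<boxtimes> m.pr (map b vs))) \<cdot> inv_arr M (LUnit M (G vs))"
      using ft p[OF vs] by (simp add: RuleUnit)
    then show ?thesis unfolding b_unit[OF f] using p[OF vs] by (simp add: m.unit_left' RuleUnit)
  next
    case (RuleSwap f g)
    have fg: "into1 t f" "into1 t g" "(f, g) \<in> orth" using r RuleSwap by auto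
    note ft = bt[OF fg(1)] bt[OF fg(2)]
    have o: "X (Dom D f) = src_obj f" "X (Dom D g) = src_obj g" using fg by (simp_all add: into1D)
    let ?a = "src_obj f" and ?b = "src_obj g" and ?p = "m.pr (map b vs)"
    have "m \<cdot> (b g \<boxtimes> (m \<cdot> (b f \<boxtimes> ?p))) = (m \<cdot> ((b g \<boxtimes> (m \<cdot> (b f \<boxtimes> ?p))) \<cdot> Assoc M ?b ?a (G vs))) \<cdot>
      inv_arr M (Assoc M ?b ?a (G vs))"
      using ft p[OF vs] by simp
    also have "\<dots> = (m \<cdot> ((m \<cdot> (b g \<boxtimes> b f)) \<boxtimes> ?p)) \<cdot> inv_arr M (Assoc M ?b ?a (G vs))"
      using ft p[OF vs] by (subst m.mult_assoc') simp_all
    finally have "m.pr (map b (rhs r @ vs)) \<cdot> rule_arr r (G vs) =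
      ((m \<cdot> ((m \<cdot> (b g \<boxtimes> b f)) \<boxtimes> ?p)) \<cdot> inv_arr M (Assoc M ?b ?a (G vs))) \<cdot> swap ?a ?b (G vs)"
      by (simp add: RuleSwap)
    also have "\<dots> = (m \<cdot> ((m \<cdot> ((b g \<boxtimes> b f) \<cdot> Sym M ?a ?b)) \<boxtimes> ?p)) \<cdot> inv_arr M (Assoc M ?a ?b (G vs))"
      using ft p[OF vs] by (simp add: swap_def)
    also have "m \<cdot> ((b g \<boxtimes> b f) \<cdot> Sym M ?a ?b) = m \<cdot> (b f \<boxtimes> b g)"
      using b_orth[OF fg] by (simp add: o)
    also have "(m \<cdot> ((m \<cdot> (b f \<boxtimes> b g)) \<boxtimes> ?p)) \<cdot> inv_arr M (Assoc M ?a ?b (G vs)) = m.pr (map b (lhs r @ vs))"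
      using ft p[OF vs] by (subst m.mult_assoc') (simp_all add: RuleSwap)
    finally show ?thesis .
  qed
  have step: "m.pr (map b (us @ rhs r @ vs)) \<cdot> tid (srcs us) (rule_arr r (G vs)) = m.pr (map b (us @ lhs r @ vs))"
    if us: "us \<in> words t" and r: "valid t r" and vs: "vs \<in> words t" for us r vs
    using us
  proof (induction us)
    case (Cons f us)
    have w: "us @ rhs r @ vs \<in> words t" "into1 t f" using Cons.prems rule_words[OF r] vs by simp_all
    have "m.pr (map b ((f # us) @ rhs r @ vs)) \<cdot> tid (srcs (f # us)) (rule_arr r (G vs)) =
       m \<cdot> (b f \<boxtimes> (m.pr (map b (us @ rhs r @ vs)) \<cdot> tid (srcs us) (rule_arr r (G vs))))"
      using p[OF w(1)] bt[OF w(2)] r by simp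
    then show ?case using Cons by simp
  qed (use base[OF r vs] in simp)
  show ?thesis
    unfolding gcocone_iff using p step by (auto simp: hom_def)
qed

end

context extension
begin

lemma tid_srcs_Comp: "f \<in> Arr M \<Longrightarrow> g \<in> Arr M \<Longrightarrow> Dom M g = Cod M f \<Longrightarrow>
    tarr (map (Id M \<circ> src_obj) us) g \<cdot> tarr (map (Id M \<circ> src_obj) us) f = tarr (map (Id M \<circ> src_obj) us) (g \<cdot> f)"
  using tid_Comp[of "srcs us" f g] by simp

text \<open>Here fullness of the subcategory enters: both ends of such a letter lie in
  \<open>C\<close>, so \<open>F\<close> applies to it.\<close>

lemma words_C:
  assumes "t \<in> Obj C" "into1 t f"
  shows "f \<in> Arr C" "Dom C f = Dom D f" "Cod C f = t"
proof -
  have f: "f \<in> Arr D" "Dom D f \<in> Obj C" "Cod D f \<in> Obj C" "Cod D f = t"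
    using assms by (auto simp: into1_def)
  show "f \<in> Arr C" "Dom C f = Dom D f" "Cod C f = t"
    using full_arr[OF f(1-3)] f(4) by simp_all
qed

text \<open>The rules hold by functoriality, by the homomorphism property of \<open>F f\<close> and,
  for the exchange of letters, by orthogonality in the pulled-back relation.\<close>

lemma gcocone_C:
  assumes t: "t \<in> Obj C"
  shows "gcocone M (words t) (edges t) G (X t) (\<lambda>fs. prod_arr M (mu t) (un t) (map F fs))"
proof (rule prod_cocone[OF A.mon[OF t]])
  note f = words_C[OF t]
  show "F f \<in> hom M (X (Dom D f)) (X t)" if "into1 t f" for f
    using f[OF that] by (auto simp: hom_def)
  show "F (f \<cdot>\<^bsub>D\<^esub> g) = F f \<cdot> F g" if "into1 t f" "g \<in> Arr C" "Cod D g = Dom D f" for f g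
    using f[OF that(1)] that by (simp add: sub_Comp A.F_Comp)
  show "F f \<cdot> mu (Dom D f) = mu t \<cdot> (F f \<boxtimes> F f)" if "into1 t f" for f
    using f[OF that] A.F_mu[of f] by simp
  show "F f \<cdot> un (Dom D f) = un t" if "into1 t f" for f
    using f[OF that] A.F_un[of f] by simp
  show "mu t \<cdot> (F f \<boxtimes> F g) = mu t \<cdot> ((F g \<boxtimes> F f) \<cdot> Sym M (X (Dom D f)) (X (Dom D g)))"
    if "into1 t f" "into1 t g" "(f, g) \<in> orth" for f g
    using f[OF that(1)] f[OF that(2)] A.F_orth[of f g] that(3) by (simp add: orth_pullback_def embedding_def)
qed

text \<open>Every word over \<open>t\<close> can be rewritten to the one-letter word of the
  identity, along its iterated product up to a unitor. A cocone is therefore determined by its value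
  on that word.\<close>

lemma gcolim_C:
  assumes t: "t \<in> Obj C"
  shows "gcolim M (words t) (edges t) G (X t) (\<lambda>fs. prod_arr M (mu t) (un t) (map F fs))"
  unfolding gcolim_def
proof (intro conjI allI impI gcocone_C[OF t])
  let ?N = "\<lambda>t fs. prod_arr M (mu t) (un t) (map F fs)" and ?i = "cat.Id D t"
  fix Y q assume "gcocone M (words t) (edges t) G Y q"
  then have Y [simp]: "Y \<in> Obj M" and q: "\<And>fs. fs \<in> words t \<Longrightarrow> q fs \<in> hom M (G fs) Y"
    and q_rule: "\<And>us r vs. us \<in> words t \<Longrightarrow> valid t r \<Longrightarrow> vs \<in> words t \<Longrightarrow>
      q (us @ rhs r @ vs) \<cdot> tid (srcs us) (rule_arr r (G vs)) = q (us @ lhs r @ vs)"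
    unfolding gcocone_iff by blast+
  have qt: "q fs \<in> Arr M" "Dom M (q fs) = G fs" "Cod M (q fs) = Y" if "fs \<in> words t" for fs
    using q[OF that] by (auto simp: hom_def)
  have N: "?N c gs \<in> Arr M" "Dom M (?N c gs) = G gs" "Cod M (?N c gs) = X c" if "c \<in> Obj C" "gs \<in> words c" for c gs
  proof -
    have "?N c gs \<in> hom M (G gs) (X c)"
      using gcocone_C[OF that(1)] that(2) unfolding gcocone_iff by blast
    then show "?N c gs \<in> Arr M" "Dom M (?N c gs) = G gs" "Cod M (?N c gs) = X c" by (auto simp: hom_def)
  qed
  \<comment> \<open>Stated for letters that all begin by composing with \<open>f\<close>, and with a
    prefix \<open>us\<close>, so that the induction can absorb letters from right to left: the part
    after the prefix collapses to the single letter \<open>f\<close>, along the product over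
    \<open>Dom D f\<close>.\<close>
  have key: "q (us @ map (\<lambda>g. f \<cdot>\<^bsub>D\<^esub> g) gs) = q (us @ [f]) \<cdot> tid (srcs us) (inv_arr M (RUnit M (X (Dom D f))) \<cdot>
    ?N (Dom D f) gs)"
    if "us \<in> words t" "into1 t f" "gs \<in> words (Dom D f)" for us f gs
    using that
  proof (induction gs arbitrary: us)
    case Nil
    have f: "Dom D f \<in> Obj C" using Nil.prems by (simp add: into1D)
    have "q us = q (us @ [f]) \<cdot> tid (srcs us) (rule_arr (RuleUnit f) I)"
      using q_rule[of us "RuleUnit f" "[]"] Nil.prems by simp
    also have "rule_arr (RuleUnit f) I = inv_arr M (RUnit M (X (Dom D f))) \<cdot> un (Dom D f)"
      using f by (simp add: LUnit_eq_RUnit RUnit_inv_nat)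
    finally show ?case by simp
  next
    case (Cons g gs)
    let ?c = "Dom D f"
    let ?n = "inv_arr M (RUnit M (X ?c)) \<cdot> ?N ?c gs"
    have f: "?c \<in> Obj C" "src_obj f = X ?c" and g: "g \<in> Arr C" "Cod D g = ?c" "Dom D g \<in> Obj C" and gs: "gs \<in> words ?c"
      using Cons.prems words_C[of ?c g] by (auto simp: into1D)
    interpret m: monoid_object M "X ?c" "mu ?c" "un ?c" by (rule A.mon[OF f(1)])
    note Nt = N[OF f(1) gs]
    have fg: "into1 t (f \<cdot>\<^bsub>D\<^esub> g)" "src_obj (f \<cdot>\<^bsub>D\<^esub> g) = X (Dom D g)" using into1_comp[OF Cons.prems(2) g(1,2)] by auto
    have nt: "?n \<in> Arr M" "Dom M ?n = G gs" "Cod M ?n = X ?c \<otimes> I" using Nt f by simp_all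
    have w: "us @ [f, f] \<in> words t" "us @ [f] \<in> words t" "us @ [f \<cdot>\<^bsub>D\<^esub> g, f] \<in> words t" using Cons.prems fg by simp_all
    have "q (us @ map (\<lambda>g. f \<cdot>\<^bsub>D\<^esub> g) (g # gs)) = q ((us @ [f \<cdot>\<^bsub>D\<^esub> g]) @ map (\<lambda>g. f \<cdot>\<^bsub>D\<^esub> g) gs)" by simp
    also have "\<dots> = q ((us @ [f \<cdot>\<^bsub>D\<^esub> g]) @ [f]) \<cdot> tid (srcs (us @ [f \<cdot>\<^bsub>D\<^esub> g])) ?n"
      by (rule Cons.IH) (use Cons.prems fg in simp_all)
    \<comment> \<open>Two letters remain after \<open>us\<close>: the composite of \<open>f\<close>
      and \<open>g\<close>, and \<open>f\<close>. \<open>RuleAct\<close> turns the first into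
      \<open>f\<close>, and \<open>RuleMult\<close> merges them.\<close>
    also have "\<dots> = q (us @ lhs (RuleAct f g) @ [f]) \<cdot> tid (srcs us) (Id M (X (Dom D g)) \<boxtimes> ?n)"
      using fg by simp
    also have "\<dots> = (q (us @ [f, f]) \<cdot> tid (srcs us) (F g \<boxtimes> Id M (X ?c \<otimes> I))) \<cdot> tid (srcs us) (Id M (X (Dom D g)) \<boxtimes> ?n)"
      using q_rule[of us "RuleAct f g" "[f]"] Cons.prems g f by simp
    also have "\<dots> = q (us @ lhs (RuleMult f)) \<cdot> tid (srcs us) (F g \<boxtimes> ?n)"
      using qt[OF w(1)] nt g f by (simp add: tid_srcs_Comp)
    also have "\<dots> = (q (us @ [f]) \<cdot> tid (srcs us) (rule_arr (RuleMult f) I)) \<cdot> tid (srcs us) (F g \<boxtimes> ?n)"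
      using q_rule[of us "RuleMult f" "[]"] Cons.prems by simp
    also have "\<dots> = q (us @ [f]) \<cdot> tid (srcs us) (rule_arr (RuleMult f) I \<cdot> (F g \<boxtimes> ?n))"
      using qt[OF w(2)] nt g f by (simp add: tid_srcs_Comp)
    also have "rule_arr (RuleMult f) I \<cdot> (F g \<boxtimes> ?n) = inv_arr M (RUnit M (X ?c)) \<cdot> ?N ?c (g # gs)"
    proof (rule iso_mono[of "RUnit M (X ?c)"])
      have "RUnit M (X ?c) \<cdot> (rule_arr (RuleMult f) I \<cdot> (F g \<boxtimes> ?n)) =
         mu ?c \<cdot> ((RUnit M (X ?c \<otimes> X ?c) \<cdot> inv_arr M (Assoc M (X ?c) (X ?c) I)) \<cdot> (F g \<boxtimes> ?n))"
        using nt g f by (simp add: reassoc[OF RUnit_nat'])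
      also have "RUnit M (X ?c \<otimes> X ?c) \<cdot> inv_arr M (Assoc M (X ?c) (X ?c) I) = Id M (X ?c) \<boxtimes> RUnit M (X ?c)"
        by (simp flip: RUnit_tensor)
      also have "mu ?c \<cdot> ((Id M (X ?c) \<boxtimes> RUnit M (X ?c)) \<cdot> (F g \<boxtimes> ?n)) =
        RUnit M (X ?c) \<cdot> (inv_arr M (RUnit M (X ?c)) \<cdot> ?N ?c (g # gs))"
        using Nt g f by simp
      finally show "RUnit M (X ?c) \<cdot> (rule_arr (RuleMult f) I \<cdot> (F g \<boxtimes> ?n)) =
        RUnit M (X ?c) \<cdot> (inv_arr M (RUnit M (X ?c)) \<cdot> ?N ?c (g # gs))" .
    qed (use nt Nt f g in simp_all)
    finally show ?case .
  qed
  interpret m: monoid_object M "X t" "mu t" "un t" by (rule A.mon[OF t])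
  have i: "into1 t ?i" "[?i] \<in> words t" "Dom D ?i = t" "src_obj ?i = X t" using t by (simp_all add: into1_def
    src_obj_def)
  note qi = qt[OF i(2)]
  show "\<exists>!h. h \<in> hom M (X t) Y \<and> (\<forall>fs\<in>words t. h \<cdot> ?N t fs = q fs)"
  \<comment> \<open>The value on the word of the identity, precomposed with the inverse unitor that
    supplies the final \<open>I\<close>; \<open>key\<close> for \<open>f\<close> the identity shows
    that it factors the cocone.\<close>
  proof (rule ex1I[of _ "q [?i] \<cdot> inv_arr M (RUnit M (X t))"], intro conjI ballI)
    show "q [?i] \<cdot> inv_arr M (RUnit M (X t)) \<in> hom M (X t) Y"
      using qi i by (simp add: hom_def)
    show "(q [?i] \<cdot> inv_arr M (RUnit M (X t))) \<cdot> ?N t fs = q fs" if fs: "fs \<in> words t" for fs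
    proof -
      have "map (\<lambda>g. ?i \<cdot>\<^bsub>D\<^esub> g) fs = fs"
        using fs by (intro map_idI) (auto simp: words_def into1_def)
      then show ?thesis
        using key[of "[]" ?i fs] i fs qi N[OF t fs] by simp
    qed
    fix h assume h: "h \<in> hom M (X t) Y \<and> (\<forall>fs\<in>words t. h \<cdot> ?N t fs = q fs)"
    have "?N t [?i] = RUnit M (X t)" using t by (simp add: sub_Id A.F_Id m.unit_right)
    then have "h \<cdot> RUnit M (X t) = q [?i]" using h i(2) by metis
    then have "h \<cdot> RUnit M (X t) = (q [?i] \<cdot> inv_arr M (RUnit M (X t))) \<cdot> RUnit M (X t)"
      using qi i by simp
    then show "h = q [?i] \<cdot> inv_arr M (RUnit M (X t))"
      by (rule iso_epi[rotated]) (use h qi i in \<open>auto simp: hom_def\<close>)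
  qed
qed

end

text \<open>The colimits are parameters so that over \<open>C\<close> they can be prescribed to be
  \<open>X t\<close> with its product cocone; such a choice is possible by
  \<open>gcolim_C\<close>.\<close>

locale extension_colimits = extension M D C orth X F mu un
  for M :: "('o, 'm, 'z) smc_scheme" (structure) and D C :: "('c, 'a) cat" and orth :: "('a \<times> 'a) set"
    and X :: "'c \<Rightarrow> 'o" and F :: "'a \<Rightarrow> 'm" and mu un :: "'c \<Rightarrow> 'm" +
  fixes L :: "'c \<Rightarrow> 'o" and \<iota> :: "'c \<Rightarrow> 'a list \<Rightarrow> 'm"
  assumes colim: "t \<in> Obj D \<Longrightarrow> gcolim M (words t) (edges t) G (L t) (\<iota> t)"
    and L_C: "t \<in> Obj C \<Longrightarrow> L t = X t"
    and \<iota>_C: "t \<in> Obj C \<Longrightarrow> fs \<in> words t \<Longrightarrow> \<iota> t fs = prod_arr M (mu t) (un t) (map F fs)"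
begin

section \<open>The extended functor and its multiplication by concatenation\<close>

lemma L_Obj [simp]: "t \<in> Obj D \<Longrightarrow> L t \<in> Obj M"
  using colim[of t] by (simp add: gcolim_def gcocone_def)

lemma \<iota>_typ:
  assumes "t \<in> Obj D" "fs \<in> words t"
  shows "\<iota> t fs \<in> Arr M" "Dom M (\<iota> t fs) = G fs" "Cod M (\<iota> t fs) = L t"
  using colim[OF assms(1)] assms(2) by (auto simp: gcolim_def gcocone_def hom_def)

lemma \<iota>_rule: "t \<in> Obj D \<Longrightarrow> us \<in> words t \<Longrightarrow> valid t r \<Longrightarrow> vs \<in> words t \<Longrightarrow>
   \<iota> t (us @ rhs r @ vs) \<cdot> tid (srcs us) (rule_arr r (G vs)) = \<iota> t (us @ lhs r @ vs)"
  using colim[of t] unfolding gcolim_def gcocone_iff by blast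

lemma L_factor:
  assumes "t \<in> Obj D" "gcocone M (words t) (edges t) G Y q"
  shows "\<exists>h. h \<in> hom M (L t) Y \<and> (\<forall>fs \<in> words t. h \<cdot> \<iota> t fs = q fs)"
proof -
  have "\<exists>!h. h \<in> hom M (L t) Y \<and> (\<forall>fs \<in> words t. h \<cdot> \<iota> t fs = q fs)"
    using colim[OF assms(1)] assms(2) unfolding gcolim_def by blast
  then show ?thesis by (rule ex1_implies_ex)
qed

lemma jointly_epi_\<iota>: "t \<in> Obj D \<Longrightarrow> jointly_epi M (\<iota> t ` words t) (L t)"
  by (rule gcolim_jointly_epi[OF category_axioms colim wf_edges])

lemma L_eqI:
  assumes "t \<in> Obj D" "h \<in> Arr M" "h' \<in> Arr M" "Dom M h = L t" "Dom M h' = L t" "Cod M h = Cod M h'"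
    "\<And>fs. fs \<in> words t \<Longrightarrow> h \<cdot> \<iota> t fs = h' \<cdot> \<iota> t fs"
  shows "h = h'"
  using jointly_epiD[OF jointly_epi_\<iota>[OF assms(1)] assms(2-6)] assms(7) by blast

lemma LL_eqI:
  assumes "t \<in> Obj D" "t' \<in> Obj D" "h \<in> Arr M" "h' \<in> Arr M" "Dom M h = L t \<otimes> L t'" "Dom M h' = L t \<otimes> L t'"
    "Cod M h = Cod M h'"
    "\<And>fs gs. fs \<in> words t \<Longrightarrow> gs \<in> words t' \<Longrightarrow> h \<cdot> (\<iota> t fs \<boxtimes> \<iota> t' gs) = h' \<cdot> (\<iota> t fs \<boxtimes> \<iota> t' gs)"
  shows "h = h'"
  by (rule jointly_epiD[OF jointly_epi_tensor[OF jointly_epi_\<iota>[OF assms(1)] jointly_epi_\<iota>[OF assms(2)]] assms(3-7)])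
    (use assms(8) in auto)

lemma rule_append:
  assumes "valid t r" "x \<in> Obj M"
  shows "append_arr (srcs (us @ rhs r @ vs)) x \<cdot> (tid (srcs us) (rule_arr r (G vs)) \<boxtimes> Id M x) =
    tid (srcs us) (rule_arr r (tobj (srcs vs) x)) \<cdot> append_arr (srcs (us @ lhs r @ vs)) x"
proof (induction us)
  case (Cons f us)
  let ?a = "src_obj f"
  have "append_arr (srcs ((f # us) @ rhs r @ vs)) x \<cdot> (tid (srcs (f # us)) (rule_arr r (G vs)) \<boxtimes> Id M x) =
    (Id M ?a \<boxtimes> append_arr (srcs (us @ rhs r @ vs)) x) \<cdot> (Assoc M ?a (G (us @ rhs r @ vs)) x \<cdot>
      ((Id M ?a \<boxtimes> tid (srcs us) (rule_arr r (G vs))) \<boxtimes> Id M x))"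
    using assms by simp
  also have "\<dots> = (Id M ?a \<boxtimes> (append_arr (srcs (us @ rhs r @ vs)) x \<cdot> (tid (srcs us) (rule_arr r (G vs)) \<boxtimes> Id M x))) \<cdot>
      Assoc M ?a (G (us @ lhs r @ vs)) x"
    using assms by (subst Assoc_nat') simp_all
  also have "\<dots> = tid (srcs (f # us)) (rule_arr r (tobj (srcs vs) x)) \<cdot> append_arr (srcs ((f # us) @ lhs r @ vs)) x"
    unfolding Cons.IH using assms by simp
  finally show ?case .
qed (use rule_arr_append[OF assms] in simp)

text \<open>Rule instances over \<open>Dom D h\<close> are carried to instances over
  \<open>Cod D h\<close>; for the exchange of letters this is stability of orthogonality under
  post-composition. Domains of letters, and hence the attached arrows, do not change.\<close>

fun post_rule :: "'a \<Rightarrow> 'a rule \<Rightarrow> 'a rule" where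
  "post_rule h (RuleAct f g) = RuleAct (h \<cdot>\<^bsub>D\<^esub> f) g"
| "post_rule h (RuleMult f) = RuleMult (h \<cdot>\<^bsub>D\<^esub> f)"
| "post_rule h (RuleUnit f) = RuleUnit (h \<cdot>\<^bsub>D\<^esub> f)"
| "post_rule h (RuleSwap f g) = RuleSwap (h \<cdot>\<^bsub>D\<^esub> f) (h \<cdot>\<^bsub>D\<^esub> g)"

lemma post_rule:
  assumes "valid (Dom D h) r" "h \<in> Arr D"
  shows "valid (Cod D h) (post_rule h r)" "lhs (post_rule h r) = map ((\<cdot>\<^bsub>D\<^esub>) h) (lhs r)"
    "rhs (post_rule h r) = map ((\<cdot>\<^bsub>D\<^esub>) h) (rhs r)" "rule_arr (post_rule h r) = rule_arr r"
proof -
  show "valid (Cod D h) (post_rule h r)"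
    using assms D.orth_post by (cases r) (auto simp: into1_def)
  show "lhs (post_rule h r) = map ((\<cdot>\<^bsub>D\<^esub>) h) (lhs r)" "rhs (post_rule h r) = map ((\<cdot>\<^bsub>D\<^esub>) h) (rhs r)"
    using assms by (cases r; auto simp: into1_def)+
  show "rule_arr (post_rule h r) = rule_arr r"
    using assms by (cases r) (auto simp: into1_def src_obj_def fun_eq_iff)
qed

lemma Lfun_ex:
  assumes f: "f \<in> Arr D"
  shows "\<exists>h. h \<in> hom M (L (Dom D f)) (L (Cod D f)) \<and>
    (\<forall>fs \<in> words (Dom D f). h \<cdot> \<iota> (Dom D f) fs = \<iota> (Cod D f) (map ((\<cdot>\<^bsub>D\<^esub>) f) fs))"
proof -
  let ?q = "\<lambda>fs. \<iota> (Cod D f) (map ((\<cdot>\<^bsub>D\<^esub>) f) fs)"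
  have w: "map ((\<cdot>\<^bsub>D\<^esub>) f) fs \<in> words (Cod D f)" "srcs (map ((\<cdot>\<^bsub>D\<^esub>) f) fs) = srcs fs" if "fs \<in> words (Dom D f)" for fs
    using words_post[OF that f] by auto
  have "gcocone M (words (Dom D f)) (edges (Dom D f)) G (L (Cod D f)) ?q"
    unfolding gcocone_iff
  proof (intro conjI ballI allI impI)
    show "L (Cod D f) \<in> Obj M" using f by simp
    show "?q fs \<in> hom M (G fs) (L (Cod D f))" if "fs \<in> words (Dom D f)" for fs
      using \<iota>_typ[of "Cod D f" "map ((\<cdot>\<^bsub>D\<^esub>) f) fs", OF _ w(1)[OF that]] f
      unfolding hom_def w(2)[OF that] by simp
    show "?q (us @ rhs r @ vs) \<cdot> tid (srcs us) (rule_arr r (G vs)) = ?q (us @ lhs r @ vs)"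
      if "us \<in> words (Dom D f)" "valid (Dom D f) r" "vs \<in> words (Dom D f)" for us r vs
      using \<iota>_rule[OF D.Obj_Dom_Cod(2)[OF f] w(1)[OF that(1)] post_rule(1)[OF that(2) f] w(1)[OF that(3)]]
      unfolding post_rule(2-4)[OF that(2) f] w(2)[OF that(1)] w(2)[OF that(3)] map_append .
  qed
  then show ?thesis by (rule L_factor[rotated]) (use f in simp)
qed

definition Lfun :: "'a \<Rightarrow> 'm" where
  "Lfun f = (SOME h. h \<in> hom M (L (Dom D f)) (L (Cod D f)) \<and>
    (\<forall>fs \<in> words (Dom D f). h \<cdot> \<iota> (Dom D f) fs = \<iota> (Cod D f) (map ((\<cdot>\<^bsub>D\<^esub>) f) fs)))"

lemma Lfun_typ [simp]:
  assumes "f \<in> Arr D"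
  shows "Lfun f \<in> Arr M" "Dom M (Lfun f) = L (Dom D f)" "Cod M (Lfun f) = L (Cod D f)"
  using someI_ex[OF Lfun_ex[OF assms]] unfolding Lfun_def[symmetric] by (auto simp: hom_def)

lemma Lfun_\<iota>: "f \<in> Arr D \<Longrightarrow> fs \<in> words (Dom D f) \<Longrightarrow> Lfun f \<cdot> \<iota> (Dom D f) fs = \<iota> (Cod D f) (map ((\<cdot>\<^bsub>D\<^esub>) f) fs)"
  using someI_ex[OF Lfun_ex] unfolding Lfun_def[symmetric] by blast

text \<open>Concatenation respects rewriting in either argument: on the left the context
  \<open>vs\<close> grows to \<open>vs @ gs\<close>, on the right \<open>us\<close> becomes
  \<open>fs @ us\<close>. The factorization through a tensor product of colimits rests on closedness
  of \<open>M\<close>.\<close>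

lemma Lmu_ex:
  assumes t: "t \<in> Obj D"
  shows "\<exists>h \<in> hom M (L t \<otimes> L t) (L t). \<forall>fs \<in> words t. \<forall>gs \<in> words t.
     h \<cdot> (\<iota> t fs \<boxtimes> \<iota> t gs) = \<iota> t (fs @ gs) \<cdot> append_arr (srcs fs) (G gs)"
proof (rule gcolim_tensor[OF colim[OF t] wf_edges colim[OF t] wf_edges])
  show "L t \<in> Obj M" using t by simp
  show "\<iota> t (fs @ gs) \<cdot> append_arr (srcs fs) (G gs) \<in> hom M (G fs \<otimes> G gs) (L t)"
    if "fs \<in> words t" "gs \<in> words t" for fs gs
    using \<iota>_typ[OF t, of "fs @ gs"] that by (simp add: hom_def)
  show "(\<iota> t (fs' @ gs) \<cdot> append_arr (srcs fs') (G gs)) \<cdot> (\<theta> \<boxtimes> Id M (G gs)) =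
    \<iota> t (fs @ gs) \<cdot> append_arr (srcs fs) (G gs)"
    if e: "(fs, fs', \<theta>) \<in> edges t" and gs: "gs \<in> words t" for fs fs' \<theta> gs
  proof -
    obtain us r vs where r: "us \<in> words t" "valid t r" "vs \<in> words t"
      and fs: "fs = us @ lhs r @ vs" "fs' = us @ rhs r @ vs" "\<theta> = tid (srcs us) (rule_arr r (G vs))"
      using e by (auto simp: edge_def edge_set_def)
    have w: "fs' \<in> words t" "fs' @ gs \<in> words t" using r gs rule_words[OF r(2)] by (simp_all add: fs)
    have \<theta>: "\<theta> \<in> Arr M" "Cod M \<theta> = G fs'" using r by (simp_all add: fs)
    have "(\<iota> t (fs' @ gs) \<cdot> append_arr (srcs fs') (G gs)) \<cdot> (\<theta> \<boxtimes> Id M (G gs)) =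
       \<iota> t (fs' @ gs) \<cdot> (append_arr (srcs fs') (G gs) \<cdot> (\<theta> \<boxtimes> Id M (G gs)))"
      using \<iota>_typ[OF t w(2)] \<theta> by simp
    also have "\<dots> = \<iota> t (fs' @ gs) \<cdot> (tid (srcs us) (rule_arr r (tobj (srcs vs) (G gs))) \<cdot> append_arr (srcs fs) (G gs))"
      unfolding fs by (subst rule_append[OF r(2)]) simp_all
    also have "\<dots> = (\<iota> t (us @ rhs r @ (vs @ gs)) \<cdot> tid (srcs us) (rule_arr r (G (vs @ gs)))) \<cdot>
      append_arr (srcs fs) (G gs)"
      using \<iota>_typ[OF t w(2)] r by (simp add: fs)
    also have "\<dots> = \<iota> t (fs @ gs) \<cdot> append_arr (srcs fs) (G gs)"
      using \<iota>_rule[OF t r(1,2), of "vs @ gs"] r gs by (simp add: fs)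
    finally show ?thesis .
  qed
  show "(\<iota> t (fs @ gs') \<cdot> append_arr (srcs fs) (G gs')) \<cdot> (Id M (G fs) \<boxtimes> \<theta>) =
    \<iota> t (fs @ gs) \<cdot> append_arr (srcs fs) (G gs)"
    if fs: "fs \<in> words t" and e: "(gs, gs', \<theta>) \<in> edges t" for fs gs gs' \<theta>
  proof -
    obtain us r vs where r: "us \<in> words t" "valid t r" "vs \<in> words t"
      and gs: "gs = us @ lhs r @ vs" "gs' = us @ rhs r @ vs" "\<theta> = tid (srcs us) (rule_arr r (G vs))"
      using e by (auto simp: edge_def edge_set_def)
    have w: "fs @ gs' \<in> words t" using r fs rule_words[OF r(2)] by (simp add: gs)
    have \<theta>: "\<theta> \<in> Arr M" "Cod M \<theta> = G gs'" "Dom M \<theta> = G gs" using r by (simp_all add: gs)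
    have "(\<iota> t (fs @ gs') \<cdot> append_arr (srcs fs) (G gs')) \<cdot> (Id M (G fs) \<boxtimes> \<theta>) =
       \<iota> t (fs @ gs') \<cdot> (append_arr (srcs fs) (G gs') \<cdot> (Id M (G fs) \<boxtimes> \<theta>))"
      using \<iota>_typ[OF t w] \<theta> by simp
    also have "\<dots> = \<iota> t (fs @ gs') \<cdot> (tid (srcs fs) \<theta> \<cdot> append_arr (srcs fs) (G gs))"
      using \<theta> by (subst append_arr_tid) simp_all
    also have "\<dots> = (\<iota> t ((fs @ us) @ rhs r @ vs) \<cdot> tid (srcs (fs @ us)) (rule_arr r (G vs))) \<cdot>
      append_arr (srcs fs) (G gs)"
      using \<iota>_typ[OF t w] r by (simp add: gs)
    also have "\<dots> = \<iota> t (fs @ gs) \<cdot> append_arr (srcs fs) (G gs)"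
      using \<iota>_rule[OF t, of "fs @ us" r vs] r fs by (simp add: gs)
    finally show ?thesis .
  qed
qed

definition Lmu :: "'c \<Rightarrow> 'm" where
  "Lmu t = (SOME h. h \<in> hom M (L t \<otimes> L t) (L t) \<and> (\<forall>fs \<in> words t. \<forall>gs \<in> words t.
     h \<cdot> (\<iota> t fs \<boxtimes> \<iota> t gs) = \<iota> t (fs @ gs) \<cdot> append_arr (srcs fs) (G gs)))"

lemma Lmu_props:
  assumes "t \<in> Obj D"
  shows "Lmu t \<in> hom M (L t \<otimes> L t) (L t) \<and> (\<forall>fs \<in> words t. \<forall>gs \<in> words t.
     Lmu t \<cdot> (\<iota> t fs \<boxtimes> \<iota> t gs) = \<iota> t (fs @ gs) \<cdot> append_arr (srcs fs) (G gs))"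
  unfolding Lmu_def by (rule someI_ex) (use Lmu_ex[OF assms] in blast)

lemma Lmu_typ [simp]:
  assumes "t \<in> Obj D"
  shows "Lmu t \<in> Arr M" "Dom M (Lmu t) = L t \<otimes> L t" "Cod M (Lmu t) = L t"
  using Lmu_props[OF assms] by (auto simp: hom_def)

lemma Lmu_\<iota>: "t \<in> Obj D \<Longrightarrow> fs \<in> words t \<Longrightarrow> gs \<in> words t \<Longrightarrow>
    Lmu t \<cdot> (\<iota> t fs \<boxtimes> \<iota> t gs) = \<iota> t (fs @ gs) \<cdot> append_arr (srcs fs) (G gs)"
  using Lmu_props by blast

definition Lun :: "'c \<Rightarrow> 'm" where
  "Lun t = \<iota> t []"

lemma Lun_typ [simp]: "t \<in> Obj D \<Longrightarrow> Lun t \<in> Arr M" "t \<in> Obj D \<Longrightarrow> Dom M (Lun t) = I" "t \<in> Obj D \<Longrightarrow> Cod M (Lun t) = L t"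
  using \<iota>_typ[of t "[]"] by (simp_all add: Lun_def)

text \<open>Tensor products of injections are jointly epic, so the laws are checked on words, where
  they become \<open>append_arr_append\<close> for associativity and \<open>append_arr_unit\<close>
  for the right unit.\<close>

lemma monoid_object_L:
  assumes t [simp]: "t \<in> Obj D"
  shows "monoid_object M (L t) (Lmu t) (Lun t)"
proof
  show "L t \<in> Obj M" "Lmu t \<in> hom M (L t \<otimes> L t) (L t)" "Lun t \<in> hom M I (L t)" by (simp_all add: hom_def)
  note \<iota> [simp] = \<iota>_typ[OF t]
  show "Lmu t \<cdot> (Lun t \<boxtimes> Id M (L t)) = LUnit M (L t)"
  proof (rule jointly_epiD[OF jointly_epi_tensor_left[OF jointly_epi_\<iota>[OF t] TUnit_Obj]])
    fix f assume "f \<in> (\<lambda>f. Id M I \<boxtimes> f) ` \<iota> t ` words t"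
    then obtain fs where fs: "fs \<in> words t" "f = Id M I \<boxtimes> \<iota> t fs" by blast
    then show "(Lmu t \<cdot> (Lun t \<boxtimes> Id M (L t))) \<cdot> f = LUnit M (L t) \<cdot> f"
      using Lmu_\<iota>[OF t, of "[]" fs] by (simp add: Lun_def LUnit_nat')
  qed simp_all
  show "Lmu t \<cdot> (Id M (L t) \<boxtimes> Lun t) = RUnit M (L t)"
  proof (rule jointly_epiD[OF jointly_epi_tensor_right[OF jointly_epi_\<iota>[OF t] TUnit_Obj]])
    fix f assume "f \<in> (\<lambda>f. f \<boxtimes> Id M I) ` \<iota> t ` words t"
    then obtain fs where fs: "fs \<in> words t" "f = \<iota> t fs \<boxtimes> Id M I" by blast
    then show "(Lmu t \<cdot> (Id M (L t) \<boxtimes> Lun t)) \<cdot> f = RUnit M (L t) \<cdot> f"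
      using Lmu_\<iota>[OF t, of fs "[]"] by (simp add: Lun_def RUnit_nat' append_arr_unit)
  qed simp_all
  show "Lmu t \<cdot> (Lmu t \<boxtimes> Id M (L t)) = Lmu t \<cdot> ((Id M (L t) \<boxtimes> Lmu t) \<cdot> Assoc M (L t) (L t) (L t))"
  proof (rule jointly_epiD[OF jointly_epi_tensor[OF jointly_epi_tensor[OF jointly_epi_\<iota>[OF t] jointly_epi_\<iota>[OF
    t]] jointly_epi_\<iota>[OF t]]])
    fix f assume "f \<in> (\<lambda>(f, g). f \<boxtimes> g) ` ((\<lambda>(f, g). f \<boxtimes> g) ` (\<iota> t ` words t \<times> \<iota> t ` words t) \<times> \<iota> t ` words t)"
    then obtain fs gs hs where w: "fs \<in> words t" "gs \<in> words t" "hs \<in> words t" and f: "f = (\<iota> t fs \<boxtimes> \<iota> t gs) \<boxtimes> \<iota> t hs"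
      by auto
    have w': "fs @ gs \<in> words t" "gs @ hs \<in> words t" "fs @ gs @ hs \<in> words t" using w by simp_all
    note \<iota>' [simp] = \<iota>[OF w(1)] \<iota>[OF w(2)] \<iota>[OF w(3)] \<iota>[OF w'(1)] \<iota>[OF w'(2)] \<iota>[OF w'(3)]
    have "(Lmu t \<cdot> (Lmu t \<boxtimes> Id M (L t))) \<cdot> f = Lmu t \<cdot> ((Lmu t \<cdot> (\<iota> t fs \<boxtimes> \<iota> t gs)) \<boxtimes> \<iota> t hs)"
      by (simp add: f)
    also have "\<dots> = (Lmu t \<cdot> (\<iota> t (fs @ gs) \<boxtimes> \<iota> t hs)) \<cdot> (append_arr (srcs fs) (G gs) \<boxtimes> Id M (G hs))"
      by (simp add: Lmu_\<iota>[OF t w(1,2)])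
    also have "\<dots> = \<iota> t (fs @ gs @ hs) \<cdot> (append_arr (srcs fs @ srcs gs) (G hs) \<cdot>
      (append_arr (srcs fs) (tobj (srcs gs) I) \<boxtimes> Id M (G hs)))"
      by (simp add: Lmu_\<iota>[OF t w'(1) w(3)])
    also have "\<dots> = \<iota> t (fs @ gs @ hs) \<cdot> (append_arr (srcs fs) (tobj (srcs gs) (G hs)) \<cdot>
        ((Id M (G fs) \<boxtimes> append_arr (srcs gs) (G hs)) \<cdot> Assoc M (G fs) (G gs) (G hs)))"
      by (subst append_arr_append) simp_all
    also have "\<dots> = (\<iota> t (fs @ gs @ hs) \<cdot> append_arr (srcs fs) (G (gs @ hs))) \<cdot>
        ((Id M (G fs) \<boxtimes> append_arr (srcs gs) (G hs)) \<cdot> Assoc M (G fs) (G gs) (G hs))"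
      by simp
    also have "\<dots> = (Lmu t \<cdot> (\<iota> t fs \<boxtimes> \<iota> t (gs @ hs))) \<cdot>
        ((Id M (G fs) \<boxtimes> append_arr (srcs gs) (G hs)) \<cdot> Assoc M (G fs) (G gs) (G hs))"
      by (simp only: Lmu_\<iota>[OF t w(1) w'(2)])
    also have "\<dots> = Lmu t \<cdot> ((\<iota> t fs \<boxtimes> (\<iota> t (gs @ hs) \<cdot> append_arr (srcs gs) (G hs))) \<cdot> Assoc M (G fs) (G gs) (G hs))"
      by simp
    also have "\<iota> t (gs @ hs) \<cdot> append_arr (srcs gs) (G hs) = Lmu t \<cdot> (\<iota> t gs \<boxtimes> \<iota> t hs)"
      by (simp only: Lmu_\<iota>[OF t w(2,3)])
    also have "Lmu t \<cdot> ((\<iota> t fs \<boxtimes> (Lmu t \<cdot> (\<iota> t gs \<boxtimes> \<iota> t hs))) \<cdot> Assoc M (G fs) (G gs) (G hs)) =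
        (Lmu t \<cdot> ((Id M (L t) \<boxtimes> Lmu t) \<cdot> Assoc M (L t) (L t) (L t))) \<cdot> f"
      by (simp add: f Assoc_nat')
    finally show "(Lmu t \<cdot> (Lmu t \<boxtimes> Id M (L t))) \<cdot> f =
      (Lmu t \<cdot> ((Id M (L t) \<boxtimes> Lmu t) \<cdot> Assoc M (L t) (L t) (L t))) \<cdot> f" .
  qed simp_all
qed

end

section \<open>Commuting orthogonal letters, agreement on the subcategory, universality\<close>

context extension_colimits
begin

lemma tid_srcs_Id [simp]: "x \<in> Obj M \<Longrightarrow> tarr (map (Id M \<circ> src_obj) us) (Id M x) = Id M (tobj (srcs us) x)"
  by (induction us) auto

text \<open>Each transposition in the insertion is one application of \<open>RuleSwap\<close>; the
  induction moves the head of \<open>bs\<close> into the prefix \<open>us\<close>. Letters are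
  indexed by positions through \<open>w\<close>, since insertions need distinct labels while words
  may repeat letters.\<close>

lemma \<iota>_insert:
  assumes t: "t \<in> Obj D" and w: "\<And>k. k \<in> S \<Longrightarrow> into1 t (w k)"
    and c: "\<And>k. c k \<in> Obj M" "\<And>k. k \<in> S \<Longrightarrow> src_obj (w k) = c k"
    and us: "us \<in> words t" and S: "l \<in> S" "set bs \<subseteq> S" "set vs \<subseteq> S"
    and orth: "\<And>k. k \<in> set bs \<Longrightarrow> (w l, w k) \<in> orth" and l: "l \<notin> set bs"
  shows "\<iota> t (us @ map w (bs @ l # vs)) \<cdot> tid (srcs us) (insert_arr c l (bs @ l # vs) I) =
    \<iota> t (us @ map w (l # bs @ vs))"
  using us S(2) orth l
proof (induction bs arbitrary: us)
  case Nil
  have wd: "us @ w l # map w vs \<in> words t" using Nil w S by (auto simp: words_def)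
  have "map (src_obj \<circ> w) vs = map c vs" using c S by auto
  then have "tobj (map (src_obj \<circ> w) vs) I = tobj (map c vs) I" by (rule arg_cong)
  then show ?case using \<iota>_typ[OF t wd] c(2)[OF S(1)] c(1) by simp
next
  case (Cons b bs)
  note [simp] = c(1) insert_arr_simps[of c, OF c(1)] image_a_Obj[of c, OF c(1)]
  have [simp]: "l \<noteq> b" "b \<noteq> l" "l \<notin> set bs" "remove1 l (bs @ l # vs) = bs @ vs"
    using Cons.prems by (auto simp: remove1_append)
  have into: "into1 t (w b)" "into1 t (w l)" "us @ [w b] \<in> words t" "map w (bs @ vs) \<in> words t"
    "map w (bs @ l # vs) \<in> words t"
    using Cons.prems S w by (auto simp: words_def)
  have sb: "src_obj (w b) = c b" "src_obj (w l) = c l" using Cons.prems S c by auto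
  have Gc: "srcs (map w (bs @ vs)) = map c (bs @ vs)" "srcs (map w (bs @ l # vs)) = map c (bs @ l # vs)"
    using Cons.prems S c by auto
  let ?z = "tobj (map c (bs @ vs)) I"
  have wd: "us @ map w (b # bs @ l # vs) \<in> words t" "us @ map w (b # l # bs @ vs) \<in> words t"
    using Cons.prems into by simp_all
  have "\<iota> t (us @ map w ((b # bs) @ l # vs)) \<cdot> tid (srcs us) (insert_arr c l ((b # bs) @ l # vs) I) =
     \<iota> t (us @ map w (b # bs @ l # vs)) \<cdot> (tid (srcs us) (Id M (c b) \<boxtimes> insert_arr c l (bs @ l # vs) I) \<cdot> tid
       (srcs us) (swap (c l) (c b) ?z))"
    by (simp add: tid_srcs_Comp)
  also have "\<dots> = (\<iota> t ((us @ [w b]) @ map w (bs @ l # vs)) \<cdot> tid (srcs (us @ [w b])) (insert_arr c l (bs @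
    l # vs) I)) \<cdot> tid (srcs us) (swap (c l) (c b) ?z)"
  proof -
    have "Dom M (\<iota> t (us @ map w (b # bs @ l # vs))) = tobj (srcs us) (c b \<otimes> tobj (map c (bs @ l # vs)) I)"
    proof -
      have "Dom M (\<iota> t (us @ map w (b # bs @ l # vs))) = tobj (srcs us) (c b \<otimes> G (map w (bs @ l # vs)))"
        using \<iota>_typ(2)[OF t wd(1)] sb by simp
      then show ?thesis unfolding Gc(2) .
    qed
    then show ?thesis using \<iota>_typ(1)[OF t wd(1)] sb by simp
  qed
  also have "\<iota> t ((us @ [w b]) @ map w (bs @ l # vs)) \<cdot> tid (srcs (us @ [w b])) (insert_arr c l (bs @ l # vs) I) =
      \<iota> t ((us @ [w b]) @ map w (l # bs @ vs))"
    by (rule Cons.IH) (use Cons.prems into in auto)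
  also have "\<iota> t ((us @ [w b]) @ map w (l # bs @ vs)) \<cdot> tid (srcs us) (swap (c l) (c b) ?z) =
     \<iota> t (us @ rhs (RuleSwap (w l) (w b)) @ map w (bs @ vs)) \<cdot> tid (srcs us) (rule_arr (RuleSwap (w l) (w b)) (G
       (map w (bs @ vs))))"
    unfolding Gc using sb by simp
  also have "\<dots> = \<iota> t (us @ lhs (RuleSwap (w l) (w b)) @ map w (bs @ vs))"
    by (rule \<iota>_rule[OF t]) (use Cons.prems into in auto)
  finally show ?case by simp
qed

text \<open>The letters of \<open>as\<close> cross \<open>bs\<close> one after another, each by
  \<open>\<iota>_insert\<close>, in step with the recursion of \<open>perm_arr\<close>.\<close>

lemma \<iota>_block_swap:
  assumes t: "t \<in> Obj D" and w: "\<And>k. k \<in> set as \<union> set bs \<Longrightarrow> into1 t (w k)"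
    and c: "\<And>k. c k \<in> Obj M" "\<And>k. k \<in> set as \<union> set bs \<Longrightarrow> src_obj (w k) = c k"
    and orth: "\<And>j k. j \<in> set as \<Longrightarrow> k \<in> set bs \<Longrightarrow> (w j, w k) \<in> orth"
    and dist: "distinct (as @ bs)"
    and us: "us \<in> words t"
  shows "\<iota> t (us @ map w (bs @ as)) \<cdot> tid (srcs us) (perm_arr c (as @ bs) (bs @ as) I) = \<iota> t (us @ map w (as @ bs))"
  using w c(2) orth dist us
proof (induction as arbitrary: us)
  case Nil
  have wd: "us @ map w bs \<in> words t" using Nil by (auto simp: words_def)
  have "map (src_obj \<circ> w) bs = map c bs" using Nil by auto
  then have "tobj (map (src_obj \<circ> w) bs) I = tobj (map c bs) I" by (rule arg_cong)
  then show ?case using \<iota>_typ[OF t wd] perm_arr_refl[of c I bs, OF c(1)] image_a_Obj[of c, OF c(1)] by simp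
next
  case (Cons l as)
  note [simp] = c(1) insert_arr_simps[of c, OF c(1)] perm_arr_simps[of c, OF c(1)] image_a_Obj[of c, OF c(1)]
  have [simp]: "l \<notin> set bs" "remove1 l (bs @ l # as) = bs @ as" "mset as + mset bs = mset bs + mset as"
    using Cons.prems by (auto simp: remove1_append)
  have wd: "us @ map w (bs @ l # as) \<in> words t" using Cons.prems by (auto simp: words_def)
  have G: "srcs (map w (bs @ l # as)) = map c (bs @ l # as)" using Cons.prems by auto
  have "\<iota> t (us @ map w (bs @ l # as)) \<cdot> tid (srcs us) (perm_arr c ((l # as) @ bs) (bs @ l # as) I) =
     \<iota> t (us @ map w (bs @ l # as)) \<cdot> (tid (srcs us) (insert_arr c l (bs @ l # as) I) \<cdot> tid (srcs us) (Id M (c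
       l) \<boxtimes> perm_arr c (as @ bs) (bs @ as) I))"
    by (simp add: tid_srcs_Comp)
  also have "\<dots> = (\<iota> t (us @ map w (bs @ l # as)) \<cdot> tid (srcs us) (insert_arr c l (bs @ l # as) I)) \<cdot>
    tid (srcs us) (Id M (c l) \<boxtimes> perm_arr c (as @ bs) (bs @ as) I)"
  proof -
    have "Dom M (\<iota> t (us @ map w (bs @ l # as))) = tobj (srcs us) (tobj (map c (bs @ l # as)) I)"
    proof -
      have "Dom M (\<iota> t (us @ map w (bs @ l # as))) = tobj (srcs us) (G (map w (bs @ l # as)))"
        using \<iota>_typ(2)[OF t wd] by simp
      then show ?thesis unfolding G .
    qed
    then show ?thesis using \<iota>_typ(1)[OF t wd] by simp
  qed
  also have "\<iota> t (us @ map w (bs @ l # as)) \<cdot> tid (srcs us) (insert_arr c l (bs @ l # as) I) =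
    \<iota> t (us @ map w (l # bs @ as))"
    by (rule \<iota>_insert[OF t, of "set (l # as) \<union> set bs"]) (use Cons.prems in auto)
  also have "\<iota> t (us @ map w (l # bs @ as)) \<cdot> tid (srcs us) (Id M (c l) \<boxtimes> perm_arr c (as @ bs) (bs @ as) I) =
     \<iota> t ((us @ [w l]) @ map w (bs @ as)) \<cdot> tid (srcs (us @ [w l])) (perm_arr c (as @ bs) (bs @ as) I)"
    using Cons.prems(2)[of l] by simp
  also have "\<dots> = \<iota> t ((us @ [w l]) @ map w (as @ bs))"
    by (rule Cons.IH) (use Cons.prems in auto)
  finally show ?case by simp
qed

text \<open>\<open>Sym_append\<close> turns the symmetry of two tensor products into a rearrangement
  of letters, which \<open>\<iota>_block_swap\<close> absorbs.\<close>

lemma \<iota>_Sym: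
  assumes t: "t \<in> Obj D" and fs: "fs \<in> words t" and gs: "gs \<in> words t"
    and orth: "\<And>f g. f \<in> set fs \<Longrightarrow> g \<in> set gs \<Longrightarrow> (f, g) \<in> orth"
  shows "\<iota> t (gs @ fs) \<cdot> (append_arr (srcs gs) (G fs) \<cdot> Sym M (G fs) (G gs)) =
    \<iota> t (fs @ gs) \<cdot> append_arr (srcs fs) (G gs)"
proof -
  \<comment> \<open>Letters are numbered by their places in \<open>fs @ gs\<close>, as a word may
    contain the same arrow twice.\<close>
  define as bs where "as = [0..<length fs]" and "bs = [length fs..<length fs + length gs]"
  define w where "w k = (fs @ gs) ! k" for k
  define c where "c k = src_obj (w k)" for k
  have c [simp]: "c k \<in> Obj M" for k by (simp add: c_def)
  have dist: "distinct (as @ bs)" by (auto simp: as_def bs_def)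
  have w: "map w as = fs" "map w bs = gs"
    by (auto simp: w_def as_def bs_def nth_append intro!: nth_equalityI)
  have wc: "map c as = srcs fs" "map c bs = srcs gs"
    unfolding w[symmetric] by (simp_all add: c_def comp_def)
  have ww: "into1 t (w k)" if "k \<in> set as \<union> set bs" for k
  proof -
    have "w k \<in> set (map w as) \<union> set (map w bs)" using that by auto
    then show ?thesis using fs gs unfolding w words_def by auto
  qed
  have oo: "(w j, w k) \<in> orth" if "j \<in> set as" "k \<in> set bs" for j k
  proof (rule orth)
    show "w j \<in> set fs" "w k \<in> set gs" using that w by (metis imageI list.set_map)+
  qed
  note wd = \<iota>_typ[OF t, of "gs @ fs"]
  note [simp] = perm_arr_simps[of c, OF c]
  have sw: "\<iota> t (gs @ fs) \<cdot> perm_arr c (as @ bs) (bs @ as) I = \<iota> t (fs @ gs)"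
    using \<iota>_block_swap[where us = "[]" and w = w and c = c, OF t ww c _ oo dist] by (simp add: c_def w)
  have "append_arr (srcs gs) (G fs) \<cdot> Sym M (G fs) (G gs) = perm_arr c (as @ bs) (bs @ as) I \<cdot>
    append_arr (srcs fs) (G gs)"
    using Sym_append[where a = c and as = as and bs = bs, OF c dist] unfolding wc .
  then have "\<iota> t (gs @ fs) \<cdot> (append_arr (srcs gs) (G fs) \<cdot> Sym M (G fs) (G gs)) =
      (\<iota> t (gs @ fs) \<cdot> perm_arr c (as @ bs) (bs @ as) I) \<cdot> append_arr (srcs fs) (G gs)"
    using wd fs gs wc by (simp add: add.commute)
  then show ?thesis by (simp only: sw)
qed

text \<open>All laws for arrows are tested on the jointly epic injections, where arrows act
  letterwise by post-composition; the commutation law then reduces to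
  \<open>\<iota>_Sym\<close>.\<close>

lemma monoid_functor_L: "monoid_functor M D orth L Lfun Lmu Lun"
proof (intro monoid_functor.intro monoid_functor_axioms.intro)
  show "symmetric_monoidal_category M" "orthogonal_category D orth" by unfold_locales
  show "monoid_object M (L t) (Lmu t) (Lun t)" if "t \<in> Obj D" for t by (rule monoid_object_L[OF that])
  show "Lfun f \<in> hom M (L (Dom D f)) (L (Cod D f))" if "f \<in> Arr D" for f using that by (simp add: hom_def)
  show "Lfun (cat.Id D t) = Id M (L t)" if t: "t \<in> Obj D" for t
  proof (rule L_eqI[OF t])
    fix fs assume fs: "fs \<in> words t"
    have "map ((\<cdot>\<^bsub>D\<^esub>) (cat.Id D t)) fs = fs" using fs by (intro map_idI) (auto simp: words_def into1_def)
    then show "Lfun (cat.Id D t) \<cdot> \<iota> t fs = Id M (L t) \<cdot> \<iota> t fs"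
      using Lfun_\<iota>[of "cat.Id D t" fs] t fs \<iota>_typ[OF t fs] by simp
  qed (use t in simp_all)
  show "Lfun (g \<cdot>\<^bsub>D\<^esub> f) = Lfun g \<cdot> Lfun f" if fg: "f \<in> Arr D" "g \<in> Arr D" "Dom D g = Cod D f" for f g
  proof (rule L_eqI[of "Dom D f"])
    fix fs assume fs: "fs \<in> words (Dom D f)"
    note w = words_post[OF fs fg(1)]
    have m: "map ((\<cdot>\<^bsub>D\<^esub>) (g \<cdot>\<^bsub>D\<^esub> f)) fs = map ((\<cdot>\<^bsub>D\<^esub>) g) (map ((\<cdot>\<^bsub>D\<^esub>) f) fs)"
      using fs fg by (auto simp: words_def into1_def)
    have "Lfun (g \<cdot>\<^bsub>D\<^esub> f) \<cdot> \<iota> (Dom D f) fs = \<iota> (Cod D g) (map ((\<cdot>\<^bsub>D\<^esub>) (g \<cdot>\<^bsub>D\<^esub> f)) fs)"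
      using Lfun_\<iota>[of "g \<cdot>\<^bsub>D\<^esub> f" fs] fs fg by simp
    also have "\<dots> = \<iota> (Cod D g) (map ((\<cdot>\<^bsub>D\<^esub>) g) (map ((\<cdot>\<^bsub>D\<^esub>) f) fs))"
      by (simp only: m)
    also have "\<dots> = Lfun g \<cdot> \<iota> (Cod D f) (map ((\<cdot>\<^bsub>D\<^esub>) f) fs)"
      using Lfun_\<iota>[OF fg(2), of "map ((\<cdot>\<^bsub>D\<^esub>) f) fs"] w fg(3) by simp
    also have "\<dots> = (Lfun g \<cdot> Lfun f) \<cdot> \<iota> (Dom D f) fs"
      using Lfun_\<iota>[OF fg(1) fs] fg \<iota>_typ[OF _ fs] by simp
    finally show "Lfun (g \<cdot>\<^bsub>D\<^esub> f) \<cdot> \<iota> (Dom D f) fs = (Lfun g \<cdot> Lfun f) \<cdot> \<iota> (Dom D f) fs" .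
  qed (use fg in simp_all)
  show "Lfun f \<cdot> Lun (Dom D f) = Lun (Cod D f)" if "f \<in> Arr D" for f
    using Lfun_\<iota>[OF that, of "[]"] by (simp add: Lun_def)
  show "Lfun f \<cdot> Lmu (Dom D f) = Lmu (Cod D f) \<cdot> (Lfun f \<boxtimes> Lfun f)" if f [simp]: "f \<in> Arr D" for f
  proof (rule LL_eqI[of "Dom D f" "Dom D f"])
    have d [simp]: "Dom D f \<in> Obj D" "Cod D f \<in> Obj D" by simp_all
    fix fs gs assume w: "fs \<in> words (Dom D f)" "gs \<in> words (Dom D f)"
    note w' = words_post[OF w(1) f] words_post[OF w(2) f]
    have "fs @ gs \<in> words (Dom D f)" using w by simp
    note t = \<iota>_typ[OF d(1) w(1)] \<iota>_typ[OF d(1) w(2)] \<iota>_typ[OF d(1) this]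
    have "(Lfun f \<cdot> Lmu (Dom D f)) \<cdot> (\<iota> (Dom D f) fs \<boxtimes> \<iota> (Dom D f) gs) = (Lfun f \<cdot> \<iota> (Dom D f) (fs @ gs)) \<cdot>
      append_arr (srcs fs) (G gs)"
      using t by (simp add: Lmu_\<iota>[OF d(1) w])
    also have "\<dots> = \<iota> (Cod D f) (map ((\<cdot>\<^bsub>D\<^esub>) f) fs @ map ((\<cdot>\<^bsub>D\<^esub>) f) gs) \<cdot> append_arr (srcs fs) (G gs)"
      using Lfun_\<iota>[OF f, of "fs @ gs"] w by simp
    also have "\<dots> = Lmu (Cod D f) \<cdot> (\<iota> (Cod D f) (map ((\<cdot>\<^bsub>D\<^esub>) f) fs) \<boxtimes> \<iota> (Cod D f) (map ((\<cdot>\<^bsub>D\<^esub>) f) gs))"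
      using Lmu_\<iota>[OF d(2), of "map ((\<cdot>\<^bsub>D\<^esub>) f) fs" "map ((\<cdot>\<^bsub>D\<^esub>) f) gs"] unfolding w'[THEN conjunct2] using w' by simp
    also have "\<dots> = (Lmu (Cod D f) \<cdot> (Lfun f \<boxtimes> Lfun f)) \<cdot> (\<iota> (Dom D f) fs \<boxtimes> \<iota> (Dom D f) gs)"
      using t by (simp add: Lfun_\<iota>[OF f w(1)] Lfun_\<iota>[OF f w(2)])
    finally show "(Lfun f \<cdot> Lmu (Dom D f)) \<cdot> (\<iota> (Dom D f) fs \<boxtimes> \<iota> (Dom D f) gs) =
       (Lmu (Cod D f) \<cdot> (Lfun f \<boxtimes> Lfun f)) \<cdot> (\<iota> (Dom D f) fs \<boxtimes> \<iota> (Dom D f) gs)" .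
  qed simp_all
  show "Lmu (Cod D f) \<cdot> (Lfun f \<boxtimes> Lfun g) = Lmu (Cod D f) \<cdot> ((Lfun g \<boxtimes> Lfun f) \<cdot> Sym M (L (Dom D f)) (L (Dom D g)))"
    if fg: "(f, g) \<in> orth" for f g
  proof -
    have f [simp]: "f \<in> Arr D" "g \<in> Arr D" "Cod D g = Cod D f" using D.orth_Arr[OF fg] by auto
    have d [simp]: "Dom D f \<in> Obj D" "Dom D g \<in> Obj D" "Cod D f \<in> Obj D" by simp_all
    show ?thesis
    proof (rule LL_eqI[of "Dom D f" "Dom D g"])
      fix fs gs assume w: "fs \<in> words (Dom D f)" "gs \<in> words (Dom D g)"
      let ?t = "Cod D f" and ?fs = "map ((\<cdot>\<^bsub>D\<^esub>) f) fs" and ?gs = "map ((\<cdot>\<^bsub>D\<^esub>) g) gs"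
      have w': "?fs \<in> words ?t" "?gs \<in> words ?t" "srcs ?fs = srcs fs" "srcs ?gs = srcs gs"
        using words_post[OF w(1) f(1)] words_post[OF w(2) f(2)] by simp_all
      note t = \<iota>_typ[OF d(1) w(1)] \<iota>_typ[OF d(2) w(2)]
      note t' = \<iota>_typ[OF d(3) w'(1), unfolded w'(3)] \<iota>_typ[OF d(3) w'(2), unfolded w'(4)]
      have lf: "Lfun f \<cdot> \<iota> (Dom D f) fs = \<iota> ?t ?fs" "Lfun g \<cdot> \<iota> (Dom D g) gs = \<iota> ?t ?gs"
        using Lfun_\<iota>[OF f(1) w(1)] Lfun_\<iota>[OF f(2) w(2)] by simp_all
      \<comment> \<open>Stability under pre-composition: the letters of \<open>?fs\<close> factor
        through \<open>f\<close> and those of \<open>?gs\<close> through \<open>g\<close>.\<close>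
      have o: "(f', g') \<in> orth" if "f' \<in> set ?fs" "g' \<in> set ?gs" for f' g'
        using that w D.orth_pre[OF fg] by (auto simp: words_def into1_def)
      have "(Lmu ?t \<cdot> ((Lfun g \<boxtimes> Lfun f) \<cdot> Sym M (L (Dom D f)) (L (Dom D g)))) \<cdot> (\<iota> (Dom D f) fs \<boxtimes> \<iota> (Dom D g) gs) =
         Lmu ?t \<cdot> (((Lfun g \<cdot> \<iota> (Dom D g) gs) \<boxtimes> (Lfun f \<cdot> \<iota> (Dom D f) fs)) \<cdot> Sym M (G fs) (G gs))"
        using t by (simp add: Sym_nat')
      also have "\<dots> = (Lmu ?t \<cdot> (\<iota> ?t ?gs \<boxtimes> \<iota> ?t ?fs)) \<cdot> Sym M (G fs) (G gs)"
        unfolding lf using t' by simp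
      also have "\<dots> = \<iota> ?t (?gs @ ?fs) \<cdot> (append_arr (srcs gs) (G fs) \<cdot> Sym M (G fs) (G gs))"
      proof -
        have gf: "?gs @ ?fs \<in> words ?t" using w' by simp
        have "Dom M (\<iota> ?t (?gs @ ?fs)) = tobj (srcs gs) (G fs)"
          using \<iota>_typ(2)[OF d(3) gf] unfolding map_append tobj_simps w'(3,4) .
        then show ?thesis
          using Lmu_\<iota>[OF d(3) w'(2,1)] \<iota>_typ(1)[OF d(3) gf] unfolding w'(3,4) by simp
      qed
      also have "\<dots> = \<iota> ?t (?fs @ ?gs) \<cdot> append_arr (srcs fs) (G gs)"
        using \<iota>_Sym[OF d(3) w'(1,2) o] unfolding w'(3,4) .
      also have "\<dots> = Lmu ?t \<cdot> (\<iota> ?t ?fs \<boxtimes> \<iota> ?t ?gs)"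
        using Lmu_\<iota>[OF d(3) w'(1,2)] unfolding w'(3,4) by simp
      also have "\<dots> = (Lmu ?t \<cdot> (Lfun f \<boxtimes> Lfun g)) \<cdot> (\<iota> (Dom D f) fs \<boxtimes> \<iota> (Dom D g) gs)"
        using t lf by simp
      finally show "(Lmu ?t \<cdot> (Lfun f \<boxtimes> Lfun g)) \<cdot> (\<iota> (Dom D f) fs \<boxtimes> \<iota> (Dom D g) gs) =
        (Lmu ?t \<cdot> ((Lfun g \<boxtimes> Lfun f) \<cdot> Sym M (L (Dom D f)) (L (Dom D g)))) \<cdot> (\<iota> (Dom D f) fs \<boxtimes> \<iota> (Dom D g) gs)" by simp
    qed simp_all
  qed
qed

lemma into_F:
  assumes t: "t \<in> Obj C" and fs: "fs \<in> words t"
  shows "monoid_object.into M (X t) (map F fs)" "map (Dom M) (map F fs) = srcs fs"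
proof -
  interpret m: monoid_object M "X t" "mu t" "un t" by (rule A.mon[OF t])
  have "F f \<in> Arr M \<and> Dom M (F f) = src_obj f \<and> Cod M (F f) = X t" if "into1 t f" for f
    using words_C[OF t that] into1D[OF that] by simp
  then show "m.into (map F fs)" "map (Dom M) (map F fs) = srcs fs"
    using fs by (auto simp: m.into_def words_def)
qed

text \<open>Over \<open>C\<close> the injections are iterated products, and \<open>F f\<close>,
  being a monoid homomorphism, satisfies the equations that determine \<open>Lfun f\<close>.\<close>

lemma Lfun_C:
  assumes f [simp]: "f \<in> Arr C"
  shows "Lfun f = F f"
proof (rule L_eqI[of "Dom D f"])
  fix fs assume fs: "fs \<in> words (Dom D f)"
  interpret m: monoid_object M "X (Dom D f)" "mu (Dom D f)" "un (Dom D f)" by (rule A.mon) simp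
  interpret m': monoid_object M "X (Cod D f)" "mu (Cod D f)" "un (Cod D f)" by (rule A.mon) simp
  have act_arr: "F (f \<cdot>\<^bsub>D\<^esub> g) = F f \<cdot> F g" if "into1 (Dom D f) g" for g
    using words_C[OF _ that] by (simp add: sub_Comp A.F_Comp)
  have "F f \<cdot> m.pr (map F fs) = m'.pr (map ((\<cdot>) (F f)) (map F fs))"
    by (rule m.prod_arr_hom[OF m'.monoid_object_axioms _ _ _ into_F(1)[OF _ fs]])
      (use A.F_mu[of f] A.F_un[of f] in \<open>simp_all add: hom_def\<close>)
  also have "map ((\<cdot>) (F f)) (map F fs) = map F (map ((\<cdot>\<^bsub>D\<^esub>) f) fs)"
    using fs act_arr by (auto simp: words_def)
  finally show "Lfun f \<cdot> \<iota> (Dom D f) fs = F f \<cdot> \<iota> (Dom D f) fs"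
    using words_post[OF fs] fs by (simp add: Lfun_\<iota>) (simp add: \<iota>_C)
qed (simp_all add: L_C)

text \<open>By \<open>prod_arr_append\<close>, the multiplication of \<open>X t\<close> satisfies
  the equations that determine \<open>Lmu t\<close>.\<close>

lemma Lmu_C:
  assumes t [simp]: "t \<in> Obj C"
  shows "Lmu t = mu t"
proof (rule LL_eqI[of t t])
  fix fs gs assume w: "fs \<in> words t" "gs \<in> words t"
  interpret m: monoid_object M "X t" "mu t" "un t" by (rule A.mon) simp
  have "mu t \<cdot> (m.pr (map F fs) \<boxtimes> m.pr (map F gs)) = m.pr (map F fs @ map F gs) \<cdot> append_arr (srcs fs) (G gs)"
    using m.prod_arr_append[OF into_F(1)[OF t w(1)] into_F(1)[OF t w(2)]] unfolding into_F(2)[OF t w(1)]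
      into_F(2)[OF t w(2)] .
  then show "Lmu t \<cdot> (\<iota> t fs \<boxtimes> \<iota> t gs) = mu t \<cdot> (\<iota> t fs \<boxtimes> \<iota> t gs)"
    using w by (simp add: Lmu_\<iota>) (simp add: \<iota>_C)
qed (simp_all add: L_C)

lemma Lun_C: "t \<in> Obj C \<Longrightarrow> Lun t = un t"
  by (simp add: Lun_def \<iota>_C)

text \<open>The one-letter word \<open>f\<close> is the image under \<open>Lfun f\<close> of the
  word of the identity over \<open>Dom D f\<close>, whose injection is a right unitor. So the
  injections are generated by the structure of the extension, which makes morphisms out of it
  unique.\<close>

lemma \<iota>_Cons:
  assumes t [simp]: "t \<in> Obj D" and f: "into1 t f" and fs: "fs \<in> words t"
  shows "\<iota> t (f # fs) = Lmu t \<cdot> (Lfun f \<boxtimes> \<iota> t fs)"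
proof (rule iso_epi[of "RUnit M (src_obj f) \<boxtimes> Id M (G fs)"])
  let ?c = "Dom D f" and ?i = "cat.Id D (Dom D f)"
  have c: "?c \<in> Obj C" "f \<in> Arr D" "Cod D f = t" "src_obj f = X ?c" using f by (auto simp: into1D)
  interpret m: monoid_object M "X ?c" "mu ?c" "un ?c" by (rule A.mon[OF c(1)])
  have i: "[?i] \<in> words ?c" using c by (simp add: into1_def)
  have "\<iota> ?c [?i] = RUnit M (X ?c)"
    using c(1) i by (simp add: \<iota>_C sub_Id A.F_Id m.unit_right)
  then have *: "Lfun f \<cdot> RUnit M (X ?c) = \<iota> t [f]"
    using Lfun_\<iota>[OF c(2) i] c by simp
  have w: "[f] \<in> words t" "f # fs \<in> words t" using f fs by simp_all
  note t' = \<iota>_typ[OF t w(1)] \<iota>_typ[OF t w(2)] \<iota>_typ[OF t fs]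
  have "Lmu t \<cdot> (\<iota> t [f] \<boxtimes> \<iota> t fs) = \<iota> t (f # fs) \<cdot> (RUnit M (src_obj f) \<boxtimes> Id M (G fs))"
    using Lmu_\<iota>[OF t w(1) fs] by (simp add: triangle)
  then show "\<iota> t (f # fs) \<cdot> (RUnit M (src_obj f) \<boxtimes> Id M (G fs)) =
      (Lmu t \<cdot> (Lfun f \<boxtimes> \<iota> t fs)) \<cdot> (RUnit M (src_obj f) \<boxtimes> Id M (G fs))"
    unfolding *[symmetric] using t' c by (simp add: L_C)
  show "Lmu t \<cdot> (Lfun f \<boxtimes> \<iota> t fs) \<in> Arr M" "Dom M (Lmu t \<cdot> (Lfun f \<boxtimes> \<iota> t fs)) =
    Cod M (RUnit M (src_obj f) \<boxtimes> Id M (G fs))"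
    using t' c by (simp_all add: L_C)
  show "\<iota> t (f # fs) \<in> Arr M" "Dom M (\<iota> t (f # fs)) = Cod M (RUnit M (src_obj f) \<boxtimes> Id M (G fs))"
    using t' c by (simp_all add: L_C)
qed simp

text \<open>On a word the morphism is forced to be the product of its values on letters. Existence
  is \<open>prod_cocone\<close> for these values, uniqueness an induction along
  \<open>\<iota>_Cons\<close>.\<close>

lemma universal:
  assumes B: "monoid_functor M D orth Y FY muY unY"
    and \<phi>: "mon_nat M C X F mu un Y FY muY unY \<phi>"
  shows "\<exists>g. mon_nat M D L Lfun Lmu Lun Y FY muY unY g \<and> (\<forall>t \<in> Obj C. g t = \<phi> t) \<and>
    (\<forall>g'. mon_nat M D L Lfun Lmu Lun Y FY muY unY g' \<and> (\<forall>t \<in> Obj C. g' t = \<phi> t) \<longrightarrow> (\<forall>t \<in> Obj D. g' t = g t))"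
proof -
  interpret B: monoid_functor M D orth Y FY muY unY by fact
  \<comment> \<open>A letter must act by \<open>\<phi>\<close> at its domain, which lies in
    \<open>C\<close>, followed by transport along the letter.\<close>
  define b where "b f = FY f \<cdot> \<phi> (Dom D f)" for f
  define \<beta> where "\<beta> t fs = prod_arr M (muY t) (unY t) (map b fs)" for t fs
  have \<phi>t: "\<phi> t \<in> Arr M" "Dom M (\<phi> t) = X t" "Cod M (\<phi> t) = Y t" "\<phi> t \<cdot> mu t = muY t \<cdot> (\<phi> t \<boxtimes> \<phi> t)" "\<phi> t \<cdot> un t = unY t"
    if "t \<in> Obj C" for t using \<phi> that by (auto simp: mon_nat_def hom_def)
  have \<phi>f: "\<phi> (Cod D f) \<cdot> F f = FY f \<cdot> \<phi> (Dom D f)" if "f \<in> Arr C" for f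
    using \<phi> that by (auto simp: mon_nat_def)
  have Bmon: "muY t \<in> Arr M" "Dom M (muY t) = Y t \<otimes> Y t" "Cod M (muY t) = Y t" "unY t \<in> Arr M" "Dom M (unY t) =
    I" "Cod M (unY t) = Y t"
    if "t \<in> Obj D" for t using monoid_object.m_u_typ[OF B.mon[OF that]] by simp_all
  have bt: "b f \<in> Arr M" "Dom M (b f) = X (Dom D f)" "Cod M (b f) = Y t" "Dom M (b f) = src_obj f"
    if "into1 t f" for f t
    using into1D[OF that] \<phi>t[of "Dom D f"] by (simp_all add: b_def)
  have cocone: "gcocone M (words t) (edges t) G (Y t) (\<beta> t)" if t: "t \<in> Obj D" for t
    unfolding \<beta>_def
  proof (rule prod_cocone[OF B.mon[OF t]])
    show "b f \<in> hom M (X (Dom D f)) (Y t)" if "into1 t f" for f using bt[OF that] by (simp add: hom_def)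
    show "b (f \<cdot>\<^bsub>D\<^esub> g) = b f \<cdot> F g" if "into1 t f" "g \<in> Arr C" "Cod D g = Dom D f" for f g
      using into1D[OF that(1)] that \<phi>f[of g] \<phi>t[of "Dom D f"] \<phi>t[of "Dom D g"] by (simp add: b_def B.F_Comp)
    show "b f \<cdot> mu (Dom D f) = muY t \<cdot> (b f \<boxtimes> b f)" if "into1 t f" for f
      using into1D[OF that] \<phi>t[of "Dom D f"] B.F_mu[of f] Bmon[of "Dom D f"] Bmon[OF t] reassoc[OF B.F_mu[of f],
        of "\<phi> (Dom D f) \<boxtimes> \<phi> (Dom D f)"]
      by (simp add: b_def)
    show "b f \<cdot> un (Dom D f) = unY t" if "into1 t f" for f
      using into1D[OF that] \<phi>t[of "Dom D f"] B.F_un[of f] by (simp add: b_def)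
    show "muY t \<cdot> (b f \<boxtimes> b g) = muY t \<cdot> ((b g \<boxtimes> b f) \<cdot> Sym M (X (Dom D f)) (X (Dom D g)))"
      if "into1 t f" "into1 t g" "(f, g) \<in> orth" for f g
    proof -
      note f = into1D[OF that(1)] \<phi>t[of "Dom D f"] and g = into1D[OF that(2)] \<phi>t[of "Dom D g"]
      have "muY t \<cdot> (b f \<boxtimes> b g) = (muY t \<cdot> (FY f \<boxtimes> FY g)) \<cdot> (\<phi> (Dom D f) \<boxtimes> \<phi> (Dom D g))"
        using f g Bmon[OF t] by (simp add: b_def)
      also have "muY t \<cdot> (FY f \<boxtimes> FY g) = muY t \<cdot> ((FY g \<boxtimes> FY f) \<cdot> Sym M (Y (Dom D f)) (Y (Dom D g)))"
        using B.F_orth[OF that(3)] f by simp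
      also have "\<dots> \<cdot> (\<phi> (Dom D f) \<boxtimes> \<phi> (Dom D g)) = muY t \<cdot> ((b g \<boxtimes> b f) \<cdot> Sym M (X (Dom D f)) (X (Dom D g)))"
        using f g Bmon[OF t] by (simp add: b_def Sym_nat')
      finally show ?thesis .
    qed
  qed
  have "\<forall>t \<in> Obj D. \<exists>h. h \<in> hom M (L t) (Y t) \<and> (\<forall>fs \<in> words t. h \<cdot> \<iota> t fs = \<beta> t fs)"
    using L_factor[OF _ cocone] by blast
  then obtain g where g: "\<And>t. t \<in> Obj D \<Longrightarrow> g t \<in> hom M (L t) (Y t)"
     and g\<iota>: "\<And>t fs. t \<in> Obj D \<Longrightarrow> fs \<in> words t \<Longrightarrow> g t \<cdot> \<iota> t fs = \<beta> t fs" by metis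
  have gt: "g t \<in> Arr M" "Dom M (g t) = L t" "Cod M (g t) = Y t" if "t \<in> Obj D" for t using g[OF that]
    by (auto simp: hom_def)
  have into: "monoid_object.into M (Y t) (map b fs)" and Dom: "map (Dom M) (map b fs) = srcs fs"
    if "t \<in> Obj D" "fs \<in> words t" for t fs
  proof -
    interpret m: monoid_object M "Y t" "muY t" "unY t" by (rule B.mon[OF that(1)])
    show "m.into (map b fs)" "map (Dom M) (map b fs) = srcs fs"
      using that(2) bt by (auto simp: m.into_def words_def)
  qed
  have "mon_nat M D L Lfun Lmu Lun Y FY muY unY g"
    unfolding mon_nat_def
  proof (intro conjI ballI g)
    show "g t \<cdot> Lun t = unY t" if "t \<in> Obj D" for t using g\<iota>[OF that, of "[]"] by (simp add: Lun_def \<beta>_def)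
    show "g t \<cdot> Lmu t = muY t \<cdot> (g t \<boxtimes> g t)" if t: "t \<in> Obj D" for t
    proof (rule LL_eqI[OF t t])
      fix fs gs assume w: "fs \<in> words t" "gs \<in> words t"
      interpret m: monoid_object M "Y t" "muY t" "unY t" by (rule B.mon[OF t])
      have w': "fs @ gs \<in> words t" using w by simp
      note \<iota>t = \<iota>_typ[OF t w(1)] \<iota>_typ[OF t w(2)] \<iota>_typ[OF t w']
      have "(g t \<cdot> Lmu t) \<cdot> (\<iota> t fs \<boxtimes> \<iota> t gs) = (g t \<cdot> \<iota> t (fs @ gs)) \<cdot> append_arr (srcs fs) (G gs)"
        using gt[OF t] \<iota>t t by (simp add: Lmu_\<iota>[OF t w])
      also have "\<dots> = muY t \<cdot> (\<beta> t fs \<boxtimes> \<beta> t gs)"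
        using m.prod_arr_append[OF into[OF t w(1)] into[OF t w(2)]]
        unfolding Dom[OF t w(1)] Dom[OF t w(2)] g\<iota>[OF t w'] \<beta>_def map_append by simp
      also have "\<dots> = (muY t \<cdot> (g t \<boxtimes> g t)) \<cdot> (\<iota> t fs \<boxtimes> \<iota> t gs)"
        using gt[OF t] \<iota>t t by (simp add: g\<iota>[OF t w(1)] g\<iota>[OF t w(2)])
      finally show "(g t \<cdot> Lmu t) \<cdot> (\<iota> t fs \<boxtimes> \<iota> t gs) = (muY t \<cdot> (g t \<boxtimes> g t)) \<cdot> (\<iota> t fs \<boxtimes> \<iota> t gs)" .
    qed (use gt[OF t] Bmon[OF t] t in simp_all)
    show "g (Cod D f) \<cdot> Lfun f = FY f \<cdot> g (Dom D f)" if f [simp]: "f \<in> Arr D" for f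
    proof (rule L_eqI[of "Dom D f"])
      have d: "Dom D f \<in> Obj D" "Cod D f \<in> Obj D" by simp_all
      interpret m: monoid_object M "Y (Dom D f)" "muY (Dom D f)" "unY (Dom D f)" by (rule B.mon[OF d(1)])
      interpret m': monoid_object M "Y (Cod D f)" "muY (Cod D f)" "unY (Cod D f)" by (rule B.mon[OF d(2)])
      fix fs assume fs: "fs \<in> words (Dom D f)"
      have w: "map ((\<cdot>\<^bsub>D\<^esub>) f) fs \<in> words (Cod D f)" using words_post[OF fs f] by simp
      note \<iota>t = \<iota>_typ[OF d(1) fs] \<iota>_typ[OF d(2) w]
      have bb: "b (f \<cdot>\<^bsub>D\<^esub> h) = FY f \<cdot> b h" if "into1 (Dom D f) h" for h
        using into1D[OF that] \<phi>t[of "Dom D h"] by (simp add: b_def B.F_Comp)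
      have "(g (Cod D f) \<cdot> Lfun f) \<cdot> \<iota> (Dom D f) fs = \<beta> (Cod D f) (map ((\<cdot>\<^bsub>D\<^esub>) f) fs)"
        using gt[OF d(2)] \<iota>t Lfun_\<iota>[OF f fs] g\<iota>[OF d(2) w] by simp
      also have "\<dots> = m'.pr (map ((\<cdot>) (FY f)) (map b fs))"
        unfolding \<beta>_def using fs bb by (intro arg_cong[where f="m'.pr"]) (auto simp: words_def)
      also have "\<dots> = FY f \<cdot> m.pr (map b fs)"
        by (rule m.prod_arr_hom[OF m'.monoid_object_axioms _ _ _ into[OF d(1) fs], symmetric])
          (use B.F_mu[of f] B.F_un[of f] in \<open>simp_all add: hom_def\<close>)
      also have "\<dots> = (FY f \<cdot> g (Dom D f)) \<cdot> \<iota> (Dom D f) fs"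
        using gt[OF d(1)] \<iota>t g\<iota>[OF d(1) fs] by (simp add: \<beta>_def)
      finally show "(g (Cod D f) \<cdot> Lfun f) \<cdot> \<iota> (Dom D f) fs = (FY f \<cdot> g (Dom D f)) \<cdot> \<iota> (Dom D f) fs" .
    qed (use gt[of "Dom D f"] gt[of "Cod D f"] in simp_all)
  qed
  \<comment> \<open>Over \<open>C\<close> both arrows send the injection of a word to the same
    product, as \<open>b f = \<phi> t \<cdot> F f\<close> by naturality of
    \<open>\<phi>\<close>.\<close>
  moreover have "g t = \<phi> t" if t: "t \<in> Obj C" for t
  proof (rule L_eqI[of t])
    interpret m: monoid_object M "X t" "mu t" "un t" by (rule A.mon[OF t])
    interpret m': monoid_object M "Y t" "muY t" "unY t" by (rule B.mon[OF Obj_sub[OF t]])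
    fix fs assume fs: "fs \<in> words t"
    have bb: "b f = \<phi> t \<cdot> F f" if "into1 t f" for f
      using words_C[OF t that] \<phi>f[of f] into1D[OF that] by (simp add: b_def)
    have "\<phi> t \<cdot> m.pr (map F fs) = m'.pr (map ((\<cdot>) (\<phi> t)) (map F fs))"
      by (rule m.prod_arr_hom[OF m'.monoid_object_axioms _ _ _ into_F(1)[OF t fs]])
        (use \<phi>t[OF t] in \<open>simp_all add: hom_def\<close>)
    also have "\<dots> = \<beta> t fs"
      unfolding \<beta>_def using fs bb by (intro arg_cong[where f="m'.pr"]) (auto simp: words_def)
    finally show "g t \<cdot> \<iota> t fs = \<phi> t \<cdot> \<iota> t fs"
      using t fs by (simp add: g\<iota>) (simp add: \<iota>_C)
  qed (use t gt[of t] \<phi>t[OF t] in \<open>simp_all add: L_C\<close>)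
  moreover have "g' t = g t" if g': "mon_nat M D L Lfun Lmu Lun Y FY muY unY g'" "\<forall>t \<in> Obj C. g' t = \<phi> t" and t:
    "t \<in> Obj D" for g' t
  proof (rule L_eqI[OF t])
    have g't: "g' s \<in> Arr M" "Dom M (g' s) = L s" "Cod M (g' s) = Y s" if "s \<in> Obj D" for s
      using g'(1) that by (auto simp: mon_nat_def hom_def)
    have g'mu: "g' t \<cdot> Lmu t = muY t \<cdot> (g' t \<boxtimes> g' t)" "g' t \<cdot> Lun t = unY t" using g'(1) t by (auto simp: mon_nat_def)
    fix fs assume "fs \<in> words t"
    then have "g' t \<cdot> \<iota> t fs = \<beta> t fs"
    proof (induction fs)
      case Nil
      then show ?case using g'mu(2) by (simp add: Lun_def \<beta>_def)
    next
      case (Cons f fs)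
      have f: "into1 t f" "fs \<in> words t" using Cons.prems by simp_all
      note f' = into1D[OF f(1)]
      note \<iota>t = \<iota>_typ[OF t f(2)]
      have nat: "g' t \<cdot> Lfun f = b f" using g' f' by (auto simp: mon_nat_def b_def)
      have "g' t \<cdot> \<iota> t (f # fs) = (g' t \<cdot> Lmu t) \<cdot> (Lfun f \<boxtimes> \<iota> t fs)"
        using g't[OF t] f' \<iota>t t by (simp add: \<iota>_Cons[OF t f])
      also have "\<dots> = muY t \<cdot> ((g' t \<cdot> Lfun f) \<boxtimes> (g' t \<cdot> \<iota> t fs))"
        unfolding g'mu using g't[OF t] f' \<iota>t t Bmon[OF t] by simp
      also have "\<dots> = \<beta> t (f # fs)"
        using Cons.IH[OF f(2)] by (simp add: nat \<beta>_def)
      finally show ?case .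
    qed
    then show "g' t \<cdot> \<iota> t fs = g t \<cdot> \<iota> t fs" using g\<iota>[OF t \<open>fs \<in> words t\<close>] by simp
  next
    show "g' t \<in> Arr M" "Dom M (g' t) = L t" "Cod M (g' t) = Cod M (g t)"
      using g'(1) t gt[OF t] by (auto simp: mon_nat_def hom_def)
  qed (use gt[OF t] in simp_all)
  ultimately show ?thesis by blast
qed

end

section \<open>Small index sets\<close>

definition small :: "'a itself \<Rightarrow> 'u itself \<Rightarrow> bool" where
  "small _ _ \<longleftrightarrow> (\<exists>f :: 'a \<Rightarrow> 'u. inj f)"

lemma small_self: "small TYPE('u) TYPE('u)"
  unfolding small_def by (rule exI[of _ id]) simp

text \<open>The cardinal identity that an infinite cardinal equals its square.\<close>

lemma small_prod_self:
  assumes "infinite (UNIV :: 'u set)"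
  shows "small TYPE('u \<times> 'u) TYPE('u)"
proof -
  have "(card_of ((UNIV :: 'u set) \<times> (UNIV :: 'u set)), card_of (UNIV :: 'u set)) \<in> ordIso"
    by (rule card_of_Times_same_infinite[OF assms])
  then have "(card_of ((UNIV :: 'u set) \<times> (UNIV :: 'u set)), card_of (UNIV :: 'u set)) \<in> ordLeq"
    by (simp add: ordIso_iff_ordLeq)
  then have "\<exists>f :: 'u \<times> 'u \<Rightarrow> 'u. inj_on f (UNIV \<times> UNIV) \<and> f ` (UNIV \<times> UNIV) \<subseteq> UNIV"
    by (simp only: card_of_ordLeq)
  then show ?thesis by (auto simp: small_def)
qed

lemma small_prod:
  assumes u: "infinite (UNIV :: 'u set)" and "small TYPE('a) TYPE('u)" "small TYPE('b) TYPE('u)"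
  shows "small TYPE('a \<times> 'b) TYPE('u)"
proof -
  obtain f :: "'a \<Rightarrow> 'u" where "inj f" using assms(2) by (auto simp: small_def)
  moreover obtain g :: "'b \<Rightarrow> 'u" where "inj g" using assms(3) by (auto simp: small_def)
  moreover obtain p :: "'u \<times> 'u \<Rightarrow> 'u" where "inj p" using small_prod_self[OF u] by (auto simp: small_def)
  ultimately have "inj (\<lambda>(a, b). p (f a, g b))" by (intro injI) (auto simp: inj_eq)
  then show ?thesis unfolding small_def by (rule exI[where P = inj])
qed

lemma small_nat: "infinite (UNIV :: 'u set) \<Longrightarrow> small TYPE(nat) TYPE('u)"
  using infinite_countable_subset[of UNIV] by (auto simp: small_def)

lemma small_sum:
  assumes u: "infinite (UNIV :: 'u set)" and "small TYPE('a) TYPE('u)" "small TYPE('b) TYPE('u)"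
  shows "small TYPE('a + 'b) TYPE('u)"
proof -
  obtain f :: "'a \<Rightarrow> 'u" where "inj f" using assms(2) by (auto simp: small_def)
  moreover obtain g :: "'b \<Rightarrow> 'u" where "inj g" using assms(3) by (auto simp: small_def)
  moreover obtain p :: "nat \<times> 'u \<Rightarrow> 'u" where "inj p"
    using small_prod[OF u small_nat[OF u] small_self] by (auto simp: small_def)
  ultimately have "inj (\<lambda>x. case x of Inl a \<Rightarrow> p (0, f a) | Inr b \<Rightarrow> p (1, g b))"
    by (intro injI) (auto simp: inj_eq split: sum.splits)
  then show ?thesis unfolding small_def by (rule exI[where P = inj])
qed

text \<open>A list is coded by its length and a fold of the pairing function; among lists of one
  length the fold is injective whatever its starting value.\<close>

lemma small_list:
  assumes u: "infinite (UNIV :: 'u set)"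
  shows "small TYPE('u list) TYPE('u)"
proof -
  obtain p :: "'u \<times> 'u \<Rightarrow> 'u" where p: "inj p" using small_prod_self[OF u] by (auto simp: small_def)
  obtain q :: "nat \<times> 'u \<Rightarrow> 'u" where q: "inj q"
    using small_prod[OF u small_nat[OF u] small_self] by (auto simp: small_def)
  define e where "e xs = foldr (\<lambda>x y. p (x, y)) xs undefined" for xs
  have "xs = ys" if "length xs = length ys" "e xs = e ys" for xs ys
    using that by (induction xs ys rule: list_induct2) (auto simp: e_def inj_eq[OF p])
  then have "inj (\<lambda>xs. q (length xs, e xs))" by (intro injI) (auto simp: inj_eq[OF q])
  then show ?thesis unfolding small_def by (rule exI[where P = inj])
qed

lemma small_inj:
  assumes "inj (f :: 'a \<Rightarrow> 'b)" "small TYPE('b) TYPE('u)"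
  shows "small TYPE('a) TYPE('u)"
proof -
  obtain g :: "'b \<Rightarrow> 'u" where "inj g" using assms(2) by (auto simp: small_def)
  then have "inj (g \<circ> f)" using assms(1) by (rule inj_compose)
  then show ?thesis unfolding small_def by (rule exI[where P = inj])
qed

lemma small_rule:
  assumes u: "infinite (UNIV :: 'u set)"
  shows "small TYPE('u rule) TYPE('u)"
proof (rule small_inj)
  show "small TYPE(nat \<times> 'u \<times> 'u) TYPE('u)"
    by (intro small_prod[OF u] small_nat[OF u] small_self)
  show "inj (\<lambda>r :: 'u rule. case r of RuleAct f g \<Rightarrow> (0 :: nat, f, g) | RuleMult f \<Rightarrow> (1, f, f) | RuleUnit f \<Rightarrow> (2, f, f)
      | RuleSwap f g \<Rightarrow> (3, f, g))"
    by (intro injI) (auto split: rule.splits)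
qed

text \<open>Vertices are words and edges are rule instances in context. Both are small over the type
  of arrows, which therefore serves as the universe in which \<open>gcolim_exists\<close> finds its
  index category.\<close>

lemma (in extension) extension_colimits_ex:
  assumes bc: "bicomplete TYPE('a) M" and u: "infinite (UNIV :: 'a set)"
  shows "\<exists>L \<iota>. extension_colimits M D C orth X F mu un L \<iota>"
proof -
  have "small TYPE('a list \<times> 'a rule \<times> 'a list) TYPE('a)"
    by (intro small_prod[OF u] small_list[OF u] small_rule[OF u])
  then have "small TYPE(('a list + 'a list \<times> 'a rule \<times> 'a list) + ('a list \<times> 'a rule \<times> 'a list + 'a list \<times>
    'a rule \<times> 'a list)) TYPE('a)"
    by (intro small_sum[OF u] small_list[OF u])
  then obtain code :: "('a list + 'a list \<times> 'a rule \<times> 'a list) + ('a list \<times> 'a rule \<times> 'a list + 'a list \<times>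
    'a rule \<times> 'a list) \<Rightarrow> 'a"
    where code: "inj code" by (auto simp: small_def)
  have ex: "\<exists>L \<iota>. gcolim M (words t) (edges t) G L \<iota>" for t
    by (rule gcolim_exists[OF bc code wf_edges])
  \<comment> \<open>For objects of \<open>C\<close> the colimit is taken to be \<open>X t\<close>,
    by \<open>gcolim_C\<close>; elsewhere it is arbitrary.\<close>
  have "\<forall>t. \<exists>L \<iota>. gcolim M (words t) (edges t) G L \<iota> \<and>
     (t \<in> Obj C \<longrightarrow> L = X t \<and> \<iota> = (\<lambda>fs. prod_arr M (mu t) (un t) (map F fs)))"
    using ex gcolim_C by metis
  then obtain L \<iota> where "\<And>t. gcolim M (words t) (edges t) G (L t) (\<iota> t)"
     "\<And>t. t \<in> Obj C \<Longrightarrow> L t = X t \<and> \<iota> t = (\<lambda>fs. prod_arr M (mu t) (un t) (map F fs))" by metis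
  then have "extension_colimits M D C orth X F mu un L \<iota>"
    by unfold_locales auto
  then show ?thesis by blast
qed

section \<open>Universal arrows whose unit is the identity\<close>

text \<open>Identities are universal arrows into \<open>R\<close>, so a left adjoint with identity
  unit can be built. For an arbitrary adjunction the inverse of the unit is found by comparing
  \<open>FObj L a\<close> with the strict extension of \<open>a\<close>; full faithfulness then
  follows from invertibility of the unit.\<close>

lemma coreflection:
  fixes C :: "('o1, 'm1) cat" and D :: "('o2, 'm2) cat"
  assumes R: "is_functor D C R"
    and univ: "\<And>a. a \<in> Obj C \<Longrightarrow> \<exists>b \<in> Obj D. FObj R b = a \<and>
      (\<forall>d \<in> Obj D. \<forall>f \<in> hom C a (FObj R d). \<exists>!g. g \<in> hom D b d \<and> FArr R g = f)"
  shows "\<exists>L \<eta> \<epsilon>. adjunction C D L R \<eta> \<epsilon>"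
    and "adjunction C D L R \<eta> \<epsilon> \<Longrightarrow> nat_iso C C id_func (comp_func R L) \<eta> \<and> fully_faithful C D L"
proof -
  interpret C: category C using R by (simp add: is_functor_def)
  interpret D: category D using R by (simp add: is_functor_def)
  have R_Obj: "FObj R b \<in> Obj C" if "b \<in> Obj D" for b using R that by (simp add: is_functor_def)
  have R_hom: "FArr R f \<in> hom C (FObj R a) (FObj R b)" if "f \<in> hom D a b" for f a b using R that
    by (simp add: is_functor_def)
  have R_Id: "FArr R (Id D b) = Id C (FObj R b)" if "b \<in> Obj D" for b using R that by (simp add: is_functor_def)
  have R_Comp: "FArr R (g \<cdot>\<^bsub>D\<^esub> f) = FArr R g \<cdot>\<^bsub>C\<^esub> FArr R f" if "f \<in> hom D a b" "g \<in> hom D b c" for f g a b c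
    using R that by (simp add: is_functor_def)
  \<comment> \<open>\<open>l a\<close> is a chosen strict extension: its image under
    \<open>R\<close> is equal to \<open>a\<close>.\<close>
  obtain l where l: "\<And>a. a \<in> Obj C \<Longrightarrow> l a \<in> Obj D" "\<And>a. a \<in> Obj C \<Longrightarrow> FObj R (l a) = a"
    and l_ex: "\<And>a d f. a \<in> Obj C \<Longrightarrow> d \<in> Obj D \<Longrightarrow> f \<in> hom C a (FObj R d) \<Longrightarrow> \<exists>!g. g \<in> hom D (l a) d \<and> FArr R g = f"
    using univ by metis
  have l_eq: "g = g'" if "a \<in> Obj C" "g \<in> hom D (l a) d" "g' \<in> hom D (l a) d" "FArr R g = FArr R g'" for a d g g'
  proof -
    have "d \<in> Obj D" using that(2) by (auto simp: hom_def)
    moreover have "FArr R g \<in> hom C a (FObj R d)" using R_hom[OF that(2)] l(2)[OF that(1)] by simp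
    ultimately show ?thesis using l_ex[OF that(1)] that by metis
  qed
  define ext where "ext a d f = (THE g. g \<in> hom D (l a) d \<and> FArr R g = f)" for a d f
  have ext: "ext a d f \<in> hom D (l a) d" "FArr R (ext a d f) = f"
    if "a \<in> Obj C" "d \<in> Obj D" "f \<in> hom C a (FObj R d)" for a d f
    using theI'[OF l_ex[OF that]] by (simp_all add: ext_def)
  define L0 where "L0 = \<lparr>FObj = l, FArr = (\<lambda>f. ext (Dom C f) (l (Cod C f)) f)\<rparr>"
  have L0_arr: "FArr L0 f \<in> hom D (l a) (l b)" "FArr R (FArr L0 f) = f" if "f \<in> hom C a b" for f a b
  proof -
    have o: "a \<in> Obj C" "b \<in> Obj C" "Dom C f = a" "Cod C f = b" using that by (auto simp: hom_def)
    have "f \<in> hom C a (FObj R (l b))" using that l(2)[OF o(2)] by simp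
    from ext[OF o(1) l(1)[OF o(2)] this] show "FArr L0 f \<in> hom D (l a) (l b)" "FArr R (FArr L0 f) = f"
      by (simp_all add: L0_def o)
  qed
  have L0: "is_functor C D L0"
    unfolding is_functor_def
  proof (intro conjI ballI allI)
    show "category C" "category D" by unfold_locales
    show "FObj L0 a \<in> Obj D" if "a \<in> Obj C" for a using l(1)[OF that] by (simp add: L0_def)
    show "FArr L0 f \<in> hom D (FObj L0 a) (FObj L0 b)" if "f \<in> hom C a b" for a b f
      using L0_arr[OF that] by (simp add: L0_def)
    show "FArr L0 (Id C a) = Id D (FObj L0 a)" if a: "a \<in> Obj C" for a
    proof (rule l_eq[OF a])
      show "FArr L0 (Id C a) \<in> hom D (l a) (l a)" by (rule L0_arr[OF C.Id_hom[OF a]])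
      show "Id D (FObj L0 a) \<in> hom D (l a) (l a)" using D.Id_hom[OF l(1)[OF a]] by (simp add: L0_def)
      show "FArr R (FArr L0 (Id C a)) = FArr R (Id D (FObj L0 a))"
        using L0_arr(2)[OF C.Id_hom[OF a]] R_Id[OF l(1)[OF a]] l(2)[OF a] by (simp add: L0_def)
    qed
    show "FArr L0 (g \<cdot>\<^bsub>C\<^esub> f) = FArr L0 g \<cdot>\<^bsub>D\<^esub> FArr L0 f" if f: "f \<in> hom C a b" and g: "g \<in> hom C b c" for a b c f g
    proof (rule l_eq)
      show "a \<in> Obj C" using f by (auto simp: hom_def)
      note gf = C.Comp_hom[OF f g]
      show "FArr L0 (g \<cdot>\<^bsub>C\<^esub> f) \<in> hom D (l a) (l c)" by (rule L0_arr[OF gf])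
      show "FArr L0 g \<cdot>\<^bsub>D\<^esub> FArr L0 f \<in> hom D (l a) (l c)" by (rule D.Comp_hom[OF L0_arr(1)[OF f] L0_arr(1)[OF g]])
      show "FArr R (FArr L0 (g \<cdot>\<^bsub>C\<^esub> f)) = FArr R (FArr L0 g \<cdot>\<^bsub>D\<^esub> FArr L0 f)"
        using R_Comp[OF L0_arr(1)[OF f] L0_arr(1)[OF g]] L0_arr(2)[OF f] L0_arr(2)[OF g] L0_arr(2)[OF gf] by simp
    qed
  qed
  define \<epsilon>0 where "\<epsilon>0 b = ext (FObj R b) b (Id C (FObj R b))" for b
  have \<epsilon>0: "\<epsilon>0 b \<in> hom D (l (FObj R b)) b" "FArr R (\<epsilon>0 b) = Id C (FObj R b)" if "b \<in> Obj D" for b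
    using ext[OF R_Obj[OF that] that C.Id_hom[OF R_Obj[OF that]]] by (simp_all add: \<epsilon>0_def)
  have "adjunction C D L0 R (Id C) \<epsilon>0"
    unfolding adjunction_def
  proof (intro conjI ballI L0 R)
    show "nat_trans C C id_func (comp_func R L0) (Id C)"
      unfolding nat_trans_def
    proof (intro conjI ballI allI)
      show "Id C a \<in> hom C (FObj id_func a) (FObj (comp_func R L0) a)" if "a \<in> Obj C" for a
        using C.Id_hom[OF that] l(2)[OF that] by (simp add: id_func_def comp_func_def L0_def)
      show "FArr (comp_func R L0) f \<cdot>\<^bsub>C\<^esub> Id C a = Id C b \<cdot>\<^bsub>C\<^esub> FArr id_func f" if f: "f \<in> hom C a b" for a b f
        using L0_arr(2)[OF f] f by (auto simp: id_func_def comp_func_def hom_def)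
    qed
    show "nat_trans D D (comp_func L0 R) id_func \<epsilon>0"
      unfolding nat_trans_def
    proof (intro conjI ballI allI)
      show "\<epsilon>0 b \<in> hom D (FObj (comp_func L0 R) b) (FObj id_func b)" if "b \<in> Obj D" for b
        using \<epsilon>0(1)[OF that] by (simp add: id_func_def comp_func_def L0_def)
      show "FArr id_func f \<cdot>\<^bsub>D\<^esub> \<epsilon>0 b = \<epsilon>0 d \<cdot>\<^bsub>D\<^esub> FArr (comp_func L0 R) f" if f: "f \<in> hom D b d" for b d f
      proof (rule l_eq[OF R_Obj])
        have o: "b \<in> Obj D" "d \<in> Obj D" using f by (auto simp: hom_def)
        show "b \<in> Obj D" by fact
        note Rf = R_hom[OF f]
        show "FArr id_func f \<cdot>\<^bsub>D\<^esub> \<epsilon>0 b \<in> hom D (l (FObj R b)) d"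
          using D.Comp_hom[OF \<epsilon>0(1)[OF o(1)] f] by (simp add: id_func_def)
        show "\<epsilon>0 d \<cdot>\<^bsub>D\<^esub> FArr (comp_func L0 R) f \<in> hom D (l (FObj R b)) d"
          using D.Comp_hom[OF L0_arr(1)[OF Rf] \<epsilon>0(1)[OF o(2)]] by (simp add: comp_func_def)
        show "FArr R (FArr id_func f \<cdot>\<^bsub>D\<^esub> \<epsilon>0 b) = FArr R (\<epsilon>0 d \<cdot>\<^bsub>D\<^esub> FArr (comp_func L0 R) f)"
          using R_Comp[OF \<epsilon>0(1)[OF o(1)] f] R_Comp[OF L0_arr(1)[OF Rf] \<epsilon>0(1)[OF o(2)]] L0_arr(2)[OF Rf]
            \<epsilon>0(2)[OF o(1)] \<epsilon>0(2)[OF o(2)] C.Comp_Id_left[OF Rf] C.Comp_Id_right[OF Rf]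
          by (simp add: id_func_def comp_func_def)
      qed
    qed
    show "\<epsilon>0 (FObj L0 a) \<cdot>\<^bsub>D\<^esub> FArr L0 (Id C a) = Id D (FObj L0 a)" if a: "a \<in> Obj C" for a
    proof (rule l_eq[OF a])
      note la = l(1)[OF a]
      have e: "\<epsilon>0 (l a) \<in> hom D (l a) (l a)" "FArr R (\<epsilon>0 (l a)) = Id C a" using \<epsilon>0[OF la] l(2)[OF a] by simp_all
      note i = L0_arr[OF C.Id_hom[OF a]]
      show "\<epsilon>0 (FObj L0 a) \<cdot>\<^bsub>D\<^esub> FArr L0 (Id C a) \<in> hom D (l a) (l a)"
        using D.Comp_hom[OF i(1) e(1)] by (simp add: L0_def)
      show "Id D (FObj L0 a) \<in> hom D (l a) (l a)" using D.Id_hom[OF la] by (simp add: L0_def)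
      have "FArr R (\<epsilon>0 (FObj L0 a) \<cdot>\<^bsub>D\<^esub> FArr L0 (Id C a)) = FArr R (\<epsilon>0 (l a)) \<cdot>\<^bsub>C\<^esub> FArr R (FArr L0 (Id C a))"
        using R_Comp[OF i(1) e(1)] by (simp add: L0_def)
      then show "FArr R (\<epsilon>0 (FObj L0 a) \<cdot>\<^bsub>D\<^esub> FArr L0 (Id C a)) = FArr R (Id D (FObj L0 a))"
        using R_Id[OF la] l(2)[OF a] e(2) i(2) a by (simp add: L0_def)
    qed
    show "FArr R (\<epsilon>0 b) \<cdot>\<^bsub>C\<^esub> Id C (FObj R b) = Id C (FObj R b)" if "b \<in> Obj D" for b
      using \<epsilon>0(2)[OF that] R_Obj[OF that] by simp
  qed
  then show "\<exists>L \<eta> \<epsilon>. adjunction C D L R \<eta> \<epsilon>" by blast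

  assume adj: "adjunction C D L R \<eta> \<epsilon>"
  have L_Obj: "FObj L a \<in> Obj D" if "a \<in> Obj C" for a using adj that by (simp add: adjunction_def is_functor_def)
  have L_hom: "FArr L f \<in> hom D (FObj L a) (FObj L b)" if "f \<in> hom C a b" for f a b
    using adj that by (simp add: adjunction_def is_functor_def)
  have L_Comp: "FArr L (g \<cdot>\<^bsub>C\<^esub> f) = FArr L g \<cdot>\<^bsub>D\<^esub> FArr L f" if "f \<in> hom C a b" "g \<in> hom C b c" for f g a b c
    using adj that by (simp add: adjunction_def is_functor_def)
  have \<eta>: "\<eta> a \<in> hom C a (FObj R (FObj L a))" if "a \<in> Obj C" for a
    using adj that by (simp add: adjunction_def nat_trans_def id_func_def comp_func_def)
  have \<eta>_nat: "FArr R (FArr L f) \<cdot>\<^bsub>C\<^esub> \<eta> a = \<eta> b \<cdot>\<^bsub>C\<^esub> f" if "f \<in> hom C a b" for f a b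
    using adj that by (simp add: adjunction_def nat_trans_def id_func_def comp_func_def)
  have \<epsilon>: "\<epsilon> b \<in> hom D (FObj L (FObj R b)) b" if "b \<in> Obj D" for b
    using adj that by (simp add: adjunction_def nat_trans_def id_func_def comp_func_def)
  have \<epsilon>_nat: "f \<cdot>\<^bsub>D\<^esub> \<epsilon> a = \<epsilon> b \<cdot>\<^bsub>D\<^esub> FArr L (FArr R f)" if "f \<in> hom D a b" for f a b
    using adj that by (simp add: adjunction_def nat_trans_def id_func_def comp_func_def)
  have tri1: "\<epsilon> (FObj L a) \<cdot>\<^bsub>D\<^esub> FArr L (\<eta> a) = Id D (FObj L a)" if "a \<in> Obj C" for a
    using adj that by (simp add: adjunction_def)
  have tri2: "FArr R (\<epsilon> b) \<cdot>\<^bsub>C\<^esub> \<eta> (FObj R b) = Id C (FObj R b)" if "b \<in> Obj D" for b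
    using adj that by (simp add: adjunction_def)
  \<comment> \<open>An arrow out of \<open>FObj L a\<close> is recovered from its adjunct, so two
    such arrows with equal adjuncts coincide.\<close>
  have transpose: "k = \<epsilon> d \<cdot>\<^bsub>D\<^esub> FArr L (FArr R k \<cdot>\<^bsub>C\<^esub> \<eta> a)" if a: "a \<in> Obj C" and k: "k \<in> hom D (FObj L a) d" for a d k
  proof -
    have d: "d \<in> Obj D" using k by (auto simp: hom_def)
    note Rk = R_hom[OF k] and L\<eta> = L_hom[OF \<eta>[OF a]]
    have "\<epsilon> d \<cdot>\<^bsub>D\<^esub> FArr L (FArr R k \<cdot>\<^bsub>C\<^esub> \<eta> a) = \<epsilon> d \<cdot>\<^bsub>D\<^esub> (FArr L (FArr R k) \<cdot>\<^bsub>D\<^esub> FArr L (\<eta> a))"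
      by (simp add: L_Comp[OF \<eta>[OF a] Rk])
    also have "\<dots> = (\<epsilon> d \<cdot>\<^bsub>D\<^esub> FArr L (FArr R k)) \<cdot>\<^bsub>D\<^esub> FArr L (\<eta> a)"
      by (rule D.Comp_assoc[OF L\<eta> L_hom[OF Rk] \<epsilon>[OF d], symmetric])
    also have "\<dots> = (k \<cdot>\<^bsub>D\<^esub> \<epsilon> (FObj L a)) \<cdot>\<^bsub>D\<^esub> FArr L (\<eta> a)"
      by (simp only: \<epsilon>_nat[OF k])
    also have "\<dots> = k \<cdot>\<^bsub>D\<^esub> (\<epsilon> (FObj L a) \<cdot>\<^bsub>D\<^esub> FArr L (\<eta> a))"
      by (rule D.Comp_assoc[OF L\<eta> \<epsilon>[OF L_Obj[OF a]] k])
    also have "\<dots> = k" by (simp only: tri1[OF a] D.Comp_Id_right[OF k])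
    finally show ?thesis by simp
  qed
  have iso: "is_iso C (\<eta> a)" if a: "a \<in> Obj C" for a
  proof -
    note \<eta>a = \<eta>[OF a] and La = L_Obj[OF a] and la = l(1)[OF a]
    \<comment> \<open>\<open>h\<close> lifts \<open>\<eta> a\<close> by universality of
      \<open>l a\<close>, and \<open>g\<close> below is the counit at \<open>l a\<close>.
      \<open>FArr R g\<close> is the inverse sought: one composite is a triangle identity, the other
      holds because \<open>h\<close> after \<open>g\<close> has the same adjunct as the
      identity.\<close>
    define h where "h = ext a (FObj L a) (\<eta> a)"
    have h: "h \<in> hom D (l a) (FObj L a)" "FArr R h = \<eta> a" using ext[OF a La \<eta>a] by (simp_all add: h_def)
    define g where "g = \<epsilon> (l a)"
    have g: "g \<in> hom D (FObj L a) (l a)" "FArr R g \<cdot>\<^bsub>C\<^esub> \<eta> a = Id C a"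
      using \<epsilon>[OF la] tri2[OF la] l(2)[OF a] by (simp_all add: g_def)
    have Rg: "FArr R g \<in> hom C (FObj R (FObj L a)) a" using R_hom[OF g(1)] l(2)[OF a] by simp
    have "FArr R (h \<cdot>\<^bsub>D\<^esub> g) \<cdot>\<^bsub>C\<^esub> \<eta> a = \<eta> a \<cdot>\<^bsub>C\<^esub> (FArr R g \<cdot>\<^bsub>C\<^esub> \<eta> a)"
      using R_Comp[OF g(1) h(1)] h(2) C.Comp_assoc[OF \<eta>a Rg \<eta>a] by simp
    then have "FArr R (h \<cdot>\<^bsub>D\<^esub> g) \<cdot>\<^bsub>C\<^esub> \<eta> a = \<eta> a" using g(2) C.Comp_Id_right[OF \<eta>a] by simp
    then have "h \<cdot>\<^bsub>D\<^esub> g = Id D (FObj L a)"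
      using transpose[OF a D.Comp_hom[OF g(1) h(1)]] tri1[OF a] by simp
    then have "\<eta> a \<cdot>\<^bsub>C\<^esub> FArr R g = Id C (FObj R (FObj L a))"
      using R_Comp[OF g(1) h(1)] h(2) R_Id[OF La] by simp
    then show ?thesis using \<eta>a Rg g(2) by (intro C.is_isoI[of _ "FArr R g"]) (auto simp: hom_def)
  qed
  have nat: "nat_iso C C id_func (comp_func R L) \<eta>"
    using adj iso by (simp add: nat_iso_def adjunction_def)
  have "bij_betw (FArr L) (hom C a b) (hom D (FObj L a) (FObj L b))" if a: "a \<in> Obj C" and b: "b \<in> Obj C" for a b
  proof (rule bij_betwI')
    note ib = iso[OF b] and \<eta>a = \<eta>[OF a] and \<eta>b = \<eta>[OF b]
    show "(FArr L f = FArr L g) = (f = g)" if f: "f \<in> hom C a b" and g: "g \<in> hom C a b" for f g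
    proof
      assume "FArr L f = FArr L g"
      then have "\<eta> b \<cdot>\<^bsub>C\<^esub> f = \<eta> b \<cdot>\<^bsub>C\<^esub> g" using \<eta>_nat[OF f] \<eta>_nat[OF g] by simp
      then show "f = g" by (rule C.iso_mono[OF ib]) (use f g \<eta>b in \<open>auto simp: hom_def\<close>)
    qed simp
    show "FArr L f \<in> hom D (FObj L a) (FObj L b)" if "f \<in> hom C a b" for f by (rule L_hom[OF that])
    show "\<exists>f \<in> hom C a b. k = FArr L f" if k: "k \<in> hom D (FObj L a) (FObj L b)" for k
    proof
      \<comment> \<open>The adjunct of \<open>k\<close>, carried back along the invertible
        unit.\<close>
      define f where "f = inv_arr C (\<eta> b) \<cdot>\<^bsub>C\<^esub> (FArr R k \<cdot>\<^bsub>C\<^esub> \<eta> a)"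
      note Rk = R_hom[OF k]
      show f: "f \<in> hom C a b" using ib \<eta>b Rk \<eta>a by (auto simp: f_def hom_def)
      have "\<eta> b \<cdot>\<^bsub>C\<^esub> f = FArr R k \<cdot>\<^bsub>C\<^esub> \<eta> a"
        unfolding f_def using ib \<eta>b Rk \<eta>a by (intro C.inv_arr_reassoc(2)) (auto simp: hom_def)
      then have "FArr R k \<cdot>\<^bsub>C\<^esub> \<eta> a = FArr R (FArr L f) \<cdot>\<^bsub>C\<^esub> \<eta> a" using \<eta>_nat[OF f] by simp
      then show "k = FArr L f" using transpose[OF a k] transpose[OF a L_hom[OF f]] by simp
    qed
  qed
  then have "fully_faithful C D L" by (simp add: fully_faithful_def)
  with nat show "nat_iso C C id_func (comp_func R L) \<eta> \<and> fully_faithful C D L" by simp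
qed

section \<open>Restricting algebras to a full subcategory\<close>

context full_sub
begin

abbreviation "orth' \<equiv> orth_pullback C embedding orth"

lemma orth'_iff: "(f, g) \<in> orth' \<longleftrightarrow> f \<in> Arr C \<and> g \<in> Arr C \<and> Cod C f = Cod C g \<and> (f, g) \<in> orth"
  by (auto simp: orth_pullback_def embedding_def)

lemma orthogonal_C: "orthogonal_category C orth'"
proof
  fix f g assume fg: "(f, g) \<in> orth'"
  then have fgC: "f \<in> Arr C" "g \<in> Arr C" "Cod C f = Cod C g" "(f, g) \<in> orth" by (auto simp: orth'_iff)
  show "f \<in> Arr C \<and> g \<in> Arr C \<and> Cod C f = Cod C g" using fgC by blast
  show "(g, f) \<in> orth'" using fgC D.orth_sym[of f g] by (auto simp: orth'_iff)
  show "(h \<cdot>\<^bsub>C\<^esub> f, h \<cdot>\<^bsub>C\<^esub> g) \<in> orth'" if h: "h \<in> Arr C" "Dom C h = Cod C f" for h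
    using fgC h D.orth_post[OF fgC(4), of h] C.Arr_Comp[of f h] C.Arr_Comp[of g h]
    by (auto simp: orth'_iff sub_Comp[symmetric])
  show "(f \<cdot>\<^bsub>C\<^esub> h, g \<cdot>\<^bsub>C\<^esub> h') \<in> orth'"
    if h: "h \<in> Arr C" "h' \<in> Arr C" "Cod C h = Dom C f" "Cod C h' = Dom C g" for h h'
    using fgC h D.orth_pre[OF fgC(4), of h h'] C.Arr_Comp[of h f] C.Arr_Comp[of h' g]
    by (auto simp: orth'_iff sub_Comp[symmetric])
qed

lemma sub_hom: "f \<in> hom C a b \<Longrightarrow> f \<in> hom D a b"
  by (auto simp: hom_def)

lemma sub_Ops:
  assumes "x \<in> Ops (cat_operad C) cs t"
  shows "x \<in> Ops (cat_operad D) cs t"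
  using assms sub_hom by (cases x) auto

lemma sub_Gam:
  assumes x: "x \<in> Ops (cat_operad C) ts t" and len: "length css = length ts" "length ys = length ts"
    and ys: "\<And>i. i < length ts \<Longrightarrow> ys ! i \<in> Ops (cat_operad C) (css ! i) (ts ! i)"
  shows "Gam (cat_operad C) ts t css x ys = Gam (cat_operad D) ts t css x ys"
proof -
  obtain \<sigma> fs where x': "x = (\<sigma>, fs)" by (cases x)
  have fs: "length fs = length ts" "\<And>i. i < length ts \<Longrightarrow> fs ! i \<in> hom C (ts ! i) t" using x by (auto simp: x')
  have "map2 (\<lambda>f gs. map ((\<cdot>\<^bsub>C\<^esub>) f) gs) fs (map snd ys) = map2 (\<lambda>f gs. map ((\<cdot>\<^bsub>D\<^esub>) f) gs) fs (map snd ys)"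
  proof (rule nth_equalityI)
    fix i assume "i < length (map2 (\<lambda>f gs. map ((\<cdot>\<^bsub>C\<^esub>) f) gs) fs (map snd ys))"
    then have i: "i < length ts" using fs len by simp
    obtain \<tau> gs where yi: "ys ! i = (\<tau>, gs)" by (cases "ys ! i")
    have gs: "g \<in> hom C (Dom C g) (ts ! i)" if "g \<in> set gs" for g
      using ys[OF i] that by (auto simp: yi in_set_conv_nth hom_def)
    have "fs ! i \<cdot>\<^bsub>C\<^esub> g = fs ! i \<cdot>\<^bsub>D\<^esub> g" if "g \<in> set gs" for g
      using gs[OF that] fs(2)[OF i] by (intro sub_Comp[symmetric]) (auto simp: hom_def)
    then show "map2 (\<lambda>f gs. map ((\<cdot>\<^bsub>C\<^esub>) f) gs) fs (map snd ys) ! i = map2 (\<lambda>f gs.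
      map ((\<cdot>\<^bsub>D\<^esub>) f) gs) fs (map snd ys) ! i"
      using i fs len by (simp add: yi)
  qed (use fs len in simp)
  then show ?thesis unfolding x' cat_operad_simps by (simp only:)
qed

lemma sub_Act: "Act (cat_operad C) cs t \<sigma> x = Act (cat_operad D) cs t \<sigma> x"
  by (cases x) simp

lemma sub_orth_rel: "orth_rel C orth' cs t x y \<Longrightarrow> orth_rel D orth cs t x y"
  unfolding orth_rel_def by (auto simp: orth'_iff)

text \<open>The generating relation of \<open>C\<close> is contained in that of \<open>D\<close>,
  and actions and composites of operations in \<open>C\<close> are computed as in \<open>D\<close>;
  induction on the derivation extends this to the congruences.\<close>

lemma sub_cong: "orth_cong C orth' cs t x y \<Longrightarrow> orth_cong D orth cs t x y"
  unfolding orth_cong_def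
proof (induction rule: op_cong.induct)
  case (base cs t x y)
  then show ?case by (intro op_cong.base sub_orth_rel sub_Ops)
next
  case (refl x cs t)
  then show ?case by (intro op_cong.refl sub_Ops)
next
  case (sym cs t x y)
  show ?case by (rule op_cong.sym[OF sym.IH])
next
  case (trans cs t x y z)
  show ?case by (rule op_cong.trans[OF trans.IH])
next
  case (Act cs t x y \<sigma>)
  show ?case unfolding sub_Act by (rule op_cong.Act[OF Act.IH Act.hyps(2)])
next
  case (Gam ts t x y css xs ys)
  have xy: "x \<in> Ops (cat_operad C) ts t" "y \<in> Ops (cat_operad C) ts t"
    using orth_cong_Ops[OF C.category_axioms] Gam.hyps(1) unfolding orth_cong_def by blast+
  have xys: "xs ! i \<in> Ops (cat_operad C) (css ! i) (ts ! i)" "ys ! i \<in> Ops (cat_operad C) (css ! i) (ts ! i)"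
    if "i < length ts" for i
    using orth_cong_Ops[OF C.category_axioms] Gam.hyps(5)[OF that] unfolding orth_cong_def by blast+
  have g: "Gam (cat_operad C) ts t css x xs = Gam (cat_operad D) ts t css x xs"
    "Gam (cat_operad C) ts t css y ys = Gam (cat_operad D) ts t css y ys"
    using xy xys Gam.hyps by (auto intro!: sub_Gam simp del: cat_operad_simps)
  show ?case
    unfolding g by (rule op_cong.Gam) (use Gam in auto)
qed

text \<open>By \<open>sub_cong\<close> all representatives in \<open>C\<close> lie in one class of
  \<open>D\<close>, so the union that defines \<open>MOp\<close> is that class.\<close>

lemma MOp_class:
  assumes x: "x \<in> Ops (cat_operad C) cs t"
  shows "MOp (orth_operad_map D orth embedding) cs t (op_class C orth' cs t x) = op_class D orth cs t x"
proof -
  have "MOp (orth_operad_map D orth embedding) cs t (op_class C orth' cs t x) =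
      {z. \<exists>y. orth_cong C orth' cs t x y \<and> orth_cong D orth cs t y z}"
    by (auto simp: orth_operad_map_def embedding_def op_class_def)
  also have "\<dots> = op_class D orth cs t x"
  proof (intro equalityI subsetI)
    fix z assume "z \<in> {z. \<exists>y. orth_cong C orth' cs t x y \<and> orth_cong D orth cs t y z}"
    then obtain y where "orth_cong D orth cs t x y" "orth_cong D orth cs t y z" using sub_cong by blast
    then show "z \<in> op_class D orth cs t x"
      unfolding op_class_def orth_cong_def by (auto intro: op_cong.trans)
  next
    fix z assume "z \<in> op_class D orth cs t x"
    moreover have "orth_cong C orth' cs t x x" unfolding orth_cong_def by (rule op_cong.refl[OF x])
    ultimately show "z \<in> {z. \<exists>y. orth_cong C orth' cs t x y \<and> orth_cong D orth cs t y z}"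
      unfolding op_class_def by blast
  qed
  finally show ?thesis .
qed

lemma rep_algebra_sub:
  assumes "rep_algebra M D orth X s"
  shows "rep_algebra M C orth' X s"
proof -
  interpret rep_algebra M D orth X s by fact
  show ?thesis
  proof
    show "X t \<in> Obj M" if "t \<in> Obj C" for t using that by simp
    show "s cs t x \<in> hom M (tens M (map X cs)) (X t)" if "x \<in> Ops (cat_operad C) cs t" for x cs t
      by (rule s_hom[OF sub_Ops[OF that]])
    show "s [t] t (Unt (cat_operad C) t) = RUnit M (X t)" if "t \<in> Obj C" for t
      using s_Unt[of t] that by (simp add: sub_Id)
    show "s (permute_list \<sigma> cs) t (Act (cat_operad C) cs t \<sigma> x) = s cs t x \<cdot>\<^bsub>M\<^esub> tens_perm M \<sigma> (map X cs)"
      if "x \<in> Ops (cat_operad C) cs t" "\<sigma> permutes {..<length cs}" for x cs t \<sigma>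
      unfolding sub_Act by (rule s_Act[OF sub_Ops[OF that(1)] that(2)])
    show "s (concat css) t (Gam (cat_operad C) ts t css x ys) \<cdot>\<^bsub>M\<^esub> tens_concat M (map (map X) css) =
      s ts t x \<cdot>\<^bsub>M\<^esub> tens_arr M (map (\<lambda>i. s (css ! i) (ts ! i) (ys ! i)) [0..<length ts])"
      if x: "x \<in> Ops (cat_operad C) ts t" and ys: "composable (cat_operad C) ts css ys" for x ts t css ys
    proof -
      have y: "length css = length ts" "length ys = length ts" "\<And>i. i < length ts \<Longrightarrow>
        ys ! i \<in> Ops (cat_operad C) (css ! i) (ts ! i)"
        using ys unfolding composable_def by auto
      have "composable (cat_operad D) ts css ys"
        unfolding composable_def using y sub_Ops by blast
      moreover have "Gam (cat_operad C) ts t css x ys = Gam (cat_operad D) ts t css x ys"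
        by (rule sub_Gam) (use x y in \<open>auto simp del: cat_operad_simps\<close>)
      ultimately show ?thesis using s_Gam[OF sub_Ops[OF x]] by (simp only:)
    qed
    show "s cs t x = s cs t y" if "orth_rel C orth' cs t x y" "x \<in> Ops (cat_operad C) cs t"
      "y \<in> Ops (cat_operad C) cs t" for cs t x y
      by (rule s_orth[OF sub_orth_rel[OF that(1)] sub_Ops[OF that(2)] sub_Ops[OF that(3)]])
  qed
qed

lemma monoid_functor_sub:
  assumes "monoid_functor M D orth X F mu un"
  shows "monoid_functor M C orth' X F mu un"
proof -
  interpret B: monoid_functor M D orth X F mu un by fact
  show ?thesis
  proof (intro monoid_functor.intro monoid_functor_axioms.intro orthogonal_C)
    show "symmetric_monoidal_category M" by unfold_locales
    show "mu (Cod C f) \<cdot>\<^bsub>M\<^esub> (F f \<boxtimes>\<^bsub>M\<^esub> F g) =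
        mu (Cod C f) \<cdot>\<^bsub>M\<^esub> ((F g \<boxtimes>\<^bsub>M\<^esub> F f) \<cdot>\<^bsub>M\<^esub> Sym M (X (Dom C f)) (X (Dom C g)))" if "(f, g) \<in> orth'" for f g
    proof -
      have fg: "f \<in> Arr C" "g \<in> Arr C" "(f, g) \<in> orth" using that by (auto simp: orth'_iff)
      show ?thesis using B.F_orth[OF fg(3)] by (simp only: sub_arr[OF fg(1)] sub_arr[OF fg(2)])
    qed
  qed (auto simp: B.mon hom_def sub_Id[symmetric] B.F_Id sub_Comp[symmetric] B.F_Comp B.F_mu B.F_un)
qed

end

section \<open>The category of algebras\<close>

lemma hom_Alg: "x \<in> hom (Alg P M) A B \<longleftrightarrow>
    (\<exists>h. x = (A, h, B) \<and> operad_algebra P M A \<and> operad_algebra P M B \<and> alg_hom P M A B h)"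
  by (auto simp: hom_def Alg_def)

lemma category_Alg:
  assumes "symmetric_monoidal_category M" "category D"
  shows "category (Alg (orth_operad D orth) M)"
proof -
  interpret M: symmetric_monoidal_category M by fact
  interpret D: category D by fact
  let ?O = "orth_operad D orth"
  have Ops_Obj: "set cs \<subseteq> Obj D \<and> t \<in> Obj D" if "x \<in> Ops (cat_operad D) cs t" for x cs t using that by (cases x) auto
  note hom = hom_Alg[where M = M]
  have Car: "Car A t \<in> Obj M" if "operad_algebra ?O M A" "t \<in> Obj D" for A t
    using operad_algebra.Car_Obj[OF that(1)] that(2) by (simp add: orth_operad_simps)
  have rep: "alg_rep D orth A cs t x \<in> hom M (M.tobj (map (Car A) cs) (TUnit M)) (Car A t)"
    if "operad_algebra ?O M A" "x \<in> Ops (cat_operad D) cs t" for A cs t x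
    using rep_algebra.s_hom[OF rep_algebra_alg_rep[OF that(1) assms] that(2)] by (simp add: M.tens_tobj)
  have ah: "h t \<in> Arr M" "Dom M (h t) = Car A t" "Cod M (h t) = Car B t" if "alg_hom ?O M A B h" "t \<in> Obj D" for A B h t
    using that by (auto simp: alg_hom_orth_operad hom_def)
  have ext: "h \<in> extensional (Obj D)" if "alg_hom ?O M A B h" for A B h
    using that by (simp add: alg_hom_orth_operad)
  have comp: "alg_hom ?O M A B' (\<lambda>t \<in> Obj D. k t \<cdot>\<^bsub>M\<^esub> h t)"
    if A: "operad_algebra ?O M A" "operad_algebra ?O M B" "operad_algebra ?O M B'" and h: "alg_hom ?O M A B h"
      and k: "alg_hom ?O M B B' k" for A B B' h k
    unfolding alg_hom_orth_operad
  proof (intro conjI ballI allI)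
    show "(\<lambda>t\<in>Obj D. k t \<cdot>\<^bsub>M\<^esub> h t) t \<in> hom M (Car A t) (Car B' t)" if "t \<in> Obj D" for t
      using ah[OF h that] ah[OF k that] that by (simp add: hom_def)
    fix cs t x assume x: "x \<in> Ops (cat_operad D) cs t"
    have cs: "set cs \<subseteq> Obj D" "t \<in> Obj D" using Ops_Obj[OF x] by auto
    have csD: "s \<in> Obj D" if "s \<in> set cs" for s using cs that by blast
    note hk = ah[OF h cs(2)] ah[OF k cs(2)]
    have sub: "h ` set cs \<subseteq> Arr M" "k ` set cs \<subseteq> Arr M" using ah(1)[OF h] ah(1)[OF k] cs by auto
    have tD: "M.tobj (map (Dom M \<circ> h) cs) (TUnit M) = M.tobj (map (Car A) cs) (TUnit M)"
        "M.tobj (map (Cod M \<circ> h) cs) (TUnit M) = M.tobj (map (Car B) cs) (TUnit M)"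
        "M.tobj (map (Dom M \<circ> k) cs) (TUnit M) = M.tobj (map (Car B) cs) (TUnit M)"
        "M.tobj (map (Cod M \<circ> k) cs) (TUnit M) = M.tobj (map (Car B') cs) (TUnit M)"
      using ah[OF h] ah[OF k] csD by (auto intro!: arg_cong[where f = "\<lambda>l. M.tobj l (TUnit M)"])
    have r: "alg_rep D orth E cs t x \<in> Arr M" "Dom M (alg_rep D orth E cs t x) =
      M.tobj (map (Car E) cs) (TUnit M)" "Cod M (alg_rep D orth E cs t x) = Car E t"
      if "operad_algebra ?O M E" for E using rep[OF that x] by (auto simp: hom_def)
    have nat: "h t \<cdot>\<^bsub>M\<^esub> alg_rep D orth A cs t x = alg_rep D orth B cs t x \<cdot>\<^bsub>M\<^esub> M.tarr (map h cs) (Id M (TUnit M))"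
       "k t \<cdot>\<^bsub>M\<^esub> alg_rep D orth B cs t x = alg_rep D orth B' cs t x \<cdot>\<^bsub>M\<^esub> M.tarr (map k cs) (Id M (TUnit M))"
      using h k x by (auto simp: alg_hom_orth_operad M.tens_arr_tarr)
    have "map (\<lambda>t\<in>Obj D. k t \<cdot>\<^bsub>M\<^esub> h t) cs = map (\<lambda>t. k t \<cdot>\<^bsub>M\<^esub> h t) cs" using cs by auto
    then have "tens_arr M (map (\<lambda>t\<in>Obj D. k t \<cdot>\<^bsub>M\<^esub> h t) cs) = M.tarr (map (\<lambda>t. k t \<cdot>\<^bsub>M\<^esub> h t) cs) (Id M (TUnit M))"
      by (simp only: M.tens_arr_tarr)
    also have "\<dots> = M.tarr (map k cs) (Id M (TUnit M)) \<cdot>\<^bsub>M\<^esub> M.tarr (map h cs) (Id M (TUnit M))"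
      using ah[OF h] ah[OF k] csD by (subst M.tarr_map_Comp) auto
    finally have ta: "tens_arr M (map (\<lambda>t\<in>Obj D. k t \<cdot>\<^bsub>M\<^esub> h t) cs) = M.tarr (map k cs) (Id M (TUnit M)) \<cdot>\<^bsub>M\<^esub>
      M.tarr (map h cs) (Id M (TUnit M))" .
    have "(k t \<cdot>\<^bsub>M\<^esub> h t) \<cdot>\<^bsub>M\<^esub> alg_rep D orth A cs t x = k t \<cdot>\<^bsub>M\<^esub> (alg_rep D orth B cs t x \<cdot>\<^bsub>M\<^esub> M.tarr (map h cs)
      (Id M (TUnit M)))"
      using hk r[OF A(1)] by (simp add: nat(1))
    also have "\<dots> = (k t \<cdot>\<^bsub>M\<^esub> alg_rep D orth B cs t x) \<cdot>\<^bsub>M\<^esub> M.tarr (map h cs) (Id M (TUnit M))"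
      using hk r[OF A(2)] sub tD by simp
    also have "\<dots> = alg_rep D orth B' cs t x \<cdot>\<^bsub>M\<^esub> (M.tarr (map k cs) (Id M (TUnit M)) \<cdot>\<^bsub>M\<^esub> M.tarr (map h cs)
      (Id M (TUnit M)))"
      using r[OF A(3)] sub tD by (simp add: nat(2))
    finally show "(\<lambda>t\<in>Obj D. k t \<cdot>\<^bsub>M\<^esub> h t) t \<cdot>\<^bsub>M\<^esub> alg_rep D orth A cs t x =
        alg_rep D orth B' cs t x \<cdot>\<^bsub>M\<^esub> tens_arr M (map (\<lambda>t\<in>Obj D. k t \<cdot>\<^bsub>M\<^esub> h t) cs)"
      using cs by (simp add: ta)
  qed simp
  have id: "alg_hom ?O M A A (\<lambda>t \<in> Obj D. Id M (Car A t))" if A: "operad_algebra ?O M A" for A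
    unfolding alg_hom_orth_operad
  proof (intro conjI ballI allI)
    show "(\<lambda>t \<in> Obj D. Id M (Car A t)) t \<in> hom M (Car A t) (Car A t)" if "t \<in> Obj D" for t
      using Car[OF A that] that by (simp add: hom_def)
    fix cs t x assume x: "x \<in> Ops (cat_operad D) cs t"
    have cs: "set cs \<subseteq> Obj D" "t \<in> Obj D" using Ops_Obj[OF x] by auto
    have "map (\<lambda>t \<in> Obj D. Id M (Car A t)) cs = map (Id M) (map (Car A) cs)" using cs by auto
    then have "tens_arr M (map (\<lambda>t \<in> Obj D. Id M (Car A t)) cs) = M.tid (map (Car A) cs) (Id M (TUnit M))"
      by (simp only: M.tens_arr_tarr)
    also have "\<dots> = Id M (M.tobj (map (Car A) cs) (TUnit M))"
      using Car[OF A] cs by (intro M.tid_Id) auto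
    finally show "(\<lambda>t \<in> Obj D. Id M (Car A t)) t \<cdot>\<^bsub>M\<^esub> alg_rep D orth A cs t x =
        alg_rep D orth A cs t x \<cdot>\<^bsub>M\<^esub> tens_arr M (map (\<lambda>t \<in> Obj D. Id M (Car A t)) cs)"
      using cs rep[OF A x] by (auto simp: hom_def)
  qed simp
  show ?thesis
  proof
    show "Dom (Alg ?O M) f \<in> Obj (Alg ?O M)" "Cod (Alg ?O M) f \<in> Obj (Alg ?O M)" if "f \<in> Arr (Alg ?O M)" for f
      using that by (auto simp: Alg_def)
    show "Id (Alg ?O M) A \<in> hom (Alg ?O M) A A" if "A \<in> Obj (Alg ?O M)" for A
      using that id[of A] by (simp add: hom) (simp add: Alg_def orth_operad_simps)
    show "g \<cdot>\<^bsub>Alg ?O M\<^esub> f \<in> hom (Alg ?O M) A B'" if "f \<in> hom (Alg ?O M) A B" "g \<in> hom (Alg ?O M) B B'" for f g A B B'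
      using that comp unfolding hom by (auto simp: Alg_def orth_operad_simps)
    show "Id (Alg ?O M) B \<cdot>\<^bsub>Alg ?O M\<^esub> f = f" if f: "f \<in> hom (Alg ?O M) A B" for f A B
    proof -
      obtain h where h: "f = (A, h, B)" "alg_hom ?O M A B h" using f hom by blast
      have "(\<lambda>t\<in>Obj D. (\<lambda>t\<in>Obj D. Id M (Car B t)) t \<cdot>\<^bsub>M\<^esub> h t) = h"
        using ah[OF h(2)] by (intro extensionalityI[OF _ ext[OF h(2)]]) auto
      then show ?thesis by (simp add: h Alg_def orth_operad_simps)
    qed
    show "f \<cdot>\<^bsub>Alg ?O M\<^esub> Id (Alg ?O M) A = f" if f: "f \<in> hom (Alg ?O M) A B" for f A B
    proof -
      obtain h where h: "f = (A, h, B)" "alg_hom ?O M A B h" using f hom by blast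
      have "(\<lambda>t\<in>Obj D. h t \<cdot>\<^bsub>M\<^esub> (\<lambda>t\<in>Obj D. Id M (Car A t)) t) = h"
        using ah[OF h(2)] by (intro extensionalityI[OF _ ext[OF h(2)]]) auto
      then show ?thesis by (simp add: h Alg_def orth_operad_simps)
    qed
    show "(h \<cdot>\<^bsub>Alg ?O M\<^esub> g) \<cdot>\<^bsub>Alg ?O M\<^esub> f = h \<cdot>\<^bsub>Alg ?O M\<^esub> (g \<cdot>\<^bsub>Alg ?O M\<^esub> f)"
      if f: "f \<in> hom (Alg ?O M) A1 A2" and g: "g \<in> hom (Alg ?O M) A2 A3" and h: "h \<in> hom (Alg ?O M) A3 A4"
        for f g h A1 A2 A3 A4
    proof -
      obtain f' where f': "f = (A1, f', A2)" "alg_hom ?O M A1 A2 f'" using f hom by blast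
      obtain g' where g': "g = (A2, g', A3)" "alg_hom ?O M A2 A3 g'" using g hom by blast
      obtain h' where h': "h = (A3, h', A4)" "alg_hom ?O M A3 A4 h'" using h hom by blast
      show ?thesis
        using ah[OF f'(2)] ah[OF g'(2)] ah[OF h'(2)]
        by (auto simp: f'(1) g'(1) h'(1) Alg_def orth_operad_simps intro!: restrict_ext)
    qed
  qed
qed

context full_sub
begin

abbreviation "restrict_alg \<equiv> pullback_alg (orth_operad C orth') (orth_operad_map D orth embedding)"

text \<open>On representatives restriction changes nothing, by \<open>MOp_class\<close>. As an
  equation of extensional algebras it reduces statements about restriction to statements about
  \<open>rep_to_alg\<close>.\<close>

lemma restrict_alg_eq:
  fixes B :: "('c, ((nat \<Rightarrow> nat) \<times> 'a list) set, 'o, 'm) alg"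
  shows "restrict_alg B = rep_to_alg C orth' (Car B) (alg_rep D orth B)"
proof -
  have "Str B (map (MCol (orth_operad_map D orth embedding)) cs) (MCol (orth_operad_map D orth embedding) t)
      (MOp (orth_operad_map D orth embedding) cs t Z) = alg_rep D orth B cs t (SOME x. x \<in> Z)"
    if Z: "Z \<in> Ops (orth_operad C orth') cs t" for Z cs t
  proof -
    obtain x where x: "x \<in> Ops (cat_operad C) cs t" "Z = op_class C orth' cs t x"
      using Z unfolding orth_operad_simps by blast
    have "x \<in> Z" unfolding x(2) by (rule op_class_self[OF x(1)])
    then have "(SOME x. x \<in> Z) \<in> Z" by (rule someI)
    then have "orth_cong C orth' cs t x (SOME x. x \<in> Z)" by (simp only: x(2) op_class_def mem_Collect_eq)
    from op_class_eq[OF sub_cong[OF this]]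
    have "MOp (orth_operad_map D orth embedding) cs t Z = op_class D orth cs t (SOME x. x \<in> Z)"
      using MOp_class[OF x(1)] by (simp only: x(2))
    then show ?thesis by (simp add: alg_rep_def) (simp add: orth_operad_map_def embedding_def)
  qed
  then show ?thesis
    by (auto simp: pullback_alg_def rep_to_alg_def orth_operad_simps fun_eq_iff restrict_def)
      (simp add: orth_operad_map_def embedding_def)
qed

lemma restrict_alg:
  assumes B: "operad_algebra (orth_operad D orth) M B" and M: "symmetric_monoidal_category M"
  shows "operad_algebra (orth_operad C orth') M (restrict_alg B)"
    and "t \<in> Obj C \<Longrightarrow> Car (restrict_alg B) t = Car B t"
    and "x \<in> Ops (cat_operad C) cs t \<Longrightarrow> alg_rep C orth' (restrict_alg B) cs t x = alg_rep D orth B cs t x"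
proof -
  have r: "rep_algebra M C orth' (Car B) (alg_rep D orth B)"
    by (rule rep_algebra_sub[OF rep_algebra_alg_rep[OF B M D.category_axioms]])
  show "operad_algebra (orth_operad C orth') M (restrict_alg B)"
    unfolding restrict_alg_eq by (rule rep_algebra.operad_algebra_rep_to_alg[OF r])
  show "t \<in> Obj C \<Longrightarrow> Car (restrict_alg B) t = Car B t"
    unfolding restrict_alg_eq by (simp add: rep_to_alg_def)
  show "x \<in> Ops (cat_operad C) cs t \<Longrightarrow> alg_rep C orth' (restrict_alg B) cs t x = alg_rep D orth B cs t x"
    unfolding restrict_alg_eq by (rule rep_algebra.alg_rep_rep_to_alg[OF r])
qed

lemma restrict_hom:
  assumes A: "operad_algebra (orth_operad D orth) M A" and B: "operad_algebra (orth_operad D orth) M B"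
    and M: "symmetric_monoidal_category M" and h: "alg_hom (orth_operad D orth) M A B h"
  shows "alg_hom (orth_operad C orth') M (restrict_alg A) (restrict_alg B) (restrict h (Obj C))"
  unfolding alg_hom_orth_operad
proof (intro conjI ballI allI)
  show "restrict h (Obj C) t \<in> hom M (Car (restrict_alg A) t) (Car (restrict_alg B) t)" if "t \<in> Obj C" for t
    using h that restrict_alg(2)[OF A M that] restrict_alg(2)[OF B M that] by (simp add: alg_hom_orth_operad)
  fix cs t x assume x: "x \<in> Ops (cat_operad C) cs t"
  then have "set cs \<subseteq> Obj C" "t \<in> Obj C" by (cases x; auto)+
  then have m: "map (restrict h (Obj C)) cs = map h cs" "restrict h (Obj C) t = h t" by auto
  show "restrict h (Obj C) t \<cdot>\<^bsub>M\<^esub> alg_rep C orth' (restrict_alg A) cs t x =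
     alg_rep C orth' (restrict_alg B) cs t x \<cdot>\<^bsub>M\<^esub> tens_arr M (map (restrict h (Obj C)) cs)"
    unfolding m restrict_alg(3)[OF A M x] restrict_alg(3)[OF B M x]
    using h sub_Ops[OF x] unfolding alg_hom_orth_operad by blast
qed simp

lemma is_functor_restrict:
  assumes M: "symmetric_monoidal_category M"
  shows "is_functor (Alg (orth_operad D orth) M) (Alg (orth_operad C orth') M)
    (pullback_functor (orth_operad C orth') (orth_operad_map D orth embedding))"
proof -
  interpret M: symmetric_monoidal_category M by fact
  have col: "MCol (orth_operad_map D orth embedding) t = t" for t
    by (simp add: orth_operad_map_def embedding_def)
  let ?R = "pullback_functor (orth_operad C orth') (orth_operad_map D orth embedding)"
  have R: "FObj ?R B = restrict_alg B" "FArr ?R (A, h, B) = (restrict_alg A, restrict h (Obj C),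
    restrict_alg B)" for A B h
    by (simp_all add: pullback_functor_def col orth_operad_simps)
  show ?thesis
    unfolding is_functor_def
  proof (intro conjI ballI allI)
    show "category (Alg (orth_operad D orth) M)" "category (Alg (orth_operad C orth') M)"
      by (rule category_Alg[OF M]; unfold_locales)+
    show "FObj ?R A \<in> Obj (Alg (orth_operad C orth') M)" if "A \<in> Obj (Alg (orth_operad D orth) M)" for A
      using that restrict_alg(1)[OF _ M] by (simp add: R Alg_def)
    show "FArr ?R f \<in> hom (Alg (orth_operad C orth') M) (FObj ?R A) (FObj ?R B)"
      if f: "f \<in> hom (Alg (orth_operad D orth) M) A B" for A B f
    proof -
      obtain h where h: "f = (A, h, B)" "operad_algebra (orth_operad D orth) M A"
        "operad_algebra (orth_operad D orth) M B"
        "alg_hom (orth_operad D orth) M A B h" using f unfolding hom_Alg by blast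
      show ?thesis
        unfolding hom_Alg h(1) R using restrict_alg(1)[OF h(2) M] restrict_alg(1)[OF h(3) M] restrict_hom[OF
          h(2,3) M h(4)] by blast
    qed
    show "FArr ?R (Id (Alg (orth_operad D orth) M) A) = Id (Alg (orth_operad C orth') M) (FObj ?R A)"
      if "A \<in> Obj (Alg (orth_operad D orth) M)" for A
    proof -
      have A: "operad_algebra (orth_operad D orth) M A" using that by (simp add: Alg_def)
      show ?thesis
        using restrict_alg(2)[OF A M] by (simp add: Alg_def R orth_operad_simps cong: restrict_cong)
    qed
    show "FArr ?R (g \<cdot>\<^bsub>Alg (orth_operad D orth) M\<^esub> f) = FArr ?R g \<cdot>\<^bsub>Alg (orth_operad C orth') M\<^esub> FArr ?R f"
      if f: "f \<in> hom (Alg (orth_operad D orth) M) A1 A2" and g: "g \<in> hom (Alg (orth_operad D orth) M) A2 A3"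
        for f g A1 A2 A3
    proof -
      obtain h where h: "f = (A1, h, A2)" using f unfolding hom_Alg by blast
      obtain k where k: "g = (A2, k, A3)" using g unfolding hom_Alg by blast
      show ?thesis by (simp add: h k R Alg_def orth_operad_simps cong: restrict_cong)
    qed
  qed
qed

end

section \<open>The universal extension of an algebra\<close>

context extension_colimits
begin

text \<open>The purpose of the choice of colimits over \<open>C\<close>: there \<open>L\<close>,
  \<open>Lfun\<close>, \<open>Lmu\<close> and \<open>Lun\<close> coincide with the given
  data.\<close>

lemma str_C:
  assumes p: "p \<in> Ops (cat_operad C) cs t"
  shows "monoid_functor.str M L Lfun Lmu Lun cs t p = A.str cs t p"
proof -
  interpret L: monoid_functor M D orth L Lfun Lmu Lun by (rule monoid_functor_L)
  obtain \<sigma> fs where p': "p = (\<sigma>, fs)" by (cases p)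
  have t: "t \<in> Obj C" and cs: "set cs \<subseteq> Obj C" and \<sigma>: "\<sigma> permutes {..<length cs}"
    and fs: "\<And>i. i < length cs \<Longrightarrow> fs ! i \<in> Arr C" using p by (auto simp: p' hom_def)
  have "map (\<lambda>i. Lfun (fs ! i)) (positions \<sigma> (length cs)) = map (\<lambda>i. F (fs ! i)) (positions \<sigma> (length cs))"
    using fs \<sigma> by (auto simp: Lfun_C)
  moreover have "L.fam cs = A.fam cs"
    using L_C[OF subsetD[OF cs nth_mem]] by (auto simp: fun_eq_iff L.fam_def A.fam_def)
  ultimately show ?thesis
    unfolding L.str_def A.str_def p' fst_conv snd_conv by (simp only: Lmu_C[OF t] Lun_C[OF t])
qed

end

text \<open>The universal property of the extended monoid functor, carried over to algebras through
  representatives; \<open>mon_nat_str\<close> and \<open>mon_natI\<close> identify algebra morphisms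
  with natural families of monoid homomorphisms.\<close>

lemma universal_extension:
  fixes M :: "('o, 'm) smc" and D C :: "('u, 'u) cat" and orth :: "('u \<times> 'u) set"
  assumes universe: "infinite (UNIV :: 'u set)"
    and M_closed: "closed_symmetric_monoidal_category M"
    and M_bicomplete: "bicomplete TYPE('u) M"
    and sub: "full_sub D C orth"
    and A: "operad_algebra (orth_operad C (orth_pullback C embedding orth)) M A"
  defines "O_C \<equiv> orth_operad C (orth_pullback C embedding orth)" and "O_D \<equiv> orth_operad D orth"
    and "R \<equiv> pullback_functor (orth_operad C (orth_pullback C embedding orth)) (orth_operad_map D orth embedding)"
  shows "\<exists>B \<in> Obj (Alg O_D M). FObj R B = A \<and>
      (\<forall>E \<in> Obj (Alg O_D M). \<forall>f \<in> hom (Alg O_C M) A (FObj R E). \<exists>!g. g \<in> hom (Alg O_D M) B E \<and> FArr R g = f)"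
proof -
  interpret full_sub D C orth by fact
  interpret M: closed_symmetric_monoidal_category M by fact
  have M: "symmetric_monoidal_category M" by unfold_locales
  let ?s = "alg_rep C orth' A"
  interpret A: orth_rep_algebra M C orth' "Car A" ?s
    by (intro orth_rep_algebra.intro rep_algebra_alg_rep[OF A M C.category_axioms] orthogonal_C)
  interpret extension M D C orth "Car A" A.act_arr A.act_mult A.act_unit
    by (intro extension.intro M_closed sub A.mf.monoid_functor_axioms)
  obtain L \<iota> where "extension_colimits M D C orth (Car A) A.act_arr A.act_mult A.act_unit L \<iota>"
    using extension_colimits_ex[OF M_bicomplete universe] by blast
  then interpret E: extension_colimits M D C orth "Car A" A.act_arr A.act_mult A.act_unit L \<iota> .
  interpret L: monoid_functor M D orth L E.Lfun E.Lmu E.Lun by (rule E.monoid_functor_L)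
  interpret Lr: rep_algebra M D orth L L.str by (rule L.rep_algebra_str)
  define B where "B = rep_to_alg D orth L L.str"
  have B: "operad_algebra (orth_operad D orth) M B" unfolding B_def by (rule Lr.operad_algebra_rep_to_alg)
  have Car_B: "Car B t = L t" if "t \<in> Obj D" for t using that by (simp add: B_def rep_to_alg_def)
  have rep_B: "alg_rep D orth B cs t x = L.str cs t x" if "x \<in> Ops (cat_operad D) cs t" for x cs t
    unfolding B_def by (rule Lr.alg_rep_rep_to_alg[OF that])
  have R: "FObj R E = restrict_alg E" "FArr R (E, h, E') = (restrict_alg E, restrict h (Obj C),
    restrict_alg E')" for E E' h
    by (simp_all add: R_def pullback_functor_def orth_operad_simps) (simp_all add: orth_operad_map_def embedding_def)
  \<comment> \<open>Equality rather than isomorphism: carriers agree by \<open>L_C\<close>,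
    structure maps by \<open>str_C\<close> and \<open>s_str\<close>, and algebras are
    extensional.\<close>
  have RB: "restrict_alg B = A"
  proof -
    have "restrict_alg B = rep_to_alg C orth' (Car A) ?s"
      unfolding restrict_alg_eq
    proof (rule rep_to_alg_cong[OF _ _ C.category_axioms])
      show "Car B t = Car A t" if "t \<in> Obj C" for t using that by (simp add: Car_B E.L_C)
      show "alg_rep D orth B cs t x = ?s cs t x" if "x \<in> Ops (cat_operad C) cs t" for cs t x
        using rep_B[OF sub_Ops[OF that]] E.str_C[OF that] A.s_str[OF that] by simp
    qed
    also have "\<dots> = A" by (rule rep_to_alg_alg_rep[OF A C.category_axioms])
    finally show ?thesis .
  qed
  have "\<exists>!g. g \<in> hom (Alg O_D M) B E \<and> FArr R g = f"
    if "E \<in> Obj (Alg O_D M)" and f: "f \<in> hom (Alg O_C M) A (FObj R E)" for E f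
  proof -
    have E: "operad_algebra (orth_operad D orth) M E" using that(1) by (simp add: Alg_def O_D_def)
    obtain \<phi> where \<phi>: "f = (A, \<phi>, restrict_alg E)" "alg_hom (orth_operad C orth') M A (restrict_alg E) \<phi>"
      using f unfolding O_C_def hom_Alg R by blast
    interpret E': orth_rep_algebra M D orth "Car E" "alg_rep D orth E"
      by (intro orth_rep_algebra.intro rep_algebra_alg_rep[OF E M D.category_axioms] D.orthogonal_category_axioms)
    have mfC: "monoid_functor M C orth' (Car E) E'.act_arr E'.act_mult E'.act_unit"
      by (rule monoid_functor_sub[OF E'.mf.monoid_functor_axioms])
    \<comment> \<open>Restriction does not change structure maps, so a morphism into the restriction
      of \<open>E\<close> is a natural family over \<open>C\<close> into the monoid functor of
      \<open>E\<close> itself.\<close>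
    have \<phi>_nat: "mon_nat M C (Car A) A.act_arr A.act_mult A.act_unit (Car E) E'.act_arr E'.act_mult E'.act_unit \<phi>"
    proof (rule mon_natI[OF A.mf.monoid_functor_axioms mfC])
      show "\<phi> t \<in> hom M (Car A t) (Car E t)" if "t \<in> Obj C" for t
        using \<phi>(2) that unfolding alg_hom_orth_operad restrict_alg(2)[OF E M that, symmetric] by blast
      show "\<phi> t \<cdot>\<^bsub>M\<^esub> A.mf.str cs t p = E'.mf.str cs t p \<cdot>\<^bsub>M\<^esub> tens_arr M (map \<phi> cs)"
        if p: "p \<in> Ops (cat_operad C) cs t" for cs t p
      proof -
        have "\<phi> t \<cdot>\<^bsub>M\<^esub> ?s cs t p = alg_rep C orth' (restrict_alg E) cs t p \<cdot>\<^bsub>M\<^esub> tens_arr M (map \<phi> cs)"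
          using \<phi>(2) p unfolding alg_hom_orth_operad by blast
        then show ?thesis
          by (simp only: restrict_alg(3)[OF E M p] A.s_str[OF p] E'.s_str[OF sub_Ops[OF p]])
      qed
    qed
    obtain g where g: "mon_nat M D L E.Lfun E.Lmu E.Lun (Car E) E'.act_arr E'.act_mult E'.act_unit g"
      "\<And>t. t \<in> Obj C \<Longrightarrow> g t = \<phi> t"
      and g_unique: "\<And>g' t. mon_nat M D L E.Lfun E.Lmu E.Lun (Car E) E'.act_arr E'.act_mult E'.act_unit g' \<Longrightarrow>
        (\<forall>t \<in> Obj C. g' t = \<phi> t) \<Longrightarrow> t \<in> Obj D \<Longrightarrow> g' t = g t"
      using E.universal[OF E'.mf.monoid_functor_axioms \<phi>_nat] by blast
    have Ops_Obj: "set cs \<subseteq> Obj D \<and> t \<in> Obj D" if "x \<in> Ops (cat_operad D) cs t" for x cs t using that by (cases x) auto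
    have hom_g: "alg_hom (orth_operad D orth) M B E (restrict g (Obj D))"
      unfolding alg_hom_orth_operad
    proof (intro conjI ballI allI)
      show "restrict g (Obj D) t \<in> hom M (Car B t) (Car E t)" if "t \<in> Obj D" for t
        using g(1) that by (simp add: mon_nat_def Car_B)
      fix cs t x assume x: "x \<in> Ops (cat_operad D) cs t"
      have m: "map (restrict g (Obj D)) cs = map g cs" "restrict g (Obj D) t = g t" using Ops_Obj[OF x] by auto
      show "restrict g (Obj D) t \<cdot>\<^bsub>M\<^esub> alg_rep D orth B cs t x = alg_rep D orth E cs t x \<cdot>\<^bsub>M\<^esub> tens_arr M
        (map (restrict g (Obj D)) cs)"
        unfolding m rep_B[OF x] E'.s_str[OF x]
        by (rule mon_nat_str[OF L.monoid_functor_axioms E'.mf.monoid_functor_axioms g(1) x])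
    qed simp
    show ?thesis
    proof (rule ex1I[of _ "(B, restrict g (Obj D), E)"], intro conjI)
      show "(B, restrict g (Obj D), E) \<in> hom (Alg O_D M) B E"
        unfolding O_D_def hom_Alg using B E hom_g by blast
      have "\<phi> \<in> extensional (Obj C)" using \<phi>(2) by (simp add: alg_hom_orth_operad)
      then have "restrict (restrict g (Obj D)) (Obj C) = \<phi>"
        using g(2) by (intro extensionalityI) auto
      then show "FArr R (B, restrict g (Obj D), E) = f" by (simp only: R RB \<phi>(1))
      fix x assume x: "x \<in> hom (Alg O_D M) B E \<and> FArr R x = f"
      then obtain k where k: "x = (B, k, E)" "alg_hom (orth_operad D orth) M B E k"
        unfolding O_D_def hom_Alg by blast
      have k_C: "\<forall>t \<in> Obj C. k t = \<phi> t"
      proof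
        fix t assume t: "t \<in> Obj C"
        have "restrict k (Obj C) = \<phi>" using x unfolding k(1) R \<phi>(1) by simp
        then have "restrict k (Obj C) t = \<phi> t" by (rule fun_cong)
        then show "k t = \<phi> t" using t by simp
      qed
      \<comment> \<open>Any other lift is again a natural family extending \<open>\<phi>\<close>,
        hence agrees with \<open>g\<close> on all objects of \<open>D\<close>; extensionality then
        gives equality.\<close>
      have "mon_nat M D L E.Lfun E.Lmu E.Lun (Car E) E'.act_arr E'.act_mult E'.act_unit k"
      proof (rule mon_natI[OF L.monoid_functor_axioms E'.mf.monoid_functor_axioms])
        show "k t \<in> hom M (L t) (Car E t)" if "t \<in> Obj D" for t
          using k(2) that by (simp add: alg_hom_orth_operad Car_B)
        show "k t \<cdot>\<^bsub>M\<^esub> L.str cs t p = E'.mf.str cs t p \<cdot>\<^bsub>M\<^esub> tens_arr M (map k cs)"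
          if p: "p \<in> Ops (cat_operad D) cs t" for cs t p
        proof -
          have "k t \<cdot>\<^bsub>M\<^esub> alg_rep D orth B cs t p = alg_rep D orth E cs t p \<cdot>\<^bsub>M\<^esub> tens_arr M (map k cs)"
            using k(2) p unfolding alg_hom_orth_operad by blast
          then show ?thesis by (simp only: rep_B[OF p] E'.s_str[OF p])
        qed
      qed
      then have "k t = g t" if "t \<in> Obj D" for t using g_unique k_C that by blast
      moreover have "k \<in> extensional (Obj D)" using k(2) by (simp add: alg_hom_orth_operad)
      ultimately have "k = restrict g (Obj D)" by (intro extensionalityI) auto
      then show "x = (B, restrict g (Obj D), E)" by (simp only: k(1))
    qed
  qed
  moreover have "B \<in> Obj (Alg O_D M)" using B by (simp add: Alg_def O_D_def)
  moreover have "FObj R B = A" by (simp only: R RB)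
  ultimately show ?thesis by blast
qed

text \<open>Existence of an adjunction is stated first; invertibility of the unit and full
  faithfulness are then claimed for every choice of left adjoint, unit and counit, so nothing
  depends on the construction. Infinity of the universe lets words over \<open>'u\<close> be coded
  in \<open>'u\<close>.\<close>

theorem proposition4p6:
  fixes M :: "('o, 'm) smc"
    and D C :: "('u, 'u) cat"
    and orth :: "('u \<times> 'u) set"
  assumes universe: "infinite (UNIV :: 'u set)"
    and M_closed: "closed_symmetric_monoidal_category M"
    and M_bicomplete: "bicomplete TYPE('u) M"
    and D_orthogonal: "orthogonal_category D orth"
    and C_full: "full_subcategory C D"
  shows "let O_C = orth_operad C (orth_pullback C embedding orth);
             O_D = orth_operad D orth;
             Alg_C = Alg O_C M;
             Alg_D = Alg O_D M;
             R = pullback_functor O_C (orth_operad_map D orth embedding)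
         in (\<exists>L \<eta> \<epsilon>. adjunction Alg_C Alg_D L R \<eta> \<epsilon>) \<and>
            (\<forall>L \<eta> \<epsilon>. adjunction Alg_C Alg_D L R \<eta> \<epsilon> \<longrightarrow>
               nat_iso Alg_C Alg_C id_func (comp_func R L) \<eta> \<and>
               fully_faithful Alg_C Alg_D L)"
proof -
  have sub: "full_sub D C orth"
    using D_orthogonal C_full
    by (intro full_sub.intro full_sub_axioms.intro) (auto simp: full_subcategory_def)
  interpret closed_symmetric_monoidal_category M by fact
  have R: "is_functor (Alg (orth_operad D orth) M) (Alg (orth_operad C (orth_pullback C embedding orth)) M)
      (pullback_functor (orth_operad C (orth_pullback C embedding orth)) (orth_operad_map D orth embedding))"
    by (rule full_sub.is_functor_restrict[OF sub]) unfold_locales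
  note univ = universal_extension[OF universe M_closed M_bicomplete sub]
  have Obj: "operad_algebra (orth_operad C (orth_pullback C embedding orth)) M A"
    if "A \<in> Obj (Alg (orth_operad C (orth_pullback C embedding orth)) M)" for A using that by (simp add: Alg_def)
  show ?thesis
    unfolding Let_def
    using coreflection(1)[OF R univ[OF Obj]] coreflection(2)[OF R univ[OF Obj]] by blast
qed

end
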